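(* Let $a,b>-1$ and $c>0$ be fixed, let $L_{N,\beta}$ be the empirical distribution of the beta Jacobi ensemble of size $N$ with parameters $(\beta,a,b)$, and let $\nu_c$ be the probability measure defined in the context. Then the following hold. (LLN) As $N\to\infty$ with $\beta N\to2c$, the empirical distribution $L_{N,\beta}$ converges weakly to $\nu_c$, almost surely. Equivalently, for any polynomial $p$, as $N\to\infty$ with $\beta N\to2c$, $\langle L_{N,\beta},p\rangle\to\langle\nu_c,p\rangle$ almost surely. (CLT) For any polynomial $p$, as $N\to\infty$ with $\beta=2c/N$, $$N\,\mathrm{Var}[\langle L_{N,\beta},p\rangle]\to\sigma_p^2,\qquad \sqrt N\big(\langle L_{N,\beta},p\rangle-\langle\nu_c,p\rangle\big)\xrightarrow{d}\mathcal N(0,\sigma_p^2),$$ where $\sigma_p^2\ge0$ is a constant. Equivalently, there are jointly Gaussian random variables $\{\zeta_n\}_{n\ge1}$ such that for any $M\in\mathbb N$, as $N\to\infty$ with $\beta=2c/N$, $$\left(\sqrt N(\langle L_{N,\beta},x^n\rangle-\langle\nu_c,x^n\rangle)\right)_{n=1}^M\xrightarrow{d}(\zeta_n)_{n=1}^M\sim\mathcal N_M(0,\Sigma),$$ where $\Sigma=(\sigma_{k,l})_{k,l=1}^M$ is the limiting covariance matrix $$\sigma_{k,l}=\lim_{N\to\infty;\ \beta=2c/N}N\,\mathrm{Cov}[\langle L_{N,\beta},x^k\rangle,\langle L_{N,\beta},x^l\rangle].$$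
   Context: Notation: $\langle\mu,f\rangle=\int f\,d\mu$; $\xrightarrow{d}$ is convergence in distribution; $\mathcal N(m,\sigma^2)$ is the Gaussian distribution; $\mathcal N_M(0,\Sigma)$ is the $M$-dimensional Gaussian distribution with mean zero and covariance matrix $\Sigma$; $\mathrm{Beta}(p,q)$ is the beta distribution on $[0,1]$ with parameters $p,q>0$. Beta Jacobi ensemble of size $N$ with parameters $\beta>0$, $a,b>-1$: the random vector $(\lambda_1,\dots,\lambda_N)$ with joint density $\frac1Z\prod_{i<j}|\lambda_j-\lambda_i|^\beta\prod_{l=1}^N\lambda_l^a(1-\lambda_l)^b$ on $0\le\lambda_1\le\cdots\le\lambda_N\le1$ ($Z$ a normalizing constant). Its empirical distribution is $L_{N,\beta}=\frac1N\sum_{i=1}^N\delta_{\lambda_i}$. For the almost sure statement, the ensembles for different $N$ are understood to be defined on a common probability space. Limiting measure $\nu_c$: let $\{p_n^{(\infty)}\}_{n\ge1}$ be i.i.d. with law $\mathrm{Beta}(c+a+1,c+b+1)$ and $\{q_n^{(\infty)}\}_{n\ge1}$ be i.i.d. with law $\mathrm{Beta}(c,c+a+b+2)$, the two sequences being independent, and $q_0^{(\infty)}=0$. Put $s_n=p_n^{(\infty)}(1-q_{n-1}^{(\infty)})$, $t_n=q_n^{(\infty)}(1-p_n^{(\infty)})$. Let $B$ be the semi-infinite lower bidiagonal matrix with $B(n,n)=\sqrt{s_n}$, $B(n+1,n)=\sqrt{t_n}$ and other entries $0$, and $J_c^{(\infty)}=BB^{\top}$. Then $\nu_c$ is the unique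 probability measure on $[0,1]$ with $\langle\nu_c,x^k\rangle=\mathbb E[(J_c^{(\infty)})^k(1,1)]$ for $k=0,1,2,\dots$. *)

theory Defs
  imports "HOL-Probability.Probability"
begin

text \<open>
  A configuration of size \<open>N\<close> is a function on the index set \<open>{1..N}\<close>, i.e. a point of
  \<open>PiM {1..N} (\<lambda>_. lborel)\<close>. At \<open>0\<close> the value \<open>0 powr e = 0\<close> is a convention that only
  concerns a null set of configurations.
\<close>

definition jacobi_weight :: "real \<Rightarrow> real \<Rightarrow> real \<Rightarrow> nat \<Rightarrow> (nat \<Rightarrow> real) \<Rightarrow> real" where
  "jacobi_weight \<beta> a b N x =
     indicator {x. mono_on {1..N} x \<and> x ` {1..N} \<subseteq> {0..1}} x *
     ((\<Prod>j\<in>{1..N}. \<Prod>i\<in>{1..<j}. \<bar>x j - x i\<bar> powr \<beta>) *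
      (\<Prod>l\<in>{1..N}. x l powr a * (1 - x l) powr b))"

definition jacobi_const :: "real \<Rightarrow> real \<Rightarrow> real \<Rightarrow> nat \<Rightarrow> real" where
  "jacobi_const \<beta> a b N = (\<integral>x. jacobi_weight \<beta> a b N x \<partial>PiM {1..N} (\<lambda>_. lborel))"

definition jacobi_ensemble :: "real \<Rightarrow> real \<Rightarrow> real \<Rightarrow> nat \<Rightarrow> (nat \<Rightarrow> real) measure" where
  "jacobi_ensemble \<beta> a b N =
     density (PiM {1..N} (\<lambda>_. lborel))
       (\<lambda>x. ennreal (jacobi_weight \<beta> a b N x / jacobi_const \<beta> a b N))"

text \<open>The measure \<open>(\<Sum>i=1..N. \<delta>\<^bsub>x i\<^esub>) / N\<close>, as the image of the uniform distribution on \<open>{1..N}\<close>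
  under \<open>i \<mapsto> x i\<close> (for \<open>N \<ge> 1\<close>).\<close>

definition empirical :: "nat \<Rightarrow> (nat \<Rightarrow> real) \<Rightarrow> real measure" where
  "empirical N x = distr (uniform_count_measure {1..N}) borel x"

definition beta_distribution :: "real \<Rightarrow> real \<Rightarrow> real measure" where
  "beta_distribution p q =
     density lborel
       (\<lambda>x. ennreal (indicator {0<..<1} x * (x powr (p - 1) * (1 - x) powr (q - 1)) / Beta p q))"

text \<open>
  Semi-infinite matrices have rows and columns indexed by \<open>1, 2, \<dots>\<close>; entries with an index \<open>0\<close>
  of the matrix \<open>B\<close> below vanish, so index \<open>0\<close> contributes nothing to the sums. All matrices to
  which the product is applied here are banded, so the series are finite sums.
\<close>

type_synonym inf_matrix = "nat \<Rightarrow> nat \<Rightarrow> real"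

definition inf_mat_mult :: "inf_matrix \<Rightarrow> inf_matrix \<Rightarrow> inf_matrix" where
  "inf_mat_mult A B = (\<lambda>i j. \<Sum>k. A i k * B k j)"

primrec inf_mat_power :: "inf_matrix \<Rightarrow> nat \<Rightarrow> inf_matrix" where
  "inf_mat_power A 0 = (\<lambda>i j. if i = j then 1 else 0)"
| "inf_mat_power A (Suc k) = inf_mat_mult A (inf_mat_power A k)"

text \<open>The sequences \<open>p\<close> and \<open>q\<close> are only used at indices \<open>n \<ge> 1\<close>; the convention \<open>q 0 = 0\<close> is
  built into \<open>s\<close>.\<close>

definition s_coeff :: "(nat \<Rightarrow> real) \<Rightarrow> (nat \<Rightarrow> real) \<Rightarrow> nat \<Rightarrow> real" where
  "s_coeff p q n = p n * (1 - (if n = 1 then 0 else q (n - 1)))"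

definition t_coeff :: "(nat \<Rightarrow> real) \<Rightarrow> (nat \<Rightarrow> real) \<Rightarrow> nat \<Rightarrow> real" where
  "t_coeff p q n = q n * (1 - p n)"

definition bidiag :: "(nat \<Rightarrow> real) \<Rightarrow> (nat \<Rightarrow> real) \<Rightarrow> inf_matrix" where
  "bidiag p q = (\<lambda>i j.
     if j \<ge> 1 \<and> i = j then sqrt (s_coeff p q j)
     else if j \<ge> 1 \<and> i = j + 1 then sqrt (t_coeff p q j)
     else 0)"

definition jacobi_matrix :: "(nat \<Rightarrow> real) \<Rightarrow> (nat \<Rightarrow> real) \<Rightarrow> inf_matrix" where
  "jacobi_matrix p q = inf_mat_mult (bidiag p q) (\<lambda>i j. bidiag p q j i)"

definition limit_parameters ::
  "real \<Rightarrow> real \<Rightarrow> real \<Rightarrow> ((nat \<Rightarrow> real) \<times> (nat \<Rightarrow> real)) measure" where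
  "limit_parameters a b c =
     PiM {1..} (\<lambda>_. beta_distribution (c + a + 1) (c + b + 1)) \<Otimes>\<^sub>M
     PiM {1..} (\<lambda>_. beta_distribution c (c + a + b + 2))"

definition limit_measure :: "real \<Rightarrow> real \<Rightarrow> real \<Rightarrow> real measure" where
  "limit_measure a b c = (THE \<nu>.
     sets \<nu> = sets borel \<and> prob_space \<nu> \<and> emeasure \<nu> {0..1} = 1 \<and>
     (\<forall>k::nat. (\<integral>x. x ^ k \<partial>\<nu>) =
        (\<integral>(p, q). inf_mat_power (jacobi_matrix p q) k 1 1 \<partial>limit_parameters a b c)))"

text \<open>Variance \<open>0\<close> is allowed and gives a point mass.\<close>

definition gaussian :: "real \<Rightarrow> real \<Rightarrow> real measure" where
  "gaussian m v =
     (if v = 0 then return borel m else density lborel (normal_density m (sqrt v)))"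

definition covar :: "'a measure \<Rightarrow> ('a \<Rightarrow> real) \<Rightarrow> ('a \<Rightarrow> real) \<Rightarrow> real" where
  "covar P X Y = (\<integral>\<omega>. (X \<omega> - integral\<^sup>L P X) * (Y \<omega> - integral\<^sup>L P Y) \<partial>P)"

definition jointly_gaussian :: "'a measure \<Rightarrow> 'i set \<Rightarrow> ('i \<Rightarrow> 'a \<Rightarrow> real) \<Rightarrow> bool" where
  "jointly_gaussian P I \<zeta> \<longleftrightarrow>
     prob_space P \<and> (\<forall>i\<in>I. \<zeta> i \<in> borel_measurable P) \<and>
     (\<forall>J t. finite J \<and> J \<subseteq> I \<longrightarrow>
        (\<exists>m v. v \<ge> 0 \<and> distr P borel (\<lambda>\<omega>. \<Sum>i\<in>J. t i * \<zeta> i \<omega>) = gaussian m v))"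

definition gaussian_vector ::
  "'a measure \<Rightarrow> 'i set \<Rightarrow> ('i \<Rightarrow> 'a \<Rightarrow> real) \<Rightarrow> ('i \<Rightarrow> real) \<Rightarrow> ('i \<Rightarrow> 'i \<Rightarrow> real) \<Rightarrow> bool" where
  "gaussian_vector P I \<zeta> m S \<longleftrightarrow>
     jointly_gaussian P I \<zeta> \<and>
     (\<forall>i\<in>I. integral\<^sup>L P (\<zeta> i) = m i) \<and>
     (\<forall>i\<in>I. \<forall>j\<in>I. covar P (\<zeta> i) (\<zeta> j) = S i j)"

text \<open>
  Weak convergence of measures on \<open>PiM I (\<lambda>_. borel)\<close> for a finite index set \<open>I\<close>, whose underlying
  space \<open>PiE I (\<lambda>_. UNIV)\<close> carries the Euclidean topology as a subspace of the product topology.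
\<close>

definition weak_conv_PiM ::
  "'i set \<Rightarrow> (nat \<Rightarrow> ('i \<Rightarrow> real) measure) \<Rightarrow> ('i \<Rightarrow> real) measure \<Rightarrow> bool" where
  "weak_conv_PiM I \<mu> \<mu>' \<longleftrightarrow>
     (\<forall>f :: ('i \<Rightarrow> real) \<Rightarrow> real.
        continuous_on (PiE I (\<lambda>_. UNIV)) f \<and> bounded (f ` PiE I (\<lambda>_. UNIV)) \<longrightarrow>
        (\<lambda>n. integral\<^sup>L (\<mu> n) f) \<longlonglongrightarrow> integral\<^sup>L \<mu>' f)"

end

(* Transporting the ensemble along the coordinatewise flow x \<mapsto> x + \<epsilon> x^(k+1) (1 - x) and differentiating at
   \<epsilon> = 0 gives loop equations for the empirical moments m_k: for f(Y) with Y a linear combination of moments,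
   E[f'(Y) Y' + N f(Y) W_k(m)] = 0, where Y' is the derivative of Y along the flow and W_k(m) is linear in
   m_(k+1), up to quadratic terms in m_0, ..., m_k with coefficients \<beta> N / 2. No tridiagonal model for finite N
   is needed.

   W_k(v) = 0 has an explicit recursive solution v = v(N), and the test functions z - v_k and (z - v_k)^3 bound the fourth
   moments of m_k - v_k by C / N^2, inductively in k; Borel--Cantelli gives almost sure convergence of m_k to the
   solution u_k of the limiting Riccati recursion. With \<beta> = 2 c / N one has u - v = O(1 / N), and linearizing
   W_k at u turns the loop equations into an approximate Stein equation for y_k = sqrt N (m_k - u_k), which
   determines the limits of all E cos(t . y), E sin(t . y) and E y_k y_l.

   That u_k = E[J^k(1,1)] comes from the continued fraction of the resolvent of J in the coordinates p_n, q_n: the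
   independence of the tail makes E of the powers of the tail series computable through the Pfaff--Saalschuetz sum,
   and the resulting quotient of hypergeometric series satisfies the same Riccati recursion. The measure \<nu>_c itself
   is obtained as a weak limit of empirical measures. *)

theory Submission
  imports Defs
begin

section \<open>Uniform first-order expansions\<close>

text \<open>The weight may be singular at 0 and 1, and its logarithmic gradient is singular on the
  diagonals, so a direct integration by parts is delicate. The field x^(k+1) (1 - x) is polynomial
  and vanishes at 0 and 1: a small step along it multiplies each of x_l, 1 - x_l and x_j - x_i by a
  positive polynomial factor close to 1. The singular factors thus split off exactly, and only
  bounded multipliers are differentiated, uniformly on the cube.

  In W_k the coefficient of m_(k+1) - v_(k+1) tends to -(k + 2 + a + b + 2 c) < 0. This sign makes
  W_k a restoring force and lets every estimate run by induction on k. The term f'(Y) Y' is of order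
  1 against the factor N in front of W_k, so fluctuations have size N^(-1/2). Second moments of
  order 1 / N would not be summable; fourth moments of order 1 / N^2 are. On the scale sqrt N the
  quadratic part of the expansion of W_k at u carries a factor N^(-1/2), so only the linear part
  survives in the limit.\<close>

definition unif_deriv :: "'a set \<Rightarrow> (real \<Rightarrow> 'a \<Rightarrow> real) \<Rightarrow> ('a \<Rightarrow> real) \<Rightarrow> bool" where
  "unif_deriv S h D \<longleftrightarrow> (\<exists>e>0. \<exists>C. e \<le> 1 \<and>
     (\<forall>x\<in>S. \<bar>h 0 x\<bar> \<le> C \<and> \<bar>D x\<bar> \<le> C \<and>
        (\<forall>\<epsilon>. 0 < \<epsilon> \<and> \<epsilon> \<le> e \<longrightarrow> \<bar>h \<epsilon> x - h 0 x - \<epsilon> * D x\<bar> \<le> C * \<epsilon>^2)))"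

lemma unif_derivI:
  assumes "e > 0"
    "\<And>x. x \<in> S \<Longrightarrow> \<bar>h 0 x\<bar> \<le> A" "\<And>x. x \<in> S \<Longrightarrow> \<bar>D x\<bar> \<le> B"
    "\<And>x \<epsilon>. x \<in> S \<Longrightarrow> 0 < \<epsilon> \<Longrightarrow> \<epsilon> \<le> e \<Longrightarrow> \<epsilon> \<le> 1 \<Longrightarrow> \<bar>h \<epsilon> x - h 0 x - \<epsilon> * D x\<bar> \<le> C * \<epsilon>^2"
  shows "unif_deriv S h D"
  unfolding unif_deriv_def
proof (intro exI conjI ballI allI impI)
  let ?C = "max A (max B C)"
  show "0 < min e 1" "min e 1 \<le> 1" using assms by auto
  fix x assume x: "x \<in> S"
  show "\<bar>h 0 x\<bar> \<le> ?C" "\<bar>D x\<bar> \<le> ?C" using assms(2,3)[OF x] by (auto simp: le_max_iff_disj)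
  fix \<epsilon> :: real assume "0 < \<epsilon> \<and> \<epsilon> \<le> min e 1"
  then have "\<bar>h \<epsilon> x - h 0 x - \<epsilon> * D x\<bar> \<le> C * \<epsilon>^2" using assms(4)[OF x] by auto
  also have "\<dots> \<le> ?C * \<epsilon>^2" by (intro mult_right_mono) auto
  finally show "\<bar>h \<epsilon> x - h 0 x - \<epsilon> * D x\<bar> \<le> ?C * \<epsilon>^2" .
qed

lemma unif_derivE:
  assumes "unif_deriv S h D"
  obtains e C where "0 < e" "e \<le> 1" "0 \<le> C"
    "\<And>x. x \<in> S \<Longrightarrow> \<bar>h 0 x\<bar> \<le> C" "\<And>x. x \<in> S \<Longrightarrow> \<bar>D x\<bar> \<le> C"
    "\<And>x \<epsilon>. x \<in> S \<Longrightarrow> 0 < \<epsilon> \<Longrightarrow> \<epsilon> \<le> e \<Longrightarrow> \<bar>h \<epsilon> x - h 0 x - \<epsilon> * D x\<bar> \<le> C * \<epsilon>^2"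
proof -
  from assms obtain e C where e: "e > 0" "e \<le> 1" and C: "\<forall>x\<in>S. \<bar>h 0 x\<bar> \<le> C \<and> \<bar>D x\<bar> \<le> C \<and>
        (\<forall>\<epsilon>. 0 < \<epsilon> \<and> \<epsilon> \<le> e \<longrightarrow> \<bar>h \<epsilon> x - h 0 x - \<epsilon> * D x\<bar> \<le> C * \<epsilon>^2)"
    unfolding unif_deriv_def by blast
  show ?thesis
  proof (rule that[of e "max C 0"])
    fix x \<epsilon> assume x: "x \<in> S" and \<epsilon>: "0 < \<epsilon>" "\<epsilon> \<le> e"
    have "\<bar>h \<epsilon> x - h 0 x - \<epsilon> * D x\<bar> \<le> C * \<epsilon>^2" using C x \<epsilon> by auto
    also have "\<dots> \<le> max C 0 * \<epsilon>^2" by (intro mult_right_mono) auto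
    finally show "\<bar>h \<epsilon> x - h 0 x - \<epsilon> * D x\<bar> \<le> max C 0 * \<epsilon>^2" .
  qed (use e C in \<open>auto simp: le_max_iff_disj\<close>)
qed

lemma unif_deriv_cong:
  assumes "unif_deriv S h D" "\<And>x. x \<in> S \<Longrightarrow> D x = D' x"
  shows "unif_deriv S h D'"
  using assms unfolding unif_deriv_def by simp

lemma unif_deriv_affine:
  assumes "\<And>x. x \<in> S \<Longrightarrow> \<bar>p x\<bar> \<le> A" "\<And>x. x \<in> S \<Longrightarrow> \<bar>u x\<bar> \<le> B"
  shows "unif_deriv S (\<lambda>\<epsilon> x. p x + \<epsilon> * u x) u"
  by (rule unif_derivI[of 1 _ _ A _ B 0]) (use assms in auto)

lemma unif_deriv_const:
  assumes "\<And>x. x \<in> S \<Longrightarrow> \<bar>p x\<bar> \<le> A"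
  shows "unif_deriv S (\<lambda>\<epsilon> x. p x) (\<lambda>_. 0)"
  by (rule unif_derivI[of 1 _ _ A _ 0 0]) (use assms in auto)

lemma unif_deriv_add:
  assumes "unif_deriv S h D" "unif_deriv S k E"
  shows "unif_deriv S (\<lambda>\<epsilon> x. h \<epsilon> x + k \<epsilon> x) (\<lambda>x. D x + E x)"
proof -
  obtain e C where e: "0 < e" "e \<le> 1" "0 \<le> C" and C:
    "\<And>x. x \<in> S \<Longrightarrow> \<bar>h 0 x\<bar> \<le> C" "\<And>x. x \<in> S \<Longrightarrow> \<bar>D x\<bar> \<le> C"
    "\<And>x \<epsilon>. x \<in> S \<Longrightarrow> 0 < \<epsilon> \<Longrightarrow> \<epsilon> \<le> e \<Longrightarrow> \<bar>h \<epsilon> x - h 0 x - \<epsilon> * D x\<bar> \<le> C * \<epsilon>^2"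
    using unif_derivE[OF assms(1)] by blast
  obtain e' C' where e': "0 < e'" "e' \<le> 1" "0 \<le> C'" and C':
    "\<And>x. x \<in> S \<Longrightarrow> \<bar>k 0 x\<bar> \<le> C'" "\<And>x. x \<in> S \<Longrightarrow> \<bar>E x\<bar> \<le> C'"
    "\<And>x \<epsilon>. x \<in> S \<Longrightarrow> 0 < \<epsilon> \<Longrightarrow> \<epsilon> \<le> e' \<Longrightarrow> \<bar>k \<epsilon> x - k 0 x - \<epsilon> * E x\<bar> \<le> C' * \<epsilon>^2"
    using unif_derivE[OF assms(2)] by blast
  show ?thesis
  proof (rule unif_derivI[of "min e e'" _ _ "C + C'" _ "C + C'" "C + C'"])
    fix x \<epsilon> assume x: "x \<in> S" and \<epsilon>: "0 < \<epsilon>" "\<epsilon> \<le> min e e'"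
    show "\<bar>h \<epsilon> x + k \<epsilon> x - (h 0 x + k 0 x) - \<epsilon> * (D x + E x)\<bar> \<le> (C + C') * \<epsilon>^2"
      using C(3)[OF x \<epsilon>(1)] C'(3)[OF x \<epsilon>(1)] \<epsilon>(2) by (simp add: algebra_simps abs_le_iff)
  next
    fix x assume x: "x \<in> S"
    show "\<bar>h 0 x + k 0 x\<bar> \<le> C + C'" "\<bar>D x + E x\<bar> \<le> C + C'"
      using C(1,2)[OF x] C'(1,2)[OF x] by linarith+
  qed (use e e' in auto)
qed

lemma unif_deriv_mult:
  assumes "unif_deriv S h D" "unif_deriv S k E"
  shows "unif_deriv S (\<lambda>\<epsilon> x. h \<epsilon> x * k \<epsilon> x) (\<lambda>x. D x * k 0 x + h 0 x * E x)"
proof -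
  obtain e C where e: "0 < e" "e \<le> 1" "0 \<le> C" and C:
    "\<And>x. x \<in> S \<Longrightarrow> \<bar>h 0 x\<bar> \<le> C" "\<And>x. x \<in> S \<Longrightarrow> \<bar>D x\<bar> \<le> C"
    "\<And>x \<epsilon>. x \<in> S \<Longrightarrow> 0 < \<epsilon> \<Longrightarrow> \<epsilon> \<le> e \<Longrightarrow> \<bar>h \<epsilon> x - h 0 x - \<epsilon> * D x\<bar> \<le> C * \<epsilon>^2"
    using unif_derivE[OF assms(1)] by blast
  obtain e' C' where e': "0 < e'" "e' \<le> 1" "0 \<le> C'" and C':
    "\<And>x. x \<in> S \<Longrightarrow> \<bar>k 0 x\<bar> \<le> C'" "\<And>x. x \<in> S \<Longrightarrow> \<bar>E x\<bar> \<le> C'"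
    "\<And>x \<epsilon>. x \<in> S \<Longrightarrow> 0 < \<epsilon> \<Longrightarrow> \<epsilon> \<le> e' \<Longrightarrow> \<bar>k \<epsilon> x - k 0 x - \<epsilon> * E x\<bar> \<le> C' * \<epsilon>^2"
    using unif_derivE[OF assms(2)] by blast
  show ?thesis
  proof (rule unif_derivI[of "min e e'" _ _ "C * C'" _ "C * C' + C * C'" "3 * C * C' + C * C' + 2 * C * C'"])
    fix x \<epsilon> assume x: "x \<in> S" and \<epsilon>: "0 < \<epsilon>" "\<epsilon> \<le> min e e'" "\<epsilon> \<le> 1"
    define r where "r = h \<epsilon> x - h 0 x - \<epsilon> * D x"
    define s where "s = k \<epsilon> x - k 0 x - \<epsilon> * E x"
    have r: "\<bar>r\<bar> \<le> C * \<epsilon>^2" and s: "\<bar>s\<bar> \<le> C' * \<epsilon>^2"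
      using C(3)[OF x \<epsilon>(1)] C'(3)[OF x \<epsilon>(1)] \<epsilon>(2) by (auto simp: r_def s_def)
    have \<epsilon>2: "\<epsilon>^2 \<le> 1" using \<epsilon> by (simp add: power_le_one)
    \<comment> \<open>The first-order terms cancel, so every remaining summand carries \<epsilon>^2
      or one of the remainders r, s.\<close>
    have eq: "h \<epsilon> x * k \<epsilon> x - h 0 x * k 0 x - \<epsilon> * (D x * k 0 x + h 0 x * E x)
       = \<epsilon>^2 * (D x * E x) + (h 0 x * s + k 0 x * r) + (\<epsilon> * (D x * s) + \<epsilon> * (E x * r)) + r * s"
      unfolding r_def s_def by (simp add: algebra_simps power2_eq_square)
    have CC: "C' * \<epsilon>^2 \<le> C'" "C * \<epsilon>^2 \<le> C" using e e' \<epsilon>2 by (simp_all add: mult_left_le)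
    have 1: "\<bar>\<epsilon>^2 * (D x * E x)\<bar> \<le> \<epsilon>^2 * (C * C')"
      unfolding abs_mult using C(2)[OF x] C'(2)[OF x] by (intro mult_mono) (auto intro!: mult_mono simp: e)
    have 2: "\<bar>h 0 x * s\<bar> \<le> C * (C' * \<epsilon>^2)" "\<bar>D x * s\<bar> \<le> C * (C' * \<epsilon>^2)"
      unfolding abs_mult using C(1,2)[OF x] s e by (auto intro!: mult_mono)
    have 3: "\<bar>k 0 x * r\<bar> \<le> C' * (C * \<epsilon>^2)" "\<bar>E x * r\<bar> \<le> C' * (C * \<epsilon>^2)"
      unfolding abs_mult using C'(1,2)[OF x] r e' by (auto intro!: mult_mono)
    have eps_le: "\<bar>\<epsilon> * y\<bar> \<le> \<bar>y\<bar>" for y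
      using \<epsilon> by (simp add: abs_mult mult_left_le_one_le)
    have 4: "\<bar>\<epsilon> * (D x * s)\<bar> \<le> C * (C' * \<epsilon>^2)" "\<bar>\<epsilon> * (E x * r)\<bar> \<le> C' * (C * \<epsilon>^2)"
      by (rule order_trans[OF eps_le 2(2)], rule order_trans[OF eps_le 3(2)])
    \<comment> \<open>Since \<epsilon> is at most 1, one of the two remainders is bounded by a
      constant and the other one supplies the factor \<epsilon>^2.\<close>
    have 5: "\<bar>r * s\<bar> \<le> (C * \<epsilon>^2) * C'"
      unfolding abs_mult using r s CC e e' by (intro mult_mono) auto
    show "\<bar>h \<epsilon> x * k \<epsilon> x - h 0 x * k 0 x - \<epsilon> * (D x * k 0 x + h 0 x * E x)\<bar>
        \<le> (3 * C * C' + C * C' + 2 * C * C') * \<epsilon>^2"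
    proof -
      let ?q = "C * C' * \<epsilon>^2"
      have *: "\<bar>a + (b + c) + (d + e) + f\<bar> \<le> \<bar>a\<bar> + (\<bar>b\<bar> + \<bar>c\<bar>) + (\<bar>d\<bar> + \<bar>e\<bar>) + \<bar>f\<bar>" for a b c d e f :: real
        by (intro order_trans[OF abs_triangle_ineq] add_mono order_refl)
      have "\<bar>\<epsilon>^2 * (D x * E x) + (h 0 x * s + k 0 x * r) + (\<epsilon> * (D x * s) + \<epsilon> * (E x * r)) + r * s\<bar>
        \<le> \<epsilon>^2 * (C * C') + (C * (C' * \<epsilon>^2) + C' * (C * \<epsilon>^2)) + (C * (C' * \<epsilon>^2) + C' * (C * \<epsilon>^2)) + (C * \<epsilon>^2) * C'"
        by (intro order_trans[OF *] add_mono 1 2 3 4 5)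
      also have "\<dots> = (3 * C * C' + C * C' + 2 * C * C') * \<epsilon>^2" by (simp add: algebra_simps)
      finally show ?thesis unfolding eq .
    qed
  next
    fix x assume x: "x \<in> S"
    show "\<bar>h 0 x * k 0 x\<bar> \<le> C * C'" unfolding abs_mult using C(1)[OF x] C'(1)[OF x] e e'
      by (intro mult_mono) auto
    have "\<bar>D x * k 0 x\<bar> \<le> C * C'" "\<bar>h 0 x * E x\<bar> \<le> C * C'"
      unfolding abs_mult using C(1,2)[OF x] C'(1,2)[OF x] e e' by (auto intro!: mult_mono)
    then show "\<bar>D x * k 0 x + h 0 x * E x\<bar> \<le> C * C' + C * C'" by linarith
  qed (use e e' in auto)
qed

lemma unif_deriv_cmult:
  assumes "unif_deriv S h D"
  shows "unif_deriv S (\<lambda>\<epsilon> x. c * h \<epsilon> x) (\<lambda>x. c * D x)"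
  by (rule unif_deriv_cong[OF unif_deriv_mult[OF unif_deriv_const[of S "\<lambda>_. c" "\<bar>c\<bar>"] assms]]) auto

lemma unif_deriv_sum:
  assumes "finite J" "\<And>i. i \<in> J \<Longrightarrow> unif_deriv S (h i) (D i)"
  shows "unif_deriv S (\<lambda>\<epsilon> x. \<Sum>i\<in>J. h i \<epsilon> x) (\<lambda>x. \<Sum>i\<in>J. D i x)"
  using assms
proof (induction J rule: finite_induct)
  case empty
  then show ?case using unif_deriv_const[of S "\<lambda>_. 0" 0] by simp
next
  case (insert i J)
  then have "unif_deriv S (\<lambda>\<epsilon> x. h i \<epsilon> x + (\<Sum>i\<in>J. h i \<epsilon> x)) (\<lambda>x. D i x + (\<Sum>i\<in>J. D i x))"
    by (intro unif_deriv_add) auto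
  then show ?case using insert by simp
qed

text \<open>When all factors equal 1 at \<epsilon> = 0, the product rule loses its cofactors and
  becomes a plain sum; the multipliers of the transported weight have this form.\<close>

lemma unif_deriv_prod_one:
  assumes "finite J" "\<And>i. i \<in> J \<Longrightarrow> unif_deriv S (h i) (D i)" "\<And>i x. i \<in> J \<Longrightarrow> h i 0 x = 1"
  shows "unif_deriv S (\<lambda>\<epsilon> x. \<Prod>i\<in>J. h i \<epsilon> x) (\<lambda>x. \<Sum>i\<in>J. D i x)"
  using assms
proof (induction J rule: finite_induct)
  case empty
  then show ?case using unif_deriv_const[of S "\<lambda>_. 1" 1] by simp
next
  case (insert i J)
  then have "unif_deriv S (\<lambda>\<epsilon> x. h i \<epsilon> x * (\<Prod>i\<in>J. h i \<epsilon> x))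
    (\<lambda>x. D i x * (\<Prod>i\<in>J. h i 0 x) + h i 0 x * (\<Sum>i\<in>J. D i x))"
    by (intro unif_deriv_mult) auto
  then show ?case using insert by simp
qed

lemma unif_deriv_power:
  assumes "unif_deriv S h D"
  shows "unif_deriv S (\<lambda>\<epsilon> x. h \<epsilon> x ^ n) (\<lambda>x. real n * h 0 x ^ (n - 1) * D x)"
proof (induction n)
  case 0
  then show ?case using unif_deriv_const[of S "\<lambda>_. 1" 1] by simp
next
  case (Suc n)
  show ?case
  proof (rule unif_deriv_cong)
    show "unif_deriv S (\<lambda>\<epsilon> x. h \<epsilon> x ^ Suc n)
      (\<lambda>x. D x * h 0 x ^ n + h 0 x * (real n * h 0 x ^ (n - 1) * D x))"
      unfolding power_Suc by (intro unif_deriv_mult assms Suc)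
    fix x
    show "D x * h 0 x ^ n + h 0 x * (real n * h 0 x ^ (n - 1) * D x) = real (Suc n) * h 0 x ^ (Suc n - 1) * D x"
      by (cases n) (auto simp: algebra_simps)
  qed
qed

text \<open>The expansion of f is only asked for within distance r of the values at \<epsilon> = 0.
  Powers with arbitrary real exponents, which behave well near 1 but not near 0, are thereby
  covered.\<close>

lemma unif_deriv_compose:
  assumes h: "unif_deriv S h D" and r: "r > 0"
    and f: "\<And>x. x \<in> S \<Longrightarrow> \<bar>f (h 0 x)\<bar> \<le> K" "\<And>x. x \<in> S \<Longrightarrow> \<bar>f' (h 0 x)\<bar> \<le> K"
      "\<And>x z. x \<in> S \<Longrightarrow> \<bar>z - h 0 x\<bar> \<le> r \<Longrightarrow> \<bar>f z - f (h 0 x) - f' (h 0 x) * (z - h 0 x)\<bar> \<le> K * (z - h 0 x)^2"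
  shows "unif_deriv S (\<lambda>\<epsilon> x. f (h \<epsilon> x)) (\<lambda>x. f' (h 0 x) * D x)"
proof -
  obtain e C where e: "0 < e" "e \<le> 1" "0 \<le> C" and C:
    "\<And>x. x \<in> S \<Longrightarrow> \<bar>h 0 x\<bar> \<le> C" "\<And>x. x \<in> S \<Longrightarrow> \<bar>D x\<bar> \<le> C"
    "\<And>x \<epsilon>. x \<in> S \<Longrightarrow> 0 < \<epsilon> \<Longrightarrow> \<epsilon> \<le> e \<Longrightarrow> \<bar>h \<epsilon> x - h 0 x - \<epsilon> * D x\<bar> \<le> C * \<epsilon>^2"
    using unif_derivE[OF h] by blast
  have K: "0 \<le> K" if "x \<in> S" for x using f(1)[OF that] by linarith
  show ?thesis
  \<comment> \<open>The displacement of h is at most 2 C \<epsilon>, so this step bound keeps it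
    below r; the summand 1 in the denominator covers C = 0.\<close>
  proof (rule unif_derivI[of "min e (r / (2 * C + 1))" _ _ K _ "K * C" "K * (2 * C)^2 + K * C"])
    fix x \<epsilon> assume x: "x \<in> S" and \<epsilon>: "0 < \<epsilon>" "\<epsilon> \<le> min e (r / (2 * C + 1))" "\<epsilon> \<le> 1"
    define s where "s = h \<epsilon> x - h 0 x - \<epsilon> * D x"
    have s: "\<bar>s\<bar> \<le> C * \<epsilon>^2" using C(3)[OF x \<epsilon>(1)] \<epsilon>(2) by (auto simp: s_def)
    have "C * \<epsilon>^2 \<le> C * \<epsilon>" using e \<epsilon> by (intro mult_left_mono) (auto simp: power2_eq_square mult_left_le)
    moreover have "\<bar>\<epsilon> * D x\<bar> \<le> \<epsilon> * C" unfolding abs_mult using \<epsilon> C(2)[OF x] by (auto intro: mult_mono)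
    ultimately have d: "\<bar>h \<epsilon> x - h 0 x\<bar> \<le> 2 * C * \<epsilon>" using s unfolding s_def by (simp add: algebra_simps)
    have "2 * C * \<epsilon> \<le> (2 * C + 1) * \<epsilon>" using \<epsilon> by (simp add: algebra_simps)
    also have "\<dots> \<le> r" using \<epsilon>(2) e by (simp add: field_simps)
    finally have "\<bar>h \<epsilon> x - h 0 x\<bar> \<le> r" using d by linarith
    from f(3)[OF x this]
    have 1: "\<bar>f (h \<epsilon> x) - f (h 0 x) - f' (h 0 x) * (h \<epsilon> x - h 0 x)\<bar> \<le> K * (h \<epsilon> x - h 0 x)^2" .
    have "(h \<epsilon> x - h 0 x)^2 \<le> (2 * C * \<epsilon>)^2" using d e \<epsilon> by (intro power2_le_iff_abs_le[THEN iffD2]) auto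
    then have 2: "K * (h \<epsilon> x - h 0 x)^2 \<le> K * (2 * C)^2 * \<epsilon>^2"
      using K[OF x] by (simp add: power_mult_distrib mult_left_mono mult.assoc)
    have "\<bar>f' (h 0 x) * s\<bar> \<le> K * (C * \<epsilon>^2)" unfolding abs_mult using f(2)[OF x] s K[OF x]
      by (intro mult_mono) auto
    moreover have "f (h \<epsilon> x) - f (h 0 x) - \<epsilon> * (f' (h 0 x) * D x)
      = (f (h \<epsilon> x) - f (h 0 x) - f' (h 0 x) * (h \<epsilon> x - h 0 x)) + f' (h 0 x) * s"
      unfolding s_def by (simp add: algebra_simps)
    ultimately show "\<bar>f (h \<epsilon> x) - f (h 0 x) - \<epsilon> * (f' (h 0 x) * D x)\<bar> \<le> (K * (2 * C)^2 + K * C) * \<epsilon>^2"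
      using 1 2 by (simp add: algebra_simps)
  next
    fix x assume x: "x \<in> S"
    show "\<bar>f (h 0 x)\<bar> \<le> K" by (rule f(1)[OF x])
    show "\<bar>f' (h 0 x) * D x\<bar> \<le> K * C" unfolding abs_mult
      using f(2)[OF x] C(2)[OF x] K[OF x] by (intro mult_mono) auto
  qed (use e r in auto)
qed

text \<open>Mean value theorem followed by the Lipschitz bound for f'; the constant L in place of L
  / 2 is good enough.\<close>

lemma taylor_remainder:
  fixes f f' :: "real \<Rightarrow> real"
  assumes "\<And>y. \<bar>y - z\<bar> \<le> r \<Longrightarrow> (f has_real_derivative f' y) (at y)"
    and "\<And>y. \<bar>y - z\<bar> \<le> r \<Longrightarrow> \<bar>f' y - f' z\<bar> \<le> L * \<bar>y - z\<bar>" and "\<bar>w - z\<bar> \<le> r" "L \<ge> 0"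
  shows "\<bar>f w - f z - f' z * (w - z)\<bar> \<le> L * (w - z)^2"
proof -
  have "\<exists>y. \<bar>y - z\<bar> \<le> \<bar>w - z\<bar> \<and> f w - f z = f' y * (w - z)"
  proof (cases w z rule: linorder_cases)
    case less
    then obtain y where "w < y" "y < z" "f z - f w = (z - w) * f' y"
      using MVT2[of w z f f'] assms(1,3) by fastforce
    then show ?thesis by (intro exI[of _ y]) (auto simp: algebra_simps)
  next
    case greater
    then obtain y where "z < y" "y < w" "f w - f z = (w - z) * f' y"
      using MVT2[of z w f f'] assms(1,3) by fastforce
    then show ?thesis by (intro exI[of _ y]) (auto simp: algebra_simps)
  qed auto
  then obtain y where y: "\<bar>y - z\<bar> \<le> \<bar>w - z\<bar>" "f w - f z = f' y * (w - z)" by blast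
  have "\<bar>f w - f z - f' z * (w - z)\<bar> = \<bar>f' y - f' z\<bar> * \<bar>w - z\<bar>"
    unfolding y(2) by (simp add: abs_mult[symmetric] algebra_simps)
  also have "\<dots> \<le> (L * \<bar>y - z\<bar>) * \<bar>w - z\<bar>" using assms(2,3) y by (intro mult_right_mono) auto
  also have "\<dots> \<le> (L * \<bar>w - z\<bar>) * \<bar>w - z\<bar>" using y assms by (intro mult_right_mono mult_left_mono) auto
  also have "\<dots> = L * (w - z)^2" by (simp add: power2_eq_square)
  finally show ?thesis .
qed

text \<open>The radius 1/2 keeps z in [1/2, 3/2], away from the singularity of z powr s at 0, so
  that the second derivative is bounded by compactness.\<close>

lemma powr_expansion_at_one:
  fixes s :: real
  shows "\<exists>K\<ge>0. \<forall>z. \<bar>z - 1\<bar> \<le> 1/2 \<longrightarrow> \<bar>z powr s - 1 - s * (z - 1)\<bar> \<le> K * (z - 1)^2"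
proof -
  define f'' where "f'' = (\<lambda>z::real. s * ((s - 1) * z powr (s - 2)))"
  have "continuous_on {1/2..3/2} f''" unfolding f''_def by (intro continuous_intros) auto
  then have "compact (f'' ` {1/2..3/2})" by (rule compact_continuous_image) auto
  then have "bounded (f'' ` {1/2..3/2})" by (rule compact_imp_bounded)
  then obtain L where "\<forall>y\<in>f'' ` {1/2..3/2}. norm y \<le> L" unfolding bounded_iff ..
  then have L: "\<And>z. z \<in> {1/2..3/2} \<Longrightarrow> \<bar>f'' z\<bar> \<le> L" by auto
  have L0: "L \<ge> 0" using L[of 1] by auto
  have d2: "((\<lambda>z. s * z powr (s - 1)) has_real_derivative f'' y) (at y)" if "y \<in> {1/2..3/2}" for y
    unfolding f''_def using that by (auto intro!: derivative_eq_intros simp: algebra_simps)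
  have lip: "\<bar>s * y powr (s - 1) - s * 1 powr (s - 1)\<bar> \<le> L * \<bar>y - 1\<bar>" if "\<bar>y - 1\<bar> \<le> 1/2" for y
  proof -
    have y: "y \<in> {1/2..3/2}" using that by (simp only: abs_le_iff atLeastAtMost_iff) linarith
    have "norm (s * y powr (s - 1) - s * 1 powr (s - 1)) \<le> L * norm (y - 1)"
    proof (rule field_differentiable_bound[of "{1/2..3/2}" _ f''])
      show "\<And>z. z \<in> {1/2..3/2} \<Longrightarrow> ((\<lambda>z. s * z powr (s - 1)) has_field_derivative f'' z) (at z within {1/2..3/2})"
        using d2 has_field_derivative_at_within by blast
    qed (use y L in auto)
    then show ?thesis by simp
  qed
  show ?thesis
  proof (intro exI[of _ L] conjI L0 allI impI)
    fix z :: real assume z: "\<bar>z - 1\<bar> \<le> 1/2"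
    have "\<bar>z powr s - 1 powr s - (s * 1 powr (s - 1)) * (z - 1)\<bar> \<le> L * (z - 1)^2"
    proof (rule taylor_remainder[where r = "1/2" and f' = "\<lambda>y. s * y powr (s - 1)"])
      fix y :: real assume "\<bar>y - 1\<bar> \<le> 1/2"
      then have "y > 0" by (simp only: abs_le_iff) linarith
      then show "((\<lambda>z. z powr s) has_real_derivative s * y powr (s - 1)) (at y)"
        by (auto intro!: derivative_eq_intros)
    qed (use z L0 lip in auto)
    then show "\<bar>z powr s - 1 - s * (z - 1)\<bar> \<le> L * (z - 1)^2" by simp
  qed
qed

lemma unif_deriv_powr_one:
  assumes "\<And>x. x \<in> S \<Longrightarrow> \<bar>u x\<bar> \<le> B"
  shows "unif_deriv S (\<lambda>\<epsilon> x. (1 + \<epsilon> * u x) powr s) (\<lambda>x. s * u x)"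
proof -
  obtain K where K: "K \<ge> 0" "\<And>z. \<bar>z - 1\<bar> \<le> 1/2 \<Longrightarrow> \<bar>z powr s - 1 - s * (z - 1)\<bar> \<le> K * (z - 1)^2"
    using powr_expansion_at_one[of s] by blast
  \<comment> \<open>The single constant K + |s| + 1 has to dominate the value 1, the derivative s
    and the remainder constant K at once.\<close>
  have *: "K * y \<le> (K + \<bar>s\<bar> + 1) * y" if "y \<ge> 0" for y using that by (intro mult_right_mono) auto
  show ?thesis
    by (rule unif_deriv_compose[of S "\<lambda>\<epsilon> x. 1 + \<epsilon> * u x" u "1/2" "\<lambda>z. z powr s" "K + \<bar>s\<bar> + 1" "\<lambda>_. s"])
      (use assms K in \<open>auto intro!: unif_deriv_affine[of _ _ 1] order_trans[OF _ *]\<close>)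
qed

section \<open>Coordinatewise change of variables\<close>

lemma density_PiM:
  assumes M: "\<And>i. sigma_finite_measure (M i)" and Md: "\<And>i. sigma_finite_measure (density (M i) (f i))"
    and I: "finite I" and f: "\<And>i. f i \<in> borel_measurable (M i)"
  shows "density (PiM I M) (\<lambda>x. \<Prod>i\<in>I. f i (x i)) = PiM I (\<lambda>i. density (M i) (f i))"
proof -
  interpret M: product_sigma_finite M using M by (simp add: product_sigma_finite_def)
  interpret D: product_sigma_finite "\<lambda>i. density (M i) (f i)" using Md by (simp add: product_sigma_finite_def)
  note [measurable] = f
  have sets_eq: "sets (PiM I (\<lambda>i. density (M i) (f i))) = sets (PiM I M)"
    by (rule sets_PiM_cong) auto
  show ?thesis
  proof (rule D.PiM_eqI[OF I])
    fix A assume A: "\<And>i. i \<in> I \<Longrightarrow> A i \<in> sets (density (M i) (f i))"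
    then have A'[measurable]: "\<And>i. i \<in> I \<Longrightarrow> A i \<in> sets (M i)" by simp
    have PA: "Pi\<^sub>E I A \<in> sets (PiM I M)" using A' I by (intro sets_PiM_I_finite) auto
    have meas: "(\<lambda>x. \<Prod>i\<in>I. f i (x i)) \<in> borel_measurable (PiM I M)"
      by measurable
    have "emeasure (density (PiM I M) (\<lambda>x. \<Prod>i\<in>I. f i (x i))) (Pi\<^sub>E I A)
      = (\<integral>\<^sup>+x. (\<Prod>i\<in>I. f i (x i)) * indicator (Pi\<^sub>E I A) x \<partial>PiM I M)"
      by (rule emeasure_density[OF meas PA])
    also have "\<dots> = (\<integral>\<^sup>+x. (\<Prod>i\<in>I. f i (x i) * indicator (A i) (x i)) \<partial>PiM I M)"
    proof (rule nn_integral_cong)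
      fix x assume x: "x \<in> space (PiM I M)"
      have "indicator (Pi\<^sub>E I A) x = (\<Prod>i\<in>I. indicator (A i) (x i) :: ennreal)"
      proof (cases "x \<in> Pi\<^sub>E I A")
        case True
        then have "\<forall>i\<in>I. x i \<in> A i" by auto
        then show ?thesis using True by simp
      next
        case False
        then obtain i where "i \<in> I" "x i \<notin> A i" using x by (auto simp: space_PiM PiE_def)
        then show ?thesis using False I by (auto simp: prod_zero_iff indicator_eq_0_iff intro!: prod_zero[symmetric])
      qed
      then show "(\<Prod>i\<in>I. f i (x i)) * indicator (Pi\<^sub>E I A) x = (\<Prod>i\<in>I. f i (x i) * indicator (A i) (x i))"
        by (simp add: prod.distrib)
    qed
    also have "\<dots> = (\<Prod>i\<in>I. \<integral>\<^sup>+y. f i y * indicator (A i) y \<partial>M i)"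
      using A' by (intro M.product_nn_integral_prod[OF I]) measurable
    also have "\<dots> = (\<Prod>i\<in>I. emeasure (density (M i) (f i)) (A i))"
      using A' by (intro prod.cong refl emeasure_density[symmetric]) auto
    finally show "emeasure (density (PiM I M) (\<lambda>x. \<Prod>i\<in>I. f i (x i))) (Pi\<^sub>E I A) =
      (\<Prod>i\<in>I. emeasure (density (M i) (f i)) (A i))" .
  qed (simp add: sets_eq)
qed

lemma distr_PiM_coordinatewise:
  assumes M: "\<And>i. sigma_finite_measure (M i)" and Md: "\<And>i. sigma_finite_measure (distr (M i) (N i) (g i))"
    and I: "finite I" and g: "\<And>i. g i \<in> measurable (M i) (N i)"
  shows "distr (PiM I M) (PiM I N) (\<lambda>x. \<lambda>i\<in>I. g i (x i)) = PiM I (\<lambda>i. distr (M i) (N i) (g i))"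
proof -
  interpret M: product_sigma_finite M using M by (simp add: product_sigma_finite_def)
  interpret D: product_sigma_finite "\<lambda>i. distr (M i) (N i) (g i)" using Md by (simp add: product_sigma_finite_def)
  note [measurable] = g
  have sets_eq: "sets (PiM I (\<lambda>i. distr (M i) (N i) (g i))) = sets (PiM I N)"
    by (rule sets_PiM_cong) auto
  show ?thesis
  proof (rule D.PiM_eqI[OF I])
    fix A assume A: "\<And>i. i \<in> I \<Longrightarrow> A i \<in> sets (distr (M i) (N i) (g i))"
    then have A': "\<And>i. i \<in> I \<Longrightarrow> A i \<in> sets (N i)" by simp
    have PA: "Pi\<^sub>E I A \<in> sets (PiM I N)" using A' I by (intro sets_PiM_I_finite) auto
    have "emeasure (distr (PiM I M) (PiM I N) (\<lambda>x. \<lambda>i\<in>I. g i (x i))) (Pi\<^sub>E I A)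
      = emeasure (PiM I M) ((\<lambda>x. \<lambda>i\<in>I. g i (x i)) -` Pi\<^sub>E I A \<inter> space (PiM I M))"
      by (rule emeasure_distr[OF _ PA]) measurable
    also have "(\<lambda>x. \<lambda>i\<in>I. g i (x i)) -` Pi\<^sub>E I A \<inter> space (PiM I M) = Pi\<^sub>E I (\<lambda>i. g i -` A i \<inter> space (M i))"
      by (auto simp: space_PiM PiE_def Pi_def)
    also have "emeasure (PiM I M) \<dots> = (\<Prod>i\<in>I. emeasure (M i) (g i -` A i \<inter> space (M i)))"
      using A' g by (intro M.emeasure_PiM I measurable_sets[OF g]) auto
    also have "\<dots> = (\<Prod>i\<in>I. emeasure (distr (M i) (N i) (g i)) (A i))"
      using A' g by (intro prod.cong refl emeasure_distr[symmetric]) auto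
    finally show "emeasure (distr (PiM I M) (PiM I N) (\<lambda>x. \<lambda>i\<in>I. g i (x i))) (Pi\<^sub>E I A) =
      (\<Prod>i\<in>I. emeasure (distr (M i) (N i) (g i)) (A i))" .
  qed (simp add: sets_eq)
qed

abbreviation "unit_uniform \<equiv> density lborel (indicator {0..1::real} :: real \<Rightarrow> ennreal)"

lemma sigma_finite_unit_uniform: "sigma_finite_measure unit_uniform"
proof -
  have "finite_measure unit_uniform" by (rule finite_measureI) (simp add: emeasure_density)
  then show ?thesis by (simp add: finite_measure.axioms)
qed

lemma distr_unit_substitution:
  assumes \<phi>: "\<phi> 0 = 0" "\<phi> 1 = (1::real)" and [measurable]: "\<phi> \<in> borel_measurable borel" "\<phi>' \<in> borel_measurable borel"
    and d: "\<And>x. x \<in> {0..1} \<Longrightarrow> (\<phi> has_real_derivative \<phi>' x) (at x)"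
    and c: "continuous_on {0..1} \<phi>'" and pos: "\<And>x. x \<in> {0..1} \<Longrightarrow> \<phi>' x \<ge> 0"
  shows "distr (density lborel (\<lambda>x. ennreal (\<phi>' x) * indicator {0..1} x)) lborel \<phi> = unit_uniform"
proof (rule measure_eqI)
  fix A assume "A \<in> sets (distr (density lborel (\<lambda>x. ennreal (\<phi>' x) * indicator {0..1} x)) lborel \<phi>)"
  then have A[measurable]: "A \<in> sets borel" by simp
  have "emeasure (distr (density lborel (\<lambda>x. ennreal (\<phi>' x) * indicator {0..1} x)) lborel \<phi>) A
    = (\<integral>\<^sup>+x. ennreal (\<phi>' x) * indicator {0..1} x * indicator (\<phi> -` A) x \<partial>lborel)"
    by (subst emeasure_distr) (auto simp: emeasure_density measurable_sets_borel[OF _ A])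
  also have "\<dots> = (\<integral>\<^sup>+x. ennreal (indicator A (\<phi> x) * \<phi>' x * indicator {0..1} x) \<partial>lborel)"
    by (intro nn_integral_cong) (auto split: split_indicator)
  also have "\<dots> = (\<integral>\<^sup>+x. ennreal (indicator A x * indicator {\<phi> 0..\<phi> 1} x) \<partial>lborel)"
    by (rule nn_integral_substitution[symmetric]) (use d c pos in \<open>auto simp: set_borel_measurable_def\<close>)
  also have "\<dots> = emeasure unit_uniform A"
    by (auto simp: emeasure_density \<phi> intro!: nn_integral_cong split: split_indicator)
  finally show "emeasure (distr (density lborel (\<lambda>x. ennreal (\<phi>' x) * indicator {0..1} x)) lborel \<phi>) A = emeasure unit_uniform A" .
qed simp

text \<open>The map acts on each coordinate separately, so the multivariate change of variables
  follows from the one-dimensional substitution: both sides integrate against the product of uniform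
  laws on [0, 1], on the right written as an image measure.\<close>

lemma nn_integral_PiM_unit_substitution:
  fixes F :: "('i \<Rightarrow> real) \<Rightarrow> ennreal"
  assumes \<phi>: "\<phi> 0 = 0" "\<phi> 1 = (1::real)" and [measurable]: "\<phi> \<in> borel_measurable borel" "\<phi>' \<in> borel_measurable borel"
    and d: "\<And>x. x \<in> {0..1} \<Longrightarrow> (\<phi> has_real_derivative \<phi>' x) (at x)"
    and c: "continuous_on {0..1} \<phi>'" and pos: "\<And>x. x \<in> {0..1} \<Longrightarrow> \<phi>' x \<ge> 0"
    and I: "finite I" and F[measurable]: "F \<in> borel_measurable (PiM I (\<lambda>_. lborel))"
  shows "(\<integral>\<^sup>+x. F x * (\<Prod>i\<in>I. indicator {0..1} (x i)) \<partial>PiM I (\<lambda>_. lborel)) =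
    (\<integral>\<^sup>+x. F (\<lambda>i\<in>I. \<phi> (x i)) * (\<Prod>i\<in>I. ennreal (\<phi>' (x i)) * indicator {0..1} (x i)) \<partial>PiM I (\<lambda>_. lborel))"
proof -
  let ?f = "\<lambda>x. ennreal (\<phi>' x) * indicator {0..1} x"
  let ?L = "PiM I (\<lambda>_. lborel :: real measure)"
  have sf: "sigma_finite_measure (density lborel ?f)"
  proof -
    have "(\<integral>\<^sup>+x. ?f x \<partial>lborel) = emeasure (distr (density lborel ?f) lborel \<phi>) UNIV"
      by (subst emeasure_distr) (auto simp: emeasure_density)
    also have "\<dots> = emeasure unit_uniform UNIV" by (subst distr_unit_substitution) (use assms in auto)
    finally have "finite_measure (density lborel ?f)"
      by (intro finite_measureI) (simp add: emeasure_density)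
    then show ?thesis by (simp add: finite_measure.axioms)
  qed
  have U: "distr (density lborel ?f) lborel \<phi> = unit_uniform" by (rule distr_unit_substitution) fact+
  have E1: "density ?L (\<lambda>x. \<Prod>i\<in>I. indicator {0..1} (x i)) = PiM I (\<lambda>_. unit_uniform)"
    by (rule density_PiM) (auto intro: sigma_finite_unit_uniform lborel.sigma_finite_measure_axioms I)
  have E2: "density ?L (\<lambda>x. \<Prod>i\<in>I. ?f (x i)) = PiM I (\<lambda>_. density lborel ?f)"
    by (rule density_PiM) (auto intro: sf lborel.sigma_finite_measure_axioms I)
  have E3: "distr (PiM I (\<lambda>_. density lborel ?f)) ?L (\<lambda>x. \<lambda>i\<in>I. \<phi> (x i)) = PiM I (\<lambda>_. unit_uniform)"
    by (subst distr_PiM_coordinatewise) (auto simp: U intro: sf sigma_finite_unit_uniform I)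
  have "(\<integral>\<^sup>+x. F x * (\<Prod>i\<in>I. indicator {0..1} (x i)) \<partial>?L) = (\<integral>\<^sup>+x. F x \<partial>density ?L (\<lambda>x. \<Prod>i\<in>I. indicator {0..1} (x i)))"
    by (subst nn_integral_density) (auto simp: mult.commute)
  also have "\<dots> = (\<integral>\<^sup>+x. F x \<partial>distr (density ?L (\<lambda>x. \<Prod>i\<in>I. ?f (x i))) ?L (\<lambda>x. \<lambda>i\<in>I. \<phi> (x i)))"
    unfolding E1 E2 E3 ..
  also have "\<dots> = (\<integral>\<^sup>+x. F (\<lambda>i\<in>I. \<phi> (x i)) \<partial>density ?L (\<lambda>x. \<Prod>i\<in>I. ?f (x i)))"
    by (subst nn_integral_distr) auto
  also have "\<dots> = (\<integral>\<^sup>+x. F (\<lambda>i\<in>I. \<phi> (x i)) * (\<Prod>i\<in>I. ?f (x i)) \<partial>?L)"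
    by (subst nn_integral_density) (auto simp: mult.commute)
  finally show ?thesis .
qed

declare One_nat_def [simp del]

section \<open>The flow of the vector field \<open>x\<^sup>k\<^sup>+\<^sup>1 (1 - x)\<close> on the Jacobi weight\<close>

text \<open>The divided difference of g(x) = x^(k+1) (1 - x), written as a polynomial so that it
  also makes sense for x = y, where it is g'(x).\<close>

definition diff_kernel :: "nat \<Rightarrow> real \<Rightarrow> real \<Rightarrow> real" where
  "diff_kernel k x y = (\<Sum>l\<le>k. x ^ l * y ^ (k - l)) - (\<Sum>l\<le>Suc k. x ^ l * y ^ (Suc k - l))"

text \<open>One Euler step rather than the exact flow: only the first order in \<epsilon> matters,
  and differences of images factor exactly through \<open>diff_kernel\<close>.\<close>

definition flow :: "nat \<Rightarrow> real \<Rightarrow> real \<Rightarrow> real" where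
  "flow k \<epsilon> x = x + \<epsilon> * (x ^ Suc k * (1 - x))"

lemma diff_kernel_mult:
  "(x - y) * diff_kernel k x y = x ^ Suc k * (1 - x) - y ^ Suc k * (1 - y)"
proof -
  have *: "(x - y) * (\<Sum>l\<le>k. x ^ l * y ^ (k - l)) = x ^ Suc k - y ^ Suc k" for k
    unfolding power_diff_sumr2[of x "Suc k" y] lessThan_Suc_atMost by (simp add: mult.commute)
  show ?thesis unfolding diff_kernel_def right_diff_distrib * by (simp add: algebra_simps)
qed

lemma diff_kernel_diag: "diff_kernel k x x = real (Suc k) * x ^ k - real (Suc (Suc k)) * x ^ Suc k"
proof -
  have *: "(\<Sum>l\<le>k. x ^ l * x ^ (k - l)) = real (Suc k) * x ^ k" for k
    by (simp flip: power_add)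
  show ?thesis unfolding diff_kernel_def * ..
qed

lemma diff_kernel_commute: "diff_kernel k x y = diff_kernel k y x"
proof -
  have *: "(\<Sum>l\<le>k. x ^ l * y ^ (k - l)) = (\<Sum>l\<le>k. y ^ l * x ^ (k - l))" for k
    by (rule sum.reindex_bij_witness[of _ "\<lambda>l. k - l" "\<lambda>l. k - l"]) auto
  show ?thesis unfolding diff_kernel_def * ..
qed

lemma abs_diff_kernel_le:
  assumes "x \<in> {0..1}" "y \<in> {0..1}"
  shows "\<bar>diff_kernel k x y\<bar> \<le> real (2 * k + 3)"
proof -
  have *: "\<bar>\<Sum>l\<le>k. x ^ l * y ^ (k - l)\<bar> \<le> real (Suc k)" for k
  proof -
    have "\<bar>\<Sum>l\<le>k. x ^ l * y ^ (k - l)\<bar> \<le> (\<Sum>l\<le>k. \<bar>x ^ l * y ^ (k - l)\<bar>)" by (rule sum_abs)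
    also have "\<dots> \<le> (\<Sum>l\<le>k. 1)"
      using assms by (intro sum_mono) (auto simp: abs_mult intro!: mult_le_one power_le_one)
    finally show ?thesis by simp
  qed
  show ?thesis unfolding diff_kernel_def using *[of k] *[of "Suc k"] by (simp del: sum.atMost_Suc)
qed

lemma flow_diff: "flow k \<epsilon> x - flow k \<epsilon> y = (x - y) * (1 + \<epsilon> * diff_kernel k x y)"
proof -
  have "flow k \<epsilon> x - flow k \<epsilon> y = (x - y) + \<epsilon> * ((x - y) * diff_kernel k x y)"
    unfolding diff_kernel_mult flow_def by (simp add: algebra_simps)
  then show ?thesis by (simp add: algebra_simps)
qed

text \<open>The two geometric sums in \<open>diff_kernel\<close> have k + 1 and k + 2 terms of size
  at most 1, so this bound gives |\<epsilon> * \<open>diff_kernel\<close>| \<le> 1/2.\<close>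

definition admissible_step :: "nat \<Rightarrow> real \<Rightarrow> bool" where
  "admissible_step k \<epsilon> \<longleftrightarrow> 0 < \<epsilon> \<and> \<epsilon> \<le> 1 / (2 * real (2 * k + 3))"

lemma diff_kernel_step_pos:
  assumes "admissible_step k \<epsilon>" "x \<in> {0..1}" "y \<in> {0..1}"
  shows "0 < 1 + \<epsilon> * diff_kernel k x y"
proof -
  have "\<bar>\<epsilon> * diff_kernel k x y\<bar> \<le> 1 / (2 * real (2 * k + 3)) * real (2 * k + 3)"
    unfolding abs_mult using assms abs_diff_kernel_le[OF assms(2,3), of k]
    by (intro mult_mono) (auto simp: admissible_step_def)
  also have "\<dots> = 1 / 2" by simp
  finally show ?thesis by (simp only: abs_le_iff) linarith
qed

text \<open>A step multiplies x - y by a positive number. Hence it respects the ordering constraint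
  in the weight and, with 0 and 1 fixed, maps the unit interval into itself.\<close>

lemma flow_le_iff:
  assumes "admissible_step k \<epsilon>" "x \<in> {0..1}" "y \<in> {0..1}"
  shows "flow k \<epsilon> x \<le> flow k \<epsilon> y \<longleftrightarrow> x \<le> y"
proof -
  have "flow k \<epsilon> x \<le> flow k \<epsilon> y \<longleftrightarrow> (x - y) * (1 + \<epsilon> * diff_kernel k x y) \<le> 0"
    unfolding flow_diff[symmetric] by simp
  also have "\<dots> \<longleftrightarrow> x \<le> y" using diff_kernel_step_pos[OF assms] by (simp add: mult_le_0_iff)
  finally show ?thesis .
qed

lemma flow_01 [simp]: "flow k \<epsilon> 0 = 0" "flow k \<epsilon> 1 = 1"
  by (auto simp: flow_def)

lemma flow_in_unit:
  assumes "admissible_step k \<epsilon>" "x \<in> {0..1}"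
  shows "flow k \<epsilon> x \<in> {0..1}"
  using flow_le_iff[OF assms(1), of 0 x] flow_le_iff[OF assms(1), of x 1] assms by auto

lemma flow_has_derivative:
  "(flow k \<epsilon> has_real_derivative 1 + \<epsilon> * diff_kernel k x x) (at x)"
  unfolding flow_def[abs_def] diff_kernel_diag
  by (rule derivative_eq_intros refl)+ (simp add: algebra_simps)

definition unit_cube :: "nat \<Rightarrow> (nat \<Rightarrow> real) set" where
  "unit_cube N = {x. x ` {1..N} \<subseteq> {0..1}}"

lemma unit_cubeD: "x \<in> unit_cube N \<Longrightarrow> l \<in> {1..N} \<Longrightarrow> x l \<in> {0..1}"
  unfolding unit_cube_def by blast

text \<open>The ratio of the transported weight, including the determinant of the coordinatewise
  map, to the original weight. The factors belong in turn to x_j - x_i, to x_l, to 1 - x_l and to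
  the derivative of the map.\<close>

definition flow_jacobian :: "real \<Rightarrow> real \<Rightarrow> real \<Rightarrow> nat \<Rightarrow> nat \<Rightarrow> real \<Rightarrow> (nat \<Rightarrow> real) \<Rightarrow> real" where
  "flow_jacobian \<beta> a b N k \<epsilon> x =
    (\<Prod>j\<in>{1..N}. \<Prod>i\<in>{1..<j}. (1 + \<epsilon> * diff_kernel k (x j) (x i)) powr \<beta>) *
    (\<Prod>l\<in>{1..N}. (1 + \<epsilon> * (x l ^ k * (1 - x l))) powr a * (1 + \<epsilon> * (- (x l ^ Suc k))) powr b *
       (1 + \<epsilon> * diff_kernel k (x l) (x l)))"

definition flow_config :: "nat \<Rightarrow> nat \<Rightarrow> real \<Rightarrow> (nat \<Rightarrow> real) \<Rightarrow> nat \<Rightarrow> real" where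
  "flow_config N k \<epsilon> x = (\<lambda>l\<in>{1..N}. flow k \<epsilon> (x l))"

lemma jacobi_weight_nonneg: "0 \<le> jacobi_weight \<beta> a b N x"
  unfolding jacobi_weight_def by (intro mult_nonneg_nonneg prod_nonneg) auto

lemma jacobi_weight_outside: "x \<notin> unit_cube N \<Longrightarrow> jacobi_weight \<beta> a b N x = 0"
  unfolding jacobi_weight_def unit_cube_def by auto

text \<open>Each base of a power is multiplied by a nonnegative factor and \<open>powr\<close> is
  multiplicative on nonnegative numbers, so the identity holds on the whole cube, also where the
  weight vanishes or where 0 \<open>powr\<close> e takes its default value.\<close>

lemma jacobi_weight_flow:
  assumes s: "admissible_step k \<epsilon>" and x: "x \<in> unit_cube N"
  shows "jacobi_weight \<beta> a b N (flow_config N k \<epsilon> x) * (\<Prod>l\<in>{1..N}. 1 + \<epsilon> * diff_kernel k (x l) (x l))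
    = jacobi_weight \<beta> a b N x * flow_jacobian \<beta> a b N k \<epsilon> x"
proof -
  note u = unit_cubeD[OF x]
  have m: "mono_on {1..N} (flow_config N k \<epsilon> x) \<longleftrightarrow> mono_on {1..N} x"
    using flow_le_iff[OF s u u] unfolding mono_on_def flow_config_def by auto
  have c: "flow_config N k \<epsilon> x ` {1..N} \<subseteq> {0..1}" "x ` {1..N} \<subseteq> {0..1}"
    using flow_in_unit[OF s u] x unfolding unit_cube_def flow_config_def by auto
  have p1: "(\<Prod>j\<in>{1..N}. \<Prod>i\<in>{1..<j}. \<bar>flow_config N k \<epsilon> x j - flow_config N k \<epsilon> x i\<bar> powr \<beta>)
    = (\<Prod>j\<in>{1..N}. \<Prod>i\<in>{1..<j}. \<bar>x j - x i\<bar> powr \<beta>) *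
      (\<Prod>j\<in>{1..N}. \<Prod>i\<in>{1..<j}. (1 + \<epsilon> * diff_kernel k (x j) (x i)) powr \<beta>)"
    unfolding prod.distrib[symmetric]
  proof (intro prod.cong refl)
    fix j i assume ji: "j \<in> {1..N}" "i \<in> {1..<j}"
    then have i: "i \<in> {1..N}" by auto
    have "flow_config N k \<epsilon> x j - flow_config N k \<epsilon> x i = (x j - x i) * (1 + \<epsilon> * diff_kernel k (x j) (x i))"
      using ji i by (simp add: flow_config_def flow_diff)
    then show "\<bar>flow_config N k \<epsilon> x j - flow_config N k \<epsilon> x i\<bar> powr \<beta> =
      \<bar>x j - x i\<bar> powr \<beta> * (1 + \<epsilon> * diff_kernel k (x j) (x i)) powr \<beta>"
      using diff_kernel_step_pos[OF s u[OF ji(1)] u[OF i]] by (simp add: abs_mult powr_mult)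
  qed
  have p2: "(\<Prod>l\<in>{1..N}. flow_config N k \<epsilon> x l powr a * (1 - flow_config N k \<epsilon> x l) powr b)
    = (\<Prod>l\<in>{1..N}. x l powr a * (1 - x l) powr b) *
      (\<Prod>l\<in>{1..N}. (1 + \<epsilon> * (x l ^ k * (1 - x l))) powr a * (1 + \<epsilon> * (- (x l ^ Suc k))) powr b)"
    unfolding prod.distrib[symmetric]
  proof (intro prod.cong refl)
    fix l assume l: "l \<in> {1..N}"
    have xl: "0 \<le> x l" "x l \<le> 1" using u[OF l] by auto
    have eps: "0 < \<epsilon>" "\<epsilon> \<le> 1"
    proof -
      have "1 / (2 * real (2 * k + 3)) \<le> 1" by simp
      then show "0 < \<epsilon>" "\<epsilon> \<le> 1" using s unfolding admissible_step_def by linarith+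
    qed
    have "\<epsilon> * x l ^ Suc k \<le> 1" using eps xl by (intro mult_le_one) (auto intro!: mult_le_one power_le_one)
    then have n: "0 \<le> 1 + \<epsilon> * (x l ^ k * (1 - x l))" "0 \<le> 1 + \<epsilon> * (- (x l ^ Suc k))"
      using eps xl by auto
    have f: "flow_config N k \<epsilon> x l = x l * (1 + \<epsilon> * (x l ^ k * (1 - x l)))"
      "1 - flow_config N k \<epsilon> x l = (1 - x l) * (1 + \<epsilon> * (- (x l ^ Suc k)))"
      using l by (auto simp: flow_config_def flow_def algebra_simps)
    show "flow_config N k \<epsilon> x l powr a * (1 - flow_config N k \<epsilon> x l) powr b
      = x l powr a * (1 - x l) powr b *
       ((1 + \<epsilon> * (x l ^ k * (1 - x l))) powr a * (1 + \<epsilon> * (- (x l ^ Suc k))) powr b)"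
      unfolding f(2) unfolding f(1) using n xl by (simp only: powr_mult diff_ge_0_iff_ge mult_ac)
  qed
  have jac: "(\<Prod>l\<in>{1..N}. (1 + \<epsilon> * (x l ^ k * (1 - x l))) powr a * (1 + \<epsilon> * (- (x l ^ Suc k))) powr b *
       (1 + \<epsilon> * diff_kernel k (x l) (x l)))
     = (\<Prod>l\<in>{1..N}. (1 + \<epsilon> * (x l ^ k * (1 - x l))) powr a * (1 + \<epsilon> * (- (x l ^ Suc k))) powr b) *
       (\<Prod>l\<in>{1..N}. 1 + \<epsilon> * diff_kernel k (x l) (x l))"
    by (rule prod.distrib)
  have ind: "indicator {x. mono_on {1..N} x \<and> x ` {1..N} \<subseteq> {0..1}} (flow_config N k \<epsilon> x)
    = (indicator {x. mono_on {1..N} x \<and> x ` {1..N} \<subseteq> {0..1}} x :: real)"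
    using m c by (simp add: indicator_def)
  show ?thesis
    unfolding jacobi_weight_def flow_jacobian_def p1 p2 jac ind by (simp only: mult_ac)
qed

lemma borel_measurable_diff_kernel [measurable]:
  assumes [measurable]: "f \<in> borel_measurable M" "g \<in> borel_measurable M"
  shows "(\<lambda>x. diff_kernel k (f x) (g x)) \<in> borel_measurable M"
  unfolding diff_kernel_def by measurable

lemma borel_measurable_flow [measurable]: "flow k \<epsilon> \<in> borel_measurable borel"
  unfolding flow_def[abs_def] by measurable

abbreviation "config_space N \<equiv> PiM {1..N} (\<lambda>_. lborel :: real measure)"

lemma measurable_coordinate: "l \<in> {1..N} \<Longrightarrow> (\<lambda>x. x l) \<in> borel_measurable (config_space N)"
  using measurable_component_singleton[of l "{1..N}" "\<lambda>_. lborel :: real measure"] by simp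

lemma borel_measurable_pair_factors:
  assumes [measurable]: "f \<in> borel_measurable M" "g \<in> borel_measurable M"
  shows "(\<lambda>x. \<bar>f x - g x\<bar> powr \<beta>) \<in> borel_measurable M"
    "(\<lambda>x. (1 + \<epsilon> * diff_kernel k (f x) (g x)) powr \<beta>) \<in> borel_measurable M"
    "Measurable.pred M (\<lambda>x. f x \<le> (g x :: real))" "Measurable.pred M (\<lambda>x. 0 \<le> f x \<and> f x \<le> (1::real))"
proof -
  show "(\<lambda>x. \<bar>f x - g x\<bar> powr \<beta>) \<in> borel_measurable M"
    "(\<lambda>x. (1 + \<epsilon> * diff_kernel k (f x) (g x)) powr \<beta>) \<in> borel_measurable M"
    by measurable
  show "Measurable.pred M (\<lambda>x. f x \<le> (g x :: real))"
    using borel_measurable_le[OF assms] by (simp add: pred_def)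
  have "Measurable.pred M (\<lambda>x. 0 \<le> f x)" "Measurable.pred M (\<lambda>x. f x \<le> (1::real))"
    using borel_measurable_le[OF borel_measurable_const assms(1), of 0]
      borel_measurable_le[OF assms(1) borel_measurable_const, of 1] by (simp_all add: pred_def)
  then show "Measurable.pred M (\<lambda>x. 0 \<le> f x \<and> f x \<le> (1::real))"
    by (rule pred_intros_logic)
qed

lemma borel_measurable_jacobi_weight [measurable]: "jacobi_weight \<beta> a b N \<in> borel_measurable (config_space N)"
proof -
  note [measurable] = measurable_coordinate
  have "Measurable.pred (config_space N) (\<lambda>x. (\<forall>i\<in>{1..N}. \<forall>j\<in>{1..N}. i \<le> j \<longrightarrow> x i \<le> x j) \<and> (\<forall>i\<in>{1..N}. 0 \<le> x i \<and> x i \<le> 1))"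
    by (intro pred_intros_logic pred_intros_finite borel_measurable_pair_factors measurable_coordinate) auto
  then have "{x \<in> space (config_space N). (\<forall>i\<in>{1..N}. \<forall>j\<in>{1..N}. i \<le> j \<longrightarrow> x i \<le> x j) \<and> (\<forall>i\<in>{1..N}. 0 \<le> x i \<and> x i \<le> 1)} \<in> sets (config_space N)"
    by (rule predE)
  also have "{x \<in> space (config_space N). (\<forall>i\<in>{1..N}. \<forall>j\<in>{1..N}. i \<le> j \<longrightarrow> x i \<le> x j) \<and> (\<forall>i\<in>{1..N}. 0 \<le> x i \<and> x i \<le> 1)} =
    {x \<in> space (config_space N). mono_on {1..N} x \<and> x ` {1..N} \<subseteq> {0..1}}"
    unfolding mono_on_def by auto
  finally have 1: "(indicator {x. mono_on {1..N} x \<and> x ` {1..N} \<subseteq> {0..1}} :: _ \<Rightarrow> real) \<in> borel_measurable (config_space N)"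
    by (subst borel_measurable_indicator_iff) (simp add: Int_def conj_commute)
  show ?thesis unfolding jacobi_weight_def[abs_def]
    by (intro borel_measurable_times 1 borel_measurable_prod borel_measurable_pair_factors) (auto intro!: measurable_coordinate)
qed

lemma borel_measurable_flow_jacobian [measurable]: "flow_jacobian \<beta> a b N k \<epsilon> \<in> borel_measurable (config_space N)"
proof -
  note [measurable] = measurable_coordinate
  show ?thesis unfolding flow_jacobian_def[abs_def]
    by (intro borel_measurable_times borel_measurable_prod borel_measurable_pair_factors) (auto intro!: measurable_coordinate)
qed

lemma measurable_flow_config [measurable]: "flow_config N k \<epsilon> \<in> measurable (config_space N) (config_space N)"
  unfolding flow_config_def[abs_def] by measurable

lemma flow_jacobian_nonneg:
  assumes "admissible_step k \<epsilon>" "x \<in> unit_cube N"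
  shows "0 \<le> flow_jacobian \<beta> a b N k \<epsilon> x"
  unfolding flow_jacobian_def
  using diff_kernel_step_pos[OF assms(1) unit_cubeD[OF assms(2)] unit_cubeD[OF assms(2)]]
  by (intro mult_nonneg_nonneg prod_nonneg) (auto intro: less_imp_le)

text \<open>Invariance is stated as an equality of measures, so that it passes to Bochner integrals
  of signed functions with no separate integrability argument.\<close>

lemma distr_jacobi_weight_flow:
  assumes s: "admissible_step k \<epsilon>"
  shows "distr (density (config_space N) (\<lambda>x. ennreal (jacobi_weight \<beta> a b N x * flow_jacobian \<beta> a b N k \<epsilon> x)))
     (config_space N) (flow_config N k \<epsilon>) = density (config_space N) (\<lambda>x. ennreal (jacobi_weight \<beta> a b N x))"
    (is "?D = ?R")
proof (rule measure_eqI)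
  let ?w = "jacobi_weight \<beta> a b N" and ?J = "flow_jacobian \<beta> a b N k \<epsilon>" and ?\<Phi> = "flow_config N k \<epsilon>"
  fix A assume "A \<in> sets ?D"
  then have A[measurable]: "A \<in> sets (config_space N)" by simp
  have "emeasure ?R A = (\<integral>\<^sup>+x. ennreal (?w x) * indicator A x \<partial>config_space N)"
    by (rule emeasure_density) measurable
  \<comment> \<open>The weight vanishes outside the cube, so the cube indicator required by the
    substitution can be inserted.\<close>
  also have "\<dots> = (\<integral>\<^sup>+x. (ennreal (?w x) * indicator A x) * (\<Prod>i\<in>{1..N}. indicator {0..1} (x i)) \<partial>config_space N)"
  proof (rule nn_integral_cong)
    fix x
    show "ennreal (?w x) * indicator A x = (ennreal (?w x) * indicator A x) * (\<Prod>i\<in>{1..N}. indicator {0..1} (x i))"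
    proof (cases "x \<in> unit_cube N")
      case True
      then have "(\<Prod>i\<in>{1..N}. indicator {0..1} (x i) :: ennreal) = 1"
        using unit_cubeD[OF True] by (intro prod.neutral) auto
      then show ?thesis by simp
    qed (simp add: jacobi_weight_outside)
  qed
  also have "\<dots> = (\<integral>\<^sup>+x. (ennreal (?w (?\<Phi> x)) * indicator A (?\<Phi> x)) *
      (\<Prod>i\<in>{1..N}. ennreal (1 + \<epsilon> * diff_kernel k (x i) (x i)) * indicator {0..1} (x i)) \<partial>config_space N)"
    unfolding flow_config_def
  proof (rule nn_integral_PiM_unit_substitution)
    fix x :: real assume "x \<in> {0..1}"
    show "(flow k \<epsilon> has_real_derivative 1 + \<epsilon> * diff_kernel k x x) (at x)" by (rule flow_has_derivative)
    show "0 \<le> 1 + \<epsilon> * diff_kernel k x x" using diff_kernel_step_pos[OF s \<open>x \<in> {0..1}\<close> \<open>x \<in> {0..1}\<close>] by simp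
  next
    show "continuous_on {0..1} (\<lambda>x. 1 + \<epsilon> * diff_kernel k x x)"
      unfolding diff_kernel_diag by (intro continuous_intros)
  qed auto
  also have "\<dots> = (\<integral>\<^sup>+x. ennreal (?w x * ?J x) * indicator (?\<Phi> -` A \<inter> space (config_space N)) x \<partial>config_space N)"
  proof (rule nn_integral_cong)
    fix x assume sp: "x \<in> space (config_space N)"
    show "(ennreal (?w (?\<Phi> x)) * indicator A (?\<Phi> x)) *
      (\<Prod>i\<in>{1..N}. ennreal (1 + \<epsilon> * diff_kernel k (x i) (x i)) * indicator {0..1} (x i))
      = ennreal (?w x * ?J x) * indicator (?\<Phi> -` A \<inter> space (config_space N)) x"
    proof (cases "x \<in> unit_cube N")
      case True
      note u = unit_cubeD[OF True]
      have "(\<Prod>i\<in>{1..N}. ennreal (1 + \<epsilon> * diff_kernel k (x i) (x i)) * indicator {0..1} (x i))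
        = (\<Prod>i\<in>{1..N}. ennreal (1 + \<epsilon> * diff_kernel k (x i) (x i)))"
        using u by (intro prod.cong) auto
      also have "\<dots> = ennreal (\<Prod>i\<in>{1..N}. 1 + \<epsilon> * diff_kernel k (x i) (x i))"
        using diff_kernel_step_pos[OF s u u] by (intro prod_ennreal) (auto intro: less_imp_le)
      finally have "ennreal (?w (?\<Phi> x)) * (\<Prod>i\<in>{1..N}. ennreal (1 + \<epsilon> * diff_kernel k (x i) (x i)) * indicator {0..1} (x i))
        = ennreal (?w x * ?J x)"
        using jacobi_weight_flow[OF s True, of \<beta> a b] by (simp add: ennreal_mult'[symmetric] jacobi_weight_nonneg)
      moreover have "indicator A (?\<Phi> x) = (indicator (?\<Phi> -` A \<inter> space (config_space N)) x :: ennreal)"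
        using sp by (simp add: indicator_def)
      moreover have swap: "p * q * r = (p * r) * q" for p q r :: ennreal by (simp only: mult_ac)
      ultimately show ?thesis by (subst swap) (simp only:)
    next
      case False
      then obtain i where i: "i \<in> {1..N}" "x i \<notin> {0..1}" unfolding unit_cube_def by blast
      then have "(\<Prod>i\<in>{1..N}. ennreal (1 + \<epsilon> * diff_kernel k (x i) (x i)) * indicator {0..1} (x i)) = 0"
        by (intro prod_zero bexI[of _ i]) (auto simp: indicator_def)
      then show ?thesis using jacobi_weight_outside[OF False, of \<beta> a b] by simp
    qed
  qed
  also have "\<dots> = emeasure (density (config_space N) (\<lambda>x. ennreal (?w x * ?J x))) (?\<Phi> -` A \<inter> space (config_space N))"
    by (rule emeasure_density[symmetric]) measurable
  also have "\<dots> = emeasure ?D A" by (subst emeasure_distr) auto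
  finally show "emeasure ?D A = emeasure ?R A" ..
qed simp

lemma integral_jacobi_weight_flow:
  assumes s: "admissible_step k \<epsilon>" and [measurable]: "G \<in> borel_measurable (config_space N)"
  shows "(\<integral>x. jacobi_weight \<beta> a b N x * (flow_jacobian \<beta> a b N k \<epsilon> x * G (flow_config N k \<epsilon> x)) \<partial>config_space N)
    = (\<integral>x. jacobi_weight \<beta> a b N x * G x \<partial>config_space N)"
proof -
  let ?w = "jacobi_weight \<beta> a b N" and ?J = "flow_jacobian \<beta> a b N k \<epsilon>"
  have nn: "0 \<le> ?w x * ?J x" for x
    using jacobi_weight_outside[of x N \<beta> a b] flow_jacobian_nonneg[OF s, of x N \<beta> a b] jacobi_weight_nonneg[of \<beta> a b N x]
    by (cases "x \<in> unit_cube N") auto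
  have "(\<integral>x. ?w x * G x \<partial>config_space N) = (\<integral>x. G x \<partial>density (config_space N) (\<lambda>x. ennreal (?w x)))"
    by (subst integral_density) (auto simp: jacobi_weight_nonneg)
  also have "\<dots> = (\<integral>x. G (flow_config N k \<epsilon> x) \<partial>density (config_space N) (\<lambda>x. ennreal (?w x * ?J x)))"
    unfolding distr_jacobi_weight_flow[OF s, symmetric] by (subst integral_distr) auto
  also have "\<dots> = (\<integral>x. (?w x * ?J x) * G (flow_config N k \<epsilon> x) \<partial>config_space N)"
    by (subst integral_density) (auto simp: nn)
  finally show ?thesis by (simp add: mult.assoc)
qed

section \<open>Normalization of the Jacobi weight\<close>

lemma nn_integral_beta_density:
  fixes a b :: real assumes "a > -1" "b > -1"
  shows "(\<integral>\<^sup>+x. ennreal (indicator {0..1} x * (x powr a * (1 - x) powr b)) \<partial>lborel) = ennreal (Beta (a + 1) (b + 1))"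
proof -
  have "((\<lambda>t. t powr (a + 1 - 1) * (1 - t) powr (b + 1 - 1)) has_integral Beta (a + 1) (b + 1)) {0..1}"
    using assms by (intro has_integral_Beta_real) auto
  then have "integral\<^sup>N lborel (\<lambda>x. indicator {0..1} x * (x powr a * (1 - x) powr b)) = Beta (a + 1) (b + 1)"
    by (intro nn_integral_has_integral_lebesgue) auto
  then show ?thesis by simp
qed

text \<open>On the cube the differences are at most 1 and \<beta> is positive, so the interaction is
  at most 1 and the integrable product of beta weights dominates.\<close>

lemma jacobi_weight_le:
  assumes "\<beta> > 0"
  shows "jacobi_weight \<beta> a b N x \<le> (\<Prod>l\<in>{1..N}. indicator {0..1} (x l) * (x l powr a * (1 - x l) powr b))"
proof (cases "x \<in> unit_cube N")
  case True
  note u = unit_cubeD[OF True]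
  have "(\<Prod>j\<in>{1..N}. \<Prod>i\<in>{1..<j}. \<bar>x j - x i\<bar> powr \<beta>) \<le> 1"
  proof (intro prod_le_1 conjI prod_nonneg)
    fix j i assume ji: "j \<in> {1..N}" "i \<in> {1..<j}"
    then have "x j \<in> {0..1}" "x i \<in> {0..1}" using u[of j] u[of i] by auto
    then have "\<bar>x j - x i\<bar> \<le> 1" by auto
    then show "\<bar>x j - x i\<bar> powr \<beta> \<le> 1" using assms by (intro powr_le1) auto
  qed auto
  moreover have "(indicator {x. mono_on {1..N} x \<and> x ` {1..N} \<subseteq> {0..1}} x :: real) \<le> 1" by (simp add: indicator_def)
  ultimately have "jacobi_weight \<beta> a b N x \<le> 1 * (1 * (\<Prod>l\<in>{1..N}. x l powr a * (1 - x l) powr b))"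
    unfolding jacobi_weight_def by (intro mult_mono) (auto intro!: prod_nonneg mult_nonneg_nonneg)
  also have "\<dots> = (\<Prod>l\<in>{1..N}. indicator {0..1} (x l) * (x l powr a * (1 - x l) powr b))"
    unfolding mult_1 using u by (intro prod.cong) auto
  finally show ?thesis .
next
  case False
  then show ?thesis by (auto simp: jacobi_weight_outside intro!: prod_nonneg)
qed

lemma integrable_jacobi_weight:
  assumes "\<beta> > 0" "a > -1" "b > -1"
  shows "integrable (config_space N) (jacobi_weight \<beta> a b N)"
proof (rule integrableI_bounded)
  interpret product_sigma_finite "\<lambda>_::nat. lborel :: real measure"
    by (simp add: product_sigma_finite_def lborel.sigma_finite_measure_axioms)
  let ?f = "\<lambda>x. indicator {0..1} x * (x powr a * (1 - x) powr b)"
  have "(\<integral>\<^sup>+x. ennreal (norm (jacobi_weight \<beta> a b N x)) \<partial>config_space N)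
    \<le> (\<integral>\<^sup>+x. (\<Prod>l\<in>{1..N}. ennreal (?f (x l))) \<partial>config_space N)"
  proof (rule nn_integral_mono)
    fix x
    have "ennreal (norm (jacobi_weight \<beta> a b N x)) \<le> ennreal (\<Prod>l\<in>{1..N}. ?f (x l))"
      using jacobi_weight_le[OF assms(1), of a b N x] by (auto simp: jacobi_weight_nonneg intro!: ennreal_leI)
    also have "\<dots> = (\<Prod>l\<in>{1..N}. ennreal (?f (x l)))" by (rule prod_ennreal[symmetric]) auto
    finally show "ennreal (norm (jacobi_weight \<beta> a b N x)) \<le> (\<Prod>l\<in>{1..N}. ennreal (?f (x l)))" .
  qed
  also have "\<dots> = (\<Prod>l\<in>{1..N}. \<integral>\<^sup>+x. ennreal (?f x) \<partial>lborel)"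
    by (rule product_nn_integral_prod) auto
  also have "\<dots> = ennreal (\<Prod>l\<in>{1..N}. Beta (a + 1) (b + 1))"
    unfolding nn_integral_beta_density[OF assms(2,3)] using assms
    by (intro prod_ennreal) (auto simp: Beta_def intro!: divide_nonneg_nonneg mult_nonneg_nonneg less_imp_le[OF Gamma_real_pos])
  also have "\<dots> < \<infinity>" by simp
  finally show "(\<integral>\<^sup>+x. ennreal (norm (jacobi_weight \<beta> a b N x)) \<partial>config_space N) < \<infinity>" .
qed simp

lemma jacobi_const_pos:
  assumes "\<beta> > 0" "a > -1" "b > -1"
  shows "jacobi_const \<beta> a b N > 0"
proof -
  interpret product_sigma_finite "\<lambda>_::nat. lborel :: real measure"
    by (simp add: product_sigma_finite_def lborel.sigma_finite_measure_axioms)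
  let ?w = "jacobi_weight \<beta> a b N"
  \<comment> \<open>Every second one of 2 N + 1 slots of equal length: points chosen in A 1, ..., A
    N are strictly increasing and lie inside (0, 1), so the weight is nonzero on a box of positive
    volume.\<close>
  define A where "A = (\<lambda>i::nat. {(2 * real i - 1) / (2 * real N + 1) <..< 2 * real i / (2 * real N + 1)})"
  have posw: "?w x \<noteq> 0" if x: "x \<in> Pi\<^sub>E {1..N} A" for x
  proof -
    have xA: "(2 * real i - 1) / (2 * real N + 1) < x i" "x i < 2 * real i / (2 * real N + 1)" if "i \<in> {1..N}" for i
      using PiE_mem[OF x that] unfolding A_def by auto
    have lt: "x i < x j" if "i \<in> {1..N}" "j \<in> {1..N}" "i < j" for i j
    proof -
      have "2 * real i / (2 * real N + 1) \<le> (2 * real j - 1) / (2 * real N + 1)"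
        using that by (intro divide_right_mono) auto
      then show ?thesis using xA(2)[OF that(1)] xA(1)[OF that(2)] by linarith
    qed
    have u: "0 < x i" "x i < 1" if "i \<in> {1..N}" for i
    proof -
      have "0 \<le> (2 * real i - 1) / (2 * real N + 1)" using that by auto
      then show "0 < x i" using xA(1)[OF that] by linarith
      have "2 * real i / (2 * real N + 1) \<le> 1" using that by auto
      then show "x i < 1" using xA(2)[OF that] by linarith
    qed
    have "mono_on {1..N} x"
    proof (rule mono_onI)
      fix r s assume "r \<in> {1..N}" "s \<in> {1..N}" "r \<le> s"
      then show "x r \<le> x s" using lt[of r s] by (cases "r = s") auto
    qed
    moreover have "x ` {1..N} \<subseteq> {0..1}" using u by (auto simp: less_imp_le)
    moreover have "(\<Prod>j\<in>{1..N}. \<Prod>i\<in>{1..<j}. \<bar>x j - x i\<bar> powr \<beta>) \<noteq> 0"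
    proof -
      have "x j \<noteq> x i" if "j \<in> {1..N}" "i \<in> {1..<j}" for i j
        using lt[of i j] that by auto
      then show ?thesis by auto
    qed
    moreover have "(\<Prod>l\<in>{1..N}. x l powr a * (1 - x l) powr b) \<noteq> 0"
    proof -
      have "x l \<noteq> 0" "x l \<noteq> 1" if "l \<in> {1..N}" for l using u[OF that] by auto
      then show ?thesis by auto
    qed
    ultimately show ?thesis unfolding jacobi_weight_def by simp
  qed
  have As: "Pi\<^sub>E {1..N} A \<in> sets (config_space N)" by (intro sets_PiM_I_finite) (auto simp: A_def)
  have "emeasure (config_space N) (Pi\<^sub>E {1..N} A) = (\<Prod>i\<in>{1..N}. emeasure lborel (A i))"
    by (rule emeasure_PiM) (auto simp: A_def)
  also have "\<dots> = (\<Prod>i\<in>{1..N}. ennreal (1 / (2 * real N + 1)))"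
    by (intro prod.cong refl) (simp add: A_def divide_right_mono diff_divide_distrib[symmetric])
  also have "\<dots> = ennreal (\<Prod>i\<in>{1..N}. 1 / (2 * real N + 1))" by (rule prod_ennreal) auto
  finally have Apos: "emeasure (config_space N) (Pi\<^sub>E {1..N} A) > 0" by simp
  have "integral\<^sup>L (config_space N) ?w \<noteq> 0"
  proof
    assume "integral\<^sup>L (config_space N) ?w = 0"
    then have "AE x in config_space N. ?w x = 0"
      using integral_nonneg_eq_0_iff_AE[OF integrable_jacobi_weight[OF assms]] by (auto simp: jacobi_weight_nonneg)
    then have "AE x in config_space N. x \<notin> Pi\<^sub>E {1..N} A"
      by (rule eventually_mono) (use posw in auto)
    then have "emeasure (config_space N) (Pi\<^sub>E {1..N} A) = 0"
      using As by (subst (asm) AE_iff_measurable[OF As]) (use sets.sets_into_space[OF As] in auto)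
    then show False using Apos by simp
  qed
  moreover have "0 \<le> integral\<^sup>L (config_space N) ?w"
    by (rule integral_nonneg_AE) (simp add: jacobi_weight_nonneg)
  ultimately show ?thesis unfolding jacobi_const_def by linarith
qed

lemma integral_jacobi_ensemble:
  assumes "\<beta> > 0" "a > -1" "b > -1" and [measurable]: "f \<in> borel_measurable (config_space N)"
  shows "integral\<^sup>L (jacobi_ensemble \<beta> a b N) f
    = (\<integral>x. jacobi_weight \<beta> a b N x * f x \<partial>config_space N) / jacobi_const \<beta> a b N"
proof -
  have "integral\<^sup>L (jacobi_ensemble \<beta> a b N) f
    = (\<integral>x. (jacobi_weight \<beta> a b N x / jacobi_const \<beta> a b N) * f x \<partial>config_space N)"
    unfolding jacobi_ensemble_def
    by (subst integral_density) (auto simp: jacobi_weight_nonneg less_imp_le[OF jacobi_const_pos[OF assms(1-3)]])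
  then show ?thesis by simp
qed

lemma prob_space_jacobi_ensemble:
  assumes "\<beta> > 0" "a > -1" "b > -1"
  shows "prob_space (jacobi_ensemble \<beta> a b N)"
proof (rule prob_spaceI)
  let ?w = "jacobi_weight \<beta> a b N" and ?Z = "jacobi_const \<beta> a b N"
  have "emeasure (jacobi_ensemble \<beta> a b N) (space (jacobi_ensemble \<beta> a b N)) = (\<integral>\<^sup>+x. ennreal (?w x / ?Z) \<partial>config_space N)"
    unfolding jacobi_ensemble_def by (subst emeasure_density) (auto intro!: nn_integral_cong)
  also have "\<dots> = ennreal (\<integral>x. ?w x / ?Z \<partial>config_space N)"
    using integrable_jacobi_weight[OF assms] jacobi_const_pos[OF assms]
    by (intro nn_integral_eq_integral) (auto simp: jacobi_weight_nonneg intro!: AE_I2 divide_nonneg_nonneg less_imp_le[OF jacobi_const_pos[OF assms]])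
  also have "\<dots> = 1" using jacobi_const_pos[OF assms, of N] by (simp add: jacobi_const_def)
  finally show "emeasure (jacobi_ensemble \<beta> a b N) (space (jacobi_ensemble \<beta> a b N)) = 1" .
qed

lemma sets_jacobi_ensemble: "sets (jacobi_ensemble \<beta> a b N) = sets (config_space N)"
  by (simp add: jacobi_ensemble_def)

lemma AE_jacobi_ensemble_unit_cube:
  assumes "\<beta> > 0" "a > -1" "b > -1"
  shows "AE x in jacobi_ensemble \<beta> a b N. x \<in> unit_cube N"
  unfolding jacobi_ensemble_def
  by (subst AE_density) (use jacobi_weight_outside in \<open>fastforce+\<close>)

section \<open>Loop equations\<close>

text \<open>Invariance removes the difference of order zero, so \<epsilon> times the integral of w D
  is at most C \<epsilon>^2 times the integral of |w|. Dividing by \<epsilon> and letting it tend to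
  0 gives the claim.\<close>

lemma unif_deriv_integral_eq_0:
  assumes w: "integrable M w" "\<And>x. x \<notin> S \<Longrightarrow> w x = 0"
    and H: "unif_deriv S H D" and d: "d > 0"
    and meas: "\<And>\<epsilon>. H \<epsilon> \<in> borel_measurable M" "D \<in> borel_measurable M"
    and inv: "\<And>\<epsilon>. 0 < \<epsilon> \<Longrightarrow> \<epsilon> \<le> d \<Longrightarrow> (\<integral>x. w x * H \<epsilon> x \<partial>M) = (\<integral>x. w x * H 0 x \<partial>M)"
  shows "(\<integral>x. w x * D x \<partial>M) = 0"
proof -
  obtain e C where e: "0 < e" "e \<le> 1" "0 \<le> C" and C:
    "\<And>x. x \<in> S \<Longrightarrow> \<bar>H 0 x\<bar> \<le> C" "\<And>x. x \<in> S \<Longrightarrow> \<bar>D x\<bar> \<le> C"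
    "\<And>x \<epsilon>. x \<in> S \<Longrightarrow> 0 < \<epsilon> \<Longrightarrow> \<epsilon> \<le> e \<Longrightarrow> \<bar>H \<epsilon> x - H 0 x - \<epsilon> * D x\<bar> \<le> C * \<epsilon>^2"
    using unif_derivE[OF H] by blast
  have wm[measurable]: "w \<in> borel_measurable M" using w by auto
  note [measurable] = meas
  have bnd: "integrable M (\<lambda>x. w x * F x)" "\<bar>\<integral>x. w x * F x \<partial>M\<bar> \<le> K * (\<integral>x. \<bar>w x\<bar> \<partial>M)"
    if [measurable]: "F \<in> borel_measurable M" and F: "\<And>x. x \<in> S \<Longrightarrow> \<bar>F x\<bar> \<le> K" for F K
  proof -
    have b: "norm (w x * F x) \<le> K * \<bar>w x\<bar>" for x
      using F[of x] w(2)[of x] by (cases "x \<in> S") (auto simp: abs_mult mult.commute intro!: mult_right_mono)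
    have b': "norm (w x * F x) \<le> norm (K * \<bar>w x\<bar>)" for x
      using b[of x] by simp
    show i: "integrable M (\<lambda>x. w x * F x)"
      by (rule Bochner_Integration.integrable_bound[of _ "\<lambda>x. K * \<bar>w x\<bar>"])
        (use w b' in \<open>auto intro!: AE_I2 integrable_abs\<close>)
    have "\<bar>\<integral>x. w x * F x \<partial>M\<bar> \<le> (\<integral>x. \<bar>w x * F x\<bar> \<partial>M)" by (rule integral_abs_bound)
    also have "\<dots> \<le> (\<integral>x. K * \<bar>w x\<bar> \<partial>M)" using b i w by (intro integral_mono) auto
    finally show "\<bar>\<integral>x. w x * F x \<partial>M\<bar> \<le> K * (\<integral>x. \<bar>w x\<bar> \<partial>M)" by simp
  qed
  define Z where "Z = (\<integral>x. \<bar>w x\<bar> \<partial>M)"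
  have small: "\<bar>\<integral>x. w x * D x \<partial>M\<bar> \<le> C * Z * \<epsilon>" if \<epsilon>: "0 < \<epsilon>" "\<epsilon> \<le> e" "\<epsilon> \<le> d" for \<epsilon>
  proof -
    have H\<epsilon>: "\<bar>H \<epsilon> x\<bar> \<le> C + \<epsilon> * C + C * \<epsilon>^2" if "x \<in> S" for x
    proof -
      have "\<bar>\<epsilon> * D x\<bar> \<le> \<epsilon> * C" using C(2)[OF that] \<epsilon> by (simp add: abs_mult)
      then show ?thesis using C(1)[OF that] C(3)[OF that \<epsilon>(1,2)] by linarith
    qed
    have "\<bar>\<integral>x. w x * (H \<epsilon> x - H 0 x - \<epsilon> * D x) \<partial>M\<bar> \<le> (C * \<epsilon>^2) * Z"
      unfolding Z_def using C(3)[OF _ \<epsilon>(1,2)] by (intro bnd) auto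
    also have "(\<integral>x. w x * (H \<epsilon> x - H 0 x - \<epsilon> * D x) \<partial>M)
      = (\<integral>x. (w x * H \<epsilon> x - w x * H 0 x) - \<epsilon> * (w x * D x) \<partial>M)"
      by (intro Bochner_Integration.integral_cong) (auto simp: algebra_simps)
    also have "\<dots> = (\<integral>x. w x * H \<epsilon> x \<partial>M) - (\<integral>x. w x * H 0 x \<partial>M) - (\<integral>x. \<epsilon> * (w x * D x) \<partial>M)"
      using bnd(1)[OF meas(1) H\<epsilon>] bnd(1)[OF meas(1) C(1)] bnd(1)[OF meas(2) C(2)]
      by (subst Bochner_Integration.integral_diff) (auto intro!: Bochner_Integration.integrable_diff integrable_mult_right)
    also have "\<dots> = - \<epsilon> * (\<integral>x. w x * D x \<partial>M)" using inv[OF \<epsilon>(1,3)] by simp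
    finally have "\<epsilon> * \<bar>\<integral>x. w x * D x \<partial>M\<bar> \<le> \<epsilon> * (C * Z * \<epsilon>)"
      using \<epsilon> by (simp add: abs_mult power2_eq_square mult_ac)
    then show ?thesis using \<epsilon> by simp
  qed
  have "((\<lambda>\<epsilon>. C * Z * \<epsilon>) \<longlongrightarrow> C * Z * 0) (at_right 0)" by (intro tendsto_intros)
  moreover have "eventually (\<lambda>\<epsilon>. \<bar>\<integral>x. w x * D x \<partial>M\<bar> \<le> C * Z * \<epsilon>) (at_right 0)"
    using e d by (intro eventually_at_rightI[of 0 "min e d"] small) auto
  ultimately have "\<bar>\<integral>x. w x * D x \<partial>M\<bar> \<le> C * Z * 0"
    by (intro tendsto_lowerbound[of _ _ "at_right (0::real)"]) auto
  then show ?thesis by simp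
qed

lemma unif_deriv_smooth_compose:
  fixes f f' f'' :: "real \<Rightarrow> real"
  assumes h: "unif_deriv S h D"
    and f: "\<And>z. (f has_real_derivative f' z) (at z)" "\<And>z. (f' has_real_derivative f'' z) (at z)"
    and c: "continuous_on UNIV f''"
  shows "unif_deriv S (\<lambda>\<epsilon> x. f (h \<epsilon> x)) (\<lambda>x. f' (h 0 x) * D x)"
proof -
  obtain e B where B: "0 \<le> B" "\<And>x. x \<in> S \<Longrightarrow> \<bar>h 0 x\<bar> \<le> B"
    by (rule unif_derivE[OF h]) blast
  have bdd: "\<exists>K. \<forall>z\<in>{-B-1..B+1}. \<bar>g z\<bar> \<le> K" if "continuous_on UNIV g" for g :: "real \<Rightarrow> real"
  proof -
    have "compact (g ` {-B-1..B+1})" using that by (intro compact_continuous_image) (auto intro: continuous_on_subset)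
    then have "bounded (g ` {-B-1..B+1})" by (rule compact_imp_bounded)
    then show ?thesis unfolding bounded_iff by auto
  qed
  have cont: "continuous_on UNIV f" "continuous_on UNIV f'"
    using f by (auto intro!: DERIV_continuous_on)
  obtain K0 where K0: "\<forall>z\<in>{-B-1..B+1}. \<bar>f z\<bar> \<le> K0" using bdd[OF cont(1)] by blast
  obtain K1 where K1: "\<forall>z\<in>{-B-1..B+1}. \<bar>f' z\<bar> \<le> K1" using bdd[OF cont(2)] by blast
  obtain K2 where K2: "\<forall>z\<in>{-B-1..B+1}. \<bar>f'' z\<bar> \<le> K2" using bdd[OF c] by blast
  let ?K = "max K0 (max K1 K2)"
  have K2': "K2 \<ge> 0" using K2[rule_format, of 0] B(1) by auto
  show ?thesis
  proof (rule unif_deriv_compose[OF h zero_less_one, where K = ?K])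
    fix x assume x: "x \<in> S"
    have hx: "h 0 x \<in> {-B-1..B+1}" "-B \<le> h 0 x" "h 0 x \<le> B" using B(2)[OF x] by (auto simp: abs_le_iff)
    show "\<bar>f (h 0 x)\<bar> \<le> ?K" "\<bar>f' (h 0 x)\<bar> \<le> ?K" using K0 K1 hx by (auto simp: le_max_iff_disj)
    fix z assume z: "\<bar>z - h 0 x\<bar> \<le> 1"
    have "\<bar>f z - f (h 0 x) - f' (h 0 x) * (z - h 0 x)\<bar> \<le> K2 * (z - h 0 x)^2"
    proof (rule taylor_remainder[where r = 1])
      fix y assume y: "\<bar>y - h 0 x\<bar> \<le> 1"
      have "norm (f' y - f' (h 0 x)) \<le> K2 * norm (y - h 0 x)"
      proof (rule field_differentiable_bound[of "{-B-1..B+1}" _ f''])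
        show "y \<in> {-B-1..B+1}" using y hx by (auto simp: abs_le_iff)
        show "(f' has_field_derivative f'' z) (at z within {-B-1..B+1})" for z
          using f(2) has_field_derivative_at_within by blast
      qed (use hx K2 in auto)
      then show "\<bar>f' y - f' (h 0 x)\<bar> \<le> K2 * \<bar>y - h 0 x\<bar>" by simp
    qed (use f z K2' in auto)
    also have "\<dots> \<le> ?K * (z - h 0 x)^2" by (intro mult_right_mono) auto
    finally show "\<bar>f z - f (h 0 x) - f' (h 0 x) * (z - h 0 x)\<bar> \<le> ?K * (z - h 0 x)^2" .
  qed
qed

definition emp_moment :: "nat \<Rightarrow> (nat \<Rightarrow> real) \<Rightarrow> nat \<Rightarrow> real" where
  "emp_moment N x k = (\<Sum>i\<in>{1..N}. x i ^ k) / real N"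

definition moment_conv :: "(nat \<Rightarrow> real) \<Rightarrow> nat \<Rightarrow> real" where
  "moment_conv m k = (\<Sum>l\<le>k. m l * m (k - l))"

text \<open>Replacing the sum over pairs i < j by half of the full double sum leaves - \<beta> / 2
  times the diagonal; together with the determinant, which contributes the same diagonal once, this
  is the coefficient 1 - \<beta> / 2.\<close>

definition loop_term :: "real \<Rightarrow> real \<Rightarrow> real \<Rightarrow> nat \<Rightarrow> nat \<Rightarrow> (nat \<Rightarrow> real) \<Rightarrow> real" where
  "loop_term \<beta> a b N k m = ((1 - \<beta> / 2) * real (Suc k) + a) * m k - ((1 - \<beta> / 2) * real (Suc (Suc k)) + a + b) * m (Suc k)
     + \<beta> * real N / 2 * (moment_conv m k - moment_conv m (Suc k))"

lemma sum_symmetric_pairs: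
  fixes h :: "nat \<Rightarrow> nat \<Rightarrow> real"
  assumes "\<And>i j. h i j = h j i"
  shows "(\<Sum>j\<in>{1..N}. \<Sum>i\<in>{1..N}. h j i) = 2 * (\<Sum>j\<in>{1..N}. \<Sum>i\<in>{1..<j}. h j i) + (\<Sum>l\<in>{1..N}. h l l)"
proof (induction N)
  case (Suc N)
  have 1: "{1..Suc N} = insert (Suc N) {1..N}" "Suc N \<notin> {1..N}" "{1..<Suc N} = {1..N}" by auto
  have "(\<Sum>j\<in>{1..Suc N}. \<Sum>i\<in>{1..Suc N}. h j i) = (\<Sum>j\<in>{1..N}. \<Sum>i\<in>{1..N}. h j i) + (\<Sum>j\<in>{1..N}. h j (Suc N))
    + ((\<Sum>i\<in>{1..N}. h (Suc N) i) + h (Suc N) (Suc N))"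
    unfolding 1(1) by (simp add: 1(2) sum.distrib)
  also have "(\<Sum>j\<in>{1..N}. h j (Suc N)) = (\<Sum>i\<in>{1..N}. h (Suc N) i)" using assms by (intro sum.cong) auto
  also note Suc
  finally show ?case using 1 by (simp add: algebra_simps)
qed simp

lemma sum_diff_kernel:
  assumes "N > 0"
  shows "(\<Sum>j\<in>{1..N}. \<Sum>i\<in>{1..N}. diff_kernel k (x j) (x i))
    = real N ^ 2 * (moment_conv (emp_moment N x) k - moment_conv (emp_moment N x) (Suc k))"
    "(\<Sum>l\<in>{1..N}. diff_kernel k (x l) (x l))
    = real N * (real (Suc k) * emp_moment N x k - real (Suc (Suc k)) * emp_moment N x (Suc k))"
proof -
  have p: "(\<Sum>i\<in>{1..N}. x i ^ k) = real N * emp_moment N x k" for k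
    using assms by (simp add: emp_moment_def)
  have *: "(\<Sum>j\<in>{1..N}. \<Sum>i\<in>{1..N}. \<Sum>l\<le>k. x j ^ l * x i ^ (k - l)) = real N ^ 2 * moment_conv (emp_moment N x) k" for k
  proof -
    have "(\<Sum>j\<in>{1..N}. \<Sum>i\<in>{1..N}. \<Sum>l\<le>k. x j ^ l * x i ^ (k - l))
      = (\<Sum>j\<in>{1..N}. \<Sum>l\<le>k. \<Sum>i\<in>{1..N}. x j ^ l * x i ^ (k - l))"
      by (rule sum.cong[OF refl sum.swap])
    also have "\<dots> = (\<Sum>l\<le>k. \<Sum>j\<in>{1..N}. \<Sum>i\<in>{1..N}. x j ^ l * x i ^ (k - l))" by (rule sum.swap)
    also have "\<dots> = (\<Sum>l\<le>k. (\<Sum>j\<in>{1..N}. x j ^ l) * (\<Sum>i\<in>{1..N}. x i ^ (k - l)))"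
      by (simp add: sum_product)
    also have "\<dots> = real N ^ 2 * moment_conv (emp_moment N x) k"
      unfolding p moment_conv_def sum_distrib_left by (intro sum.cong refl) (simp add: power2_eq_square)
    finally show ?thesis .
  qed
  show "(\<Sum>j\<in>{1..N}. \<Sum>i\<in>{1..N}. diff_kernel k (x j) (x i))
    = real N ^ 2 * (moment_conv (emp_moment N x) k - moment_conv (emp_moment N x) (Suc k))"
    unfolding diff_kernel_def sum_subtractf * by (simp add: algebra_simps)
  show "(\<Sum>l\<in>{1..N}. diff_kernel k (x l) (x l))
    = real N * (real (Suc k) * emp_moment N x k - real (Suc (Suc k)) * emp_moment N x (Suc k))"
    unfolding diff_kernel_diag sum_subtractf sum_distrib_left[symmetric] p by (simp add: algebra_simps)
qed

text \<open>The left side is the derivative of \<open>flow_jacobian\<close> at \<epsilon> = 0. That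
  it depends on the configuration only through its moments is what closes the loop
  equations.\<close>

lemma loop_term_eq:
  assumes "N > 0"
  shows "(\<Sum>j\<in>{1..N}. \<Sum>i\<in>{1..<j}. \<beta> * diff_kernel k (x j) (x i)) +
     (\<Sum>l\<in>{1..N}. a * (x l ^ k * (1 - x l)) + b * (- (x l ^ Suc k)) + diff_kernel k (x l) (x l))
    = real N * loop_term \<beta> a b N k (emp_moment N x)"
proof -
  let ?m = "emp_moment N x"
  have p: "(\<Sum>i\<in>{1..N}. x i ^ k) = real N * ?m k" for k
    using assms by (simp add: emp_moment_def)
  have 1: "(\<Sum>j\<in>{1..N}. \<Sum>i\<in>{1..<j}. diff_kernel k (x j) (x i)) =
    (real N ^ 2 * (moment_conv ?m k - moment_conv ?m (Suc k)) -
     real N * (real (Suc k) * ?m k - real (Suc (Suc k)) * ?m (Suc k))) / 2"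
    using sum_symmetric_pairs[of "\<lambda>j i. diff_kernel k (x j) (x i)" N, OF diff_kernel_commute]
    unfolding sum_diff_kernel[OF assms] by simp
  have 2: "(\<Sum>j\<in>{1..N}. \<Sum>i\<in>{1..<j}. \<beta> * diff_kernel k (x j) (x i)) =
    \<beta> * (\<Sum>j\<in>{1..N}. \<Sum>i\<in>{1..<j}. diff_kernel k (x j) (x i))" by (simp add: sum_distrib_left)
  have 3: "(\<Sum>l\<in>{1..N}. a * (x l ^ k * (1 - x l)) + b * (- (x l ^ Suc k)) + diff_kernel k (x l) (x l))
    = a * (real N * ?m k - real N * ?m (Suc k)) - b * (real N * ?m (Suc k)) +
      real N * (real (Suc k) * ?m k - real (Suc (Suc k)) * ?m (Suc k))"
  proof -
    have "(\<Sum>l\<in>{1..N}. a * (x l ^ k * (1 - x l)) + b * (- (x l ^ Suc k)) + diff_kernel k (x l) (x l))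
      = (\<Sum>l\<in>{1..N}. a * (x l ^ k) - a * x l ^ Suc k - b * x l ^ Suc k + diff_kernel k (x l) (x l))"
      by (intro sum.cong refl) (simp add: algebra_simps)
    also have "\<dots> = a * (\<Sum>l\<in>{1..N}. x l ^ k) - a * (\<Sum>l\<in>{1..N}. x l ^ Suc k) - b * (\<Sum>l\<in>{1..N}. x l ^ Suc k) +
      (\<Sum>l\<in>{1..N}. diff_kernel k (x l) (x l))"
      by (simp only: sum.distrib sum_subtractf sum_distrib_left)
    finally show ?thesis unfolding p sum_diff_kernel[OF assms] by (simp add: algebra_simps)
  qed
  show ?thesis unfolding 2 1 3 loop_term_def by (simp add: field_simps power2_eq_square)
qed

lemma borel_measurable_emp_moment [measurable]: "(\<lambda>x. emp_moment N x k) \<in> borel_measurable (config_space N)"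
proof -
  note [measurable] = measurable_coordinate
  show ?thesis unfolding emp_moment_def by measurable
qed

lemma borel_measurable_loop_term [measurable]:
  "(\<lambda>x. loop_term \<beta> a b N k (emp_moment N x)) \<in> borel_measurable (config_space N)"
  unfolding loop_term_def moment_conv_def by measurable

lemma unif_deriv_flow_coordinate:
  assumes "l \<in> {1..N}"
  shows "unif_deriv (unit_cube N) (\<lambda>\<epsilon> x. flow k \<epsilon> (x l)) (\<lambda>x. x l ^ Suc k * (1 - x l))"
  unfolding flow_def
proof (rule unif_deriv_affine[where A = 1 and B = 1])
  fix x assume "x \<in> unit_cube N"
  from unit_cubeD[OF this assms] show "\<bar>x l\<bar> \<le> 1" "\<bar>x l ^ Suc k * (1 - x l)\<bar> \<le> 1"
    unfolding abs_mult by (auto intro!: mult_le_one power_le_one)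
qed

lemma unif_deriv_emp_moment_flow:
  "unif_deriv (unit_cube N) (\<lambda>\<epsilon> x. emp_moment N (flow_config N k \<epsilon> x) j)
    (\<lambda>x. real j * (emp_moment N x (j + k) - emp_moment N x (Suc (j + k))))"
proof -
  have "unif_deriv (unit_cube N) (\<lambda>\<epsilon> x. 1 / real N * (\<Sum>l\<in>{1..N}. flow k \<epsilon> (x l) ^ j))
    (\<lambda>x. 1 / real N * (\<Sum>l\<in>{1..N}. real j * flow k 0 (x l) ^ (j - 1) * (x l ^ Suc k * (1 - x l))))"
    by (intro unif_deriv_cmult unif_deriv_sum unif_deriv_power unif_deriv_flow_coordinate) auto
  moreover have "1 / real N * (\<Sum>l\<in>{1..N}. real j * flow k 0 (x l) ^ (j - 1) * (x l ^ Suc k * (1 - x l)))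
    = real j * (emp_moment N x (j + k) - emp_moment N x (Suc (j + k)))" for x
  proof -
    have "(\<Sum>l\<in>{1..N}. real j * flow k 0 (x l) ^ (j - 1) * (x l ^ Suc k * (1 - x l)))
      = (\<Sum>l\<in>{1..N}. real j * (x l ^ (j + k) - x l ^ Suc (j + k)))"
      \<comment> \<open>For j = 0 the truncated exponent j - 1 does no harm, because the factor j
        vanishes.\<close>
      by (intro sum.cong refl, cases j) (auto simp: flow_def algebra_simps power_add)
    then show ?thesis
      by (simp add: emp_moment_def sum_subtractf diff_divide_distrib right_diff_distrib flip: sum_distrib_left)
  qed
  moreover have "1 / real N * (\<Sum>l\<in>{1..N}. flow k \<epsilon> (x l) ^ j) = emp_moment N (flow_config N k \<epsilon> x) j" for \<epsilon> x
    by (simp add: emp_moment_def flow_config_def)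
  ultimately show ?thesis by simp
qed

lemma unif_deriv_flow_jacobian:
  "unif_deriv (unit_cube N) (flow_jacobian \<beta> a b N k)
    (\<lambda>x. (\<Sum>j\<in>{1..N}. \<Sum>i\<in>{1..<j}. \<beta> * diff_kernel k (x j) (x i)) +
     (\<Sum>l\<in>{1..N}. a * (x l ^ k * (1 - x l)) + b * (- (x l ^ Suc k)) + diff_kernel k (x l) (x l)))"
proof -
  let ?S = "unit_cube N"
  have u: "x l \<in> {0..1}" if "x \<in> ?S" "l \<in> {1..N}" for x l by (rule unit_cubeD[OF that])
  have dk: "\<bar>diff_kernel k (x j) (x i)\<bar> \<le> real (2 * k + 3)" if "x \<in> ?S" "j \<in> {1..N}" "i \<in> {1..N}" for x i j
    using that by (intro abs_diff_kernel_le u)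
  have le1: "\<bar>x l ^ k * (1 - x l)\<bar> \<le> 1" "\<bar>- (x l ^ Suc k)\<bar> \<le> 1" if "x \<in> ?S" "l \<in> {1..N}" for x l
    using u[OF that] by (auto simp: abs_mult intro!: mult_le_one power_le_one)
  have A: "unif_deriv ?S (\<lambda>\<epsilon> x. \<Prod>j\<in>{1..N}. \<Prod>i\<in>{1..<j}. (1 + \<epsilon> * diff_kernel k (x j) (x i)) powr \<beta>)
    (\<lambda>x. \<Sum>j\<in>{1..N}. \<Sum>i\<in>{1..<j}. \<beta> * diff_kernel k (x j) (x i))"
    by (intro unif_deriv_prod_one unif_deriv_powr_one[where B = "real (2 * k + 3)"] dk) auto
  have B: "unif_deriv ?S (\<lambda>\<epsilon> x. (1 + \<epsilon> * (x l ^ k * (1 - x l))) powr a * (1 + \<epsilon> * (- (x l ^ Suc k))) powr b *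
       (1 + \<epsilon> * diff_kernel k (x l) (x l)))
    (\<lambda>x. a * (x l ^ k * (1 - x l)) + b * (- (x l ^ Suc k)) + diff_kernel k (x l) (x l))" if l: "l \<in> {1..N}" for l
  proof -
    have 1: "unif_deriv ?S (\<lambda>\<epsilon> x. (1 + \<epsilon> * (x l ^ k * (1 - x l))) powr a) (\<lambda>x. a * (x l ^ k * (1 - x l)))"
      using le1(1)[OF _ l] by (rule unif_deriv_powr_one)
    have 2: "unif_deriv ?S (\<lambda>\<epsilon> x. (1 + \<epsilon> * (- (x l ^ Suc k))) powr b) (\<lambda>x. b * (- (x l ^ Suc k)))"
      using le1(2)[OF _ l] by (rule unif_deriv_powr_one)
    have 3: "unif_deriv ?S (\<lambda>\<epsilon> x. 1 + \<epsilon> * diff_kernel k (x l) (x l)) (\<lambda>x. diff_kernel k (x l) (x l))"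
      by (rule unif_deriv_affine[where A = 1, OF _ dk[OF _ l l]]) auto
    show ?thesis by (rule unif_deriv_cong[OF unif_deriv_mult[OF unif_deriv_mult[OF 1 2] 3]]) simp
  qed
  have "unif_deriv ?S (\<lambda>\<epsilon> x. (\<Prod>l\<in>{1..N}. (1 + \<epsilon> * (x l ^ k * (1 - x l))) powr a * (1 + \<epsilon> * (- (x l ^ Suc k))) powr b *
       (1 + \<epsilon> * diff_kernel k (x l) (x l))))
    (\<lambda>x. \<Sum>l\<in>{1..N}. a * (x l ^ k * (1 - x l)) + b * (- (x l ^ Suc k)) + diff_kernel k (x l) (x l))"
    by (intro unif_deriv_prod_one B) auto
  from unif_deriv_mult[OF A this] show ?thesis
    unfolding flow_jacobian_def[abs_def] by simp
qed

text \<open>The derivative at \<epsilon> = 0 of the integral of weight, Jacobian and transported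
  f(Y), an expression constant in \<epsilon>: moving Y gives the term with f', differentiating the
  Jacobian gives the term with N f.\<close>

theorem jacobi_loop_equation:
  fixes f f' f'' :: "real \<Rightarrow> real" and t :: "nat \<Rightarrow> real" and J :: "nat set"
  assumes par: "\<beta> > 0" "a > -1" "b > -1" and N: "N > 0"
    and f: "\<And>z. (f has_real_derivative f' z) (at z)" "\<And>z. (f' has_real_derivative f'' z) (at z)"
    and c: "continuous_on UNIV f''"
  defines "Y \<equiv> \<lambda>x. \<Sum>j\<in>J. t j * emp_moment N x j"
  assumes J: "finite J"
  shows "(\<integral>x. f' (Y x) * (\<Sum>j\<in>J. t j * (real j * (emp_moment N x (j + k) - emp_moment N x (Suc (j + k)))))
      + real N * (f (Y x) * loop_term \<beta> a b N k (emp_moment N x)) \<partial>jacobi_ensemble \<beta> a b N) = 0"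
proof -
  let ?S = "unit_cube N" and ?w = "jacobi_weight \<beta> a b N" and ?L = "config_space N"
  have cont: "continuous_on UNIV f" "continuous_on UNIV f'"
    using f by (auto intro!: DERIV_continuous_on)
  then have [measurable]: "f \<in> borel_measurable borel" "f' \<in> borel_measurable borel"
    by (auto intro: borel_measurable_continuous_onI)
  have [measurable]: "Y \<in> borel_measurable ?L" unfolding Y_def by measurable
  define D where "D = (\<lambda>x. f' (Y x) * (\<Sum>j\<in>J. t j * (real j * (emp_moment N x (j + k) - emp_moment N x (Suc (j + k)))))
      + real N * (f (Y x) * loop_term \<beta> a b N k (emp_moment N x)))"
  have [measurable]: "D \<in> borel_measurable ?L" unfolding D_def by measurable
  define H where "H = (\<lambda>\<epsilon> x. flow_jacobian \<beta> a b N k \<epsilon> x * f (Y (flow_config N k \<epsilon> x)))"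
  have m0: "emp_moment N (flow_config N k 0 x) j = emp_moment N x j" for x j
    by (simp add: emp_moment_def flow_config_def flow_def)
  have Y0: "Y (flow_config N k 0 x) = Y x" for x unfolding Y_def m0 ..
  have J0: "flow_jacobian \<beta> a b N k 0 x = 1" for x by (simp add: flow_jacobian_def)
  have Yd: "unif_deriv ?S (\<lambda>\<epsilon> x. Y (flow_config N k \<epsilon> x))
    (\<lambda>x. \<Sum>j\<in>J. t j * (real j * (emp_moment N x (j + k) - emp_moment N x (Suc (j + k)))))"
    unfolding Y_def by (intro unif_deriv_sum unif_deriv_cmult unif_deriv_emp_moment_flow J)
  have "unif_deriv ?S (\<lambda>\<epsilon> x. f (Y (flow_config N k \<epsilon> x)))
    (\<lambda>x. f' (Y (flow_config N k 0 x)) * (\<Sum>j\<in>J. t j * (real j * (emp_moment N x (j + k) - emp_moment N x (Suc (j + k))))))"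
    by (rule unif_deriv_smooth_compose[OF Yd f c])
  from unif_deriv_mult[OF unif_deriv_flow_jacobian[of N \<beta> a b k] this]
  have HD: "unif_deriv ?S H D"
    unfolding H_def
  proof (rule unif_deriv_cong)
    fix x
    show "((\<Sum>j\<in>{1..N}. \<Sum>i\<in>{1..<j}. \<beta> * diff_kernel k (x j) (x i)) +
      (\<Sum>l\<in>{1..N}. a * (x l ^ k * (1 - x l)) + b * (- (x l ^ Suc k)) + diff_kernel k (x l) (x l))) * f (Y (flow_config N k 0 x)) +
      flow_jacobian \<beta> a b N k 0 x * (f' (Y (flow_config N k 0 x)) *
        (\<Sum>j\<in>J. t j * (real j * (emp_moment N x (j + k) - emp_moment N x (Suc (j + k)))))) = D x"
      unfolding loop_term_eq[OF N] Y0 J0 D_def by (simp add: mult_ac)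
  qed
  have "(\<integral>x. ?w x * D x \<partial>?L) = 0"
  proof (rule unif_deriv_integral_eq_0[OF integrable_jacobi_weight[OF par] jacobi_weight_outside HD, where d = "1 / (2 * real (2 * k + 3))"])
    fix \<epsilon> :: real
    show "H \<epsilon> \<in> borel_measurable ?L" unfolding H_def by measurable
    assume "0 < \<epsilon>" "\<epsilon> \<le> 1 / (2 * real (2 * k + 3))"
    then have s: "admissible_step k \<epsilon>" by (simp add: admissible_step_def)
    show "(\<integral>x. ?w x * H \<epsilon> x \<partial>?L) = (\<integral>x. ?w x * H 0 x \<partial>?L)"
      unfolding H_def J0 Y0 by (subst integral_jacobi_weight_flow[OF s]) auto
  qed auto
  then show ?thesis
    using integral_jacobi_ensemble[OF par, of D N] by (simp add: D_def)
qed

unbundle no vec_syntax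
unbundle fps_syntax

section \<open>Moments of Jacobi matrices in canonical-moment coordinates\<close>

text \<open>\<open>inv_tail w\<close> is the power series \<open>R\<close> with \<open>R(w) = 1 / (1 - (1 - w\<^sub>0) z w\<^sub>1 R(w\<^sub>1, w\<^sub>2, \<dots>))\<close>. The continued
  fraction of the moment generating function of \<open>J\<close> at \<open>(1,1)\<close> has the coefficients \<open>w\<^sub>0\<close>, \<open>(1 - w\<^sub>0) w\<^sub>1\<close>,
  \<open>(1 - w\<^sub>1) w\<^sub>2\<close>, \<open>\<dots>\<close> where \<open>w = (p\<^sub>1, q\<^sub>1, p\<^sub>2, q\<^sub>2, \<dots>)\<close>.\<close>

abbreviation (input) shift :: "(nat \<Rightarrow> 'a) \<Rightarrow> nat \<Rightarrow> 'a" where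
  "shift w \<equiv> (\<lambda>n. w (Suc n))"

fun inv_tail_coeff :: "(nat \<Rightarrow> real) \<Rightarrow> nat \<Rightarrow> real" where
  "inv_tail_coeff w 0 = 1"
| "inv_tail_coeff w (Suc k) =
     (1 - w 0) * w 1 * (\<Sum>i\<in>{..k}. inv_tail_coeff w i * inv_tail_coeff (shift w) (k - i))"

definition inv_tail :: "(nat \<Rightarrow> real) \<Rightarrow> real fps" where
  "inv_tail w = Abs_fps (inv_tail_coeff w)"

definition tail_fps :: "(nat \<Rightarrow> real) \<Rightarrow> real fps" where
  "tail_fps w = fps_const (w 0) * inv_tail w"

lemma inv_tail_eq:
  "inv_tail w = 1 + fps_const ((1 - w 0) * w 1) * fps_X * inv_tail w * inv_tail (shift w)"
proof (rule fps_ext)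
  fix n
  show "inv_tail w $ n = (1 + fps_const ((1 - w 0) * w 1) * fps_X * inv_tail w * inv_tail (shift w)) $ n"
  proof (cases n)
    case (Suc m)
    have "1 + fps_const ((1 - w 0) * w 1) * fps_X * inv_tail w * inv_tail (shift w)
      = 1 + fps_const ((1 - w 0) * w 1) * (fps_X * (inv_tail w * inv_tail (shift w)))" by (simp only: mult.assoc)
    moreover have "(1 + fps_const c * (fps_X * P)) $ Suc m = c * P $ m" for c and P :: "real fps" by simp
    ultimately show ?thesis unfolding Suc
      by (simp only: fps_mult_nth[of "inv_tail w"] atLeast0AtMost) (simp add: inv_tail_def)
  qed (simp add: inv_tail_def mult.assoc)
qed

text \<open>The levels S_j = 1 / (1 - c_j z S_(j+1)) of a Stieltjes fraction. Level 0 is separate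
  because its coefficient is w_0 alone, with no factor coming from a preceding parameter.\<close>

definition cf_tail :: "(nat \<Rightarrow> real) \<Rightarrow> nat \<Rightarrow> real fps" where
  "cf_tail w j = (case j of 0 \<Rightarrow> inverse (1 - fps_X * tail_fps w) | Suc i \<Rightarrow> inv_tail (\<lambda>n. w (n + i)))"

definition cf_coeff :: "(nat \<Rightarrow> real) \<Rightarrow> nat \<Rightarrow> real" where
  "cf_coeff w j = (case j of 0 \<Rightarrow> w 0 | Suc i \<Rightarrow> (1 - w i) * w (Suc i))"

lemma cf_tail_eq: "cf_tail w j = 1 + fps_const (cf_coeff w j) * fps_X * cf_tail w j * cf_tail w (Suc j)"
proof (cases j)
  case 0
  let ?A = "1 - fps_X * tail_fps w"
  have "inverse ?A * ?A = 1" by (rule inverse_mult_eq_1) simp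
  then have "inverse ?A = 1 + inverse ?A * (fps_X * tail_fps w)" by (simp add: algebra_simps)
  then show ?thesis using 0 by (simp add: cf_tail_def cf_coeff_def tail_fps_def mult_ac)
next
  case (Suc i)
  have "cf_tail w j = inv_tail (\<lambda>n. w (n + i))" "cf_tail w (Suc j) = inv_tail (shift (\<lambda>n. w (n + i)))"
    "cf_coeff w j = (1 - w (0 + i)) * w (1 + i)"
    using Suc by (simp_all add: cf_tail_def cf_coeff_def One_nat_def)
  then show ?thesis using inv_tail_eq[of "\<lambda>n. w (n + i)"] by simp
qed

definition interleave :: "(nat \<Rightarrow> real) \<Rightarrow> (nat \<Rightarrow> real) \<Rightarrow> nat \<Rightarrow> real" where
  "interleave p q m = (if even m then p (m div 2 + 1) else q (m div 2 + 1))"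

text \<open>The convention q_0 = 0 built into \<open>s_coeff\<close> matches the special case of
  \<open>cf_coeff\<close> at index 0.\<close>

lemma cf_coeff_interleave:
  "cf_coeff (interleave p q) (2 * n) = s_coeff p q (Suc n)"
  "cf_coeff (interleave p q) (Suc (2 * n)) = t_coeff p q (Suc n)"
proof -
  show "cf_coeff (interleave p q) (2 * n) = s_coeff p q (Suc n)"
  proof (cases n)
    case 0 then show ?thesis by (simp add: cf_coeff_def interleave_def s_coeff_def One_nat_def)
  next
    case (Suc k)
    have "2 * n = Suc (Suc (2 * k))" using Suc by simp
    then show ?thesis using Suc by (simp add: cf_coeff_def interleave_def s_coeff_def One_nat_def)
  qed
  show "cf_coeff (interleave p q) (Suc (2 * n)) = t_coeff p q (Suc n)"
    by (simp add: cf_coeff_def interleave_def t_coeff_def One_nat_def)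
qed

section \<open>Entries of the tridiagonal matrix and the row recursion of its powers\<close>

lemma jacobi_matrix_entry:
  assumes i: "i \<ge> 1"
  shows "jacobi_matrix p q i j = bidiag p q i i * bidiag p q j i +
    (if i \<ge> 2 then bidiag p q i (i - 1) * bidiag p q j (i - 1) else 0)"
proof -
  have "jacobi_matrix p q i j = (\<Sum>k\<in>{i - 1, i}. bidiag p q i k * bidiag p q j k)"
    unfolding jacobi_matrix_def inf_mat_mult_def
    by (rule suminf_finite) (auto simp: bidiag_def)
  also have "\<dots> = bidiag p q i (i - 1) * bidiag p q j (i - 1) + bidiag p q i i * bidiag p q j i"
    using i by (subst sum.insert) auto
  finally show ?thesis using i by (auto simp: bidiag_def)
qed

lemma jacobi_matrix_tridiagonal:
  assumes "i \<ge> 1" "j > Suc i \<or> Suc j < i \<or> j = 0"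
  shows "jacobi_matrix p q i j = 0"
  using assms by (auto simp: jacobi_matrix_entry bidiag_def)

lemma jacobi_matrix_diag:
  assumes "\<And>n. n \<ge> 1 \<Longrightarrow> p n \<in> {0..1}" "\<And>n. n \<ge> 1 \<Longrightarrow> q n \<in> {0..1}"
  shows "jacobi_matrix p q (Suc n) (Suc n) = s_coeff p q (Suc n) + (if n = 0 then 0 else t_coeff p q n)"
    "jacobi_matrix p q (Suc n) (Suc (Suc n)) = sqrt (s_coeff p q (Suc n) * t_coeff p q (Suc n))"
    "jacobi_matrix p q (Suc (Suc n)) (Suc n) = sqrt (s_coeff p q (Suc n) * t_coeff p q (Suc n))"
proof -
  have s: "s_coeff p q m \<ge> 0" if "m \<ge> 1" for m
    using assms(1)[OF that] assms(2)[of "m - 1"] that by (auto simp: s_coeff_def)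
  have t: "t_coeff p q m \<ge> 0" if "m \<ge> 1" for m
    using assms(1)[OF that] assms(2)[OF that] by (auto simp: t_coeff_def)
  show "jacobi_matrix p q (Suc n) (Suc n) = s_coeff p q (Suc n) + (if n = 0 then 0 else t_coeff p q n)"
    using s[of "Suc n"] t[of n] by (auto simp: jacobi_matrix_entry bidiag_def)
  show "jacobi_matrix p q (Suc n) (Suc (Suc n)) = sqrt (s_coeff p q (Suc n) * t_coeff p q (Suc n))"
    by (auto simp: jacobi_matrix_entry bidiag_def real_sqrt_mult)
  show "jacobi_matrix p q (Suc (Suc n)) (Suc n) = sqrt (s_coeff p q (Suc n) * t_coeff p q (Suc n))"
    by (auto simp: jacobi_matrix_entry bidiag_def real_sqrt_mult)
qed

lemma inf_mat_power_jacobi_Suc: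
  "inf_mat_power (jacobi_matrix p q) (Suc k) (Suc n) 1 =
    (if n = 0 then 0 else jacobi_matrix p q (Suc n) n * inf_mat_power (jacobi_matrix p q) k n 1) +
    jacobi_matrix p q (Suc n) (Suc n) * inf_mat_power (jacobi_matrix p q) k (Suc n) 1 +
    jacobi_matrix p q (Suc n) (Suc (Suc n)) * inf_mat_power (jacobi_matrix p q) k (Suc (Suc n)) 1"
proof -
  let ?J = "jacobi_matrix p q" and ?P = "inf_mat_power (jacobi_matrix p q) k"
  have "inf_mat_power ?J (Suc k) (Suc n) 1 = (\<Sum>m\<in>{n, Suc n, Suc (Suc n)}. ?J (Suc n) m * ?P m 1)"
    unfolding inf_mat_power.simps inf_mat_mult_def
  proof (rule suminf_finite)
    fix m assume "m \<notin> {n, Suc n, Suc (Suc n)}"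
    then have "m > Suc (Suc n) \<or> Suc m < Suc n \<or> m = 0" by auto
    then show "?J (Suc n) m * ?P m 1 = 0" by (simp add: jacobi_matrix_tridiagonal)
  qed simp
  also have "\<dots> = ?J (Suc n) n * ?P n 1 + (?J (Suc n) (Suc n) * ?P (Suc n) 1 + ?J (Suc n) (Suc (Suc n)) * ?P (Suc (Suc n)) 1)"
    by simp
  finally show ?thesis by (auto simp: jacobi_matrix_tridiagonal)
qed

text \<open>The resolvent column \<open>(1 - z J)\<^sup>-\<^sup>1 e\<^sub>1\<close>, expressed through the tails of the continued fraction.\<close>

fun resolvent_column :: "(nat \<Rightarrow> real) \<Rightarrow> nat \<Rightarrow> real fps" where
  "resolvent_column w 0 = cf_tail w 0"
| "resolvent_column w (Suc n) = fps_X * fps_const (sqrt (cf_coeff w (2 * n) * cf_coeff w (Suc (2 * n)))) *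
     cf_tail w (Suc (2 * n)) * cf_tail w (Suc (Suc (2 * n))) * resolvent_column w n"

declare resolvent_column.simps(2) [simp del]

text \<open>These are the rows of (1 - z J) G = e_1. Merging two consecutive levels of the Stieltjes
  fraction, its even contraction, produces the Jacobi fraction with diagonal entries c_(2n) +
  c_(2n-1) and squared off-diagonal entries c_(2n) c_(2n+1).\<close>

lemma resolvent_column_eq:
  assumes nn: "\<And>j. cf_coeff w j \<ge> 0"
  defines "r \<equiv> \<lambda>n. fps_const (sqrt (cf_coeff w (2 * n) * cf_coeff w (Suc (2 * n))))"
    and "c \<equiv> \<lambda>j. fps_const (cf_coeff w j)"
  shows "resolvent_column w 0 = 1 + fps_X * (c 0 * resolvent_column w 0 + r 0 * resolvent_column w 1)"
    "resolvent_column w (Suc n) = fps_X * (r n * resolvent_column w n +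
      (c (2 * Suc n) + c (Suc (2 * n))) * resolvent_column w (Suc n) + r (Suc n) * resolvent_column w (Suc (Suc n)))"
proof -
  let ?S = "cf_tail w" and ?X = "fps_X :: real fps"
  have r2: "r n * r n = c (2 * n) * c (Suc (2 * n))" for n
    unfolding r_def c_def fps_const_mult using nn by (simp add: real_sqrt_mult_self)
  have S: "?S j = 1 + c j * ?X * ?S j * ?S (Suc j)" for j
    unfolding c_def by (rule cf_tail_eq)
  have res1: "resolvent_column w (Suc n) = ?X * r n * ?S (Suc (2 * n)) * ?S (Suc (Suc (2 * n))) * resolvent_column w n" for n
    by (simp add: r_def resolvent_column.simps(2))
  have "resolvent_column w 1 = ?X * r 0 * ?S 1 * ?S 2 * ?S 0"
    using res1[of 0] by (simp add: numeral_2_eq_2 One_nat_def)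
  then have "1 + ?X * (c 0 * resolvent_column w 0 + r 0 * resolvent_column w 1)
    = 1 + ?X * (c 0 * ?S 0 + ?X * (r 0 * r 0) * ?S 1 * ?S 2 * ?S 0)" by (simp add: mult_ac)
  also have "\<dots> = 1 + c 0 * ?X * ?S 0 * (1 + c 1 * ?X * ?S 1 * ?S 2)"
    unfolding r2 by (simp add: algebra_simps One_nat_def)
  also have "\<dots> = ?S 0" using S[of 1] S[of 0] by (simp add: numeral_2_eq_2 One_nat_def)
  finally show "resolvent_column w 0 = 1 + ?X * (c 0 * resolvent_column w 0 + r 0 * resolvent_column w 1)" by simp
  define G where "G = resolvent_column w n"
  define s1 where "s1 = ?S (Suc (2 * n))"
  define s2 where "s2 = ?S (Suc (Suc (2 * n)))"
  define s3 where "s3 = ?S (Suc (Suc (Suc (2 * n))))"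
  define s4 where "s4 = ?S (Suc (Suc (Suc (Suc (2 * n)))))"
  define c1 where "c1 = c (Suc (2 * n))"
  define c2 where "c2 = c (Suc (Suc (2 * n)))"
  define c3 where "c3 = c (Suc (Suc (Suc (2 * n))))"
  define ra where "ra = r n"
  define rb where "rb = r (Suc n)"
  have e1: "s1 = 1 + c1 * ?X * s1 * s2" and e2: "s2 = 1 + c2 * ?X * s2 * s3" and e3: "s3 = 1 + c3 * ?X * s3 * s4"
    unfolding s1_def s2_def s3_def s4_def c1_def c2_def c3_def by (rule S)+
  have rb: "rb * rb = c2 * c3" unfolding rb_def c2_def c3_def r2 by simp
  have g1: "resolvent_column w (Suc n) = ?X * ra * s1 * s2 * G" by (simp add: res1 ra_def s1_def s2_def G_def)
  have g2: "resolvent_column w (Suc (Suc n)) = ?X * rb * s3 * s4 * (?X * ra * s1 * s2 * G)"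
    using res1[of "Suc n"] unfolding g1 by (simp add: rb_def s3_def s4_def)
  \<comment> \<open>The contraction s1 s2 (1 - z c1 - z c2 s3) = 1, obtained by eliminating two
    consecutive levels.\<close>
  have key: "s1 * s2 - s1 * s2 * ?X * c1 - s1 * s2 * ?X * c2 * s3 = 1"
  proof -
    have "s1 * s2 - s1 * s2 * ?X * c1 - s1 * s2 * ?X * c2 * s3 = s1 * (s2 - c2 * ?X * s2 * s3) - c1 * ?X * s1 * s2"
      by (simp add: algebra_simps)
    also have "s2 - c2 * ?X * s2 * s3 = 1" using e2 by (simp add: algebra_simps)
    also have "s1 * 1 - c1 * ?X * s1 * s2 = 1" using e1 by (simp add: algebra_simps)
    finally show ?thesis .
  qed
  have "?X * (ra * G + (c2 + c1) * (?X * ra * s1 * s2 * G) + rb * (?X * rb * s3 * s4 * (?X * ra * s1 * s2 * G)))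
    = ?X * ra * G * (1 + s1 * s2 * ?X * c1 + s1 * s2 * ?X * (c2 + ?X * (rb * rb) * s3 * s4))"
    by (simp add: algebra_simps)
  also have "c2 + ?X * (rb * rb) * s3 * s4 = c2 * (1 + c3 * ?X * s3 * s4)" unfolding rb by (simp add: algebra_simps)
  also have "\<dots> = c2 * s3" using e3 by simp
  also have "1 + s1 * s2 * ?X * c1 + s1 * s2 * ?X * (c2 * s3) = s1 * s2"
    using key by (simp add: algebra_simps)
  finally have fin: "?X * (ra * G + (c2 + c1) * (?X * ra * s1 * s2 * G) + rb * (?X * rb * s3 * s4 * (?X * ra * s1 * s2 * G)))
    = ?X * ra * G * (s1 * s2)" .
  have c2': "c (2 * Suc n) = c2" by (simp add: c2_def)
  show "resolvent_column w (Suc n) = ?X * (r n * resolvent_column w n +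
      (c (2 * Suc n) + c (Suc (2 * n))) * resolvent_column w (Suc n) + r (Suc n) * resolvent_column w (Suc (Suc n)))"
    unfolding g2 g1 c2' G_def[symmetric] ra_def[symmetric] rb_def[symmetric] c1_def[symmetric] fin by (simp only: mult_ac)
qed

text \<open>The resolvent rows determine coefficient k + 1 of each entry from coefficient k of the
  neighbouring entries exactly as multiplication by J does. Parameters in [0, 1] make the square
  roots in J genuine.\<close>

theorem inf_mat_power_jacobi_matrix:
  assumes pq: "\<And>n. n \<ge> 1 \<Longrightarrow> p n \<in> {0..1}" "\<And>n. n \<ge> 1 \<Longrightarrow> q n \<in> {0..1}"
  shows "inf_mat_power (jacobi_matrix p q) k 1 1 = inverse (1 - fps_X * tail_fps (interleave p q)) $ k"
proof -
  let ?w = "interleave p q"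
  have w01: "?w m \<in> {0..1}" for m using pq[of "m div 2 + 1"] by (simp add: interleave_def)
  have "cf_coeff ?w j \<ge> 0" for j
    using w01 by (cases j) (auto simp: cf_coeff_def intro!: mult_nonneg_nonneg)
  note eq = resolvent_column_eq[OF this]
  have diag: "jacobi_matrix p q (Suc n) (Suc n) = s_coeff p q (Suc n) + (if n = 0 then 0 else t_coeff p q n)"
    "jacobi_matrix p q (Suc n) (Suc (Suc n)) = sqrt (s_coeff p q (Suc n) * t_coeff p q (Suc n))"
    "jacobi_matrix p q (Suc (Suc n)) (Suc n) = sqrt (s_coeff p q (Suc n) * t_coeff p q (Suc n))" for n
    using jacobi_matrix_diag[of p q n] pq by blast+
  have "resolvent_column ?w n $ k = inf_mat_power (jacobi_matrix p q) k (Suc n) 1" for n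
  proof (induction k arbitrary: n)
    case 0
    show ?case
    proof (cases n)
      assume n: "n = 0"
      show ?thesis unfolding n by (subst eq(1)) (simp add: One_nat_def)
    next
      case (Suc m)
      show ?thesis unfolding Suc by (subst eq(2)) (simp add: One_nat_def)
    qed
  next
    case (Suc k)
    show ?case
    proof (cases n)
      case 0
      show ?thesis unfolding inf_mat_power_jacobi_Suc 0 diag Suc[symmetric]
        by (subst eq(1)) (simp add: cf_coeff_interleave[of p q 0, simplified] One_nat_def)
    next
      case (Suc m)
      show ?thesis unfolding inf_mat_power_jacobi_Suc Suc diag Suc.IH[symmetric]
        by (subst eq(2)) (simp only: cf_coeff_interleave, simp add: algebra_simps)
    qed
  qed
  from this[of 0] show ?thesis by (simp add: cf_tail_def One_nat_def)
qed

section \<open>Expansion of powers of the tail series\<close>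

lemma fps_inverse_one_minus_X_power:
  "(inverse (1 - fps_X :: real fps) ^ r) $ j = pochhammer (real r) j / fact j"
proof -
  define A where "A = (\<lambda>r. Abs_fps (\<lambda>j. pochhammer (real r) j / fact j) :: real fps)"
  \<comment> \<open>Pascal's rule for the negative binomial coefficients.\<close>
  have step: "(1 - fps_X) * A (Suc r) = A r" for r
  proof (rule fps_ext)
    fix n
    show "((1 - fps_X) * A (Suc r)) $ n = A r $ n"
    proof (cases n)
      case (Suc m)
      have p: "pochhammer (real (Suc r)) (Suc m) = pochhammer (real (Suc r)) m * (real (Suc r) + real m)"
        "pochhammer (real r) (Suc m) = real r * pochhammer (real (Suc r)) m"
        by (rule pochhammer_Suc, simp only: pochhammer_rec of_nat_Suc add.commute)
      have alg: "x * (s + n) / (n * y) - x / y = s * x / (n * y)" if "y \<noteq> 0" "n \<noteq> 0" for x y s n :: real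
        using that by (simp add: field_simps)
      have "A (Suc r) $ Suc m - A (Suc r) $ m = A r $ Suc m"
        using alg[of "fact m" "real (Suc m)" "pochhammer (real (Suc r)) m" "real r"]
        by (simp add: A_def p del: of_nat_Suc) (simp add: algebra_simps)
      then show ?thesis unfolding Suc by (simp add: left_diff_distrib)
    qed (simp add: A_def left_diff_distrib)
  qed
  have "inverse (1 - fps_X :: real fps) ^ r = A r"
  proof (induction r)
    case 0
    have "A 0 = 1" by (rule fps_ext) (simp add: A_def pochhammer_0_left)
    then show ?case by simp
  next
    case (Suc r)
    have "A (Suc r) = (inverse (1 - fps_X) * (1 - fps_X)) * A (Suc r)"
      by (subst inverse_mult_eq_1) simp_all
    also have "\<dots> = inverse (1 - fps_X) * A r" by (simp add: mult.assoc step)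
    finally show ?case using Suc by simp
  qed
  then show ?thesis by (simp add: A_def)
qed

lemma fps_nth_inverse_one_minus:
  fixes U :: "real fps"
  assumes U: "U $ 0 = 0"
  shows "(inverse (1 - U) ^ r) $ k = (\<Sum>j\<in>{0..k}. pochhammer (real r) j / fact j * (U ^ j) $ k)"
proof -
  have "inverse (1 - U) = inverse (1 - fps_X) oo U"
    using U by (subst fps_inverse_compose) (simp_all add: fps_compose_sub_distrib)
  then have "inverse (1 - U) ^ r = (inverse (1 - fps_X) ^ r) oo U"
    using U by (simp add: fps_compose_power)
  then show ?thesis by (simp add: fps_compose_nth fps_inverse_one_minus_X_power)
qed

lemma jacobi_moment_tail:
  "inverse (1 - fps_X * tail_fps w) $ k = (\<Sum>r\<in>{0..k}. (tail_fps w ^ r) $ (k - r))"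
proof -
  have "inverse (1 - fps_X * tail_fps w) ^ 1 $ k =
    (\<Sum>j\<in>{0..k}. pochhammer (real 1) j / fact j * ((fps_X * tail_fps w) ^ j) $ k)"
    by (rule fps_nth_inverse_one_minus) simp
  then show ?thesis
    by (auto simp: pochhammer_fact[symmetric] power_mult_distrib fps_X_power_mult_nth intro!: sum.cong)
qed

text \<open>The first parameter enters only through monomials w_0^r (1 - w_0)^j, multiplied by
  powers of the shifted tail. For independent parameters the expectation then factors one coordinate
  at a time.\<close>

lemma tail_fps_power_nth:
  "(tail_fps w ^ r) $ k = (\<Sum>j\<in>{0..k}. pochhammer (real r) j / fact j * (w 0 ^ r * (1 - w 0) ^ j) *
     (tail_fps (shift w) ^ j) $ (k - j))"
proof -
  define U where "U = fps_const (1 - w 0) * fps_X * tail_fps (shift w)"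
  have U0: "U $ 0 = 0" by (simp add: U_def mult.assoc)
  have "inv_tail w = 1 + U * inv_tail w"
    using inv_tail_eq[of w] by (simp add: U_def tail_fps_def mult_ac One_nat_def flip: fps_const_mult)
  then have "inv_tail w * (1 - U) = 1" by (simp add: algebra_simps)
  then have "inv_tail w = inverse (1 - U)"
    using U0 by (metis fps_inverse_unique mult.commute)
  then have "tail_fps w ^ r = fps_const (w 0 ^ r) * inverse (1 - U) ^ r"
    by (simp add: tail_fps_def power_mult_distrib fps_const_power)
  then have "(tail_fps w ^ r) $ k = w 0 ^ r * (\<Sum>j\<in>{0..k}. pochhammer (real r) j / fact j * (U ^ j) $ k)"
    by (simp add: fps_nth_inverse_one_minus[OF U0])
  also have "\<dots> = (\<Sum>j\<in>{0..k}. pochhammer (real r) j / fact j * (w 0 ^ r * (1 - w 0) ^ j) * (tail_fps (shift w) ^ j) $ (k - j))"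
    unfolding sum_distrib_left
  proof (rule sum.cong[OF refl])
    fix j assume "j \<in> {0..k}"
    then have "(U ^ j) $ k = (1 - w 0) ^ j * (tail_fps (shift w) ^ j) $ (k - j)"
      by (simp add: U_def power_mult_distrib fps_const_power mult.assoc fps_X_power_mult_nth)
    then show "w 0 ^ r * (pochhammer (real r) j / fact j * (U ^ j) $ k)
      = pochhammer (real r) j / fact j * (w 0 ^ r * (1 - w 0) ^ j) * (tail_fps (shift w) ^ j) $ (k - j)"
      by simp
  qed
  finally show ?thesis .
qed

section \<open>A Pfaff--Saalschuetz identity and the Riccati recursion\<close>

lemma sum_triangle_swap:
  fixes h :: "nat \<Rightarrow> nat \<Rightarrow> real"
  shows "(\<Sum>i\<in>{0..k}. \<Sum>j\<in>{l..k-i}. h i j) = (\<Sum>j\<in>{l..k}. \<Sum>i\<in>{0..k-j}. h i j)"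
proof -
  have "(\<Sum>i\<in>{0..k}. \<Sum>j\<in>{l..k-i}. h i j) = (\<Sum>i\<in>{0..k}. \<Sum>j | j \<in> {l..k} \<and> i + j \<le> k. h i j)"
    by (intro sum.cong refl) auto
  also have "\<dots> = (\<Sum>j\<in>{l..k}. \<Sum>i | i \<in> {0..k} \<and> i + j \<le> k. h i j)"
    by (rule sum.swap_restrict) auto
  also have "\<dots> = (\<Sum>j\<in>{l..k}. \<Sum>i\<in>{0..k-j}. h i j)"
    by (intro sum.cong refl) auto
  finally show ?thesis .
qed

text \<open>Up to a factor independent of j, the summand of the balanced series 3F2(r, g, -k; al + g
  + r, 1 - al - k; 1). The value 0 for j > k reflects its termination.\<close>

definition saal_term :: "real \<Rightarrow> real \<Rightarrow> real \<Rightarrow> nat \<Rightarrow> nat \<Rightarrow> real" where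
  "saal_term al g r k j = pochhammer r j / fact j * (pochhammer g j / pochhammer (al + g + r) j) *
     (if j \<le> k then pochhammer al (k - j) / fact (k - j) else 0)"

text \<open>The telescoping certificate is \<open>-(r + j) (g + j)\<close>, found by the WZ method.\<close>

lemma saal_term_telescope:
  fixes al g r :: real
  assumes pos: "al > 0" "g > 0" "r \<ge> 0" and j: "j \<le> k"
  shows "(al + g + r + real k) * (real k + 1) * saal_term al g r (Suc k) j - (al + r + real k) * (al + g + real k) * saal_term al g r k j
    = (if j = 0 then 0 else (r + real (j - 1)) * (g + real (j - 1)) * saal_term al g r k (j - 1)) - (r + real j) * (g + real j) * saal_term al g r k j"
proof -
  define d where "d = k - j"
  have k: "k = d + j" using j by (simp add: d_def)
  have P: "pochhammer (al + g + r) j > 0" for j using pos by (intro pochhammer_pos) auto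
  have A: "pochhammer al (Suc d) = pochhammer al d * (al + real d)" by (rule pochhammer_Suc)
  show ?thesis
  proof (cases j)
    case 0
    have "(al + g + r + real k) * (real k + 1) * (pochhammer al (Suc k) / fact (Suc k)) =
      (al + g + r + real k) * (al + real k) * (pochhammer al k / fact k)"
    proof -
      have alg: "c * n * (x * y / (n * f)) = c * y * (x / f)" if "n \<noteq> 0" for c n x y f :: real
        using that by simp
      show ?thesis
        using alg[of "real (Suc k)" "al + g + r + real k" "pochhammer al k" "al + real k" "fact k"]
        by (simp add: pochhammer_Suc add.commute)
    qed
    then show ?thesis using 0 by (simp add: saal_term_def algebra_simps)
  next
    case (Suc i)
    define T where "T = pochhammer r i / fact i * (pochhammer g i / pochhammer (al + g + r) i) * (pochhammer al d / fact d)"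
    have nz: "al + g + r + real i \<noteq> 0" "pochhammer (al + g + r) i \<noteq> 0" "real d + 1 \<noteq> 0" "1 + real i \<noteq> 0"
      using pos P[of i] by auto
    have t1: "saal_term al g r k j = T * ((r + real i) * (g + real i) / ((1 + real i) * (al + g + r + real i)))"
      using nz by (simp add: saal_term_def T_def k Suc pochhammer_Suc field_simps)
    have t2: "saal_term al g r (Suc k) j = T * ((r + real i) * (g + real i) / ((1 + real i) * (al + g + r + real i))) * ((al + real d) / (real d + 1))"
      using nz by (simp add: saal_term_def T_def k Suc pochhammer_Suc field_simps)
    have t3: "saal_term al g r k i = T * ((al + real d) / (real d + 1))"
      using nz by (simp add: saal_term_def T_def k Suc pochhammer_Suc Suc_diff_le field_simps)
    have "(al + g + r + real k) * (real k + 1) * (((r + real i) * (g + real i) / ((1 + real i) * (al + g + r + real i))) * ((al + real d) / (real d + 1)))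
      - (al + r + real k) * (al + g + real k) * ((r + real i) * (g + real i) / ((1 + real i) * (al + g + r + real i)))
      = (r + real i) * (g + real i) * ((al + real d) / (real d + 1)) - (r + real j) * (g + real j) * ((r + real i) * (g + real i) / ((1 + real i) * (al + g + r + real i)))"
      (is "?l1 * (?q * ?e) - ?l2 * ?q = ?m * ?e - ?l3 * ?q")
    proof -
      define M where "M = (1 + real i) * (al + g + r + real i)"
      have q: "?q = ?m / M" by (simp add: M_def)
      have gen1: "l1 * (m / M * (a / e)) - l2 * (m / M) = m / M / e * (l1 * a - l2 * e)"
        if "e \<noteq> 0" for l1 l2 m M a e :: real
        using that by (simp add: right_diff_distrib mult_ac)
      have gen2: "m / M / e * (M * a - l3 * e) = m * (a / e) - l3 * (m / M)"
        if "e \<noteq> 0" "M \<noteq> 0" for l3 m M a e :: real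
        using that by (simp add: right_diff_distrib mult_ac)
      have M: "M \<noteq> 0" using nz by (simp add: M_def)
      \<comment> \<open>With denominators cleared, the certificate amounts to this polynomial
        identity.\<close>
      have *: "?l1 * (al + real d) - ?l2 * (real d + 1) = M * (al + real d) - ?l3 * (real d + 1)"
        unfolding M_def k Suc by (simp add: algebra_simps)
      have "?l1 * (?q * ?e) - ?l2 * ?q = ?m / M / (real d + 1) * (?l1 * (al + real d) - ?l2 * (real d + 1))"
        unfolding q using gen1[OF nz(3)] .
      also have "\<dots> = ?m / M / (real d + 1) * (M * (al + real d) - ?l3 * (real d + 1))" unfolding * ..
      also have "\<dots> = ?m * ?e - ?l3 * ?q" unfolding q using gen2[OF nz(3) M] .
      finally show ?thesis .
    qed
    note eq = this
    have gen3: "l1 * (T * q * e) - l2 * (T * q) = m * (T * e) - l3 * (T * q)"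
      if "l1 * (q * e) - l2 * q = m * e - l3 * q" for l1 l2 l3 q e m
    proof -
      have "l1 * (T * q * e) - l2 * (T * q) = T * (l1 * (q * e) - l2 * q)" by (simp add: algebra_simps)
      also have "\<dots> = m * (T * e) - l3 * (T * q)" unfolding that by (simp add: algebra_simps)
      finally show ?thesis .
    qed
    have ifeq: "(if j = 0 then 0 else (r + real (j - 1)) * (g + real (j - 1)) * saal_term al g r k (j - 1)) =
      (r + real i) * (g + real i) * saal_term al g r k i" by (simp add: Suc)
    show ?thesis unfolding t1 t2 ifeq unfolding t3 by (rule gen3[OF eq])
  qed
qed

text \<open>Summing the telescoping relation over j gives a first-order recurrence in k for the sum,
  and the closed form obeys the same recurrence.\<close>

lemma pfaff_saalschuetz:
  fixes al g r :: real
  assumes pos: "al > 0" "g > 0" "r \<ge> 0"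
  shows "(\<Sum>j\<in>{0..k}. saal_term al g r k j) =
    pochhammer (al + r) k * pochhammer (al + g) k / (pochhammer (al + g + r) k * fact k)"
proof (induction k)
  case 0
  then show ?case by (simp add: saal_term_def)
next
  case (Suc k)
  let ?t = "saal_term al g r" and ?G = "\<lambda>j. (r + real j) * (g + real j) * saal_term al g r k j"
  have P: "pochhammer (al + g + r) j > 0" for j using pos by (intro pochhammer_pos) auto
  have tele: "(\<Sum>j\<in>{0..k}. (if j = 0 then 0 else ?G (j - 1)) - ?G j) = - ?G k" for k
    by (induction k) auto
  \<comment> \<open>The additional term j = k + 1 of the longer sum is exactly the boundary term
    left over by telescoping.\<close>
  have last: "(al + g + r + real k) * (real k + 1) * ?t (Suc k) (Suc k) = ?G k"
  proof -
    have alg: "S * n * (x * a / (n * f) * (y * b / (z * S))) = a * b * (x / f * (y / z))"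
      if "S \<noteq> 0" "n \<noteq> 0" for S n x a f y b z :: real
      using that by (simp add: mult_ac)
    show ?thesis unfolding saal_term_def pochhammer_Suc fact_Suc
      using alg[of "al + g + r + real k" "real (Suc k)" "pochhammer r k" "r + real k" "fact k" "pochhammer g k" "g + real k" "pochhammer (al + g + r) k"] pos
      by (simp add: add.commute)
  qed
  have "(al + g + r + real k) * (real k + 1) * (\<Sum>j\<in>{0..k}. ?t (Suc k) j) - (al + r + real k) * (al + g + real k) * (\<Sum>j\<in>{0..k}. ?t k j)
    = (\<Sum>j\<in>{0..k}. (al + g + r + real k) * (real k + 1) * ?t (Suc k) j - (al + r + real k) * (al + g + real k) * ?t k j)"
    by (simp add: sum_subtractf sum_distrib_left)
  also have "\<dots> = (\<Sum>j\<in>{0..k}. (if j = 0 then 0 else ?G (j - 1)) - ?G j)"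
    using pos by (intro sum.cong refl saal_term_telescope) auto
  also have "\<dots> = - ?G k"
  proof -
    have "(\<Sum>j\<in>{0..n}. (if j = 0 then 0 else ?G (j - 1)) - ?G j) = - ?G n" for n by (induction n) auto
    then show ?thesis .
  qed
  finally have "(al + g + r + real k) * (real k + 1) * (\<Sum>j\<in>{0..Suc k}. ?t (Suc k) j) =
     (al + r + real k) * (al + g + real k) * (\<Sum>j\<in>{0..k}. ?t k j)"
    using last by (simp add: algebra_simps)
  moreover have "S = E / D * s" if "D * S = E * s" "D \<noteq> 0" for D E S s :: real
    using that by (simp add: field_simps)
  moreover have "(al + g + r + real k) * (real k + 1) \<noteq> 0" using pos by auto
  ultimately have "(\<Sum>j\<in>{0..Suc k}. ?t (Suc k) j) = (al + r + real k) * (al + g + real k) / ((al + g + r + real k) * (real k + 1)) * (\<Sum>j\<in>{0..k}. ?t k j)"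
    by blast
  also have "\<dots> = pochhammer (al + r) (Suc k) * pochhammer (al + g) (Suc k) / (pochhammer (al + g + r) (Suc k) * fact (Suc k))"
    unfolding Suc using pos P[of k] by (simp add: pochhammer_Suc field_simps)
  finally show ?case .
qed

text \<open>The mixed moment E[w^r (1 - w)^j] of w with law Beta(al, ga - al).\<close>

definition beta_moment :: "real \<Rightarrow> real \<Rightarrow> nat \<Rightarrow> nat \<Rightarrow> real" where
  "beta_moment al ga r j = pochhammer al r * pochhammer (ga - al) j / pochhammer ga (r + j)"

text \<open>\<open>tail_mean al de ga k r\<close> is the coefficient of \<open>z\<^sup>k\<close> in the expectation of the \<open>r\<close>-th power of \<open>tail_fps w\<close>,
  when the \<open>w\<^sub>i\<close> are independent, alternately \<open>Beta(al, ga - al)\<close> and \<open>Beta(de, ga - de)\<close>.\<close>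

fun tail_mean :: "real \<Rightarrow> real \<Rightarrow> real \<Rightarrow> nat \<Rightarrow> nat \<Rightarrow> real" where
  "tail_mean al de ga 0 r = beta_moment al ga r 0"
| "tail_mean al de ga (Suc k) r =
    (\<Sum>j\<in>{0..k}. pochhammer (real r) (Suc j) / fact (Suc j) * beta_moment al ga r (Suc j) * tail_mean de al ga (k - j) (Suc j))"

text \<open>The Gauss series 2F1(al, de; ga; z).\<close>

definition hyp_fps :: "real \<Rightarrow> real \<Rightarrow> real \<Rightarrow> real fps" where
  "hyp_fps al de ga = Abs_fps (\<lambda>k. pochhammer de k * pochhammer al k / (pochhammer ga k * fact k))"

text \<open>The right side is a coefficient of (al)_r / (ga)_r * 2F1(al + r, de; ga + r; z), so the
  mean of the r-th tail power is a quotient of two contiguous hypergeometric series. The inner sum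
  comes from the induction hypothesis with al and de exchanged, the outer one from the
  Pfaff--Saalschuetz sum.\<close>

lemma tail_mean_mult_hyp:
  assumes "al > 0" "de > 0" "ga > al" "ga > de"
  shows "(\<Sum>i\<in>{0..k}. hyp_fps al de ga $ i * tail_mean al de ga (k - i) r)
    = pochhammer de k / fact k * (pochhammer al (r + k) / pochhammer ga (r + k))"
  using assms
proof (induction k arbitrary: al de r rule: less_induct)
  case (less k)
  \<comment> \<open>Symmetry of the series in al and de lets the same multiplier serve the
    alternating laws.\<close>
  have F: "hyp_fps al de ga $ i = hyp_fps de al ga $ i" for i by (simp add: hyp_fps_def mult.commute)
  have P: "pochhammer ga j > 0" for j using less.prems by (intro pochhammer_pos) auto
  have t: "tail_mean al de ga n r = (if n = 0 then beta_moment al ga r 0 else 0) +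
     (\<Sum>j\<in>{1..n}. pochhammer (real r) j / fact j * beta_moment al ga r j * tail_mean de al ga (n - j) j)" for n
  proof (cases n)
    case (Suc m)
    have "(\<Sum>j\<in>{1..Suc m}. pochhammer (real r) j / fact j * beta_moment al ga r j * tail_mean de al ga (Suc m - j) j)
      = (\<Sum>j\<in>{0..m}. pochhammer (real r) (Suc j) / fact (Suc j) * beta_moment al ga r (Suc j) * tail_mean de al ga (Suc m - Suc j) (Suc j))"
      unfolding One_nat_def by (rule sum.shift_bounds_cl_Suc_ivl)
    then show ?thesis using Suc by simp
  qed simp
  have "(\<Sum>i\<in>{0..k}. hyp_fps al de ga $ i * tail_mean al de ga (k - i) r)
    = hyp_fps al de ga $ k * beta_moment al ga r 0 +
      (\<Sum>i\<in>{0..k}. \<Sum>j\<in>{1..k-i}. pochhammer (real r) j / fact j * beta_moment al ga r j * (hyp_fps al de ga $ i * tail_mean de al ga (k - i - j) j))"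
  proof -
    have "(\<Sum>i\<in>{0..k}. hyp_fps al de ga $ i * tail_mean al de ga (k - i) r)
      = (\<Sum>i\<in>{0..k}. hyp_fps al de ga $ i * (if k - i = 0 then beta_moment al ga r 0 else 0)) +
      (\<Sum>i\<in>{0..k}. \<Sum>j\<in>{1..k-i}. pochhammer (real r) j / fact j * beta_moment al ga r j * (hyp_fps al de ga $ i * tail_mean de al ga (k - i - j) j))"
      unfolding t[of "k - i" for i] by (simp add: algebra_simps sum.distrib sum_distrib_left)
    also have "(\<Sum>i\<in>{0..k}. hyp_fps al de ga $ i * (if k - i = 0 then beta_moment al ga r 0 else 0)) =
      (\<Sum>i\<in>{0..k}. if i = k then hyp_fps al de ga $ i * beta_moment al ga r 0 else 0)"
      by (intro sum.cong) auto
    finally show ?thesis by simp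
  qed
  also have "(\<Sum>i\<in>{0..k}. \<Sum>j\<in>{1..k-i}. pochhammer (real r) j / fact j * beta_moment al ga r j * (hyp_fps al de ga $ i * tail_mean de al ga (k - i - j) j))
    = (\<Sum>j\<in>{1..k}. \<Sum>i\<in>{0..k-j}. pochhammer (real r) j / fact j * beta_moment al ga r j * (hyp_fps al de ga $ i * tail_mean de al ga (k - i - j) j))"
    by (rule sum_triangle_swap)
  also have "\<dots> = (\<Sum>j\<in>{1..k}. pochhammer (real r) j / fact j * beta_moment al ga r j *
      (pochhammer al (k - j) / fact (k - j) * (pochhammer de k / pochhammer ga k)))"
  proof (intro sum.cong refl)
    fix j assume j: "j \<in> {1..k}"
    have "(\<Sum>i\<in>{0..k-j}. pochhammer (real r) j / fact j * beta_moment al ga r j * (hyp_fps al de ga $ i * tail_mean de al ga (k - i - j) j))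
      = pochhammer (real r) j / fact j * beta_moment al ga r j * (\<Sum>i\<in>{0..k-j}. hyp_fps de al ga $ i * tail_mean de al ga (k - j - i) j)"
      unfolding sum_distrib_left F by (intro sum.cong refl) (simp add: add.commute)
    also have "(\<Sum>i\<in>{0..k-j}. hyp_fps de al ga $ i * tail_mean de al ga (k - j - i) j)
      = pochhammer al (k - j) / fact (k - j) * (pochhammer de (j + (k - j)) / pochhammer ga (j + (k - j)))"
      using j less.prems by (intro less.IH) auto
    finally show "(\<Sum>i\<in>{0..k-j}. pochhammer (real r) j / fact j * beta_moment al ga r j * (hyp_fps al de ga $ i * tail_mean de al ga (k - i - j) j))
      = pochhammer (real r) j / fact j * beta_moment al ga r j * (pochhammer al (k - j) / fact (k - j) * (pochhammer de k / pochhammer ga k))"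
      using j by simp
  qed
  also have "hyp_fps al de ga $ k * beta_moment al ga r 0 + \<dots> = (\<Sum>j\<in>{0..k}. pochhammer (real r) j / fact j * beta_moment al ga r j *
      (pochhammer al (k - j) / fact (k - j) * (pochhammer de k / pochhammer ga k)))"
  proof -
    have "{0..k} = insert 0 {1..k}" by auto
    then show ?thesis by (simp add: hyp_fps_def mult_ac)
  qed
  \<comment> \<open>With g = ga - al the parameter al + g + r is ga + r, and (ga)_(r+j) = (ga)_r (ga
    + r)_j turns the sum into the balanced one.\<close>
  also have "\<dots> = (pochhammer de k / pochhammer ga k) * (pochhammer al r / pochhammer ga r) * (\<Sum>j\<in>{0..k}. saal_term al (ga - al) (real r) k j)"
    unfolding sum_distrib_left
  proof (intro sum.cong refl)
    fix j assume "j \<in> {0..k}"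
    then show "pochhammer (real r) j / fact j * beta_moment al ga r j * (pochhammer al (k - j) / fact (k - j) * (pochhammer de k / pochhammer ga k))
      = (pochhammer de k / pochhammer ga k) * (pochhammer al r / pochhammer ga r) * saal_term al (ga - al) (real r) k j"
      using P by (simp add: beta_moment_def saal_term_def pochhammer_product'[of ga r j] mult_ac)
  qed
  also have "\<dots> = (pochhammer de k / pochhammer ga k) * (pochhammer al r / pochhammer ga r) *
    (pochhammer (al + real r) k * pochhammer ga k / (pochhammer (ga + real r) k * fact k))"
    using less.prems by (subst pfaff_saalschuetz) auto
  also have "\<dots> = pochhammer de k / fact k * (pochhammer al (r + k) / pochhammer ga (r + k))"
    using P[of k] by (simp add: pochhammer_product'[of ga r k] pochhammer_product'[of al r k])
  finally show ?case .
qed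

text \<open>The geometric series \<open>jacobi_moment_tail\<close> with each tail coefficient
  replaced by its mean.\<close>

definition mean_moment :: "real \<Rightarrow> real \<Rightarrow> real \<Rightarrow> nat \<Rightarrow> real" where
  "mean_moment al de ga k = (\<Sum>r\<in>{0..k}. tail_mean al de ga (k - r) r)"

lemma sum_pochhammer_hockey_stick:
  "(\<Sum>i\<in>{0..n}. pochhammer (d::real) i / fact i) = pochhammer (d + 1) n / fact n"
proof (induction n)
  case (Suc n)
  have "(d + real (Suc n)) * pochhammer (d + 1) n = pochhammer (d + 1) (Suc n)"
    by (simp add: pochhammer_Suc algebra_simps)
  moreover have "pochhammer d (Suc n) = d * pochhammer (d + 1) n" by (rule pochhammer_rec)
  moreover have "(\<Sum>i\<in>{0..Suc n}. pochhammer d i / fact i) = pochhammer (d + 1) n / fact n + pochhammer d (Suc n) / fact (Suc n)"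
    using Suc by simp
  moreover have "x / f + d * x / (n * f) = (d + n) * x / (n * f)" if "n \<noteq> 0" "f \<noteq> 0" for x f n :: real
    using that by (simp add: field_simps)
  from this[of "real (Suc n)" "fact n" "pochhammer (d + 1) n"]
  have "pochhammer (d + 1) n / fact n + d * pochhammer (d + 1) n / fact (Suc n) = (d + real (Suc n)) * pochhammer (d + 1) n / fact (Suc n)"
    by (simp del: of_nat_Suc)
  ultimately show ?case by simp
qed simp

text \<open>In other words U = 1 + z F' / (de F) for the generating series U: up to scale U - 1 is a
  logarithmic derivative, the substitution that turns a linear second-order equation into a Riccati
  equation. The sum over r collapses by the hockey-stick identity.\<close>

lemma hyp_mult_mean_moment:
  assumes "al > 0" "de > 0" "ga > al" "ga > de"
  shows "hyp_fps al de ga * Abs_fps (mean_moment al de ga) =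
    hyp_fps al de ga + fps_const (1 / de) * fps_X * fps_deriv (hyp_fps al de ga)"
proof (rule fps_ext)
  fix n
  let ?F = "hyp_fps al de ga"
  have P: "pochhammer ga n > 0" using assms by (intro pochhammer_pos) auto
  have "(?F * Abs_fps (mean_moment al de ga)) $ n = (\<Sum>i\<in>{0..n}. \<Sum>r\<in>{0..n-i}. ?F $ i * tail_mean al de ga (n - i - r) r)"
    by (simp add: fps_mult_nth mean_moment_def sum_distrib_left)
  also have "\<dots> = (\<Sum>r\<in>{0..n}. \<Sum>i\<in>{0..n-r}. ?F $ i * tail_mean al de ga (n - i - r) r)"
    by (rule sum_triangle_swap)
  also have "\<dots> = (\<Sum>r\<in>{0..n}. pochhammer de (n - r) / fact (n - r) * (pochhammer al n / pochhammer ga n))"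
  proof (intro sum.cong refl)
    fix r assume "r \<in> {0..n}"
    then show "(\<Sum>i\<in>{0..n-r}. ?F $ i * tail_mean al de ga (n - i - r) r) = pochhammer de (n - r) / fact (n - r) * (pochhammer al n / pochhammer ga n)"
      using tail_mean_mult_hyp[OF assms, of "n - r" r] by (simp add: add.commute)
  qed
  also have "\<dots> = (\<Sum>i\<in>{0..n}. pochhammer de i / fact i) * (pochhammer al n / pochhammer ga n)"
    unfolding sum_distrib_right
    by (rule sum.reindex_bij_witness[of _ "\<lambda>i. n - i" "\<lambda>i. n - i"]) auto
  also have "\<dots> = pochhammer (de + 1) n / fact n * (pochhammer al n / pochhammer ga n)"
    unfolding sum_pochhammer_hockey_stick ..
  also have "pochhammer (de + 1) n = pochhammer de n * (1 + real n / de)"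
    using pochhammer_rec[of de n] pochhammer_Suc[of de n] assms by (simp add: field_simps)
  also have "pochhammer de n * (1 + real n / de) / fact n * (pochhammer al n / pochhammer ga n)
    = (?F + fps_const (1 / de) * fps_X * fps_deriv ?F) $ n"
  proof -
    have "(?F + fps_const (1 / de) * fps_X * fps_deriv ?F) $ n = ?F $ n * (1 + real n / de)"
      by (cases n) (simp_all add: mult.assoc[of "fps_const _"] One_nat_def ring_distribs add_divide_distrib mult_ac)
    then show ?thesis by (simp add: hyp_fps_def mult_ac)
  qed
  finally show "(?F * Abs_fps (mean_moment al de ga)) $ n = (?F + fps_const (1 / de) * fps_X * fps_deriv ?F) $ n" .
qed

text \<open>The hypergeometric equation T (T + ga - 1) F = z (T + al) (T + de) F in terms of the
  Euler operator T = z d/dz.\<close>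

lemma hyp_fps_ode:
  fixes al de ga :: real
  assumes "ga > 0"
  defines "F \<equiv> hyp_fps al de ga" and "T \<equiv> \<lambda>f. fps_X * fps_deriv f"
  shows "T (T F) + fps_const (ga - 1) * T F = fps_X * (T (T F + fps_const de * F) + fps_const al * (T F + fps_const de * F))"
proof (rule fps_ext)
  fix n
  have Tn: "T f $ n = real n * f $ n" for f n unfolding T_def by (cases n) (simp_all add: One_nat_def)
  have P: "pochhammer ga m > 0" for m using assms by (intro pochhammer_pos) auto
  show "(T (T F) + fps_const (ga - 1) * T F) $ n = (fps_X * (T (T F + fps_const de * F) + fps_const al * (T F + fps_const de * F))) $ n"
  proof (cases n)
    case 0
    then show ?thesis by (simp add: Tn)
  next
    case (Suc m)
    have "F $ Suc m * ((real m + 1) * (ga + real m)) = F $ m * ((de + real m) * (al + real m))"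
    proof -
      have "ga + real m \<noteq> 0" using assms(1) by auto
      moreover have "x * dm * (y * am) / (z * gm * (n * f)) * (n * gm) = x * y / (z * f) * (dm * am)"
        if "gm \<noteq> 0" "n \<noteq> 0" for x dm y am z gm n f :: real using that by simp
      note this[of "ga + real m" "real m + 1" "pochhammer de m" "de + real m" "pochhammer al m" "al + real m" "pochhammer ga m" "fact m"]
      ultimately show ?thesis
        by (simp add: F_def hyp_fps_def pochhammer_Suc add.commute)
    qed
    then show ?thesis using Suc by (simp add: Tn) (simp add: algebra_simps)
  qed
qed

text \<open>Substituting T F = de F (U - 1) makes F a common factor of the hypergeometric equation.
  It can be cancelled in the ring of power series because its constant term is 1, and coefficients
  are compared afterwards.\<close>

lemma mean_moment_riccati:
  assumes "al > 0" "de > 0" "ga > al" "ga > de"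
  defines "u \<equiv> mean_moment al de ga"
  shows "(real k + al - de) * u k - (real (Suc k) + ga - 1) * u (Suc k)
    + de * (moment_conv u k - (moment_conv u (Suc k) - 2 * u (Suc k))) = 0" "u 0 = 1"
proof -
  define F where "F = hyp_fps al de ga"
  define U where "U = Abs_fps u"
  define T where "T = (\<lambda>f :: real fps. fps_X * fps_deriv f)"
  define d where "d = fps_const de"
  define g where "g = fps_const (ga - 1)"
  define A where "A = fps_const al"
  have F0: "F $ 0 = 1" by (simp add: F_def hyp_fps_def)
  then have Fnz: "F \<noteq> 0" by auto
  have Tm: "T (f * h) = T f * h + f * T h" for f h by (simp add: T_def algebra_simps)
  have Ta: "T (f + h) = T f + T h" "T (f - h) = T f - T h" for f h by (simp_all add: T_def algebra_simps)
  have Tc: "T (fps_const c * f) = fps_const c * T f" for c f by (simp add: T_def mult_ac)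
  have T1: "T 1 = 0" by (simp add: T_def)
  have "d * (F * U) = d * F + (d * fps_const (1 / de)) * (fps_X * fps_deriv F)"
    unfolding U_def u_def F_def hyp_mult_mean_moment[OF assms(1-4)] by (simp add: algebra_simps)
  also have "d * fps_const (1 / de) = 1" using assms by (simp add: d_def)
  finally have FU: "T F = d * (F * (U - 1))" by (simp add: T_def algebra_simps)
  have ode: "T (T F) + g * T F = fps_X * (T (T F + d * F) + A * (T F + d * F))"
    unfolding F_def T_def d_def g_def A_def using assms by (intro hyp_fps_ode) auto
  have e1: "T F + d * F = d * (F * U)" unfolding FU by (simp add: algebra_simps)
  have Td: "T (d * f) = d * T f" for f unfolding d_def by (rule Tc)
  have "T (T F) = T (d * (F * (U - 1)))" unfolding FU ..
  also have "\<dots> = d * (T F * (U - 1) + F * T U)" unfolding Td unfolding Tm Ta T1 by simp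
  finally have e2: "T (T F) = F * (d * (d * (U - 1) * (U - 1) + T U))"
    unfolding FU by (simp add: algebra_simps)
  have "T (d * (F * U)) = d * (T F * U + F * T U)" unfolding Td unfolding Tm ..
  then have e3: "T (d * (F * U)) = F * (d * (d * (U - 1) * U + T U))"
    unfolding FU by (simp add: algebra_simps)
  have "F * (d * (d * (U - 1) * (U - 1) + T U + g * (U - 1))) = F * (d * (fps_X * (d * (U - 1) * U + T U + A * U)))"
    using ode unfolding e1 e2 e3 unfolding FU by (simp add: algebra_simps)
  then have "d * (d * (U - 1) * (U - 1) + T U + g * (U - 1)) = d * (fps_X * (d * (U - 1) * U + T U + A * U))"
    using Fnz by simp
  moreover have "d \<noteq> 0" using assms by (simp add: d_def)
  ultimately have eq: "d * (U - 1) * (U - 1) + T U + g * (U - 1) = fps_X * (d * (U - 1) * U + T U + A * U)"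
    by simp
  have Tn: "T f $ n = real n * f $ n" for f n unfolding T_def by (cases n) (simp_all add: One_nat_def)
  have UU: "(U * U) $ n = moment_conv u n" for n
    by (simp add: U_def fps_mult_nth moment_conv_def atLeast0AtMost)
  have Un: "U $ n = u n" for n by (simp add: U_def)
  have "(d * (U - 1) * (U - 1)) = d * (U * U - U - U + 1)" "d * (U - 1) * U = d * (U * U - U)"
    by (simp_all add: algebra_simps)
  from eq[unfolded this]
  have "(d * (U * U - U - U + 1) + T U + g * (U - 1)) $ Suc k = (fps_X * (d * (U * U - U) + T U + A * U)) $ Suc k"
    by simp
  then have "de * (moment_conv u (Suc k) - u (Suc k) - u (Suc k)) + real (Suc k) * u (Suc k) + (ga - 1) * u (Suc k)
    = de * (moment_conv u k - u k) + real k * u k + al * u k"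
    unfolding d_def g_def A_def by (simp add: Tn UU Un del: of_nat_Suc)
  then show "(real k + al - de) * u k - (real (Suc k) + ga - 1) * u (Suc k)
    + de * (moment_conv u k - (moment_conv u (Suc k) - 2 * u (Suc k))) = 0" by (simp add: algebra_simps)
  show "u 0 = 1" by (simp add: u_def mean_moment_def beta_moment_def)
qed

section \<open>Expected moments of the random Jacobi matrix\<close>

lemma integrable_integral_pair_mult:
  fixes F :: "'a \<Rightarrow> real" and G :: "'b \<Rightarrow> real"
  assumes M: "prob_space M1" "prob_space M2" and F: "integrable M1 F" and G: "integrable M2 G"
  shows "integrable (M1 \<Otimes>\<^sub>M M2) (\<lambda>\<omega>. F (fst \<omega>) * G (snd \<omega>))"
    "(\<integral>\<omega>. F (fst \<omega>) * G (snd \<omega>) \<partial>(M1 \<Otimes>\<^sub>M M2)) = integral\<^sup>L M1 F * integral\<^sup>L M2 G"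
proof -
  interpret M1: prob_space M1 by fact
  interpret M2: prob_space M2 by fact
  interpret P: pair_sigma_finite M1 M2 ..
  have [measurable]: "F \<in> borel_measurable M1" "G \<in> borel_measurable M2" using F G by auto
  show int: "integrable (M1 \<Otimes>\<^sub>M M2) (\<lambda>\<omega>. F (fst \<omega>) * G (snd \<omega>))"
  proof (rule P.Fubini_integrable)
    show "integrable M1 (\<lambda>x. \<integral>y. norm (F (fst (x, y)) * G (snd (x, y))) \<partial>M2)"
      using F by (simp add: abs_mult)
    show "AE x in M1. integrable M2 (\<lambda>y. F (fst (x, y)) * G (snd (x, y)))" using G by simp
  qed measurable
  have "(\<integral>\<omega>. F (fst \<omega>) * G (snd \<omega>) \<partial>(M1 \<Otimes>\<^sub>M M2)) = (\<integral>x. (\<integral>y. F x * G y \<partial>M2) \<partial>M1)"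
    using P.integral_fst'[OF int] by simp
  then show "(\<integral>\<omega>. F (fst \<omega>) * G (snd \<omega>) \<partial>(M1 \<Otimes>\<^sub>M M2)) = integral\<^sup>L M1 F * integral\<^sup>L M2 G" by simp
qed

lemma distr_pair_snd:
  assumes "prob_space M1" "prob_space M2"
  shows "distr (M1 \<Otimes>\<^sub>M M2) M2 snd = M2"
proof (rule measure_eqI)
  interpret M1: prob_space M1 by fact
  interpret M2: prob_space M2 by fact
  fix A assume "A \<in> sets (distr (M1 \<Otimes>\<^sub>M M2) M2 snd)"
  then have A: "A \<in> sets M2" by simp
  have "snd -` A \<inter> space (M1 \<Otimes>\<^sub>M M2) = space M1 \<times> A"
    using sets.sets_into_space[OF A] by (auto simp: space_pair_measure)
  then show "emeasure (distr (M1 \<Otimes>\<^sub>M M2) M2 snd) A = emeasure M2 A"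
    using A by (simp add: emeasure_distr M2.emeasure_pair_measure_Times M1.emeasure_space_1)
qed simp

text \<open>Only finitely many coordinates occur, so the integral is that of the finite marginal,
  which restriction maps the infinite product onto.\<close>

lemma integrable_integral_PiM_prod:
  fixes f :: "'i \<Rightarrow> 'a \<Rightarrow> real"
  assumes M: "\<And>i. prob_space (M i)" and J: "finite J" "J \<subseteq> I" and f: "\<And>i. i \<in> J \<Longrightarrow> integrable (M i) (f i)"
  shows "integrable (PiM I M) (\<lambda>x. \<Prod>i\<in>J. f i (x i))"
    "(\<integral>x. (\<Prod>i\<in>J. f i (x i)) \<partial>PiM I M) = (\<Prod>i\<in>J. integral\<^sup>L (M i) (f i))"
proof -
  interpret product_prob_space M I
    using M by (auto simp: product_prob_space_def product_prob_space_axioms_def product_sigma_finite_def prob_space_imp_sigma_finite)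
  have [measurable]: "(\<lambda>x. \<Prod>i\<in>J. f i (x i)) \<in> borel_measurable (PiM J M)"
    using product_integrable_prod[OF J(1) f] by auto
  have rm: "(\<lambda>x. restrict x J) \<in> measurable (PiM I M) (PiM J M)" using J by (intro measurable_restrict_subset)
  have D: "distr (PiM I M) (PiM J M) (\<lambda>x. restrict x J) = PiM J M" by (rule distr_PiM_restrict_finite[OF J])
  have e: "(\<Prod>i\<in>J. f i (restrict x J i)) = (\<Prod>i\<in>J. f i (x i))" for x by (intro prod.cong) auto
  have "integrable (distr (PiM I M) (PiM J M) (\<lambda>x. restrict x J)) (\<lambda>x. \<Prod>i\<in>J. f i (x i))"
    unfolding D by (rule product_integrable_prod[OF J(1) f])
  from integrable_distr[OF rm this] show "integrable (PiM I M) (\<lambda>x. \<Prod>i\<in>J. f i (x i))"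
    unfolding e .
  have "(\<Prod>i\<in>J. integral\<^sup>L (M i) (f i)) = (\<integral>x. (\<Prod>i\<in>J. f i (x i)) \<partial>distr (PiM I M) (PiM J M) (\<lambda>x. restrict x J))"
    unfolding D by (rule product_integral_prod[OF J(1) f, symmetric])
  also have "\<dots> = (\<integral>x. (\<Prod>i\<in>J. f i (restrict x J i)) \<partial>PiM I M)"
    by (rule integral_distr[OF rm]) measurable
  finally show "(\<integral>x. (\<Prod>i\<in>J. f i (x i)) \<partial>PiM I M) = (\<Prod>i\<in>J. integral\<^sup>L (M i) (f i))" unfolding e ..
qed

section \<open>Mixed moments of the beta distributions\<close>

lemma Beta_shift:
  assumes "p > 0" "q > (0::real)"
  shows "Beta (p + real r) (q + real j) / Beta p q = beta_moment p (p + q) r j"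
proof -
  have G: "Gamma (x + real n) = pochhammer x n * Gamma x" if "x > 0" for x n
  proof -
    have "x \<notin> \<int>\<^sub>\<le>\<^sub>0" using that by (auto elim!: nonpos_Ints_cases)
    moreover have "Gamma x \<noteq> 0" using Gamma_real_pos[OF that] by linarith
    ultimately show ?thesis using that by (simp add: pochhammer_Gamma)
  qed
  have "Gamma (p + real r + (q + real j)) = pochhammer (p + q) (r + j) * Gamma (p + q)"
    using G[of "p + q" "r + j"] assms by (simp add: algebra_simps)
  moreover have "Gamma p \<noteq> 0" "Gamma q \<noteq> 0" "Gamma (p + q) \<noteq> 0"
    using Gamma_real_pos[of p] Gamma_real_pos[of q] Gamma_real_pos[of "p + q"] assms by linarith+
  ultimately show ?thesis using assms by (simp add: Beta_def G beta_moment_def)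
qed

lemma Beta_pos: "p > 0 \<Longrightarrow> q > 0 \<Longrightarrow> Beta p (q::real) > 0"
  unfolding Beta_def by (intro divide_pos_pos mult_pos_pos Gamma_real_pos) auto

lemma nn_integral_beta_monomial:
  assumes "p > 0" "q > (0::real)"
  shows "(\<integral>\<^sup>+x. ennreal (x ^ r * (1 - x) ^ j) \<partial>beta_distribution p q) = ennreal (beta_moment p (p + q) r j)"
proof -
  have "(\<integral>\<^sup>+x. ennreal (x ^ r * (1 - x) ^ j) \<partial>beta_distribution p q)
    = (\<integral>\<^sup>+x. ennreal (indicator {0<..<1} x * (x powr (p - 1) * (1 - x) powr (q - 1)) / Beta p q) * ennreal (x ^ r * (1 - x) ^ j) \<partial>lborel)"
    unfolding beta_distribution_def by (rule nn_integral_density) auto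
  also have "\<dots> = (\<integral>\<^sup>+x. ennreal (1 / Beta p q) * ennreal (indicator {0..1} x * (x powr (p + real r - 1) * (1 - x) powr (q + real j - 1))) \<partial>lborel)"
  \<comment> \<open>The density lives on the open interval and the Beta integral on the closed one;
    the endpoints are discarded as null sets.\<close>
  proof (rule nn_integral_cong_AE, rule AE_mp[OF AE_lborel_singleton[of 0]], rule AE_mp[OF AE_lborel_singleton[of 1]], intro AE_I2 impI)
    fix x :: real assume x: "x \<noteq> 1" "x \<noteq> 0"
    show "ennreal (indicator {0<..<1} x * (x powr (p - 1) * (1 - x) powr (q - 1)) / Beta p q) * ennreal (x ^ r * (1 - x) ^ j)
      = ennreal (1 / Beta p q) * ennreal (indicator {0..1} x * (x powr (p + real r - 1) * (1 - x) powr (q + real j - 1)))"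
    proof (cases "x \<in> {0<..<1}")
      case True
      have "x powr (p + real r - 1) = x powr (p - 1) * x ^ r" "(1 - x) powr (q + real j - 1) = (1 - x) powr (q - 1) * (1 - x) ^ j"
        using True by (simp_all add: powr_realpow[symmetric] powr_add[symmetric] algebra_simps)
      then show ?thesis using True Beta_pos[OF assms] by (simp add: ennreal_mult[symmetric] mult_ac)
    next
      case False
      then have "x \<notin> {0..1}" using x by auto
      then show ?thesis using False by simp
    qed
  qed
  also have "\<dots> = ennreal (1 / Beta p q) * ennreal (Beta (p + real r) (q + real j))"
    using nn_integral_beta_density[of "p + real r - 1" "q + real j - 1"] assms by (subst nn_integral_cmult) auto
  also have "\<dots> = ennreal (beta_moment p (p + q) r j)"
    using Beta_pos[OF assms] Beta_pos[of "p + real r" "q + real j"] assms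
    by (simp add: ennreal_mult[symmetric] Beta_shift[symmetric])
  finally show ?thesis .
qed

lemma sets_beta_distribution [measurable_cong, simp]: "sets (beta_distribution p q) = sets borel"
  by (simp add: beta_distribution_def)

lemma space_beta_distribution [simp]: "space (beta_distribution p q) = UNIV"
  by (simp add: beta_distribution_def)

lemma prob_space_beta_distribution:
  assumes "p > 0" "q > (0::real)"
  shows "prob_space (beta_distribution p q)"
proof (rule prob_spaceI)
  have "emeasure (beta_distribution p q) (space (beta_distribution p q)) = (\<integral>\<^sup>+x. ennreal (x ^ 0 * (1 - x) ^ 0) \<partial>beta_distribution p q)"
    by simp
  also have "\<dots> = ennreal (beta_moment p (p + q) 0 0)" using assms by (rule nn_integral_beta_monomial)
  finally show "emeasure (beta_distribution p q) (space (beta_distribution p q)) = 1" by (simp add: beta_moment_def)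
qed

lemma AE_beta_distribution: "AE x in beta_distribution p q. x \<in> {0..1}"
  unfolding beta_distribution_def by (subst AE_density) (auto simp: indicator_def)

lemma beta_distribution_monomial:
  assumes "p > 0" "q > (0::real)"
  shows "integrable (beta_distribution p q) (\<lambda>x. x ^ r * (1 - x) ^ j)"
    "(\<integral>x. x ^ r * (1 - x) ^ j \<partial>beta_distribution p q) = beta_moment p (p + q) r j"
proof -
  interpret prob_space "beta_distribution p q" using assms by (rule prob_space_beta_distribution)
  have nn: "AE x in beta_distribution p q. 0 \<le> x ^ r * (1 - x) ^ j"
    using AE_beta_distribution[of p q] by (rule eventually_mono) auto
  show int: "integrable (beta_distribution p q) (\<lambda>x. x ^ r * (1 - x) ^ j)"
  proof (rule integrable_const_bound[of _ 1])
    show "AE x in beta_distribution p q. norm (x ^ r * (1 - x) ^ j) \<le> 1"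
      using AE_beta_distribution[of p q] by (rule eventually_mono) (auto simp: abs_mult intro!: mult_le_one power_le_one)
  qed measurable
  have "0 \<le> beta_moment p (p + q) r j" unfolding beta_moment_def using assms
    by (auto intro!: divide_nonneg_nonneg mult_nonneg_nonneg pochhammer_nonneg)
  moreover have "ennreal (\<integral>x. x ^ r * (1 - x) ^ j \<partial>beta_distribution p q) = ennreal (beta_moment p (p + q) r j)"
    using nn_integral_eq_integral[OF int nn] nn_integral_beta_monomial[OF assms] by simp
  ultimately show "(\<integral>x. x ^ r * (1 - x) ^ j \<partial>beta_distribution p q) = beta_moment p (p + q) r j"
    using integral_nonneg_AE[OF nn] by simp
qed

text \<open>Both laws have the same parameter total ga, as do Beta(c + a + 1, c + b + 1) and Beta(c,
  c + a + b + 2) with ga = 2 c + a + b + 2. This common total makes the sums over the alternating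
  parameters balanced.\<close>

locale beta_parameters =
  fixes al de ga :: real
  assumes al: "0 < al" "al < ga" and de: "0 < de" "de < ga"
begin

definition "A = beta_distribution al (ga - al)"
definition "B = beta_distribution de (ga - de)"
definition "param_space = PiM {1::nat..} (\<lambda>_. A) \<Otimes>\<^sub>M PiM {1::nat..} (\<lambda>_. B)"
definition "coord m \<omega> = interleave (fst \<omega>) (snd \<omega>) m"
definition "par m = (if even m then al else de)"

lemma prob_space_A: "prob_space A" and prob_space_B: "prob_space B"
  unfolding A_def B_def using al de by (auto intro!: prob_space_beta_distribution)

lemma coord_monomials:
  "integrable param_space (\<lambda>\<omega>. \<Prod>i<n. coord i \<omega> ^ r i * (1 - coord i \<omega>) ^ s i)" (is "?I n")
  "(\<integral>\<omega>. (\<Prod>i<n. coord i \<omega> ^ r i * (1 - coord i \<omega>) ^ s i) \<partial>param_space) = (\<Prod>i<n. beta_moment (par i) ga (r i) (s i))" (is "?E n")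
proof -
  \<comment> \<open>An even number of interleaved coordinates consists of equally many entries of p
    and of q, which separates the monomial over the two factors of the space.\<close>
  have even_case: "integrable param_space (\<lambda>\<omega>. \<Prod>i<2*n. coord i \<omega> ^ r i * (1 - coord i \<omega>) ^ s i) \<and>
    (\<integral>\<omega>. (\<Prod>i<2*n. coord i \<omega> ^ r i * (1 - coord i \<omega>) ^ s i) \<partial>param_space) = (\<Prod>i<2*n. beta_moment (par i) ga (r i) (s i))" for n and r s :: "nat \<Rightarrow> nat"
  proof -
    define f where "f = (\<lambda>i. \<lambda>x::real. x ^ r (2 * (i - 1)) * (1 - x) ^ s (2 * (i - 1)))"
    define g where "g = (\<lambda>i. \<lambda>x::real. x ^ r (Suc (2 * (i - 1))) * (1 - x) ^ s (Suc (2 * (i - 1))))"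
    have split: "(\<Prod>i<2*n. h i) = (\<Prod>i\<in>{1..n}. h (2 * (i - 1))) * (\<Prod>i\<in>{1..n}. h (Suc (2 * (i - 1))))" for h :: "nat \<Rightarrow> real"
      by (induction n) (simp_all add: mult_ac)
    have eq: "(\<Prod>i<2*n. coord i \<omega> ^ r i * (1 - coord i \<omega>) ^ s i) = (\<Prod>i\<in>{1..n}. f i (fst \<omega> i)) * (\<Prod>i\<in>{1..n}. g i (snd \<omega> i))" for \<omega>
      unfolding split by (intro arg_cong2[of _ _ _ _ "(*)"] prod.cong refl) (auto simp: coord_def interleave_def f_def g_def)
    have If: "integrable A (f i)" "integral\<^sup>L A (f i) = beta_moment al ga (r (2 * (i - 1))) (s (2 * (i - 1)))" for i
      unfolding A_def f_def using beta_distribution_monomial[of al "ga - al"] al by auto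
    have Ig: "integrable B (g i)" "integral\<^sup>L B (g i) = beta_moment de ga (r (Suc (2 * (i - 1)))) (s (Suc (2 * (i - 1))))" for i
      unfolding B_def g_def using beta_distribution_monomial[of de "ga - de"] de by auto
    have P: "integrable (PiM {1::nat..} (\<lambda>_. A)) (\<lambda>x. \<Prod>i\<in>{1..n}. f i (x i))"
      "(\<integral>x. (\<Prod>i\<in>{1..n}. f i (x i)) \<partial>PiM {1::nat..} (\<lambda>_. A)) = (\<Prod>i\<in>{1..n}. integral\<^sup>L A (f i))"
      by (rule integrable_integral_PiM_prod; use prob_space_A If in auto)+
    have Q: "integrable (PiM {1::nat..} (\<lambda>_. B)) (\<lambda>x. \<Prod>i\<in>{1..n}. g i (x i))"
      "(\<integral>x. (\<Prod>i\<in>{1..n}. g i (x i)) \<partial>PiM {1::nat..} (\<lambda>_. B)) = (\<Prod>i\<in>{1..n}. integral\<^sup>L B (g i))"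
      by (rule integrable_integral_PiM_prod; use prob_space_B Ig in auto)+
    have pA: "prob_space (PiM {1::nat..} (\<lambda>_. A))" "prob_space (PiM {1::nat..} (\<lambda>_. B))"
      by (intro prob_space_PiM prob_space_A, intro prob_space_PiM prob_space_B)
    have rhs: "(\<Prod>i<2*n. beta_moment (par i) ga (r i) (s i)) = (\<Prod>i\<in>{1..n}. beta_moment al ga (r (2 * (i - 1))) (s (2 * (i - 1)))) *
      (\<Prod>i\<in>{1..n}. beta_moment de ga (r (Suc (2 * (i - 1)))) (s (Suc (2 * (i - 1)))))"
      unfolding split by (simp add: par_def)
    show ?thesis
      unfolding eq rhs param_space_def using integrable_integral_pair_mult[OF pA P(1) Q(1)] unfolding P(2) Q(2) If Ig
      by blast
  qed
  \<comment> \<open>Padding with exponents 0 up to index 2 n reduces an arbitrary n to the even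
    case.\<close>
  define r' where "r' = (\<lambda>i. if i < n then r i else 0)"
  define s' where "s' = (\<lambda>i. if i < n then s i else 0)"
  have ext: "(\<Prod>i<2*n. h i) = (\<Prod>i<n. h i)" if "\<And>i. i \<ge> n \<Longrightarrow> h i = 1" for h :: "nat \<Rightarrow> real"
    using that by (intro prod.mono_neutral_right) auto
  have e1: "(\<Prod>i<2*n. coord i \<omega> ^ r' i * (1 - coord i \<omega>) ^ s' i) = (\<Prod>i<n. coord i \<omega> ^ r i * (1 - coord i \<omega>) ^ s i)" for \<omega>
    by (subst ext) (auto simp: r'_def s'_def)
  have e2: "(\<Prod>i<2*n. beta_moment (par i) ga (r' i) (s' i)) = (\<Prod>i<n. beta_moment (par i) ga (r i) (s i))"
    by (subst ext) (auto simp: r'_def s'_def beta_moment_def)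
  show "?I n" "?E n" using even_case[of r' s' n] unfolding e1 e2 by auto
qed

text \<open>Each expansion of the tail releases one more coordinate as a monomial, so the induction
  has to carry arbitrary monomials in the coordinates released already.\<close>

lemma coord_tail_mean:
  "integrable param_space (\<lambda>\<omega>. (\<Prod>i<n. coord i \<omega> ^ r i * (1 - coord i \<omega>) ^ s i) * (tail_fps (\<lambda>m. coord (m + n) \<omega>) ^ l) $ k) \<and>
   (\<integral>\<omega>. (\<Prod>i<n. coord i \<omega> ^ r i * (1 - coord i \<omega>) ^ s i) * (tail_fps (\<lambda>m. coord (m + n) \<omega>) ^ l) $ k \<partial>param_space)
    = (\<Prod>i<n. beta_moment (par i) ga (r i) (s i)) * tail_mean (par n) (par (Suc n)) ga k l"
proof (induction k arbitrary: n r s l rule: less_induct)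
  case (less k)
  show ?case
  proof (cases k)
    case 0
    have e: "(\<Prod>i<n. coord i \<omega> ^ r i * (1 - coord i \<omega>) ^ s i) * (tail_fps (\<lambda>m. coord (m + n) \<omega>) ^ l) $ k
      = (\<Prod>i<Suc n. coord i \<omega> ^ (r(n := l)) i * (1 - coord i \<omega>) ^ (s(n := 0)) i)" for \<omega>
    proof -
      have "(tail_fps (\<lambda>m. coord (m + n) \<omega>) ^ l) $ k = coord n \<omega> ^ l"
        using tail_fps_power_nth[of "\<lambda>m. coord (m + n) \<omega>" l 0] 0 by simp
      moreover have "(\<Prod>i<n. coord i \<omega> ^ (r(n := l)) i * (1 - coord i \<omega>) ^ (s(n := 0)) i) = (\<Prod>i<n. coord i \<omega> ^ r i * (1 - coord i \<omega>) ^ s i)"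
        by (intro prod.cong) auto
      ultimately show ?thesis by simp
    qed
    have e2: "(\<Prod>i<Suc n. beta_moment (par i) ga ((r(n := l)) i) ((s(n := 0)) i)) =
      (\<Prod>i<n. beta_moment (par i) ga (r i) (s i)) * tail_mean (par n) (par (Suc n)) ga k l"
    proof -
      have "(\<Prod>i<n. beta_moment (par i) ga ((r(n := l)) i) ((s(n := 0)) i)) = (\<Prod>i<n. beta_moment (par i) ga (r i) (s i))"
        by (intro prod.cong) auto
      then show ?thesis using 0 by simp
    qed
    show ?thesis unfolding e e2[symmetric] using coord_monomials[where n = "Suc n" and r = "r(n := l)" and s = "s(n := 0)"] by blast
  next
    case (Suc k')
    define c where "c = (\<lambda>j. pochhammer (real l) (Suc j) / fact (Suc j))"
    define r' where "r' = r(n := l)"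
    define s' where "s' = (\<lambda>j. s(n := Suc j))"
    define h where "h = (\<lambda>j \<omega>. (\<Prod>i<Suc n. coord i \<omega> ^ r' i * (1 - coord i \<omega>) ^ s' j i) * (tail_fps (\<lambda>m. coord (m + Suc n) \<omega>) ^ Suc j) $ (k' - j))"
    have e: "(\<Prod>i<n. coord i \<omega> ^ r i * (1 - coord i \<omega>) ^ s i) * (tail_fps (\<lambda>m. coord (m + n) \<omega>) ^ l) $ k
      = (\<Sum>j\<in>{0..k'}. c j * h j \<omega>)" for \<omega>
    proof -
      let ?w = "\<lambda>m. coord (m + n) \<omega>"
      let ?F = "\<lambda>j. pochhammer (real l) j / fact j * (?w 0 ^ l * (1 - ?w 0) ^ j) * (tail_fps (shift ?w) ^ j) $ (k - j)"
      have "(tail_fps ?w ^ l) $ k = (\<Sum>j\<in>{0..Suc k'}. ?F j)" unfolding tail_fps_power_nth[of ?w] Suc ..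
      also have "\<dots> = ?F 0 + (\<Sum>j\<in>{0..k'}. ?F (Suc j))" by (simp only: sum.atLeast0_atMost_Suc_shift o_def)
      \<comment> \<open>The zeroth power of the tail is the series 1, which has no coefficient at
        the positive index k.\<close>
      also have "?F 0 = 0" using Suc by simp
      finally have t: "(tail_fps ?w ^ l) $ k = (\<Sum>j\<in>{0..k'}. c j * (coord n \<omega> ^ l * (1 - coord n \<omega>) ^ Suc j) * (tail_fps (\<lambda>m. coord (m + Suc n) \<omega>) ^ Suc j) $ (k' - j))"
        using Suc by (simp add: c_def)
      have p: "(\<Prod>i<Suc n. coord i \<omega> ^ r' i * (1 - coord i \<omega>) ^ s' j i) = (\<Prod>i<n. coord i \<omega> ^ r i * (1 - coord i \<omega>) ^ s i) * (coord n \<omega> ^ l * (1 - coord n \<omega>) ^ Suc j)" for j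
      proof -
        have "(\<Prod>i<n. coord i \<omega> ^ r' i * (1 - coord i \<omega>) ^ s' j i) = (\<Prod>i<n. coord i \<omega> ^ r i * (1 - coord i \<omega>) ^ s i)"
          unfolding r'_def s'_def by (intro prod.cong) auto
        then show ?thesis by (simp add: r'_def s'_def)
      qed
      show ?thesis unfolding t h_def p sum_distrib_left by (intro sum.cong refl) (simp only: mult_ac)
    qed
    have IH: "integrable param_space (h j)"
      "integral\<^sup>L param_space (h j) = (\<Prod>i<n. beta_moment (par i) ga (r i) (s i)) * (beta_moment (par n) ga l (Suc j) * tail_mean (par (Suc n)) (par n) ga (k' - j) (Suc j))"
      if "j \<in> {0..k'}" for j
    proof -
      have lt: "k' - j < k" using Suc by simp
      have p: "(\<Prod>i<Suc n. beta_moment (par i) ga (r' i) (s' j i)) = (\<Prod>i<n. beta_moment (par i) ga (r i) (s i)) * beta_moment (par n) ga l (Suc j)"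
      proof -
        have "(\<Prod>i<n. beta_moment (par i) ga (r' i) (s' j i)) = (\<Prod>i<n. beta_moment (par i) ga (r i) (s i))"
          unfolding r'_def s'_def by (intro prod.cong) auto
        then show ?thesis by (simp add: r'_def s'_def)
      qed
      have par2: "par (Suc (Suc n)) = par n" by (simp add: par_def)
      show "integrable param_space (h j)"
        unfolding h_def using less.IH[OF lt, of r' "s' j" "Suc n" "Suc j"] by blast
      show "integral\<^sup>L param_space (h j) = (\<Prod>i<n. beta_moment (par i) ga (r i) (s i)) * (beta_moment (par n) ga l (Suc j) * tail_mean (par (Suc n)) (par n) ga (k' - j) (Suc j))"
        unfolding h_def using less.IH[OF lt, of r' "s' j" "Suc n" "Suc j"] unfolding p par2 mult.assoc by blast
    qed
    have "integrable param_space (\<lambda>\<omega>. \<Sum>j\<in>{0..k'}. c j * h j \<omega>)" using IH(1) by auto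
    moreover have "(\<integral>\<omega>. (\<Sum>j\<in>{0..k'}. c j * h j \<omega>) \<partial>param_space) = (\<Prod>i<n. beta_moment (par i) ga (r i) (s i)) * tail_mean (par n) (par (Suc n)) ga k l"
    proof -
      have "(\<integral>\<omega>. (\<Sum>j\<in>{0..k'}. c j * h j \<omega>) \<partial>param_space) = (\<Sum>j\<in>{0..k'}. c j * integral\<^sup>L param_space (h j))"
        using IH(1) by (subst Bochner_Integration.integral_sum) auto
      also have "\<dots> = (\<Prod>i<n. beta_moment (par i) ga (r i) (s i)) * tail_mean (par n) (par (Suc n)) ga k l"
        unfolding Suc tail_mean.simps sum_distrib_left by (intro sum.cong refl) (simp only: IH c_def mult_ac)
      finally show ?thesis .
    qed
    ultimately show ?thesis unfolding e by blast
  qed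
qed

lemma expected_resolvent_moment:
  "(\<integral>\<omega>. inverse (1 - fps_X * tail_fps (interleave (fst \<omega>) (snd \<omega>))) $ k \<partial>param_space) = mean_moment al de ga k"
  "(\<lambda>\<omega>. inverse (1 - fps_X * tail_fps (interleave (fst \<omega>) (snd \<omega>))) $ k) \<in> borel_measurable param_space"
proof -
  have e: "(\<lambda>m. coord (m + 0) \<omega>) = interleave (fst \<omega>) (snd \<omega>)" for \<omega> by (simp add: coord_def fun_eq_iff)
  have t: "integrable param_space (\<lambda>\<omega>. (tail_fps (interleave (fst \<omega>) (snd \<omega>)) ^ r) $ j)"
    "(\<integral>\<omega>. (tail_fps (interleave (fst \<omega>) (snd \<omega>)) ^ r) $ j \<partial>param_space) = tail_mean al de ga j r" for r j
    using coord_tail_mean[where n = 0 and l = r and k = j] unfolding e by (simp_all add: par_def)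
  show "(\<integral>\<omega>. inverse (1 - fps_X * tail_fps (interleave (fst \<omega>) (snd \<omega>))) $ k \<partial>param_space) = mean_moment al de ga k"
    unfolding jacobi_moment_tail mean_moment_def by (subst Bochner_Integration.integral_sum) (auto simp: t)
  show "(\<lambda>\<omega>. inverse (1 - fps_X * tail_fps (interleave (fst \<omega>) (snd \<omega>))) $ k) \<in> borel_measurable param_space"
    unfolding jacobi_moment_tail using t(1) by (intro borel_measurable_sum) auto
qed

lemma AE_param_unit: "AE \<omega> in param_space. \<forall>n\<ge>1. fst \<omega> n \<in> {0..1} \<and> snd \<omega> n \<in> {0..1}"
proof -
  interpret PA: prob_space "PiM {1::nat..} (\<lambda>_. A)" by (intro prob_space_PiM prob_space_A)
  interpret QB: prob_space "PiM {1::nat..} (\<lambda>_. B)" by (intro prob_space_PiM prob_space_B)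
  have a: "AE x in PiM {1::nat..} (\<lambda>_. A). \<forall>n\<in>{1..}. x n \<in> {0..1}"
    using AE_beta_distribution prob_space_A unfolding A_def
    by (intro AE_ball_countable[THEN iffD2] ballI AE_PiM_component) auto
  have b: "AE x in PiM {1::nat..} (\<lambda>_. B). \<forall>n\<in>{1..}. x n \<in> {0..1}"
    using AE_beta_distribution prob_space_B unfolding B_def
    by (intro AE_ball_countable[THEN iffD2] ballI AE_PiM_component) auto
  have "AE \<omega> in param_space. \<forall>n\<in>{1..}. fst \<omega> n \<in> {0..1}"
    unfolding param_space_def
    by (rule AE_distrD[OF measurable_fst]) (subst QB.distr_pair_fst, rule a)
  moreover have "AE \<omega> in param_space. \<forall>n\<in>{1..}. snd \<omega> n \<in> {0..1}"
    unfolding param_space_def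
    by (rule AE_distrD[OF measurable_snd]) (subst distr_pair_snd[OF PA.prob_space_axioms QB.prob_space_axioms], rule b)
  ultimately show ?thesis by eventually_elim auto
qed

lemma measurable_coordinates:
  assumes "n \<ge> 1"
  shows "(\<lambda>\<omega>. fst \<omega> n) \<in> borel_measurable param_space" "(\<lambda>\<omega>. snd \<omega> n) \<in> borel_measurable param_space"
proof -
  have "(\<lambda>x. x n) \<in> measurable (PiM {1::nat..} (\<lambda>_. A)) A" "(\<lambda>x. x n) \<in> measurable (PiM {1::nat..} (\<lambda>_. B)) B"
    using assms by (auto intro!: measurable_component_singleton)
  then have "(\<lambda>x. x n) \<in> borel_measurable (PiM {1::nat..} (\<lambda>_. A))" "(\<lambda>x. x n) \<in> borel_measurable (PiM {1::nat..} (\<lambda>_. B))"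
    by (simp_all add: A_def B_def cong: measurable_cong_sets)
  note m = this
  show "(\<lambda>\<omega>. fst \<omega> n) \<in> borel_measurable param_space"
    unfolding param_space_def by (rule measurable_compose[OF measurable_fst m(1)])
  show "(\<lambda>\<omega>. snd \<omega> n) \<in> borel_measurable param_space"
    unfolding param_space_def by (rule measurable_compose[OF measurable_snd m(2)])
qed

lemma borel_measurable_inf_mat_power:
  "(\<lambda>\<omega>. inf_mat_power (jacobi_matrix (fst \<omega>) (snd \<omega>)) k i j) \<in> borel_measurable param_space"
proof -
  have s: "(\<lambda>\<omega>. s_coeff (fst \<omega>) (snd \<omega>) n) \<in> borel_measurable param_space" if "n \<ge> 1" for n
  proof (cases "n = 1")
    case True
    then show ?thesis using measurable_coordinates[of 1] by (simp add: s_coeff_def)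
  next
    case False
    then show ?thesis using that measurable_coordinates[of n] measurable_coordinates[of "n - 1"] by (simp add: s_coeff_def)
  qed
  have t: "(\<lambda>\<omega>. t_coeff (fst \<omega>) (snd \<omega>) n) \<in> borel_measurable param_space" if "n \<ge> 1" for n
    using that measurable_coordinates[of n] by (simp add: t_coeff_def)
  have b: "(\<lambda>\<omega>. bidiag (fst \<omega>) (snd \<omega>) i j) \<in> borel_measurable param_space" for i j
    unfolding bidiag_def using s[of j] t[of j] by (cases "j \<ge> 1"; cases "i = j"; cases "i = j + 1") auto
  note [measurable] = b
  have [measurable]: "(\<lambda>\<omega>. jacobi_matrix (fst \<omega>) (snd \<omega>) i j) \<in> borel_measurable param_space" for i j
    unfolding jacobi_matrix_def inf_mat_mult_def by measurable
  show ?thesis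
  proof (induction k arbitrary: i j)
    case (Suc k)
    note [measurable] = Suc
    show ?case unfolding inf_mat_power.simps inf_mat_mult_def by measurable
  qed simp
qed

text \<open>Matrix power and series coefficient agree only where all parameters lie in [0, 1], hence
  almost surely; this is why both sides need to be known measurable.\<close>

lemma expected_jacobi_moment:
  "(\<integral>\<omega>. inf_mat_power (jacobi_matrix (fst \<omega>) (snd \<omega>)) k 1 1 \<partial>param_space) = mean_moment al de ga k"
proof -
  have "(\<integral>\<omega>. inf_mat_power (jacobi_matrix (fst \<omega>) (snd \<omega>)) k 1 1 \<partial>param_space)
    = (\<integral>\<omega>. inverse (1 - fps_X * tail_fps (interleave (fst \<omega>) (snd \<omega>))) $ k \<partial>param_space)"
  proof (rule integral_cong_AE)
    show "AE \<omega> in param_space. inf_mat_power (jacobi_matrix (fst \<omega>) (snd \<omega>)) k 1 1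
      = inverse (1 - fps_X * tail_fps (interleave (fst \<omega>) (snd \<omega>))) $ k"
      using AE_param_unit by (rule eventually_mono) (blast intro: inf_mat_power_jacobi_matrix)
  qed (rule borel_measurable_inf_mat_power expected_resolvent_moment)+
  then show ?thesis using expected_resolvent_moment(1) by simp
qed

end

lemma limit_parameters_moment:
  assumes "a > -1" "b > -1" "c > (0::real)"
  shows "(\<integral>(p, q). inf_mat_power (jacobi_matrix p q) k 1 1 \<partial>limit_parameters a b c)
    = mean_moment (c + a + 1) c (2 * c + a + b + 2) k"
proof -
  interpret beta_parameters "c + a + 1" c "2 * c + a + b + 2" by unfold_locales (use assms in auto)
  have "limit_parameters a b c = param_space"
    unfolding limit_parameters_def param_space_def A_def B_def by (simp add: algebra_simps)
  then show ?thesis using expected_jacobi_moment[of k] by (simp add: case_prod_unfold)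
qed

section \<open>Moment bounds from the loop equations\<close>

text \<open>The bound is required everywhere rather than almost everywhere, so that integrability of
  any polynomial expression and every comparison of integrands become pointwise matters.\<close>

definition brv :: "'a measure \<Rightarrow> ('a \<Rightarrow> real) \<Rightarrow> bool" where
  "brv M f \<longleftrightarrow> f \<in> borel_measurable M \<and> (\<exists>B. \<forall>x. \<bar>f x\<bar> \<le> B)"

lemma brv_const: "brv M (\<lambda>_. c)"
  by (auto simp: brv_def)

lemma brv_add:
  assumes a: "brv M f" "brv M g"
  shows "brv M (\<lambda>x. f x + g x)"
proof -
  from a obtain B C where "\<forall>x. \<bar>f x\<bar> \<le> B" "\<forall>x. \<bar>g x\<bar> \<le> C" by (auto simp: brv_def)
  then have "\<forall>x. \<bar>f x + g x\<bar> \<le> B + C" by (meson abs_triangle_ineq add_mono order_trans)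
  moreover have "(\<lambda>x. f x + g x) \<in> borel_measurable M" using a by (auto simp: brv_def)
  ultimately show ?thesis unfolding brv_def by blast
qed

lemma brv_mult:
  assumes a: "brv M f" "brv M g"
  shows "brv M (\<lambda>x. f x * g x)"
proof -
  from a obtain B C where B: "\<forall>x. \<bar>f x\<bar> \<le> B" and C: "\<forall>x. \<bar>g x\<bar> \<le> C" by (auto simp: brv_def)
  have "\<bar>f x * g x\<bar> \<le> B * C" for x
  proof -
    have "0 \<le> B" using B[rule_format, of x] by linarith
    then show ?thesis unfolding abs_mult using B C by (intro mult_mono) auto
  qed
  moreover have "(\<lambda>x. f x * g x) \<in> borel_measurable M" using a by (auto simp: brv_def)
  ultimately show ?thesis unfolding brv_def by blast
qed

lemma brv_cmult: "brv M f \<Longrightarrow> brv M (\<lambda>x. c * f x)"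
  by (intro brv_mult brv_const)

lemma brv_diff: "brv M f \<Longrightarrow> brv M g \<Longrightarrow> brv M (\<lambda>x. f x - g x)"
  using brv_add[of M f "\<lambda>x. (-1) * g x"] brv_cmult[of M g "-1"] by simp

lemma brv_sum: "(\<And>i. i \<in> I \<Longrightarrow> brv M (f i)) \<Longrightarrow> brv M (\<lambda>x. \<Sum>i\<in>I. f i x)"
proof (induction I rule: infinite_finite_induct)
  case (insert i I)
  then show ?case using brv_add[of M "f i" "\<lambda>x. \<Sum>i\<in>I. f i x"] by simp
qed (auto simp: brv_const)

lemma brv_power: "brv M f \<Longrightarrow> brv M (\<lambda>x. f x ^ n)"
  by (induction n) (auto intro: brv_const brv_mult)

lemma brv_abs: "brv M f \<Longrightarrow> brv M (\<lambda>x. \<bar>f x\<bar>)"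
  by (auto simp: brv_def)

lemma brv_continuous:
  assumes g: "continuous_on UNIV g" and f: "brv M f"
  shows "brv M (\<lambda>x. g (f x) :: real)"
proof -
  from f obtain B where B: "\<forall>x. \<bar>f x\<bar> \<le> B" by (auto simp: brv_def)
  have "compact (g ` {-B..B})" using g by (intro compact_continuous_image) (auto intro: continuous_on_subset)
  then have "bounded (g ` {-B..B})" by (rule compact_imp_bounded)
  then obtain C where C: "\<forall>y\<in>g ` {-B..B}. norm y \<le> C" unfolding bounded_iff ..
  have "\<bar>g (f x)\<bar> \<le> C" for x using B[rule_format, of x] C by (auto simp: abs_le_iff)
  moreover have "(\<lambda>x. g (f x)) \<in> borel_measurable M"
    using borel_measurable_continuous_onI[OF g] f by (auto simp: brv_def intro: measurable_compose)
  ultimately show ?thesis unfolding brv_def by blast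
qed

lemmas brv_intros = brv_const brv_add brv_mult brv_diff brv_sum brv_power brv_abs

lemma brv_integrable:
  assumes "prob_space M" "brv M f" shows "integrable M f"
proof -
  interpret prob_space M by fact
  from assms(2) obtain B where "\<forall>x. \<bar>f x\<bar> \<le> B" "f \<in> borel_measurable M" by (auto simp: brv_def)
  then show ?thesis by (intro integrable_const_bound[of _ B]) auto
qed

lemma integral_mono_brv:
  assumes "prob_space M" "brv M f" "brv M g" "\<And>x. f x \<le> g x"
  shows "integral\<^sup>L M f \<le> integral\<^sup>L M g"
  using assms by (intro integral_mono brv_integrable) auto

text \<open>Absorbs a mixed cubic term into a small multiple of x^4 at the cost of a fourth power of
  y. Splitting at K |y| = d |x| avoids fractional exponents and the sharp constant.\<close>

lemma young_cubic:
  fixes x y K d :: real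
  assumes "d > 0" "K \<ge> 0"
  shows "K * \<bar>y\<bar> * \<bar>x\<bar> ^ 3 \<le> d * x ^ 4 + K ^ 4 / d ^ 3 * y ^ 4"
proof (cases "K * \<bar>y\<bar> \<le> d * \<bar>x\<bar>")
  case True
  have "K * \<bar>y\<bar> * \<bar>x\<bar> ^ 3 \<le> d * \<bar>x\<bar> * \<bar>x\<bar> ^ 3" using True by (intro mult_right_mono) auto
  also have "\<dots> = d * x ^ 4" by (simp add: power_abs[symmetric] power_numeral_reduce abs_mult)
  also have "\<dots> \<le> d * x ^ 4 + K ^ 4 / d ^ 3 * y ^ 4" using assms by simp
  finally show ?thesis .
next
  case False
  then have "\<bar>x\<bar> \<le> K * \<bar>y\<bar> / d" using assms by (simp add: field_simps)
  then have "\<bar>x\<bar> ^ 3 \<le> (K * \<bar>y\<bar> / d) ^ 3" by (intro power_mono) auto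
  then have "K * \<bar>y\<bar> * \<bar>x\<bar> ^ 3 \<le> K * \<bar>y\<bar> * (K * \<bar>y\<bar> / d) ^ 3" using assms by (intro mult_left_mono) auto
  also have "\<dots> = K ^ 4 / d ^ 3 * \<bar>y\<bar> ^ 4" by (simp add: power_divide power_mult_distrib power_numeral_reduce)
  also have "\<dots> = K ^ 4 / d ^ 3 * y ^ 4" by (simp add: power_even_abs)
  also have "\<dots> \<le> d * x ^ 4 + K ^ 4 / d ^ 3 * y ^ 4" using assms by simp
  finally show ?thesis .
qed

lemma young_quadratic:
  fixes x K d :: real
  assumes "d > 0" "K \<ge> 0"
  shows "K * x ^ 2 \<le> d * x ^ 4 + K ^ 2 / d"
proof (cases "K \<le> d * x ^ 2")
  case True
  have "K * x ^ 2 \<le> d * x ^ 2 * x ^ 2" using True by (intro mult_right_mono) auto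
  also have "\<dots> = d * x ^ 4" by (simp add: power_numeral_reduce)
  also have "\<dots> \<le> d * x ^ 4 + K ^ 2 / d" using assms by simp
  finally show ?thesis .
next
  case False
  then have "x ^ 2 \<le> K / d" using assms by (simp add: field_simps)
  then have "K * x ^ 2 \<le> K * (K / d)" using assms by (intro mult_left_mono) auto
  also have "\<dots> = K ^ 2 / d" by (simp add: power2_eq_square)
  also have "\<dots> \<le> d * x ^ 4 + K ^ 2 / d" using assms by simp
  finally show ?thesis .
qed

lemma moment_conv_diff:
  "moment_conv m k - moment_conv v k = (\<Sum>l\<le>k. (m l - v l) * (m (k - l) + v (k - l)))"
proof -
  have "(\<Sum>l\<le>k. m l * v (k - l)) = (\<Sum>l\<le>k. m (k - l) * v l)"
    by (rule sum.reindex_bij_witness[of _ "\<lambda>l. k - l" "\<lambda>l. k - l"]) auto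
  then show ?thesis
    unfolding moment_conv_def by (simp add: algebra_simps sum.distrib sum_subtractf)
qed

text \<open>In the convolution of order k + 1 the summand l = k + 1 has the factor m_0 + v_0 = 2 and
  yields the share \<beta> N of the leading coefficient. The other summands involve differences of
  index at most k, so the system is triangular.\<close>

lemma loop_term_diff:
  assumes "m 0 = 1" "v 0 = 1"
  shows "loop_term \<beta> a b N k m - loop_term \<beta> a b N k v =
    - ((1 - \<beta> / 2) * real (Suc (Suc k)) + a + b + \<beta> * real N) * (m (Suc k) - v (Suc k))
    + ((1 - \<beta> / 2) * real (Suc k) + a) * (m k - v k)
    + \<beta> * real N / 2 * (\<Sum>l\<le>k. (m l - v l) * (m (k - l) + v (k - l) - m (Suc k - l) - v (Suc k - l)))"
proof -
  have 1: "moment_conv m (Suc k) - moment_conv v (Suc k) = (\<Sum>l\<le>k. (m l - v l) * (m (Suc k - l) + v (Suc k - l))) + 2 * (m (Suc k) - v (Suc k))"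
    unfolding moment_conv_diff using assms by (simp add: algebra_simps)
  have 2: "(\<Sum>l\<le>k. (m l - v l) * (m (k - l) + v (k - l) - m (Suc k - l) - v (Suc k - l)))
    = (moment_conv m k - moment_conv v k) - (\<Sum>l\<le>k. (m l - v l) * (m (Suc k - l) + v (Suc k - l)))"
    unfolding moment_conv_diff sum_subtractf[symmetric] by (intro sum.cong refl) (simp add: algebra_simps)
  have "loop_term \<beta> a b N k m - loop_term \<beta> a b N k v = ((1 - \<beta> / 2) * real (Suc k) + a) * (m k - v k)
    - ((1 - \<beta> / 2) * real (Suc (Suc k)) + a + b) * (m (Suc k) - v (Suc k))
    + \<beta> * real N / 2 * ((moment_conv m k - moment_conv v k) - (moment_conv m (Suc k) - moment_conv v (Suc k)))"
  proof -
    define h where "h = \<beta> / 2"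
    have "\<beta> = 2 * h" by (simp add: h_def)
    then show ?thesis unfolding loop_term_def by (simp add: algebra_simps)
  qed
  then show ?thesis unfolding 2 1 by (simp add: algebra_simps)
qed

text \<open>What the asymptotic analysis uses of the ensemble: loop equations and moments with
  values in [0, 1]. The bounds hold pointwise; the ensemble fulfils them after a change on a null
  set.\<close>

locale loop_model =
  fixes M :: "nat \<Rightarrow> 'a measure" and m :: "nat \<Rightarrow> 'a \<Rightarrow> nat \<Rightarrow> real" and \<beta> :: "nat \<Rightarrow> real" and a b c :: real
  assumes par: "a > -1" "b > -1" "c > 0"
    and \<beta>_pos: "\<And>N. N \<ge> 1 \<Longrightarrow> \<beta> N > 0" and \<beta>_lim: "(\<lambda>N. \<beta> N * real N) \<longlonglongrightarrow> 2 * c"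
    and prob: "\<And>N. N \<ge> 1 \<Longrightarrow> prob_space (M N)"
    and meas: "\<And>N k. N \<ge> 1 \<Longrightarrow> (\<lambda>x. m N x k) \<in> borel_measurable (M N)"
    and m_range: "\<And>N x k. 0 \<le> m N x k" "\<And>N x k. m N x k \<le> 1" and m_0: "\<And>N x. m N x 0 = 1"
    and loop: "\<And>N f f' f'' (t :: nat \<Rightarrow> real) J k. N \<ge> 1 \<Longrightarrow> (\<And>z. (f has_real_derivative f' z) (at z)) \<Longrightarrow>
       (\<And>z. (f' has_real_derivative f'' z) (at z)) \<Longrightarrow> continuous_on UNIV f'' \<Longrightarrow> finite J \<Longrightarrow>
       (\<integral>x. f' (\<Sum>j\<in>J. t j * m N x j) * (\<Sum>j\<in>J. t j * (real j * (m N x (j + k) - m N x (Suc (j + k)))))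
         + real N * (f (\<Sum>j\<in>J. t j * m N x j) * loop_term (\<beta> N) a b N k (m N x)) \<partial>M N) = 0"
begin

lemma brv_m: "N \<ge> 1 \<Longrightarrow> brv (M N) (\<lambda>x. m N x k)"
  unfolding brv_def using meas m_range by (auto simp: abs_le_iff intro!: exI[of _ 1])

lemma brv_loop_term: "N \<ge> 1 \<Longrightarrow> brv (M N) (\<lambda>x. loop_term (\<beta> N) a b N k (m N x))"
  unfolding loop_term_def moment_conv_def by (intro brv_intros brv_m)

lemma \<beta>_tendsto_0: "\<beta> \<longlonglongrightarrow> 0"
proof -
  have "(\<lambda>N. (\<beta> N * real N) * (1 / real N)) \<longlonglongrightarrow> 2 * c * 0"
    by (rule tendsto_mult[OF \<beta>_lim lim_1_over_n])
  moreover have "eventually (\<lambda>N. (\<beta> N * real N) * (1 / real N) = \<beta> N) sequentially"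
    using eventually_gt_at_top[of 0] by eventually_elim auto
  ultimately show ?thesis by (simp add: tendsto_cong)
qed

text \<open>The restoring coefficient of the top moment in \<open>loop_term_diff\<close>. Its limit
  is positive because a + b > -2.\<close>

definition "drift N k = (1 - \<beta> N / 2) * real (Suc (Suc k)) + a + b + \<beta> N * real N"
definition "drift_lim k = real (Suc (Suc k)) + a + b + 2 * c"

lemma drift_tendsto: "(\<lambda>N. drift N k) \<longlonglongrightarrow> drift_lim k"
proof -
  have "(\<lambda>N. drift N k) \<longlonglongrightarrow> (1 - 0 / 2) * real (Suc (Suc k)) + a + b + 2 * c"
    unfolding drift_def by (intro tendsto_add[OF _ \<beta>_lim] tendsto_intros \<beta>_tendsto_0) auto
  then show ?thesis by (simp add: drift_lim_def)
qed

lemma drift_lim_pos: "drift_lim k > 0"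
  using par unfolding drift_lim_def by simp

lemma eventually_drift: "eventually (\<lambda>N. drift N k \<ge> drift_lim k / 2) sequentially"
  using order_tendstoD(1)[OF drift_tendsto, of "drift_lim k / 2" k] drift_lim_pos[of k]
  by (auto elim!: eventually_mono)

lemma eventually_\<beta>: "eventually (\<lambda>N. N \<ge> 1 \<and> 0 < \<beta> N \<and> \<beta> N \<le> 1 \<and> 0 \<le> \<beta> N * real N / 2 \<and> \<beta> N * real N / 2 \<le> c + 1) sequentially"
proof -
  have "eventually (\<lambda>N. \<beta> N < 1) sequentially" by (rule order_tendstoD(2)[OF \<beta>_tendsto_0]) simp
  moreover have "eventually (\<lambda>N. \<beta> N * real N < 2 * c + 2) sequentially" by (rule order_tendstoD(2)[OF \<beta>_lim]) simp
  ultimately show ?thesis using eventually_ge_at_top[of "1::nat"]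
  proof eventually_elim
    case (elim N)
    then show ?case using \<beta>_pos[of N] by auto
  qed
qed

text \<open>A residual of order 1 / N is tolerated, so that the notion covers the recursive solution
  v as well as, for \<beta> = 2 c / N, the constant sequence u.\<close>

definition approx_solution :: "(nat \<Rightarrow> nat \<Rightarrow> real) \<Rightarrow> bool" where
  "approx_solution v \<longleftrightarrow> (\<forall>N. v N 0 = 1) \<and> (\<forall>k. \<exists>V. eventually (\<lambda>N. \<bar>v N k\<bar> \<le> V) sequentially) \<and>
     (\<forall>k. \<exists>w. eventually (\<lambda>N. \<bar>loop_term (\<beta> N) a b N k (v N)\<bar> \<le> w / real N) sequentially)"

text \<open>Write X for the deviation of the top moment. The drift yields d X^4, while the noise
  term 3 X^2 G / N costs by Young's inequality a small multiple of X^4 plus O(1 / N^2), which sets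
  the rate. The residual costs O(1 / N^4), and the lower deviations enter through their fourth
  powers, bounded by induction.\<close>

lemma fourth_moment_bound:
  assumes v: "approx_solution v"
  shows "\<exists>C\<ge>0. eventually (\<lambda>N. (\<integral>x. (m N x k - v N k) ^ 4 \<partial>M N) \<le> C / real N ^ 2) sequentially"
proof (induction k rule: less_induct)
  case (less k')
  show ?case
  proof (cases k')
    case 0
    have "(\<integral>x. (m N x k' - v N k') ^ 4 \<partial>M N) = 0" for N
      using v 0 by (simp add: m_0 approx_solution_def)
    then show ?thesis by (intro exI[of _ 0]) simp
  next
    case (Suc k)
    have IH: "\<forall>j\<in>{..k}. \<exists>C. C \<ge> 0 \<and> eventually (\<lambda>N. (\<integral>x. (m N x j - v N j) ^ 4 \<partial>M N) \<le> C / real N ^ 2) sequentially"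
      using less.IH Suc by auto
    obtain C where C: "\<And>j. j \<le> k \<Longrightarrow> C j \<ge> 0 \<and> eventually (\<lambda>N. (\<integral>x. (m N x j - v N j) ^ 4 \<partial>M N) \<le> C j / real N ^ 2) sequentially"
      using bchoice[OF IH] by auto
    have "\<forall>j. \<exists>V. eventually (\<lambda>N. \<bar>v N j\<bar> \<le> V) sequentially" using v by (auto simp: approx_solution_def)
    then obtain V where V: "\<And>j. eventually (\<lambda>N. \<bar>v N j\<bar> \<le> V j) sequentially" by metis
    obtain w where w: "eventually (\<lambda>N. \<bar>loop_term (\<beta> N) a b N k (v N)\<bar> \<le> w / real N) sequentially"
      using v unfolding approx_solution_def by blast
    define Vm where "Vm = (\<Sum>j\<le>Suc k. \<bar>V j\<bar>)"
    have Vm: "\<bar>V j\<bar> \<le> Vm" if "j \<le> Suc k" for j unfolding Vm_def using that by (intro member_le_sum) auto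
    have Vm0: "Vm \<ge> 0" unfolding Vm_def by (intro sum_nonneg) auto
    define d where "d = drift_lim k / 2"
    have d: "d > 0" using drift_lim_pos[of k] by (simp add: d_def)
    \<comment> \<open>There are k + 3 absorbed terms: noise, residual and the k + 1 lower moments.
      Together they use up half of the drift d.\<close>
    define \<delta> where "\<delta> = d / (2 * (real k + 3))"
    have \<delta>: "\<delta> > 0" using d by (simp add: \<delta>_def)
    \<comment> \<open>Bounds the coefficient of each lower deviation: k + 1 + |a| from the linear
      part, and (c + 1) (2 + 2 Vm) from the convolutions.\<close>
    define B where "B = (real k + 1 + \<bar>a\<bar>) + (c + 1) * (2 + 2 * Vm)"
    have B0: "B \<ge> 0" using par Vm0 by (auto simp: B_def)
    define C1 where "C1 = (3 * (real k + 1)) ^ 2 / \<delta> + \<bar>w\<bar> ^ 4 / \<delta> ^ 3"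
    define C2 where "C2 = B ^ 4 / \<delta> ^ 3"
    have C12: "C1 \<ge> 0" "C2 \<ge> 0" using \<delta> by (auto simp: C1_def C2_def)
    define CC where "CC = (C1 + C2 * (\<Sum>j\<le>k. C j)) * 2 / d"
    have ev: "eventually (\<lambda>N. (\<forall>j\<in>{..k}. (\<integral>x. (m N x j - v N j) ^ 4 \<partial>M N) \<le> C j / real N ^ 2) \<and> (\<forall>j\<in>{..Suc k}. \<bar>v N j\<bar> \<le> V j)) sequentially"
      by (intro eventually_conj eventually_ball_finite) (use C V in auto)
    have "eventually (\<lambda>N. (\<integral>x. (m N x (Suc k) - v N (Suc k)) ^ 4 \<partial>M N) \<le> CC / real N ^ 2) sequentially"
      using ev w eventually_drift[of k] eventually_\<beta>
    proof eventually_elim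
      case (elim N)
      then have N: "N \<ge> 1" "real N \<ge> 1" and \<beta>N: "0 < \<beta> N" "\<beta> N \<le> 1" "0 \<le> \<beta> N * real N / 2" "\<beta> N * real N / 2 \<le> c + 1"
        and dr: "drift N k \<ge> d" and wN: "\<bar>loop_term (\<beta> N) a b N k (v N)\<bar> \<le> w / real N" and
        vN': "\<And>j. j \<le> Suc k \<Longrightarrow> \<bar>v N j\<bar> \<le> V j" and
        CN: "\<And>j. j \<le> k \<Longrightarrow> (\<integral>x. (m N x j - v N j) ^ 4 \<partial>M N) \<le> C j / real N ^ 2"
        by (auto simp: d_def)
      have vN: "\<bar>v N j\<bar> \<le> Vm" if "j \<le> Suc k" for j
        using vN'[OF that] Vm[OF that] by linarith
      have w0: "w \<ge> 0"
      proof -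
        have "0 \<le> w / real N" using wN by linarith
        then show ?thesis using N by (simp add: zero_le_divide_iff)
      qed
      define X where "X = (\<lambda>j x. m N x j - v N j)"
      have bX: "brv (M N) (X j)" for j unfolding X_def by (intro brv_intros brv_m N)
      define G where "G = (\<lambda>x. real (Suc k) * (m N x (Suc k + k) - m N x (Suc (Suc k + k))))"
      define W where "W = (\<lambda>x. loop_term (\<beta> N) a b N k (m N x))"
      \<comment> \<open>The integrand of the loop equation for f(z) = (z - v)^3. Its mean vanishes,
        so it can be added to the pointwise estimate before integration.\<close>
      define H where "H = (\<lambda>x. 3 * X (Suc k) x ^ 2 * G x + real N * (X (Suc k) x ^ 3 * W x))"
      have bH: "brv (M N) H" unfolding H_def G_def W_def by (intro brv_intros brv_m bX brv_loop_term N)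
      have EH: "integral\<^sup>L (M N) H = 0"
      proof -
        have "(\<integral>x. 3 * ((\<Sum>j\<in>{Suc k}. 1 * m N x j) - v N (Suc k)) ^ 2 * (\<Sum>j\<in>{Suc k}. 1 * (real j * (m N x (j + k) - m N x (Suc (j + k)))))
         + real N * (((\<Sum>j\<in>{Suc k}. 1 * m N x j) - v N (Suc k)) ^ 3 * loop_term (\<beta> N) a b N k (m N x)) \<partial>M N) = 0"
        proof (rule loop[where f = "\<lambda>z. (z - v N (Suc k)) ^ 3" and f' = "\<lambda>z. 3 * (z - v N (Suc k)) ^ 2" and f'' = "\<lambda>z. 6 * (z - v N (Suc k))" and t = "\<lambda>_. 1" and J = "{Suc k}"])
          show "continuous_on UNIV (\<lambda>z. 6 * (z - v N (Suc k)))" by (intro continuous_intros)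
        qed (use N in \<open>auto intro!: derivative_eq_intros\<close>)
        then show ?thesis unfolding H_def G_def W_def X_def by simp
      qed
      have G: "\<bar>G x\<bar> \<le> real k + 1" for x
      proof -
        have "\<bar>m N x (Suc k + k) - m N x (Suc (Suc k + k))\<bar> \<le> 1"
          using m_range[of N x "Suc k + k"] m_range[of N x "Suc (Suc k + k)"] by (simp only: abs_le_iff) linarith
        then have "real (Suc k) * \<bar>m N x (Suc k + k) - m N x (Suc (Suc k + k))\<bar> \<le> real (Suc k) * 1" by (intro mult_left_mono) auto
        then show ?thesis by (simp add: G_def abs_mult add.commute)
      qed
      have pw: "d / 2 * X (Suc k) x ^ 4 \<le> - (1 / real N) * H x + (C1 / real N ^ 2 + C2 * (\<Sum>j\<le>k. X j x ^ 4))" for x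
      proof -
        define y where "y = X (Suc k) x"
        define L where "L = ((1 - \<beta> N / 2) * real (Suc k) + a) * X k x + \<beta> N * real N / 2 * (\<Sum>l\<le>k. X l x * (m N x (k - l) + v N (k - l) - m N x (Suc k - l) - v N (Suc k - l)))"
        have Wx: "W x = loop_term (\<beta> N) a b N k (v N) - drift N k * y + L"
          using loop_term_diff[of "m N x" "v N" "\<beta> N" a b N k] v
          unfolding W_def L_def y_def X_def drift_def by (simp add: m_0 approx_solution_def algebra_simps)
        have L: "\<bar>L\<bar> \<le> (\<Sum>j\<le>k. B * \<bar>X j x\<bar>)"
        proof -
          have A: "\<bar>(1 - \<beta> N / 2) * real (Suc k) + a\<bar> \<le> real k + 1 + \<bar>a\<bar>"
          proof -
            have "\<bar>(1 - \<beta> N / 2) * real (Suc k)\<bar> \<le> 1 * real (Suc k)"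
              unfolding abs_mult using \<beta>N by (intro mult_mono) auto
            then show ?thesis by simp
          qed
          have e: "\<bar>m N x (k - l) + v N (k - l) - m N x (Suc k - l) - v N (Suc k - l)\<bar> \<le> 2 + 2 * Vm" for l
            using m_range[of N x "k - l"] m_range[of N x "Suc k - l"] vN[OF le_SucI[OF diff_le_self, of k l]] vN[OF diff_le_self, of l]
            by (simp add: abs_le_iff)
          have "\<bar>\<Sum>l\<le>k. X l x * (m N x (k - l) + v N (k - l) - m N x (Suc k - l) - v N (Suc k - l))\<bar>
            \<le> (\<Sum>l\<le>k. \<bar>X l x\<bar> * (2 + 2 * Vm))"
            by (rule order_trans[OF sum_abs]) (auto simp: abs_mult intro!: sum_mono mult_left_mono e)
          then have "\<bar>\<beta> N * real N / 2 * (\<Sum>l\<le>k. X l x * (m N x (k - l) + v N (k - l) - m N x (Suc k - l) - v N (Suc k - l)))\<bar>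
            \<le> (c + 1) * (\<Sum>l\<le>k. \<bar>X l x\<bar> * (2 + 2 * Vm))"
            unfolding abs_mult[of "\<beta> N * real N / 2"] using \<beta>N par by (intro mult_mono) auto
          moreover have "\<bar>((1 - \<beta> N / 2) * real (Suc k) + a) * X k x\<bar> \<le> (real k + 1 + \<bar>a\<bar>) * (\<Sum>l\<le>k. \<bar>X l x\<bar>)"
            unfolding abs_mult using A by (intro mult_mono) (auto intro: member_le_sum[of k "{..k}" "\<lambda>l. \<bar>X l x\<bar>"])
          ultimately have "\<bar>L\<bar> \<le> (real k + 1 + \<bar>a\<bar>) * (\<Sum>l\<le>k. \<bar>X l x\<bar>) + (c + 1) * (\<Sum>l\<le>k. \<bar>X l x\<bar> * (2 + 2 * Vm))"
            unfolding L_def by linarith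
          also have "\<dots> = (\<Sum>j\<le>k. B * \<bar>X j x\<bar>)"
            by (simp add: B_def sum_distrib_left sum_distrib_right sum.distrib[symmetric] algebra_simps)
          finally show ?thesis .
        qed
        have Hx: "(1 / real N) * H x = 3 * y ^ 2 * G x / real N + y ^ 3 * W x" using N by (simp add: H_def y_def field_simps)
        have t1: "\<bar>3 * y ^ 2 * G x / real N\<bar> \<le> \<delta> * y ^ 4 + (3 * (real k + 1)) ^ 2 / \<delta> / real N ^ 2"
        proof -
          have "\<bar>3 * y ^ 2 * G x / real N\<bar> \<le> 3 * y ^ 2 * (real k + 1) / real N"
            using G[of x] by (simp add: abs_mult divide_right_mono mult_left_mono)
          also have "\<dots> = (3 * (real k + 1) / real N) * y ^ 2" by simp
          also have "\<dots> \<le> \<delta> * y ^ 4 + (3 * (real k + 1) / real N) ^ 2 / \<delta>" by (rule young_quadratic[OF \<delta>]) auto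
          finally show ?thesis by (simp add: power_divide mult.commute)
        qed
        have t2: "\<bar>y ^ 3 * loop_term (\<beta> N) a b N k (v N)\<bar> \<le> \<delta> * y ^ 4 + \<bar>w\<bar> ^ 4 / \<delta> ^ 3 / real N ^ 2"
        proof -
          have "\<bar>y ^ 3 * loop_term (\<beta> N) a b N k (v N)\<bar> \<le> \<bar>y\<bar> ^ 3 * (w / real N)"
            unfolding abs_mult power_abs using wN by (intro mult_left_mono) auto
          also have "\<dots> = w * \<bar>1 / real N\<bar> * \<bar>y\<bar> ^ 3" by simp
          also have "\<dots> \<le> \<delta> * y ^ 4 + w ^ 4 / \<delta> ^ 3 * (1 / real N) ^ 4" by (rule young_cubic[OF \<delta> w0])
          also have "w ^ 4 / \<delta> ^ 3 * (1 / real N) ^ 4 \<le> w ^ 4 / \<delta> ^ 3 * (1 / real N ^ 2)"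
          proof (rule mult_left_mono)
            have "real N ^ 2 \<le> real N ^ 4" using N by (intro power_increasing) auto
            then show "(1 / real N) ^ 4 \<le> 1 / real N ^ 2" using N by (simp add: power_divide frac_le)
          qed (use \<delta> in simp)
          finally show ?thesis using w0 by simp
        qed
        have t3: "\<bar>y ^ 3 * L\<bar> \<le> (\<Sum>j\<le>k. \<delta> * y ^ 4 + C2 * X j x ^ 4)"
        proof -
          have "\<bar>y ^ 3 * L\<bar> \<le> \<bar>y\<bar> ^ 3 * (\<Sum>j\<le>k. B * \<bar>X j x\<bar>)"
            unfolding abs_mult power_abs using L by (intro mult_left_mono) auto
          also have "\<dots> = (\<Sum>j\<le>k. B * \<bar>X j x\<bar> * \<bar>y\<bar> ^ 3)" by (simp add: sum_distrib_left mult_ac)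
          also have "\<dots> \<le> (\<Sum>j\<le>k. \<delta> * y ^ 4 + C2 * X j x ^ 4)"
            unfolding C2_def by (intro sum_mono young_cubic \<delta> B0)
          finally show ?thesis .
        qed
        have t4: "d * y ^ 4 \<le> drift N k * y ^ 4" using dr by (intro mult_right_mono) auto
        have y4: "y ^ 3 * (drift N k * y) = drift N k * y ^ 4" by (simp add: power_numeral_reduce)
        have "d * y ^ 4 \<le> - (1 / real N) * H x + (\<bar>3 * y ^ 2 * G x / real N\<bar> + \<bar>y ^ 3 * loop_term (\<beta> N) a b N k (v N)\<bar> + \<bar>y ^ 3 * L\<bar>)"
        proof -
          have "- (1 / real N) * H x = - (3 * y ^ 2 * G x / real N) - y ^ 3 * loop_term (\<beta> N) a b N k (v N) + drift N k * y ^ 4 - y ^ 3 * L"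
            unfolding y4[symmetric] using Hx unfolding Wx by (simp add: algebra_simps)
          then show ?thesis using t4 by linarith
        qed
        also have "\<dots> \<le> - (1 / real N) * H x + ((\<delta> * y ^ 4 + (3 * (real k + 1)) ^ 2 / \<delta> / real N ^ 2) + (\<delta> * y ^ 4 + \<bar>w\<bar> ^ 4 / \<delta> ^ 3 / real N ^ 2)
            + (\<Sum>j\<le>k. \<delta> * y ^ 4 + C2 * X j x ^ 4))"
          by (intro add_mono t1 t2 t3 order_refl)
        also have "(\<Sum>j\<le>k. \<delta> * y ^ 4 + C2 * X j x ^ 4) = real (Suc k) * (\<delta> * y ^ 4) + C2 * (\<Sum>j\<le>k. X j x ^ 4)"
          by (simp add: sum.distrib sum_distrib_left)
        finally have A: "d * y ^ 4 \<le> - (1 / real N) * H x + (C1 / real N ^ 2 + C2 * (\<Sum>j\<le>k. X j x ^ 4)) + (real k + 3) * \<delta> * y ^ 4"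
          by (simp add: C1_def add_divide_distrib algebra_simps)
        have B: "(real k + 3) * \<delta> = d / 2" unfolding \<delta>_def by (simp add: field_simps)
        from A[unfolded B] show ?thesis unfolding y_def by (simp add: algebra_simps)
      qed
      have "(\<integral>x. d / 2 * X (Suc k) x ^ 4 \<partial>M N) \<le> (\<integral>x. - (1 / real N) * H x + (C1 / real N ^ 2 + C2 * (\<Sum>j\<le>k. X j x ^ 4)) \<partial>M N)"
        by (intro integral_mono_brv prob N brv_intros bX bH pw)
      also have "\<dots> = - (1 / real N) * integral\<^sup>L (M N) H + (C1 / real N ^ 2 + C2 * (\<Sum>j\<le>k. \<integral>x. X j x ^ 4 \<partial>M N))"
      proof -
        interpret prob_space "M N" by (rule prob[OF N(1)])
        have i: "integrable (M N) H" "integrable (M N) (\<lambda>x. X j x ^ 4)" for j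
          by (intro brv_integrable prob N bH, intro brv_integrable prob N brv_intros bX)
        show ?thesis using i by (simp add: prob_space)
      qed
      also have "\<dots> \<le> C1 / real N ^ 2 + C2 * (\<Sum>j\<le>k. C j / real N ^ 2)"
        unfolding EH using C12 CN by (auto intro!: mult_left_mono sum_mono simp: X_def)
      also have "\<dots> = (C1 + C2 * (\<Sum>j\<le>k. C j)) / real N ^ 2"
        by (simp add: add_divide_distrib sum_divide_distrib[symmetric])
      finally have "d / 2 * (\<integral>x. X (Suc k) x ^ 4 \<partial>M N) \<le> (C1 + C2 * (\<Sum>j\<le>k. C j)) / real N ^ 2" by simp
      then show ?case unfolding X_def CC_def using d N by (simp add: field_simps)
    qed
    moreover have "CC \<ge> 0" unfolding CC_def using C12 d C by (auto intro!: divide_nonneg_pos mult_nonneg_nonneg add_nonneg_nonneg sum_nonneg)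
    ultimately show ?thesis unfolding Suc by blast
  qed
qed

end

text \<open>W_k(v) = 0 solved for v_(k+1): the two end terms of the convolution of order k + 1 give
  2 v_(k+1) and move into the denominator, which leaves the sum over {1..k}.\<close>

function loop_solution :: "real \<Rightarrow> real \<Rightarrow> real \<Rightarrow> nat \<Rightarrow> nat \<Rightarrow> real" where
  "loop_solution \<beta> a b N 0 = 1"
| "loop_solution \<beta> a b N (Suc k) =
    (((1 - \<beta> / 2) * real (Suc k) + a) * loop_solution \<beta> a b N k
     + \<beta> * real N / 2 * ((\<Sum>l\<in>{..k}. loop_solution \<beta> a b N l * loop_solution \<beta> a b N (k - l))
        - (\<Sum>l\<in>{1..k}. loop_solution \<beta> a b N l * loop_solution \<beta> a b N (Suc k - l))))
    / ((1 - \<beta> / 2) * real (Suc (Suc k)) + a + b + \<beta> * real N)"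
  by pat_completeness auto
termination by (relation "Wellfounded.measure (\<lambda>(\<beta>, a, b, N, k). k)") auto

lemma moment_conv_Suc:
  assumes "v 0 = 1"
  shows "moment_conv v (Suc k) = 2 * v (Suc k) + (\<Sum>l\<in>{1..k}. v l * v (Suc k - l))"
proof -
  have "{..Suc k} = insert 0 (insert (Suc k) {1..k})" by auto
  then show ?thesis using assms by (simp add: moment_conv_def)
qed

lemma loop_term_loop_solution:
  assumes "(1 - \<beta> / 2) * real (Suc (Suc k)) + a + b + \<beta> * real N \<noteq> 0"
  shows "loop_term \<beta> a b N k (loop_solution \<beta> a b N) = 0"
proof -
  let ?v = "loop_solution \<beta> a b N" and ?D = "(1 - \<beta> / 2) * real (Suc (Suc k)) + a + b + \<beta> * real N"
  have "?D * ?v (Suc k) = ((1 - \<beta> / 2) * real (Suc k) + a) * ?v k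
     + \<beta> * real N / 2 * ((\<Sum>l\<in>{..k}. ?v l * ?v (k - l)) - (\<Sum>l\<in>{1..k}. ?v l * ?v (Suc k - l)))"
    using assms by simp
  moreover have "loop_term \<beta> a b N k ?v = ((1 - \<beta> / 2) * real (Suc k) + a) * ?v k
     + \<beta> * real N / 2 * ((\<Sum>l\<in>{..k}. ?v l * ?v (k - l)) - (\<Sum>l\<in>{1..k}. ?v l * ?v (Suc k - l))) - ?D * ?v (Suc k)"
    unfolding loop_term_def moment_conv_Suc[of ?v, OF loop_solution.simps(1)]
    by (simp add: moment_conv_def algebra_simps del: loop_solution.simps(2))
  ultimately show ?thesis by simp
qed

section \<open>Convergence of the recursive solutions to the limiting moments\<close>

context loop_model
begin

definition "u = mean_moment (c + a + 1) c (2 * c + a + b + 2)"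

lemma u_0: "u 0 = 1"
  unfolding u_def by (rule mean_moment_riccati(2)) (use par in auto)

text \<open>Here the two computations meet. With al = c + a + 1, de = c and ga = 2 c + a + b + 2 one
  has k + al - de = k + 1 + a and k + ga = \<open>drift_lim\<close> k, so the Riccati recursion is
  W_k(u) = 0 in the limit \<beta> \<rightarrow> 0, \<beta> N \<rightarrow> 2 c.\<close>

lemma u_riccati: "(real (Suc k) + a) * u k - drift_lim k * u (Suc k) + c * (moment_conv u k - (moment_conv u (Suc k) - 2 * u (Suc k))) = 0"
  using mean_moment_riccati(1)[of "c + a + 1" c "2 * c + a + b + 2" k] par
  by (simp add: u_def drift_lim_def algebra_simps)

lemma u_Suc: "u (Suc k) = ((real (Suc k) + a) * u k + c * ((\<Sum>l\<in>{..k}. u l * u (k - l)) - (\<Sum>l\<in>{1..k}. u l * u (Suc k - l)))) / drift_lim k"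
  using u_riccati[of k] drift_lim_pos[of k]
  unfolding moment_conv_Suc[of u, OF u_0] by (simp add: moment_conv_def field_simps)

definition "v N = loop_solution (\<beta> N) a b N"

lemma v_tendsto_u: "(\<lambda>N. v N k) \<longlonglongrightarrow> u k"
proof (induction k rule: less_induct)
  case (less k)
  show ?case
  proof (cases k)
    case 0
    then show ?thesis by (simp add: v_def u_0)
  next
    case (Suc j)
    have IH: "(\<lambda>N. v N i) \<longlonglongrightarrow> u i" if "i \<le> j" for i using less that Suc by auto
    have h: "(\<lambda>N. \<beta> N * real N / 2) \<longlonglongrightarrow> c" using tendsto_divide[OF \<beta>_lim tendsto_const[of 2]] by simp
    have s1: "(\<lambda>N. \<Sum>l\<in>{..j}. v N l * v N (j - l)) \<longlonglongrightarrow> (\<Sum>l\<in>{..j}. u l * u (j - l))"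
      by (intro tendsto_sum tendsto_mult IH) auto
    have s2: "(\<lambda>N. \<Sum>l\<in>{1..j}. v N l * v N (Suc j - l)) \<longlonglongrightarrow> (\<Sum>l\<in>{1..j}. u l * u (Suc j - l))"
      by (intro tendsto_sum tendsto_mult IH) auto
    have A: "(\<lambda>N. (1 - \<beta> N / 2) * real (Suc j) + a) \<longlonglongrightarrow> (1 - 0 / 2) * real (Suc j) + a"
      by (intro tendsto_intros \<beta>_tendsto_0) auto
    have "(\<lambda>N. (((1 - \<beta> N / 2) * real (Suc j) + a) * v N j + \<beta> N * real N / 2 * ((\<Sum>l\<in>{..j}. v N l * v N (j - l))
        - (\<Sum>l\<in>{1..j}. v N l * v N (Suc j - l)))) / drift N j) \<longlonglongrightarrow>
      (((1 - 0 / 2) * real (Suc j) + a) * u j + c * ((\<Sum>l\<in>{..j}. u l * u (j - l)) - (\<Sum>l\<in>{1..j}. u l * u (Suc j - l)))) / drift_lim j"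
      using drift_lim_pos[of j]
      by (intro tendsto_divide tendsto_add[OF tendsto_mult[OF A IH[OF order_refl]] tendsto_mult[OF h tendsto_diff[OF s1 s2]]] drift_tendsto) auto
    then show ?thesis unfolding Suc u_Suc v_def loop_solution.simps drift_def by simp
  qed
qed

lemma approx_solution_v: "approx_solution v"
  unfolding approx_solution_def
proof (intro conjI allI)
  fix N k
  show "v N 0 = 1" by (simp add: v_def)
  have "eventually (\<lambda>N. \<bar>v N k\<bar> < \<bar>u k\<bar> + 1) sequentially"
    by (rule order_tendstoD(2)[OF tendsto_rabs[OF v_tendsto_u]]) simp
  then show "\<exists>V. eventually (\<lambda>N. \<bar>v N k\<bar> \<le> V) sequentially"
    by (intro exI[of _ "\<bar>u k\<bar> + 1"]) (auto elim!: eventually_mono)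
  \<comment> \<open>For small N the denominator of the recursion might vanish; once the drift is
    positive the residual is exactly 0.\<close>
  have "eventually (\<lambda>N. \<bar>loop_term (\<beta> N) a b N k (v N)\<bar> \<le> 0 / real N) sequentially"
    using eventually_drift[of k]
  proof eventually_elim
    case (elim N)
    then have "drift N k \<noteq> 0" using drift_lim_pos[of k] by linarith
    then show ?case unfolding v_def drift_def by (subst loop_term_loop_solution) auto
  qed
  then show "\<exists>w. eventually (\<lambda>N. \<bar>loop_term (\<beta> N) a b N k (v N)\<bar> \<le> w / real N) sequentially" ..
qed

lemma fourth_moment_summable:
  "\<exists>N0\<ge>1. \<exists>C. \<forall>N\<ge>N0. (\<integral>x. (m N x k - v N k) ^ 4 \<partial>M N) \<le> C / real N ^ 2"
proof -
  obtain C where "eventually (\<lambda>N. (\<integral>x. (m N x k - v N k) ^ 4 \<partial>M N) \<le> C / real N ^ 2) sequentially"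
    using fourth_moment_bound[OF approx_solution_v] by blast
  then obtain N0 where "\<forall>N\<ge>N0. (\<integral>x. (m N x k - v N k) ^ 4 \<partial>M N) \<le> C / real N ^ 2"
    unfolding eventually_sequentially by blast
  then show ?thesis by (intro exI[of _ "max N0 1"]) auto
qed

end

section \<open>Approximate Stein equation for the fluctuations\<close>

text \<open>The partial derivative at u of the limiting W_k with respect to the moment of index l
  \<le> k.\<close>

definition lin_coeff :: "(nat \<Rightarrow> real) \<Rightarrow> real \<Rightarrow> real \<Rightarrow> nat \<Rightarrow> nat \<Rightarrow> real" where
  "lin_coeff u a c k l = 2 * c * (u (k - l) - u (Suc k - l)) + (if l = k then real (Suc k) + a else 0)"

text \<open>The Stein equation with the limiting coefficients, solved for the covariance with the
  top moment. The source j (u_(j+k) - u_(j+k+1)) is the limit of the derivative of m_j along the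
  flow. Symmetry in the two indices is not visible in this form.\<close>

fun cov_lim :: "(nat \<Rightarrow> real) \<Rightarrow> real \<Rightarrow> real \<Rightarrow> real \<Rightarrow> nat \<Rightarrow> nat \<Rightarrow> real" where
  "cov_lim u a b c j 0 = 0"
| "cov_lim u a b c j (Suc k) =
    ((\<Sum>l\<in>{..k}. lin_coeff u a c k l * cov_lim u a b c j l) + real j * (u (j + k) - u (Suc (j + k))))
      / (real (Suc (Suc k)) + a + b + 2 * c)"

text \<open>The convergence of \<beta> N to 2 c has no rate, and after multiplication by sqrt N its
  error could survive as a bias; hence the exact relation.\<close>

locale clt_model = loop_model +
  assumes \<beta>_eq: "\<And>N. N \<ge> 1 \<Longrightarrow> \<beta> N = 2 * c / real N"
begin

definition "y N x l = sqrt (real N) * (m N x l - u l)"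

text \<open>The limiting recursion cancels everything except the corrections by \<beta> / 2 = c /
  N.\<close>

lemma loop_term_u:
  assumes N: "N \<ge> 1"
  shows "loop_term (\<beta> N) a b N k u = - (c / real N) * (real (Suc k) * u k - real (Suc (Suc k)) * u (Suc k))"
proof -
  define h where "h = c / real N"
  have b: "\<beta> N / 2 = h" "\<beta> N * real N = 2 * c" using N by (auto simp: \<beta>_eq h_def)
  show ?thesis
    using u_riccati[of k] unfolding loop_term_def b drift_lim_def h_def[symmetric] by (simp add: algebra_simps)
qed

text \<open>W_k is quadratic, so its expansion at u is exact. In the variables y the quadratic part
  and the bias from \<open>loop_term_u\<close> both carry the factor c / sqrt N.\<close>

lemma loop_term_expansion:
  assumes N: "N \<ge> 1"
  shows "sqrt (real N) * loop_term (\<beta> N) a b N k (m N x) = - drift_lim k * y N x (Suc k) + (\<Sum>l\<le>k. lin_coeff u a c k l * y N x l)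
    + c / sqrt (real N) * ((\<Sum>l\<le>k. y N x l * (y N x (k - l) - y N x (Suc k - l))) + (real (Suc (Suc k)) * m N x (Suc k) - real (Suc k) * m N x k))"
proof -
  define S where "S = sqrt (real N)"
  have S: "S > 0" "S * S = real N" using N by (auto simp: S_def)
  have b: "\<beta> N / 2 = c / real N" "\<beta> N * real N = 2 * c" using N by (auto simp: \<beta>_eq)
  define X where "X = (\<lambda>l. m N x l - u l)"
  have yX: "y N x l = S * X l" for l by (simp add: y_def S_def X_def)
  note Wu = loop_term_u[OF N, of k]
  have sum_eq: "(\<Sum>l\<le>k. X l * (m N x (k - l) + u (k - l) - m N x (Suc k - l) - u (Suc k - l)))
    = (\<Sum>l\<le>k. X l * (2 * (u (k - l) - u (Suc k - l)))) + (\<Sum>l\<le>k. X l * (X (k - l) - X (Suc k - l)))"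
    unfolding sum.distrib[symmetric] by (intro sum.cong refl) (simp add: X_def algebra_simps)
  have lin: "(\<Sum>l\<le>k. lin_coeff u a c k l * X l) = c * (\<Sum>l\<le>k. X l * (2 * (u (k - l) - u (Suc k - l)))) + (real (Suc k) + a) * X k"
  proof -
    have "(\<Sum>l\<le>k. lin_coeff u a c k l * X l) = (\<Sum>l\<le>k. c * (X l * (2 * (u (k - l) - u (Suc k - l)))) + (if l = k then (real (Suc k) + a) * X k else 0))"
      by (intro sum.cong refl) (simp add: lin_coeff_def algebra_simps)
    then show ?thesis by (simp add: sum.distrib sum_distrib_left)
  qed
  have "loop_term (\<beta> N) a b N k (m N x) = loop_term (\<beta> N) a b N k u
    - ((1 - c / real N) * real (Suc (Suc k)) + a + b + 2 * c) * X (Suc k) + ((1 - c / real N) * real (Suc k) + a) * X k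
    + c * (\<Sum>l\<le>k. X l * (m N x (k - l) + u (k - l) - m N x (Suc k - l) - u (Suc k - l)))"
  proof -
    have gen: "A = B - P * z + q + r" if "A - B = - P * z + q + r" for A B P z q r :: real using that by simp
    have cc: "2 * c / 2 = c" by simp
    show ?thesis using loop_term_diff[of "m N x" u "\<beta> N" a b N k, OF m_0 u_0] unfolding b cc X_def by (rule gen)
  qed
  also have "\<dots> = - drift_lim k * X (Suc k) + (\<Sum>l\<le>k. lin_coeff u a c k l * X l)
    + c * (\<Sum>l\<le>k. X l * (X (k - l) - X (Suc k - l))) + c / real N * (real (Suc (Suc k)) * m N x (Suc k) - real (Suc k) * m N x k)"
    unfolding Wu sum_eq lin drift_lim_def by (simp add: X_def algebra_simps add_divide_distrib)
  finally have W: "loop_term (\<beta> N) a b N k (m N x) = - drift_lim k * X (Suc k) + (\<Sum>l\<le>k. lin_coeff u a c k l * X l)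
    + c * (\<Sum>l\<le>k. X l * (X (k - l) - X (Suc k - l))) + c / real N * (real (Suc (Suc k)) * m N x (Suc k) - real (Suc k) * m N x k)" .
  have q: "c / S * (\<Sum>l\<le>k. y N x l * (y N x (k - l) - y N x (Suc k - l))) = S * (c * (\<Sum>l\<le>k. X l * (X (k - l) - X (Suc k - l))))"
  proof -
    have "(\<Sum>l\<le>k. y N x l * (y N x (k - l) - y N x (Suc k - l))) = (S * S) * (\<Sum>l\<le>k. X l * (X (k - l) - X (Suc k - l)))"
      unfolding yX sum_distrib_left by (intro sum.cong refl) (simp add: algebra_simps)
    then show ?thesis using S(1) by simp
  qed
  have r: "S * (c / real N * z) = c / S * z" for z using S(1) by (simp add: S(2)[symmetric])
  have l: "(\<Sum>l\<le>k. lin_coeff u a c k l * y N x l) = S * (\<Sum>l\<le>k. lin_coeff u a c k l * X l)"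
    unfolding yX sum_distrib_left by (intro sum.cong refl) simp
  show ?thesis unfolding S_def[symmetric] W distrib_left[of "c / S"] q l yX[of "Suc k"] distrib_left[of S] r by simp
qed

lemma approx_solution_u: "approx_solution (\<lambda>N. u)"
  unfolding approx_solution_def
proof (intro conjI allI)
  fix k
  show "u 0 = 1" by (rule u_0)
  show "\<exists>V. eventually (\<lambda>N. \<bar>u k\<bar> \<le> V) sequentially" by (intro exI[of _ "\<bar>u k\<bar>"]) simp
  have "eventually (\<lambda>N. \<bar>loop_term (\<beta> N) a b N k u\<bar> \<le> (c * \<bar>real (Suc k) * u k - real (Suc (Suc k)) * u (Suc k)\<bar>) / real N) sequentially"
    using eventually_ge_at_top[of "1::nat"]
  proof eventually_elim
    case (elim N)
    show ?case unfolding loop_term_u[OF elim] using par by (simp add: abs_mult)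
  qed
  then show "\<exists>w. eventually (\<lambda>N. \<bar>loop_term (\<beta> N) a b N k u\<bar> \<le> w / real N) sequentially" by blast
qed

lemma brv_y: "N \<ge> 1 \<Longrightarrow> brv (M N) (\<lambda>x. y N x l)"
  unfolding y_def by (intro brv_intros brv_m)

text \<open>One variable with bounded mean that dominates all products of at most three of the y_0,
  ..., y_n: linear growth of a test function times the quadratic error produces no more than
  three.\<close>

definition "Z n N x = 1 + (\<Sum>l\<le>n. y N x l ^ 4)"

lemma brv_Z: "N \<ge> 1 \<Longrightarrow> brv (M N) (Z n N)"
  unfolding Z_def[abs_def] by (intro brv_intros brv_y)

lemma Z_bounds:
  assumes "i \<le> n" "j \<le> n" "l \<le> n"
  shows "1 \<le> Z n N x" "\<bar>y N x i\<bar> \<le> Z n N x" "\<bar>y N x i\<bar> * \<bar>y N x j\<bar> \<le> Z n N x" "\<bar>y N x i\<bar> * \<bar>y N x j\<bar> * \<bar>y N x l\<bar> \<le> Z n N x"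
proof -
  \<comment> \<open>Including 1 in the maximum makes s, s^2 and s^3 at most s^4.\<close>
  define s where "s = max 1 (max \<bar>y N x i\<bar> (max \<bar>y N x j\<bar> \<bar>y N x l\<bar>))"
  have s: "s \<ge> 1" "\<bar>y N x i\<bar> \<le> s" "\<bar>y N x j\<bar> \<le> s" "\<bar>y N x l\<bar> \<le> s" by (simp_all add: s_def le_max_iff_disj)
  have mem: "y N x r ^ 4 \<le> (\<Sum>l\<le>n. y N x l ^ 4)" if "r \<le> n" for r
    using that by (intro member_le_sum) auto
  have nn: "0 \<le> (\<Sum>l\<le>n. y N x l ^ 4)" by (intro sum_nonneg) auto
  then show "1 \<le> Z n N x" by (simp add: Z_def)
  have "s = 1 \<or> s = \<bar>y N x i\<bar> \<or> s = \<bar>y N x j\<bar> \<or> s = \<bar>y N x l\<bar>" unfolding s_def max_def by auto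
  then have "s ^ 4 \<le> Z n N x"
    using nn mem[OF assms(1)] mem[OF assms(2)] mem[OF assms(3)] by (auto simp: Z_def)
  moreover have "s ^ 1 \<le> s ^ 4" "s ^ 2 \<le> s ^ 4" "s ^ 3 \<le> s ^ 4" using s(1) by (intro power_increasing; simp)+
  ultimately have sZ: "s \<le> Z n N x" "s * s \<le> Z n N x" "s * s * s \<le> Z n N x"
    by (simp_all add: power_numeral_reduce)
  show "\<bar>y N x i\<bar> \<le> Z n N x" using s sZ by linarith
  have "\<bar>y N x i\<bar> * \<bar>y N x j\<bar> \<le> s * s" using s by (intro mult_mono) auto
  then show "\<bar>y N x i\<bar> * \<bar>y N x j\<bar> \<le> Z n N x" using sZ by linarith
  have "\<bar>y N x i\<bar> * \<bar>y N x j\<bar> * \<bar>y N x l\<bar> \<le> s * s * s" using s by (intro mult_mono) auto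
  then show "\<bar>y N x i\<bar> * \<bar>y N x j\<bar> * \<bar>y N x l\<bar> \<le> Z n N x" using sZ by linarith
qed

lemma mean_Z_bound: "\<exists>C\<ge>0. eventually (\<lambda>N. integral\<^sup>L (M N) (Z n N) \<le> C) sequentially"
proof -
  have "\<forall>k. \<exists>C\<ge>0. eventually (\<lambda>N. (\<integral>x. (m N x k - u k) ^ 4 \<partial>M N) \<le> C / real N ^ 2) sequentially"
    using fourth_moment_bound[OF approx_solution_u] by blast
  from choice[OF this] obtain C where C0: "\<forall>k. C k \<ge> 0 \<and> eventually (\<lambda>N. (\<integral>x. (m N x k - u k) ^ 4 \<partial>M N) \<le> C k / real N ^ 2) sequentially" ..
  have C: "\<And>k. C k \<ge> 0" "\<And>k. eventually (\<lambda>N. (\<integral>x. (m N x k - u k) ^ 4 \<partial>M N) \<le> C k / real N ^ 2) sequentially"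
    using C0 by blast+
  have "eventually (\<lambda>N. \<forall>k\<in>{..n}. (\<integral>x. (m N x k - u k) ^ 4 \<partial>M N) \<le> C k / real N ^ 2) sequentially"
    by (intro eventually_ball_finite) (auto simp: C)
  then have "eventually (\<lambda>N. integral\<^sup>L (M N) (Z n N) \<le> 1 + (\<Sum>k\<le>n. C k)) sequentially"
    using eventually_ge_at_top[of "1::nat"]
  proof eventually_elim
    case (elim N)
    interpret prob_space "M N" by (rule prob[OF elim(2)])
    have i: "integrable (M N) (\<lambda>x. y N x l ^ 4)" for l by (intro brv_integrable prob elim brv_intros brv_y)
    have e: "(\<integral>x. y N x l ^ 4 \<partial>M N) \<le> C l" if "l \<le> n" for l
    proof -
      have "y N x l ^ 4 = real N ^ 2 * (m N x l - u l) ^ 4" for x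
      proof -
        have "z ^ 4 = (z ^ 2) ^ 2" for z :: real by (simp add: power2_eq_square power4_eq_xxxx mult.assoc)
        from this[of "sqrt (real N)"] have "sqrt (real N) ^ 4 = real N ^ 2" by simp
        then show ?thesis by (simp add: y_def power_mult_distrib)
      qed
      then have "(\<integral>x. y N x l ^ 4 \<partial>M N) = real N ^ 2 * (\<integral>x. (m N x l - u l) ^ 4 \<partial>M N)" by simp
      also have "\<dots> \<le> real N ^ 2 * (C l / real N ^ 2)" using elim that by (intro mult_left_mono) auto
      finally show ?thesis using elim by simp
    qed
    have "integral\<^sup>L (M N) (Z n N) = 1 + (\<Sum>l\<le>n. \<integral>x. y N x l ^ 4 \<partial>M N)"
      unfolding Z_def[abs_def] using i by (simp add: prob_space)
    also have "\<dots> \<le> 1 + (\<Sum>k\<le>n. C k)" by (intro add_left_mono sum_mono e) auto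
    finally show ?case .
  qed
  moreover have "0 \<le> 1 + (\<Sum>k\<le>n. C k)" using C(1) by (intro add_nonneg_nonneg sum_nonneg) auto
  ultimately show ?thesis by blast
qed

definition "cov j l = cov_lim u a b c j l"

text \<open>Linear growth admits f(z) = z, which gives the covariances, besides the trigonometric
  functions. The constant K is tracked so that error bounds are uniform over whole families of test
  functions.\<close>

definition smooth_test :: "real \<Rightarrow> (real \<Rightarrow> real) \<Rightarrow> (real \<Rightarrow> real) \<Rightarrow> bool" where
  "smooth_test K f f' \<longleftrightarrow> (\<forall>z. (f has_real_derivative f' z) (at z)) \<and>
     (\<exists>f''. (\<forall>z. (f' has_real_derivative f'' z) (at z)) \<and> continuous_on UNIV f'') \<and>
     (\<forall>z. \<bar>f z\<bar> \<le> K * (1 + \<bar>z\<bar>)) \<and> (\<forall>z. \<bar>f' z\<bar> \<le> K)"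

lemma smooth_test_continuous: "smooth_test K f f' \<Longrightarrow> continuous_on UNIV f" "smooth_test K f f' \<Longrightarrow> continuous_on UNIV f'"
  unfolding smooth_test_def by (auto intro: DERIV_continuous_on)

text \<open>The loop equation for f(sqrt N (z - s)), where s is the same combination of the limiting
  moments. The chain rule gives a factor sqrt N, and dividing by it turns N W_k into sqrt N
  W_k.\<close>

lemma stein_loop:
  fixes t :: "nat \<Rightarrow> real"
  assumes N: "N \<ge> 1" and f: "smooth_test K f f'" and J: "finite J"
  shows "(\<integral>x. f' (\<Sum>j\<in>J. t j * y N x j) * (\<Sum>j\<in>J. t j * (real j * (m N x (j + k) - m N x (Suc (j + k)))))
    + f (\<Sum>j\<in>J. t j * y N x j) * (sqrt (real N) * loop_term (\<beta> N) a b N k (m N x)) \<partial>M N) = 0"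
proof -
  define S where "S = sqrt (real N)"
  have S: "S > 0" "S * S = real N" using N by (auto simp: S_def)
  define s where "s = (\<Sum>j\<in>J. t j * u j)"
  from f obtain f'' where f'': "\<And>z. (f has_real_derivative f' z) (at z)" "\<And>z. (f' has_real_derivative f'' z) (at z)" "continuous_on UNIV f''"
    by (auto simp: smooth_test_def)
  have Y: "S * ((\<Sum>j\<in>J. t j * m N x j) - s) = (\<Sum>j\<in>J. t j * y N x j)" for x
    unfolding s_def sum_subtractf[symmetric] sum_distrib_left by (intro sum.cong refl) (simp add: y_def S_def algebra_simps)
  have "(\<integral>x. (f' (S * ((\<Sum>j\<in>J. t j * m N x j) - s)) * S) * (\<Sum>j\<in>J. t j * (real j * (m N x (j + k) - m N x (Suc (j + k)))))
    + real N * (f (S * ((\<Sum>j\<in>J. t j * m N x j) - s)) * loop_term (\<beta> N) a b N k (m N x)) \<partial>M N) = 0"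
  proof (rule loop[OF N, where f = "\<lambda>z. f (S * (z - s))" and f' = "\<lambda>z. f' (S * (z - s)) * S" and f'' = "\<lambda>z. f'' (S * (z - s)) * S * S", OF _ _ _ J])
    fix z
    have d: "((\<lambda>z. S * (z - s)) has_real_derivative S) (at z)" by (auto intro!: derivative_eq_intros)
    show "((\<lambda>z. f (S * (z - s))) has_real_derivative f' (S * (z - s)) * S) (at z)" by (rule DERIV_chain2[OF f''(1) d])
    show "((\<lambda>z. f' (S * (z - s)) * S) has_real_derivative f'' (S * (z - s)) * S * S) (at z)"
      by (rule DERIV_cmult_right[OF DERIV_chain2[OF f''(2) d]])
  next
    have "continuous_on UNIV (\<lambda>z. f'' (S * (z - s)))"
      by (rule continuous_on_compose2[OF f''(3)]) (auto intro!: continuous_intros)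
    then show "continuous_on UNIV (\<lambda>z. f'' (S * (z - s)) * S * S)" by (intro continuous_intros)
  qed
  then have "(\<integral>x. S * (f' (\<Sum>j\<in>J. t j * y N x j) * (\<Sum>j\<in>J. t j * (real j * (m N x (j + k) - m N x (Suc (j + k)))))
    + f (\<Sum>j\<in>J. t j * y N x j) * (S * loop_term (\<beta> N) a b N k (m N x))) \<partial>M N) = 0"
    unfolding Y S(2)[symmetric] by (simp add: algebra_simps)
  then show ?thesis using S(1) by (simp add: S_def)
qed

text \<open>Gaussian integration by parts with error O(1 / sqrt N). The loop equation at k expresses
  y_(k+1) through lower coordinates, hence the induction. The test function is quantified inside
  \<open>eventually\<close>: at a fixed N the bound will be applied to all rescalings of one
  function.\<close>

lemma stein_approximation:
  fixes t :: "nat \<Rightarrow> real"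
  assumes J: "finite J"
  shows "\<exists>C\<ge>0. eventually (\<lambda>N. \<forall>K f f'. smooth_test K f f' \<longrightarrow>
    \<bar>(\<integral>x. y N x l * f (\<Sum>j\<in>J. t j * y N x j) \<partial>M N) - (\<Sum>j\<in>J. t j * cov j l) * (\<integral>x. f' (\<Sum>j\<in>J. t j * y N x j) \<partial>M N)\<bar>
      \<le> C * K / sqrt (real N)) sequentially"
proof (induction l rule: less_induct)
  case (less l)
  show ?case
  proof (cases l)
    case 0
    have K0: "0 \<le> K" if "smooth_test K f f'" for K f f'
    proof -
      have "\<bar>f' 0\<bar> \<le> K" using that unfolding smooth_test_def by blast
      then show ?thesis by linarith
    qed
    \<comment> \<open>Both zeroth moments are 1, so this coordinate does not fluctuate and its
      covariances vanish.\<close>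
    have "y N x 0 = 0" for N x by (simp add: y_def m_0 u_0)
    then show ?thesis using K0 0 by (intro exI[of _ 0]) (simp add: cov_def)
  next
    case (Suc k)
    have "\<forall>i\<in>{..k}. \<exists>C. C \<ge> 0 \<and> eventually (\<lambda>N. \<forall>K f f'. smooth_test K f f' \<longrightarrow>
      \<bar>(\<integral>x. y N x i * f (\<Sum>j\<in>J. t j * y N x j) \<partial>M N) - (\<Sum>j\<in>J. t j * cov j i) * (\<integral>x. f' (\<Sum>j\<in>J. t j * y N x j) \<partial>M N)\<bar>
      \<le> C * K / sqrt (real N)) sequentially"
      using less.IH Suc by auto
    from bchoice[OF this] obtain C where C0: "\<forall>i\<in>{..k}. C i \<ge> 0 \<and> eventually (\<lambda>N. \<forall>K f f'. smooth_test K f f' \<longrightarrow>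
      \<bar>(\<integral>x. y N x i * f (\<Sum>j\<in>J. t j * y N x j) \<partial>M N) - (\<Sum>j\<in>J. t j * cov j i) * (\<integral>x. f' (\<Sum>j\<in>J. t j * y N x j) \<partial>M N)\<bar>
      \<le> C i * K / sqrt (real N)) sequentially" ..
    have C: "\<And>i. i \<le> k \<Longrightarrow> C i \<ge> 0" using C0 by auto
    \<comment> \<open>Large enough for \<open>Z\<close> to dominate every coordinate that occurs, up
      to index j + k + 1 with j in J.\<close>
    define n where "n = Suc (k + (\<Sum>j\<in>J. j))"
    have nJ: "j + k \<le> n" "Suc (j + k) \<le> n" "j \<le> n" if "j \<in> J" for j
      using member_le_sum[of j J "\<lambda>j. j"] that J by (auto simp: n_def)
    obtain CZ where CZ: "CZ \<ge> 0" "eventually (\<lambda>N. integral\<^sup>L (M N) (Z n N) \<le> CZ) sequentially"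
      using mean_Z_bound by blast
    define D where "D = drift_lim k"
    have D: "D > 0" using drift_lim_pos by (simp add: D_def)
    define T where "T = (\<Sum>j\<in>J. \<bar>t j\<bar>)"
    have T: "T \<ge> 0" unfolding T_def by (intro sum_nonneg) auto
    \<comment> \<open>The factor 1 + T stems from the growth of f. The 2 (k + 1) quadratic products
      and the bias, bounded by 2 k + 3, add up to 4 k + 5.\<close>
    define C1 where "C1 = c * (1 + T) * real (4 * k + 5)"
    define C2 where "C2 = (\<Sum>j\<in>J. \<bar>t j\<bar> * (real j * 2))"
    have C12: "C1 \<ge> 0" "C2 \<ge> 0" using par T unfolding C1_def C2_def by (auto intro!: sum_nonneg)
    define CC where "CC = ((\<Sum>i\<le>k. \<bar>lin_coeff u a c k i\<bar> * C i) + (C1 + C2) * CZ) / D"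
    have CC: "CC \<ge> 0" unfolding CC_def using C C12 CZ D by (auto intro!: divide_nonneg_pos add_nonneg_nonneg sum_nonneg mult_nonneg_nonneg)
    define g where "g = (\<Sum>j\<in>J. t j * (real j * (u (j + k) - u (Suc (j + k)))))"
    define sg where "sg = (\<lambda>i. \<Sum>j\<in>J. t j * cov j i)"
    \<comment> \<open>The recursion \<open>cov_lim\<close> averaged with the weights t; it matches
      the main terms of the loop equation.\<close>
    have sg: "D * sg (Suc k) = (\<Sum>i\<le>k. lin_coeff u a c k i * sg i) + g"
    proof -
      have "D * cov j (Suc k) = (\<Sum>i\<le>k. lin_coeff u a c k i * cov j i) + real j * (u (j + k) - u (Suc (j + k)))" for j
        using D unfolding cov_def D_def drift_lim_def by simp
      then have "D * sg (Suc k) = (\<Sum>j\<in>J. t j * ((\<Sum>i\<le>k. lin_coeff u a c k i * cov j i) + real j * (u (j + k) - u (Suc (j + k)))))"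
        unfolding sg_def sum_distrib_left by (intro sum.cong refl) (simp add: mult.left_commute[of D])
      also have "\<dots> = (\<Sum>j\<in>J. \<Sum>i\<le>k. lin_coeff u a c k i * (t j * cov j i)) + g"
        unfolding g_def by (simp add: distrib_left sum.distrib sum_distrib_left mult_ac)
      also have "(\<Sum>j\<in>J. \<Sum>i\<le>k. lin_coeff u a c k i * (t j * cov j i)) = (\<Sum>i\<le>k. lin_coeff u a c k i * sg i)"
        unfolding sg_def sum_distrib_left by (rule sum.swap)
      finally show ?thesis .
    qed
    have "eventually (\<lambda>N. \<forall>i\<in>{..k}. \<forall>K f f'. smooth_test K f f' \<longrightarrow>
      \<bar>(\<integral>x. y N x i * f (\<Sum>j\<in>J. t j * y N x j) \<partial>M N) - sg i * (\<integral>x. f' (\<Sum>j\<in>J. t j * y N x j) \<partial>M N)\<bar>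
      \<le> C i * K / sqrt (real N)) sequentially"
      unfolding sg_def by (rule eventually_ball_finite) (use C0 in auto)
    then have "eventually (\<lambda>N. \<forall>K f f'. smooth_test K f f' \<longrightarrow>
      \<bar>(\<integral>x. y N x (Suc k) * f (\<Sum>j\<in>J. t j * y N x j) \<partial>M N) - sg (Suc k) * (\<integral>x. f' (\<Sum>j\<in>J. t j * y N x j) \<partial>M N)\<bar>
      \<le> CC * K / sqrt (real N)) sequentially"
      using CZ(2) eventually_ge_at_top[of "1::nat"]
    proof eventually_elim
      case (elim N)
      then have N: "N \<ge> 1" and IH: "\<And>i K f f'. i \<le> k \<Longrightarrow> smooth_test K f f' \<Longrightarrow>
        \<bar>(\<integral>x. y N x i * f (\<Sum>j\<in>J. t j * y N x j) \<partial>M N) - sg i * (\<integral>x. f' (\<Sum>j\<in>J. t j * y N x j) \<partial>M N)\<bar> \<le> C i * K / sqrt (real N)"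
        and EZ: "integral\<^sup>L (M N) (Z n N) \<le> CZ" by auto
      interpret prob_space "M N" by (rule prob[OF N])
      define S where "S = sqrt (real N)"
      have S: "S > 0" using N by (simp add: S_def)
      define Y where "Y = (\<lambda>x. \<Sum>j\<in>J. t j * y N x j)"
      have bY: "brv (M N) Y" unfolding Y_def by (intro brv_intros brv_y N)
      define R where "R = (\<lambda>x. c / S * ((\<Sum>l\<le>k. y N x l * (y N x (k - l) - y N x (Suc k - l))) + (real (Suc (Suc k)) * m N x (Suc k) - real (Suc k) * m N x k)))"
      have bR: "brv (M N) R" unfolding R_def by (intro brv_intros brv_y brv_m N)
      define G where "G = (\<lambda>x. \<Sum>j\<in>J. t j * (real j * (m N x (j + k) - m N x (Suc (j + k)))))"
      have bG: "brv (M N) G" unfolding G_def by (intro brv_intros brv_m N)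
      show ?case
      proof (intro allI impI)
        fix K f f' assume f: "smooth_test K f f'"
        have fK: "\<And>z. \<bar>f z\<bar> \<le> K * (1 + \<bar>z\<bar>)" "\<And>z. \<bar>f' z\<bar> \<le> K" using f by (auto simp: smooth_test_def)
        have K: "K \<ge> 0" using fK(2)[of 0] by linarith
        have bf: "brv (M N) (\<lambda>x. f (Y x))" "brv (M N) (\<lambda>x. f' (Y x))"
          using smooth_test_continuous[OF f] bY by (auto intro: brv_continuous)
        define Ef' where "Ef' = (\<integral>x. f' (Y x) \<partial>M N)"
        define A where "A = (\<lambda>i. \<integral>x. y N x i * f (Y x) \<partial>M N)"
        have iA: "integrable (M N) (\<lambda>x. y N x i * f (Y x))" for i by (intro brv_integrable prob N brv_intros brv_y bf)
        have iR: "integrable (M N) (\<lambda>x. f (Y x) * R x)" by (intro brv_integrable prob N brv_intros bR bf)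
        have iG: "integrable (M N) (\<lambda>x. f' (Y x) * (G x - g))" by (intro brv_integrable prob N brv_intros bG bf)
        have if': "integrable (M N) (\<lambda>x. f' (Y x))" by (intro brv_integrable prob N bf)
        have "0 = (\<integral>x. f' (Y x) * G x + f (Y x) * (S * loop_term (\<beta> N) a b N k (m N x)) \<partial>M N)"
          using stein_loop[OF N f J, of t k] unfolding Y_def G_def S_def by simp
        \<comment> \<open>The first summand, with G - g, and the last one, with R, are errors of
          order 1 / sqrt N; the rest is the limiting linear relation.\<close>
        also have "\<dots> = (\<integral>x. (f' (Y x) * (G x - g) + g * f' (Y x)) + ((- D * (y N x (Suc k) * f (Y x)) + (\<Sum>i\<le>k. lin_coeff u a c k i * (y N x i * f (Y x)))) + f (Y x) * R x) \<partial>M N)"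
        proof (rule Bochner_Integration.integral_cong[OF refl])
          fix x
          have "f (Y x) * (\<Sum>i\<le>k. lin_coeff u a c k i * y N x i) = (\<Sum>i\<le>k. lin_coeff u a c k i * (y N x i * f (Y x)))"
            by (simp add: sum_distrib_left mult_ac)
          then show "f' (Y x) * G x + f (Y x) * (S * loop_term (\<beta> N) a b N k (m N x)) =
            (f' (Y x) * (G x - g) + g * f' (Y x)) + ((- D * (y N x (Suc k) * f (Y x)) + (\<Sum>i\<le>k. lin_coeff u a c k i * (y N x i * f (Y x)))) + f (Y x) * R x)"
            unfolding S_def loop_term_expansion[OF N] R_def D_def by (simp add: algebra_simps)
        qed
        also have "\<dots> = ((\<integral>x. f' (Y x) * (G x - g) \<partial>M N) + g * Ef') + ((- D * A (Suc k) + (\<Sum>i\<le>k. lin_coeff u a c k i * A i)) + (\<integral>x. f (Y x) * R x \<partial>M N))"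
          unfolding Ef'_def A_def using iA iR iG if' by simp
        finally have main: "D * A (Suc k) = (\<integral>x. f' (Y x) * (G x - g) \<partial>M N) + g * Ef' + (\<Sum>i\<le>k. lin_coeff u a c k i * A i) + (\<integral>x. f (Y x) * R x \<partial>M N)"
          by simp
        have Z1: "1 \<le> Z n N x" for x using Z_bounds(1)[of 0 n 0 0] by simp
        have pR: "\<bar>f (Y x) * R x\<bar> \<le> K / S * C1 * Z n N x" for x
        proof -
          define q where "q = 1 + (\<Sum>j\<in>J. \<bar>t j\<bar> * \<bar>y N x j\<bar>)"
          have "\<bar>Y x\<bar> \<le> (\<Sum>j\<in>J. \<bar>t j\<bar> * \<bar>y N x j\<bar>)" unfolding Y_def abs_mult[symmetric] by (rule sum_abs)
          then have fq: "\<bar>f (Y x)\<bar> \<le> K * q" using fK(1)[of "Y x"] K unfolding q_def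
            by (smt (verit, best) mult_left_mono)
          have q0: "q \<ge> 0" unfolding q_def by (intro add_nonneg_nonneg sum_nonneg) auto
          have qz: "q * z \<le> (1 + T) * Z n N x" if z: "z \<le> Z n N x" and zy: "\<And>j. j \<in> J \<Longrightarrow> \<bar>y N x j\<bar> * z \<le> Z n N x" for z
          proof -
            have "q * z = z + (\<Sum>j\<in>J. \<bar>t j\<bar> * (\<bar>y N x j\<bar> * z))" by (simp add: q_def algebra_simps sum_distrib_left)
            also have "\<dots> \<le> Z n N x + (\<Sum>j\<in>J. \<bar>t j\<bar> * Z n N x)" by (intro add_mono z sum_mono mult_left_mono zy) auto
            also have "\<dots> = (1 + T) * Z n N x" by (simp add: T_def sum_distrib_right algebra_simps)
            finally show ?thesis .
          qed
          have kn: "l \<le> n" if "l \<le> Suc k" for l using that by (simp add: n_def)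
          have qyy: "q * (\<bar>y N x i\<bar> * \<bar>y N x j\<bar>) \<le> (1 + T) * Z n N x" if "i \<le> Suc k" "j \<le> Suc k" for i j
          proof (rule qz)
            show "\<bar>y N x i\<bar> * \<bar>y N x j\<bar> \<le> Z n N x" using kn that by (intro Z_bounds(3)) auto
            show "\<bar>y N x r\<bar> * (\<bar>y N x i\<bar> * \<bar>y N x j\<bar>) \<le> Z n N x" if "r \<in> J" for r
              unfolding mult.assoc[symmetric] using kn \<open>i \<le> Suc k\<close> \<open>j \<le> Suc k\<close> nJ(3)[OF that] by (intro Z_bounds(4)) auto
          qed
          have q1: "q * 1 \<le> (1 + T) * Z n N x"
            by (rule qz) (use Z1 Z_bounds(2)[OF nJ(3) nJ(3) nJ(3)] in auto)
          have R1: "\<bar>R x\<bar> \<le> c / S * ((\<Sum>l\<le>k. \<bar>y N x l\<bar> * \<bar>y N x (k - l)\<bar> + \<bar>y N x l\<bar> * \<bar>y N x (Suc k - l)\<bar>) + real (2 * k + 3) * 1)"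
          proof -
            have e: "real (Suc (Suc k)) * 1 + real (Suc k) * 1 = real (2 * k + 3) * 1" by simp
            have M1: "\<bar>real (Suc (Suc k)) * m N x (Suc k) - real (Suc k) * m N x k\<bar> \<le> real (2 * k + 3) * 1"
              unfolding e[symmetric]
              using m_range[of N x] by (intro order_trans[OF abs_triangle_ineq4] add_mono) (auto simp: abs_mult)
            have S1: "\<bar>\<Sum>l\<le>k. y N x l * (y N x (k - l) - y N x (Suc k - l))\<bar> \<le> (\<Sum>l\<le>k. \<bar>y N x l\<bar> * \<bar>y N x (k - l)\<bar> + \<bar>y N x l\<bar> * \<bar>y N x (Suc k - l)\<bar>)"
              by (rule order_trans[OF sum_abs]) (auto simp: abs_mult distrib_left[symmetric] intro!: sum_mono mult_left_mono abs_triangle_ineq4)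
            have "\<bar>(\<Sum>l\<le>k. y N x l * (y N x (k - l) - y N x (Suc k - l))) + (real (Suc (Suc k)) * m N x (Suc k) - real (Suc k) * m N x k)\<bar>
              \<le> (\<Sum>l\<le>k. \<bar>y N x l\<bar> * \<bar>y N x (k - l)\<bar> + \<bar>y N x l\<bar> * \<bar>y N x (Suc k - l)\<bar>) + real (2 * k + 3) * 1"
              by (rule order_trans[OF abs_triangle_ineq add_mono[OF S1 M1]])
            then show ?thesis unfolding R_def abs_mult using par S by (intro mult_mono) auto
          qed
          have "\<bar>f (Y x) * R x\<bar> \<le> K * q * (c / S * ((\<Sum>l\<le>k. \<bar>y N x l\<bar> * \<bar>y N x (k - l)\<bar> + \<bar>y N x l\<bar> * \<bar>y N x (Suc k - l)\<bar>) + real (2 * k + 3) * 1))"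
            unfolding abs_mult using fq R1 K q0 by (intro mult_mono) auto
          also have "\<dots> = K * c / S * ((\<Sum>l\<le>k. q * (\<bar>y N x l\<bar> * \<bar>y N x (k - l)\<bar>) + q * (\<bar>y N x l\<bar> * \<bar>y N x (Suc k - l)\<bar>)) + real (2 * k + 3) * (q * 1))"
          proof -
            have qs: "q * (\<Sum>l\<le>k. \<bar>y N x l\<bar> * \<bar>y N x (k - l)\<bar> + \<bar>y N x l\<bar> * \<bar>y N x (Suc k - l)\<bar>) = (\<Sum>l\<le>k. q * (\<bar>y N x l\<bar> * \<bar>y N x (k - l)\<bar>) + q * (\<bar>y N x l\<bar> * \<bar>y N x (Suc k - l)\<bar>))"
              unfolding sum_distrib_left distrib_left ..
            show ?thesis unfolding qs[symmetric] by (simp add: algebra_simps)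
          qed
          also have "\<dots> \<le> K * c / S * ((\<Sum>l\<le>k. (1 + T) * Z n N x + (1 + T) * Z n N x) + real (2 * k + 3) * ((1 + T) * Z n N x))"
            using K par S by (intro mult_left_mono add_mono sum_mono qyy q1) auto
          also have "\<dots> = K / S * C1 * Z n N x" by (simp add: C1_def algebra_simps)
          finally show ?thesis .
        qed
        have pG: "\<bar>f' (Y x) * (G x - g)\<bar> \<le> K / S * C2 * Z n N x" for x
        proof -
          have dm: "\<bar>m N x i - u i\<bar> \<le> Z n N x / S" if "i \<le> n" for i
          proof -
            have "S * \<bar>m N x i - u i\<bar> \<le> Z n N x" using Z_bounds(2)[OF that that that, of N x] S by (simp add: y_def S_def abs_mult)
            then show ?thesis using S by (simp add: field_simps)
          qed
          have Gg: "G x - g = (\<Sum>j\<in>J. t j * (real j * ((m N x (j + k) - u (j + k)) - (m N x (Suc (j + k)) - u (Suc (j + k))))))"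
            unfolding G_def g_def sum_subtractf[symmetric] by (intro sum.cong refl) (simp add: algebra_simps)
          have "\<bar>G x - g\<bar> \<le> (\<Sum>j\<in>J. \<bar>t j\<bar> * (real j * (Z n N x / S + Z n N x / S)))"
            unfolding Gg
          proof (rule order_trans[OF sum_abs], rule sum_mono)
            fix j assume j: "j \<in> J"
            have "\<bar>(m N x (j + k) - u (j + k)) - (m N x (Suc (j + k)) - u (Suc (j + k)))\<bar> \<le> Z n N x / S + Z n N x / S"
              by (rule order_trans[OF abs_triangle_ineq4 add_mono[OF dm dm]]) (use nJ j in auto)
            then show "\<bar>t j * (real j * ((m N x (j + k) - u (j + k)) - (m N x (Suc (j + k)) - u (Suc (j + k)))))\<bar> \<le> \<bar>t j\<bar> * (real j * (Z n N x / S + Z n N x / S))"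
              unfolding abs_mult abs_of_nat by (intro mult_left_mono) auto
          qed
          also have "\<dots> = C2 * (Z n N x / S)" unfolding C2_def sum_distrib_right by (intro sum.cong refl) simp
          finally have "\<bar>G x - g\<bar> \<le> C2 * (Z n N x / S)" .
          then have "\<bar>f' (Y x) * (G x - g)\<bar> \<le> K * (C2 * (Z n N x / S))" unfolding abs_mult using fK(2) K by (intro mult_mono) auto
          then show ?thesis by simp
        qed
        have EKZ: "\<bar>\<integral>x. h x \<partial>M N\<bar> \<le> K / S * Cc * CZ" if bh: "brv (M N) h" and h: "\<And>x. \<bar>h x\<bar> \<le> K / S * Cc * Z n N x" and Cc: "Cc \<ge> 0" for h Cc
        proof -
          have "\<bar>\<integral>x. h x \<partial>M N\<bar> \<le> (\<integral>x. \<bar>h x\<bar> \<partial>M N)" by (rule integral_abs_bound)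
          also have "\<dots> \<le> (\<integral>x. K / S * Cc * Z n N x \<partial>M N)" by (intro integral_mono_brv prob N brv_intros bh h brv_Z)
          also have "\<dots> = K / S * Cc * integral\<^sup>L (M N) (Z n N)" by simp
          also have "\<dots> \<le> K / S * Cc * CZ" using EZ K S Cc by (intro mult_left_mono) auto
          finally show ?thesis .
        qed
        have eR: "\<bar>\<integral>x. f (Y x) * R x \<partial>M N\<bar> \<le> K / S * C1 * CZ" by (rule EKZ[OF _ pR C12(1)]) (intro brv_intros bf bR)
        have eG: "\<bar>\<integral>x. f' (Y x) * (G x - g) \<partial>M N\<bar> \<le> K / S * C2 * CZ" by (rule EKZ[OF _ pG C12(2)]) (intro brv_intros bf bG)
        have eA: "\<bar>(\<Sum>i\<le>k. lin_coeff u a c k i * A i) - (\<Sum>i\<le>k. lin_coeff u a c k i * sg i) * Ef'\<bar> \<le> (\<Sum>i\<le>k. \<bar>lin_coeff u a c k i\<bar> * C i) * (K / S)"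
        proof -
          have eq: "(\<Sum>i\<le>k. lin_coeff u a c k i * A i) - (\<Sum>i\<le>k. lin_coeff u a c k i * sg i) * Ef' = (\<Sum>i\<le>k. lin_coeff u a c k i * (A i - sg i * Ef'))"
            by (simp add: sum_distrib_right right_diff_distrib sum_subtractf mult.assoc)
          have "\<bar>(\<Sum>i\<le>k. lin_coeff u a c k i * A i) - (\<Sum>i\<le>k. lin_coeff u a c k i * sg i) * Ef'\<bar> \<le> (\<Sum>i\<le>k. \<bar>lin_coeff u a c k i\<bar> * (C i * (K / S)))"
            unfolding eq
          proof (rule order_trans[OF sum_abs], rule sum_mono)
            fix i assume "i \<in> {..k}"
            then have "\<bar>A i - sg i * Ef'\<bar> \<le> C i * (K / S)" using IH[OF _ f, of i] unfolding A_def Ef'_def Y_def S_def by simp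
            then show "\<bar>lin_coeff u a c k i * (A i - sg i * Ef')\<bar> \<le> \<bar>lin_coeff u a c k i\<bar> * (C i * (K / S))"
              unfolding abs_mult by (intro mult_left_mono) auto
          qed
          also have "\<dots> = (\<Sum>i\<le>k. \<bar>lin_coeff u a c k i\<bar> * C i) * (K / S)" unfolding sum_distrib_right by (simp add: mult.assoc)
          finally show ?thesis .
        qed
        have "D * (A (Suc k) - sg (Suc k) * Ef') = (\<integral>x. f' (Y x) * (G x - g) \<partial>M N) + (\<integral>x. f (Y x) * R x \<partial>M N)
          + ((\<Sum>i\<le>k. lin_coeff u a c k i * A i) - (\<Sum>i\<le>k. lin_coeff u a c k i * sg i) * Ef')"
        proof -
          have "D * (A (Suc k) - sg (Suc k) * Ef') = D * A (Suc k) - (D * sg (Suc k)) * Ef'" by (simp add: algebra_simps)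
          then show ?thesis unfolding main sg by (simp add: algebra_simps)
        qed
        then have "\<bar>D * (A (Suc k) - sg (Suc k) * Ef')\<bar> \<le> K / S * C2 * CZ + K / S * C1 * CZ + (\<Sum>i\<le>k. \<bar>lin_coeff u a c k i\<bar> * C i) * (K / S)"
          using eR eG eA by linarith
        also have "\<dots> = D * (CC * K / S)" unfolding CC_def using D S by (simp add: field_simps)
        finally have "D * \<bar>A (Suc k) - sg (Suc k) * Ef'\<bar> \<le> D * (CC * K / S)" using D by (simp add: abs_mult)
        then have "\<bar>A (Suc k) - sg (Suc k) * Ef'\<bar> \<le> CC * K / S" by (rule mult_left_le_imp_le[OF _ D])
        then show "\<bar>(\<integral>x. y N x (Suc k) * f (\<Sum>j\<in>J. t j * y N x j) \<partial>M N) - sg (Suc k) * (\<integral>x. f' (\<Sum>j\<in>J. t j * y N x j) \<partial>M N)\<bar>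
          \<le> CC * K / sqrt (real N)" unfolding A_def Ef'_def Y_def S_def .
      qed
    qed
    then show ?thesis using CC unfolding Suc sg_def by blast
  qed
qed

end

section \<open>Gaussian limit of characteristic functions\<close>

lemma DERIV_of_quadratic_remainder:
  fixes F :: "real \<Rightarrow> real"
  assumes "\<And>h. \<bar>F (s + h) - F s - h * d\<bar> \<le> C * h ^ 2"
  shows "(F has_real_derivative d) (at s)"
proof -
  have "(\<lambda>h. (F (s + h) - F s) / h - d) \<midarrow>0\<rightarrow> 0"
  proof (rule Lim_null_comparison)
    show "eventually (\<lambda>h. norm ((F (s + h) - F s) / h - d) \<le> C * \<bar>h\<bar>) (at 0)"
    proof (rule eventually_at_filter[THEN iffD2], intro always_eventually allI impI)
      fix h :: real assume h: "h \<noteq> 0"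
      have "norm ((F (s + h) - F s) / h - d) = \<bar>F (s + h) - F s - h * d\<bar> / \<bar>h\<bar>"
        using h by (simp add: abs_divide[symmetric] diff_divide_distrib)
      also have "\<dots> \<le> C * h ^ 2 / \<bar>h\<bar>" using assms by (intro divide_right_mono) auto
      also have "\<dots> = C * \<bar>h\<bar>" using h by (simp add: power2_eq_square abs_if)
      finally show "norm ((F (s + h) - F s) / h - d) \<le> C * \<bar>h\<bar>" .
    qed
    have "((\<lambda>h::real. C * \<bar>h\<bar>) \<longlongrightarrow> C * \<bar>0\<bar>) (at 0)" by (intro tendsto_intros)
    then show "((\<lambda>h::real. C * \<bar>h\<bar>) \<longlongrightarrow> 0) (at 0)" by simp
  qed
  then show ?thesis unfolding DERIV_def by (simp add: LIM_zero_iff)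
qed

lemma inverse_sqrt_tendsto: "(\<lambda>N. 1 / sqrt (real N)) \<longlonglongrightarrow> 0"
  using tendsto_real_sqrt[OF lim_1_over_n] by (simp add: real_sqrt_divide)

context clt_model
begin

definition "quad_form J t = (\<Sum>l\<in>J. \<Sum>j\<in>J. t l * t j * cov j l)"

text \<open>The Stein estimate for f = 1, whose derivative vanishes.\<close>

lemma mean_y_tendsto_0: "(\<lambda>N. \<integral>x. y N x l \<partial>M N) \<longlonglongrightarrow> 0"
proof -
  have st: "smooth_test 1 (\<lambda>_. 1) (\<lambda>_. 0)"
    unfolding smooth_test_def by (auto intro!: exI[of _ "\<lambda>_. 0"])
  obtain C where "eventually (\<lambda>N. \<forall>K f f'. smooth_test K f f' \<longrightarrow>
    \<bar>(\<integral>x. y N x l * f (\<Sum>j\<in>{}. 0 * y N x j) \<partial>M N) - (\<Sum>j\<in>{}. 0 * cov j l) * (\<integral>x. f' (\<Sum>j\<in>{}. 0 * y N x j) \<partial>M N)\<bar>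
      \<le> C * K / sqrt (real N)) sequentially"
    using stein_approximation[of "{}" l "\<lambda>_. 0"] by auto
  then have "eventually (\<lambda>N. norm (\<integral>x. y N x l \<partial>M N) \<le> C * (1 / sqrt (real N))) sequentially"
    by (rule eventually_mono) (use st in force)
  moreover have "(\<lambda>N. C * (1 / sqrt (real N))) \<longlonglongrightarrow> 0"
    by (intro tendsto_mult_right_zero inverse_sqrt_tendsto)
  ultimately show ?thesis by (rule Lim_null_comparison)
qed

text \<open>The Stein estimate for f(z) = z applied to the single coordinate y_j.\<close>

lemma second_moment_tendsto: "(\<lambda>N. \<integral>x. y N x l * y N x j \<partial>M N) \<longlonglongrightarrow> cov j l"
proof -
  have st: "smooth_test 1 (\<lambda>z. z) (\<lambda>_. 1)"
    unfolding smooth_test_def by (auto intro!: exI[of _ "\<lambda>_. 0"] derivative_eq_intros)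
  obtain C where "eventually (\<lambda>N. \<forall>K f f'. smooth_test K f f' \<longrightarrow>
    \<bar>(\<integral>x. y N x l * f (\<Sum>j\<in>{j}. 1 * y N x j) \<partial>M N) - (\<Sum>j\<in>{j}. 1 * cov j l) * (\<integral>x. f' (\<Sum>j\<in>{j}. 1 * y N x j) \<partial>M N)\<bar>
      \<le> C * K / sqrt (real N)) sequentially"
    using stein_approximation[of "{j}" l "\<lambda>_. 1"] by auto
  then have "eventually (\<lambda>N. norm ((\<integral>x. y N x l * y N x j \<partial>M N) - cov j l) \<le> C * (1 / sqrt (real N))) sequentially"
    using eventually_ge_at_top[of "1::nat"]
  proof eventually_elim
    case (elim N)
    interpret prob_space "M N" by (rule prob[OF elim(2)])
    show ?case using elim(1)[rule_format, OF st] by (simp add: prob_space)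
  qed
  moreover have "(\<lambda>N. C * (1 / sqrt (real N))) \<longlonglongrightarrow> 0"
    by (intro tendsto_mult_right_zero inverse_sqrt_tendsto)
  ultimately have "(\<lambda>N. (\<integral>x. y N x l * y N x j \<partial>M N) - cov j l) \<longlonglongrightarrow> 0" by (rule Lim_null_comparison)
  then show ?thesis by (simp add: LIM_zero_iff)
qed

text \<open>The recursion treats its two indices differently; symmetry comes from the second
  moments, whose limits these numbers are.\<close>

lemma cov_commute: "cov j l = cov l j"
  using second_moment_tendsto[of l j] second_moment_tendsto[of j l] by (auto simp: mult.commute intro: LIMSEQ_unique)

text \<open>Centring at u instead of at the mean changes N times the covariance by the product of
  the means of y_k and y_l, which tends to 0.\<close>

lemma covariance_tendsto: "(\<lambda>N. real N * covar (M N) (\<lambda>x. m N x k) (\<lambda>x. m N x l)) \<longlonglongrightarrow> cov k l"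
proof -
  have "(\<lambda>N. (\<integral>x. y N x l * y N x k \<partial>M N) - (\<integral>x. y N x k \<partial>M N) * (\<integral>x. y N x l \<partial>M N)) \<longlonglongrightarrow> cov k l - 0 * 0"
    by (intro tendsto_diff tendsto_mult second_moment_tendsto mean_y_tendsto_0)
  moreover have "eventually (\<lambda>N. (\<integral>x. y N x l * y N x k \<partial>M N) - (\<integral>x. y N x k \<partial>M N) * (\<integral>x. y N x l \<partial>M N)
    = real N * covar (M N) (\<lambda>x. m N x k) (\<lambda>x. m N x l)) sequentially"
    using eventually_ge_at_top[of "1::nat"]
  proof eventually_elim
    case (elim N)
    interpret prob_space "M N" by (rule prob[OF elim])
    define S where "S = sqrt (real N)"
    have S: "S * S = real N" by (simp add: S_def)
    have i: "integrable (M N) (\<lambda>x. m N x i)" "integrable (M N) (\<lambda>x. m N x i * m N x j)" for i j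
      by (intro brv_integrable prob elim brv_m, intro brv_integrable prob elim brv_intros brv_m)
    have e1: "(\<integral>x. y N x i \<partial>M N) = S * (expectation (\<lambda>x. m N x i) - u i)" for i
      unfolding y_def S_def using i by (simp add: prob_space)
    have e2: "(\<integral>x. y N x l * y N x k \<partial>M N) = real N * (expectation (\<lambda>x. m N x k * m N x l) - u l * expectation (\<lambda>x. m N x k) - u k * expectation (\<lambda>x. m N x l) + u k * u l)"
    proof -
      have "(\<integral>x. y N x l * y N x k \<partial>M N) = (\<integral>x. real N * (m N x k * m N x l - u l * m N x k - u k * m N x l + u k * u l) \<partial>M N)"
        unfolding y_def S_def[symmetric] S[symmetric] by (intro Bochner_Integration.integral_cong refl) (simp add: algebra_simps)
      then show ?thesis using i by (simp add: prob_space)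
    qed
    have e3: "covar (M N) (\<lambda>x. m N x k) (\<lambda>x. m N x l) = expectation (\<lambda>x. m N x k * m N x l) - expectation (\<lambda>x. m N x k) * expectation (\<lambda>x. m N x l)"
    proof -
      define A where "A = expectation (\<lambda>x. m N x k)"
      define B where "B = expectation (\<lambda>x. m N x l)"
      have "covar (M N) (\<lambda>x. m N x k) (\<lambda>x. m N x l) = (\<integral>x. m N x k * m N x l - B * m N x k - A * m N x l + A * B \<partial>M N)"
        unfolding covar_def A_def[symmetric] B_def[symmetric] by (intro Bochner_Integration.integral_cong refl) (simp add: algebra_simps)
      then show ?thesis using i by (simp add: prob_space A_def[symmetric] B_def[symmetric])
    qed
    show ?case unfolding e1 e2 e3 S[symmetric] by (simp add: algebra_simps)
  qed
  ultimately show ?thesis by (simp add: tendsto_cong)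
qed

lemma quad_form_tendsto:
  assumes J: "finite J"
  shows "(\<lambda>N. \<integral>x. (\<Sum>j\<in>J. t j * y N x j) ^ 2 \<partial>M N) \<longlonglongrightarrow> quad_form J t"
proof -
  have "(\<lambda>N. \<Sum>l\<in>J. \<Sum>j\<in>J. t l * t j * (\<integral>x. y N x l * y N x j \<partial>M N)) \<longlonglongrightarrow> quad_form J t"
    unfolding quad_form_def by (intro tendsto_sum tendsto_mult tendsto_const second_moment_tendsto)
  moreover have "eventually (\<lambda>N. (\<Sum>l\<in>J. \<Sum>j\<in>J. t l * t j * (\<integral>x. y N x l * y N x j \<partial>M N)) = (\<integral>x. (\<Sum>j\<in>J. t j * y N x j) ^ 2 \<partial>M N)) sequentially"
    using eventually_ge_at_top[of "1::nat"]
  proof eventually_elim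
    case (elim N)
    have i: "integrable (M N) (\<lambda>x. t l * t j * (y N x l * y N x j))" for l j
      by (intro brv_integrable prob elim brv_intros brv_y)
    have "(\<integral>x. (\<Sum>j\<in>J. t j * y N x j) ^ 2 \<partial>M N) = (\<integral>x. (\<Sum>l\<in>J. \<Sum>j\<in>J. t l * t j * (y N x l * y N x j)) \<partial>M N)"
      by (intro Bochner_Integration.integral_cong refl) (simp add: power2_eq_square sum_product mult_ac)
    also have "\<dots> = (\<Sum>l\<in>J. \<integral>x. (\<Sum>j\<in>J. t l * t j * (y N x l * y N x j)) \<partial>M N)"
      by (rule Bochner_Integration.integral_sum) (intro Bochner_Integration.integrable_sum i)
    also have "\<dots> = (\<Sum>l\<in>J. \<Sum>j\<in>J. \<integral>x. t l * t j * (y N x l * y N x j) \<partial>M N)"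
      by (intro sum.cong refl Bochner_Integration.integral_sum i)
    finally show ?case by simp
  qed
  ultimately show ?thesis by (simp add: tendsto_cong)
qed

lemma quad_form_nonneg:
  assumes "finite J" shows "0 \<le> quad_form J t"
proof (rule tendsto_lowerbound[OF quad_form_tendsto[OF assms]])
  show "\<forall>\<^sub>F N in sequentially. 0 \<le> (\<integral>x. (\<Sum>j\<in>J. t j * y N x j) ^ 2 \<partial>M N)" by (intro always_eventually) simp
qed simp

text \<open>With \<open>F(s) = E f(s Y)\<close> and \<open>G(s) = E (Y f'(s Y)) = F'(s)\<close> the Stein equation says \<open>G(s) \<approx> - s V F(s)\<close> both for
  \<open>f = cos\<close> and \<open>f = sin\<close>, so \<open>F(s) exp(s\<^sup>2 V / 2)\<close> is almost constant.\<close>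

lemma trig_expectation_tendsto:
  fixes t :: "nat \<Rightarrow> real" and f f' :: "real \<Rightarrow> real"
  assumes J: "finite J"
    and f: "\<And>z. (f has_real_derivative f' z) (at z)" "\<And>z. (f' has_real_derivative - f z) (at z)"
    and b: "\<And>z. \<bar>f z\<bar> \<le> 1" "\<And>z. \<bar>f' z\<bar> \<le> 1"
  shows "(\<lambda>N. \<integral>x. f (\<Sum>j\<in>J. t j * y N x j) \<partial>M N) \<longlonglongrightarrow> f 0 * exp (- quad_form J t / 2)"
proof -
  define V where "V = quad_form J t"
  have V: "V \<ge> 0" using quad_form_nonneg[OF J] by (simp add: V_def)
  have cf: "continuous_on UNIV f" "continuous_on UNIV f'"
    using DERIV_continuous_on[of UNIV f f'] DERIV_continuous_on[of UNIV f' "\<lambda>z. - f z"] f by auto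
  have "\<forall>l. \<exists>C\<ge>0. eventually (\<lambda>N. \<forall>K g g'. smooth_test K g g' \<longrightarrow>
    \<bar>(\<integral>x. y N x l * g (\<Sum>j\<in>J. t j * y N x j) \<partial>M N) - (\<Sum>j\<in>J. t j * cov j l) * (\<integral>x. g' (\<Sum>j\<in>J. t j * y N x j) \<partial>M N)\<bar>
      \<le> C * K / sqrt (real N)) sequentially"
    by (intro allI stein_approximation[OF J])
  from choice[OF this] obtain C where C0: "\<forall>l. C l \<ge> 0 \<and> eventually (\<lambda>N. \<forall>K g g'. smooth_test K g g' \<longrightarrow>
    \<bar>(\<integral>x. y N x l * g (\<Sum>j\<in>J. t j * y N x j) \<partial>M N) - (\<Sum>j\<in>J. t j * cov j l) * (\<integral>x. g' (\<Sum>j\<in>J. t j * y N x j) \<partial>M N)\<bar>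
      \<le> C l * K / sqrt (real N)) sequentially" ..
  define CC where "CC = (\<Sum>l\<in>J. \<bar>t l\<bar> * C l)"
  have CC: "CC \<ge> 0" unfolding CC_def using C0 by (intro sum_nonneg mult_nonneg_nonneg) auto
  have "eventually (\<lambda>N. \<forall>l\<in>J. \<forall>K g g'. smooth_test K g g' \<longrightarrow>
    \<bar>(\<integral>x. y N x l * g (\<Sum>j\<in>J. t j * y N x j) \<partial>M N) - (\<Sum>j\<in>J. t j * cov j l) * (\<integral>x. g' (\<Sum>j\<in>J. t j * y N x j) \<partial>M N)\<bar>
      \<le> C l * K / sqrt (real N)) sequentially"
    by (rule eventually_ball_finite[OF J]) (use C0 in auto)
  then have "eventually (\<lambda>N. norm ((\<integral>x. f (\<Sum>j\<in>J. t j * y N x j) \<partial>M N) - f 0 * exp (- V / 2)) \<le> (2 * CC * exp (V / 2)) * (1 / sqrt (real N))) sequentially"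
    using eventually_ge_at_top[of "1::nat"]
  proof eventually_elim
    case (elim N)
    then have N: "N \<ge> 1" and st: "\<And>l K g g'. l \<in> J \<Longrightarrow> smooth_test K g g' \<Longrightarrow>
      \<bar>(\<integral>x. y N x l * g (\<Sum>j\<in>J. t j * y N x j) \<partial>M N) - (\<Sum>j\<in>J. t j * cov j l) * (\<integral>x. g' (\<Sum>j\<in>J. t j * y N x j) \<partial>M N)\<bar>
      \<le> C l * K / sqrt (real N)" by blast+
    interpret prob_space "M N" by (rule prob[OF N])
    define Y where "Y = (\<lambda>x. \<Sum>j\<in>J. t j * y N x j)"
    have bY: "brv (M N) Y" unfolding Y_def by (intro brv_intros brv_y N)
    have bc: "brv (M N) (\<lambda>x. g (s * Y x))" if "continuous_on UNIV g" for g :: "real \<Rightarrow> real" and s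
      by (rule brv_continuous[OF that]) (intro brv_intros bY)
    define F where "F = (\<lambda>s. \<integral>x. f (s * Y x) \<partial>M N)"
    define G where "G = (\<lambda>s. \<integral>x. Y x * f' (s * Y x) \<partial>M N)"
    have iF: "integrable (M N) (\<lambda>x. f (s * Y x))" and iG: "integrable (M N) (\<lambda>x. Y x * f' (s * Y x))" for s
      by (intro brv_integrable prob N bc cf, intro brv_integrable prob N brv_mult bY bc cf)
    have iY2: "integrable (M N) (\<lambda>x. Y x ^ 2)" by (intro brv_integrable prob N brv_power bY)
    have lip: "\<bar>f' z - f' w\<bar> \<le> 1 * \<bar>z - w\<bar>" for z w
    proof -
      have "norm (f' z - f' w) \<le> 1 * norm (z - w)"
        by (rule field_differentiable_bound[of UNIV f' "\<lambda>z. - f z"]) (use f b in auto)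
      then show ?thesis by simp
    qed
    have dF: "(F has_real_derivative G s) (at s)" for s
    proof (rule DERIV_of_quadratic_remainder)
      fix h :: real
      have pw: "\<bar>f ((s + h) * Y x) - f (s * Y x) - h * (Y x * f' (s * Y x))\<bar> \<le> h ^ 2 * Y x ^ 2" for x
      proof -
        have "\<bar>f ((s + h) * Y x) - f (s * Y x) - f' (s * Y x) * ((s + h) * Y x - s * Y x)\<bar> \<le> 1 * ((s + h) * Y x - s * Y x) ^ 2"
          by (rule taylor_remainder[where r = "\<bar>(s + h) * Y x - s * Y x\<bar>"]) (use f lip in auto)
        then show ?thesis by (simp add: algebra_simps power_mult_distrib)
      qed
      have "F (s + h) - F s - h * G s = (\<integral>x. f ((s + h) * Y x) - f (s * Y x) - h * (Y x * f' (s * Y x)) \<partial>M N)"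
        unfolding F_def G_def using iF iG by simp
      moreover have "\<bar>\<integral>x. f ((s + h) * Y x) - f (s * Y x) - h * (Y x * f' (s * Y x)) \<partial>M N\<bar> \<le> (\<integral>x. h ^ 2 * Y x ^ 2 \<partial>M N)"
        by (rule order_trans[OF integral_abs_bound], rule integral_mono) (use iF iG iY2 pw in auto)
      ultimately have "\<bar>F (s + h) - F s - h * G s\<bar> \<le> (\<integral>x. h ^ 2 * Y x ^ 2 \<partial>M N)" by simp
      then show "\<bar>F (s + h) - F s - h * G s\<bar> \<le> (\<integral>x. Y x ^ 2 \<partial>M N) * h ^ 2" by (simp add: mult.commute)
    qed
    have GF: "\<bar>G s + s * V * F s\<bar> \<le> CC * (1 + \<bar>s\<bar>) / sqrt (real N)" for s
    proof -
      \<comment> \<open>The derivative of z \<mapsto> f'(s z) is - s f(s z), which brings F back.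
        The constant 1 + |s| bounds both functions and is at most 2 on the interval [0, 1] used
        below.\<close>
      have sm: "smooth_test (1 + \<bar>s\<bar>) (\<lambda>z. f' (s * z)) (\<lambda>z. - f (s * z) * s)"
        unfolding smooth_test_def
      proof (intro conjI allI exI[of _ "\<lambda>z. - (f' (s * z) * s) * s"])
        fix z
        have d: "((\<lambda>z. s * z) has_real_derivative s) (at z)" by (auto intro!: derivative_eq_intros)
        show "((\<lambda>z. f' (s * z)) has_real_derivative - f (s * z) * s) (at z)" by (rule DERIV_chain2[OF f(2) d])
        show "((\<lambda>z. - f (s * z) * s) has_real_derivative - (f' (s * z) * s) * s) (at z)"
          by (rule DERIV_cmult_right[OF DERIV_minus[OF DERIV_chain2[OF f(1) d]]])
        have "1 * 1 \<le> (1 + \<bar>s\<bar>) * (1 + \<bar>z\<bar>)" by (intro mult_mono) auto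
        then show "\<bar>f' (s * z)\<bar> \<le> (1 + \<bar>s\<bar>) * (1 + \<bar>z\<bar>)" using b(2)[of "s * z"] by linarith
        have "\<bar>f (s * z)\<bar> * \<bar>s\<bar> \<le> 1 * \<bar>s\<bar>" using b by (intro mult_right_mono) auto
        then show "\<bar>- f (s * z) * s\<bar> \<le> 1 + \<bar>s\<bar>" by (simp add: abs_mult)
      next
        have "continuous_on UNIV (\<lambda>z. f' (s * z))" by (rule continuous_on_compose2[OF cf(2)]) (auto intro!: continuous_intros)
        then show "continuous_on UNIV (\<lambda>z. - (f' (s * z) * s) * s)" by (intro continuous_intros)
      qed
      have iy: "integrable (M N) (\<lambda>x. y N x l * f' (s * Y x))" for l by (intro brv_integrable prob N brv_mult brv_y bc cf)
      have e1: "G s = (\<Sum>l\<in>J. t l * (\<integral>x. y N x l * f' (s * Y x) \<partial>M N))"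
      proof -
        have "G s = (\<integral>x. (\<Sum>l\<in>J. t l * (y N x l * f' (s * Y x))) \<partial>M N)"
          unfolding G_def by (intro Bochner_Integration.integral_cong refl) (simp add: Y_def[of] sum_distrib_right mult.assoc)
        then show ?thesis using iy by simp
      qed
      have e2: "s * V * F s = - (\<Sum>l\<in>J. t l * ((\<Sum>j\<in>J. t j * cov j l) * (\<integral>x. - f (s * Y x) * s \<partial>M N)))"
      proof -
        have eI: "(\<integral>x. - f (s * Y x) * s \<partial>M N) = - (s * F s)" unfolding F_def using iF by simp
        show ?thesis unfolding V_def quad_form_def eI by (simp add: sum_distrib_left sum_distrib_right sum_negf mult_ac)
      qed
      have "G s + s * V * F s = (\<Sum>l\<in>J. t l * ((\<integral>x. y N x l * f' (s * Y x) \<partial>M N) - (\<Sum>j\<in>J. t j * cov j l) * (\<integral>x. - f (s * Y x) * s \<partial>M N)))"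
        unfolding e1 e2 by (simp only: sum_subtractf right_diff_distrib add_uminus_conv_diff)
      then have "\<bar>G s + s * V * F s\<bar> \<le> (\<Sum>l\<in>J. \<bar>t l * ((\<integral>x. y N x l * f' (s * Y x) \<partial>M N) - (\<Sum>j\<in>J. t j * cov j l) * (\<integral>x. - f (s * Y x) * s \<partial>M N))\<bar>)"
        by (simp only: sum_abs)
      also have "\<dots> \<le> (\<Sum>l\<in>J. \<bar>t l\<bar> * (C l * (1 + \<bar>s\<bar>) / sqrt (real N)))"
        unfolding abs_mult[of "t _"] using st[OF _ sm] by (intro sum_mono mult_left_mono) (auto simp: Y_def)
      also have "\<dots> = CC * (1 + \<bar>s\<bar>) / sqrt (real N)" unfolding CC_def sum_distrib_right sum_divide_distrib by (simp add: mult.assoc)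
      finally show ?thesis .
    qed
    define H where "H = (\<lambda>s. F s * exp (V / 2 * s ^ 2))"
    have dH: "(H has_real_derivative (G s + s * V * F s) * exp (V / 2 * s ^ 2)) (at s)" for s
    proof -
      have "((\<lambda>s. exp (V / 2 * s ^ 2)) has_real_derivative exp (V / 2 * s ^ 2) * (V * s)) (at s)"
        by (auto intro!: derivative_eq_intros)
      from DERIV_mult[OF dF this] show ?thesis unfolding H_def by (simp add: algebra_simps)
    qed
    have "norm (H 1 - H 0) \<le> (CC * 2 / sqrt (real N) * exp (V / 2)) * norm (1 - 0 :: real)"
    proof (rule field_differentiable_bound[of "{0..1}" H])
      fix s :: real assume s: "s \<in> {0..1}"
      show "(H has_field_derivative (G s + s * V * F s) * exp (V / 2 * s ^ 2)) (at s within {0..1})"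
        using dH has_field_derivative_at_within by blast
      have "\<bar>G s + s * V * F s\<bar> \<le> CC * 2 / sqrt (real N)"
        using s CC N by (intro order_trans[OF GF] divide_right_mono mult_left_mono) auto
      moreover have "exp (V / 2 * s ^ 2) \<le> exp (V / 2)"
      proof -
        have "V / 2 * s ^ 2 \<le> V / 2 * 1" using s V by (intro mult_left_mono) (auto intro: power_le_one)
        then show ?thesis by simp
      qed
      ultimately show "norm ((G s + s * V * F s) * exp (V / 2 * s ^ 2)) \<le> CC * 2 / sqrt (real N) * exp (V / 2)"
        unfolding norm_mult using CC by (intro mult_mono) auto
    qed auto
    then have "\<bar>F 1 * exp (V / 2) - f 0\<bar> \<le> CC * 2 / sqrt (real N) * exp (V / 2)"
      by (simp add: H_def F_def prob_space)
    moreover have e: "F 1 - f 0 * exp (- V / 2) = (F 1 * exp (V / 2) - f 0) * exp (- V / 2)"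
      by (simp add: left_diff_distrib mult.assoc flip: exp_add)
    moreover have "exp (- V / 2) \<le> 1" using V by simp
    ultimately have "\<bar>F 1 - f 0 * exp (- V / 2)\<bar> \<le> CC * 2 / sqrt (real N) * exp (V / 2) * 1"
      unfolding e abs_mult using CC by (intro mult_mono) auto
    then show ?case by (simp add: F_def Y_def mult_ac)
  qed
  moreover have "(\<lambda>N. (2 * CC * exp (V / 2)) * (1 / sqrt (real N))) \<longlonglongrightarrow> 0"
    by (intro tendsto_mult_right_zero inverse_sqrt_tendsto)
  ultimately have "(\<lambda>N. (\<integral>x. f (\<Sum>j\<in>J. t j * y N x j) \<partial>M N) - f 0 * exp (- V / 2)) \<longlonglongrightarrow> 0" by (rule Lim_null_comparison)
  then show ?thesis by (simp add: LIM_zero_iff V_def)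
qed

lemma cos_sin_tendsto:
  fixes t :: "nat \<Rightarrow> real"
  assumes J: "finite J"
  shows "(\<lambda>N. \<integral>x. cos (\<Sum>j\<in>J. t j * y N x j) \<partial>M N) \<longlonglongrightarrow> exp (- quad_form J t / 2)"
    "(\<lambda>N. \<integral>x. sin (\<Sum>j\<in>J. t j * y N x j) \<partial>M N) \<longlonglongrightarrow> 0"
proof -
  show "(\<lambda>N. \<integral>x. cos (\<Sum>j\<in>J. t j * y N x j) \<partial>M N) \<longlonglongrightarrow> exp (- quad_form J t / 2)"
  proof -
    have d: "((\<lambda>z. - sin z) has_real_derivative - cos z) (at z)" for z :: real by (auto intro!: derivative_eq_intros)
    show ?thesis using trig_expectation_tendsto[OF J, of cos "\<lambda>z. - sin z" t, OF DERIV_cos d] by simp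
  qed
  show "(\<lambda>N. \<integral>x. sin (\<Sum>j\<in>J. t j * y N x j) \<partial>M N) \<longlonglongrightarrow> 0"
    using trig_expectation_tendsto[OF J, of sin cos t, OF DERIV_sin DERIV_cos] by simp
qed

end

section \<open>Gaussian sequences with a given covariance\<close>

definition psd_kernel :: "(nat \<Rightarrow> nat \<Rightarrow> real) \<Rightarrow> bool" where
  "psd_kernel K \<longleftrightarrow> (\<forall>i j. K i j = K j i) \<and> (\<forall>J t. finite J \<longrightarrow> 0 \<le> (\<Sum>i\<in>J. \<Sum>j\<in>J. t i * t j * K i j))"

text \<open>Eliminating the pivots one after the other (with \<open>x / 0 = 0\<close> for a vanishing pivot, whose row vanishes) leaves the Schur
  complements; the pivot columns are those of a Cholesky factor.\<close>

definition schur_step :: "nat \<Rightarrow> (nat \<Rightarrow> nat \<Rightarrow> real) \<Rightarrow> nat \<Rightarrow> nat \<Rightarrow> real" where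
  "schur_step p K i j = K i j - K i p * K p j / K p p"

fun schur :: "(nat \<Rightarrow> nat \<Rightarrow> real) \<Rightarrow> nat \<Rightarrow> nat \<Rightarrow> nat \<Rightarrow> real" where
  "schur K 0 = K"
| "schur K (Suc n) = schur_step n (schur K n)"

lemma psd_kernel_diag: "psd_kernel K \<Longrightarrow> 0 \<le> K i i"
  unfolding psd_kernel_def by (drule conjunct2, drule spec[of _ "{i}"], drule spec[of _ "\<lambda>_. 1"]) simp

lemma psd_kernel_extend:
  assumes K: "psd_kernel K" and J: "finite J"
  shows "0 \<le> (\<Sum>i\<in>J. \<Sum>j\<in>J. t i * t j * K i j) + 2 * s * (\<Sum>i\<in>J. t i * K i p) + s ^ 2 * K p p"
proof -
  have sym: "K i j = K j i" for i j using K by (simp add: psd_kernel_def)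
  \<comment> \<open>The two contributions are added, so that the case p \<in> J is covered as
    well.\<close>
  define r where "r = (\<lambda>i. (if i \<in> J then t i else 0) + (if i = p then s else 0))"
  let ?I = "insert p J"
  have fin: "finite ?I" using J by simp
  have a: "(\<Sum>j\<in>?I. r j * h j) = (\<Sum>j\<in>J. t j * h j) + s * h p" for h :: "nat \<Rightarrow> real"
  proof -
    have "(\<Sum>j\<in>?I. r j * h j) = (\<Sum>j\<in>?I. (if j \<in> J then t j * h j else 0)) + (\<Sum>j\<in>?I. (if j = p then s * h j else 0))"
      unfolding sum.distrib[symmetric] by (intro sum.cong refl) (auto simp: r_def algebra_simps)
    also have "(\<Sum>j\<in>?I. (if j \<in> J then t j * h j else 0)) = (\<Sum>j\<in>J. t j * h j)"
      using fin by (subst sum.inter_restrict[symmetric]) (auto intro!: sum.cong)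
    finally show ?thesis using fin by simp
  qed
  have "0 \<le> (\<Sum>i\<in>?I. \<Sum>j\<in>?I. r i * r j * K i j)"
    using K fin unfolding psd_kernel_def by blast
  also have "(\<Sum>i\<in>?I. \<Sum>j\<in>?I. r i * r j * K i j) = (\<Sum>i\<in>?I. r i * (\<Sum>j\<in>?I. r j * K i j))"
    by (simp add: sum_distrib_left mult.assoc)
  also have "\<dots> = (\<Sum>i\<in>J. t i * ((\<Sum>j\<in>J. t j * K i j) + s * K i p)) + s * ((\<Sum>j\<in>J. t j * K p j) + s * K p p)"
    unfolding a ..
  also have "(\<Sum>j\<in>J. t j * K p j) = (\<Sum>i\<in>J. t i * K i p)" by (intro sum.cong refl) (simp add: sym)
  also have "(\<Sum>i\<in>J. t i * ((\<Sum>j\<in>J. t j * K i j) + s * K i p)) = (\<Sum>i\<in>J. \<Sum>j\<in>J. t i * t j * K i j) + s * (\<Sum>i\<in>J. t i * K i p)"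
    by (simp add: distrib_left sum.distrib sum_distrib_left mult_ac)
  finally show ?thesis by (simp add: algebra_simps power2_eq_square)
qed

text \<open>Without the quadratic term in s the form is affine in s and can stay nonnegative only if
  its slope vanishes.\<close>

lemma psd_kernel_zero_pivot:
  assumes K: "psd_kernel K" and p: "K p p = 0"
  shows "K i p = 0"
proof (rule ccontr)
  assume n: "K i p \<noteq> 0"
  \<comment> \<open>This s makes the right side equal to -1.\<close>
  have "0 \<le> K i i + 2 * (- (K i i + 1) / (2 * K i p)) * K i p"
    using psd_kernel_extend[OF K, of "{i}" "\<lambda>_. 1" "- (K i i + 1) / (2 * K i p)" p] p by simp
  then show False using n by (simp add: field_simps)
qed

lemma psd_kernel_schur_step:
  assumes K: "psd_kernel K"
  shows "psd_kernel (schur_step p K)"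
proof (cases "K p p = 0")
  case True
  then have "schur_step p K = K" by (simp add: schur_step_def fun_eq_iff)
  then show ?thesis using K by simp
next
  case False
  then have pp: "K p p > 0" using psd_kernel_diag[OF K, of p] by simp
  have sym: "K i j = K j i" for i j using K by (simp add: psd_kernel_def)
  show ?thesis unfolding psd_kernel_def
  proof (intro conjI allI impI)
    show "schur_step p K i j = schur_step p K j i" for i j
      unfolding schur_step_def using sym[of i j] sym[of i p] sym[of j p] by simp
    fix J :: "nat set" and t :: "nat \<Rightarrow> real" assume J: "finite J"
    define B where "B = (\<Sum>i\<in>J. t i * K i p)"
    have "t i * t j * schur_step p K i j = t i * t j * K i j - (t i * K i p) * (t j * K j p) / K p p" for i j
      unfolding schur_step_def sym[of p j] by (simp add: right_diff_distrib)
    then have "(\<Sum>i\<in>J. \<Sum>j\<in>J. t i * t j * schur_step p K i j) = (\<Sum>i\<in>J. \<Sum>j\<in>J. t i * t j * K i j) - (\<Sum>i\<in>J. \<Sum>j\<in>J. (t i * K i p) * (t j * K j p)) / K p p"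
      by (simp only: sum_subtractf sum_divide_distrib)
    also have "(\<Sum>i\<in>J. \<Sum>j\<in>J. (t i * K i p) * (t j * K j p)) = B * B" unfolding B_def sum_product ..
    finally have e: "(\<Sum>i\<in>J. \<Sum>j\<in>J. t i * t j * schur_step p K i j) = (\<Sum>i\<in>J. \<Sum>j\<in>J. t i * t j * K i j) - B * B / K p p" .
    \<comment> \<open>The weight - B / K p p minimizes the extended quadratic form, and the minimum
      is the form of the Schur complement.\<close>
    have "0 \<le> (\<Sum>i\<in>J. \<Sum>j\<in>J. t i * t j * K i j) + 2 * (- B / K p p) * B + (- B / K p p) ^ 2 * K p p"
      using psd_kernel_extend[OF K J, of t "- B / K p p" p] unfolding B_def .
    also have "\<dots> = (\<Sum>i\<in>J. \<Sum>j\<in>J. t i * t j * K i j) - B * B / K p p"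
      using pp by (simp add: field_simps power2_eq_square)
    finally show "0 \<le> (\<Sum>i\<in>J. \<Sum>j\<in>J. t i * t j * schur_step p K i j)" unfolding e .
  qed
qed

lemma psd_kernel_schur: "psd_kernel K \<Longrightarrow> psd_kernel (schur K n)"
  by (induction n) (auto intro: psd_kernel_schur_step)

lemma schur_eliminated:
  assumes K: "psd_kernel K"
  shows "i < n \<Longrightarrow> schur K n i j = 0"
proof (induction n arbitrary: i j)
  case (Suc n)
  have psd: "psd_kernel (schur K n)" by (rule psd_kernel_schur[OF K])
  have sym: "schur K n i j = schur K n j i" for i j using psd by (simp add: psd_kernel_def)
  show ?case
  proof (cases "i < n")
    case True
    then show ?thesis using Suc.IH by (simp add: schur_step_def)
  next
    case False
    then have "i = n" using Suc by simp
    then show ?thesis using psd_kernel_zero_pivot[OF psd, of n j] sym[of n j]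
      by (cases "schur K n n n = 0") (auto simp: schur_step_def)
  qed
qed simp

definition cholesky :: "(nat \<Rightarrow> nat \<Rightarrow> real) \<Rightarrow> nat \<Rightarrow> nat \<Rightarrow> real" where
  "cholesky K i p = schur K p i p / sqrt (schur K p p p)"

lemma cholesky_upper: "psd_kernel K \<Longrightarrow> i < p \<Longrightarrow> cholesky K i p = 0"
  by (simp add: cholesky_def schur_eliminated)

lemma cholesky_partial:
  assumes K: "psd_kernel K"
  shows "K i j = (\<Sum>p<n. cholesky K i p * cholesky K j p) + schur K n i j"
proof (induction n)
  case (Suc n)
  have psd: "psd_kernel (schur K n)" by (rule psd_kernel_schur[OF K])
  have "cholesky K i n * cholesky K j n = schur K n i n * schur K n n j / schur K n n n"
  proof -
    have "schur K n j n = schur K n n j" using psd by (simp add: psd_kernel_def)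
    then show ?thesis using psd_kernel_diag[OF psd, of n] by (simp add: cholesky_def)
  qed
  then show ?case using Suc by (simp add: schur_step_def)
qed simp

lemma cholesky_factorization:
  assumes K: "psd_kernel K" and n: "i < n"
  shows "(\<Sum>p<n. cholesky K i p * cholesky K j p) = K i j"
  using cholesky_partial[OF K, of i j n] schur_eliminated[OF K n, of j] by simp

abbreviation "std_normal \<equiv> density lborel (\<lambda>x. ennreal (std_normal_density x))"

section \<open>Linear combinations of independent standard normal variables\<close>

definition "normal_sequence = PiM (UNIV :: nat set) (\<lambda>_. std_normal)"

lemma prob_space_std_normal: "prob_space std_normal"
  by (rule prob_space_normal_density) simp

lemma prob_space_normal_sequence: "prob_space normal_sequence"
  unfolding normal_sequence_def by (intro prob_space_PiM prob_space_std_normal)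

lemma measurable_normal_coordinate [measurable]: "(\<lambda>\<omega>. \<omega> i) \<in> borel_measurable normal_sequence"
proof -
  have "(\<lambda>\<omega>. \<omega> i) \<in> measurable normal_sequence std_normal"
    unfolding normal_sequence_def by (rule measurable_component_singleton) simp
  then show ?thesis by (simp cong: measurable_cong_sets)
qed

lemma distr_normal_coordinate: "distr normal_sequence borel (\<lambda>\<omega>. \<omega> i) = std_normal"
proof -
  have "distr normal_sequence std_normal (\<lambda>\<omega>. \<omega> i) = std_normal"
    unfolding normal_sequence_def by (rule distr_PiM_component) (auto intro: prob_space_std_normal)
  moreover have "distr normal_sequence std_normal (\<lambda>\<omega>. \<omega> i) = distr normal_sequence borel (\<lambda>\<omega>. \<omega> i)"
    by (rule distr_cong) auto
  ultimately show ?thesis by simp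
qed

lemma indep_vars_normal_sequence: "prob_space.indep_vars normal_sequence (\<lambda>_. borel) (\<lambda>i \<omega>. \<omega> i) UNIV"
proof -
  interpret prob_space normal_sequence by (rule prob_space_normal_sequence)
  have "distr normal_sequence (PiM UNIV (\<lambda>_. borel)) (\<lambda>x. \<lambda>i\<in>UNIV. x i) = normal_sequence"
  proof -
    have "distr normal_sequence (PiM UNIV (\<lambda>_. borel)) (\<lambda>x. \<lambda>i\<in>UNIV. x i) = distr normal_sequence normal_sequence (\<lambda>x. x)"
      by (rule distr_cong) (auto simp: normal_sequence_def intro!: sets_PiM_cong)
    then show ?thesis by simp
  qed
  then show ?thesis
    by (subst indep_vars_iff_distr_eq_PiM) (auto simp: distr_normal_coordinate, simp add: normal_sequence_def)
qed

lemma distr_normal_combination: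
  assumes I: "finite I"
  shows "distr normal_sequence borel (\<lambda>\<omega>. \<Sum>i\<in>I. c i * \<omega> i) = gaussian 0 (\<Sum>i\<in>I. (c i)\<^sup>2)"
proof -
  interpret prob_space normal_sequence by (rule prob_space_normal_sequence)
  \<comment> \<open>Vanishing coefficients are dropped because a normal density needs a positive
    standard deviation; if none remain, the law is the point mass at 0.\<close>
  define I' where "I' = {i\<in>I. c i \<noteq> 0}"
  have I': "finite I'" using I by (simp add: I'_def)
  have s: "(\<Sum>i\<in>I. c i * \<omega> i) = (\<Sum>i\<in>I'. c i * \<omega> i)" for \<omega>
    unfolding I'_def using I by (intro sum.mono_neutral_right) auto
  have v: "(\<Sum>i\<in>I. (c i)\<^sup>2) = (\<Sum>i\<in>I'. \<bar>c i\<bar>\<^sup>2)"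
    unfolding I'_def using I by (simp, intro sum.mono_neutral_right) auto
  show ?thesis
  proof (cases "I' = {}")
    case True
    have "distr normal_sequence borel (\<lambda>\<omega>. 0) = return borel (0::real)"
    proof (rule measure_eqI)
      fix A assume "A \<in> sets (distr normal_sequence borel (\<lambda>\<omega>. 0::real))"
      then have A: "A \<in> sets borel" by simp
      then show "emeasure (distr normal_sequence borel (\<lambda>\<omega>. 0)) A = emeasure (return borel 0) A"
        by (subst emeasure_distr) (auto simp: emeasure_space_1 indicator_def vimage_def)
    qed simp
    then show ?thesis unfolding s v True by (simp add: gaussian_def)
  next
    case False
    have ind: "indep_vars (\<lambda>_. borel) (\<lambda>i \<omega>. c i * \<omega> i) I'"
      by (rule indep_vars_compose2[OF indep_vars_subset[OF indep_vars_normal_sequence subset_UNIV]]) simp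
    have d1: "distributed normal_sequence lborel (\<lambda>\<omega>. \<omega> i) std_normal_density" for i
      unfolding distributed_def using distr_normal_coordinate[of i]
      by (auto cong: distr_cong)
    have "distributed normal_sequence lborel (\<lambda>\<omega>. c i * \<omega> i) (normal_density 0 \<bar>c i\<bar>)" if "i \<in> I'" for i
      using normal_density_affine[OF d1[of i], of "c i" 0] that by (simp add: I'_def)
    then have "distributed normal_sequence lborel (\<lambda>\<omega>. \<Sum>i\<in>I'. c i * \<omega> i) (normal_density (\<Sum>i\<in>I'. 0) (sqrt (\<Sum>i\<in>I'. \<bar>c i\<bar>\<^sup>2)))"
      by (intro sum_indep_normal I' False ind) (auto simp: I'_def)
    then have "distr normal_sequence lborel (\<lambda>\<omega>. \<Sum>i\<in>I'. c i * \<omega> i) = density lborel (normal_density 0 (sqrt (\<Sum>i\<in>I'. \<bar>c i\<bar>\<^sup>2)))"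
      by (simp add: distributed_distr_eq_density)
    moreover have "distr normal_sequence borel (\<lambda>\<omega>. \<Sum>i\<in>I'. c i * \<omega> i) = distr normal_sequence lborel (\<lambda>\<omega>. \<Sum>i\<in>I'. c i * \<omega> i)"
      by (rule distr_cong) auto
    moreover have "(\<Sum>i\<in>I'. \<bar>c i\<bar>\<^sup>2) \<noteq> 0"
      using I' False by (subst sum_nonneg_eq_0_iff) (auto simp: I'_def)
    ultimately show ?thesis unfolding s v by (simp add: gaussian_def)
  qed
qed

lemma std_normal_integrals:
  "integrable std_normal (\<lambda>x. x)" "integral\<^sup>L std_normal (\<lambda>x. x) = 0"
  "integrable std_normal (\<lambda>x. x * x)" "integral\<^sup>L std_normal (\<lambda>x. x * x) = 1"
proof -
  show "integrable std_normal (\<lambda>x. x)"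
    using integrable_std_normal_moment[of 1] by (subst integrable_density) auto
  show "integral\<^sup>L std_normal (\<lambda>x. x) = 0"
    using integral_std_normal_moment_odd[of 0] by (subst integral_density) auto
  show "integrable std_normal (\<lambda>x. x * x)"
    using integrable_std_normal_moment[of 2] by (subst integrable_density) (auto simp: power2_eq_square)
  show "integral\<^sup>L std_normal (\<lambda>x. x * x) = 1"
    using integral_std_normal_moment_even[of 1] by (subst integral_density) (auto simp: power2_eq_square)
qed

lemma normal_sequence_moments:
  "integrable normal_sequence (\<lambda>\<omega>. \<omega> i)" "integral\<^sup>L normal_sequence (\<lambda>\<omega>. \<omega> i) = 0"
  "integrable normal_sequence (\<lambda>\<omega>. \<omega> i * \<omega> j)" "integral\<^sup>L normal_sequence (\<lambda>\<omega>. \<omega> i * \<omega> j) = (if i = j then 1 else 0)"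
proof -
  have 1: "integrable normal_sequence (\<lambda>\<omega>. \<Prod>r\<in>J. f r (\<omega> r))" "(\<integral>\<omega>. (\<Prod>r\<in>J. f r (\<omega> r)) \<partial>normal_sequence) = (\<Prod>r\<in>J. integral\<^sup>L std_normal (f r))"
    if "finite J" "\<And>r. r \<in> J \<Longrightarrow> integrable std_normal (f r)" for J and f :: "nat \<Rightarrow> real \<Rightarrow> real"
    unfolding normal_sequence_def using that by (intro integrable_integral_PiM_prod; auto intro: prob_space_std_normal)+
  show "integrable normal_sequence (\<lambda>\<omega>. \<omega> i)" "integral\<^sup>L normal_sequence (\<lambda>\<omega>. \<omega> i) = 0"
    using 1[of "{i}" "\<lambda>_ x. x"] std_normal_integrals by auto
  show "integrable normal_sequence (\<lambda>\<omega>. \<omega> i * \<omega> j)" "integral\<^sup>L normal_sequence (\<lambda>\<omega>. \<omega> i * \<omega> j) = (if i = j then 1 else 0)"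
    using 1[of "{i}" "\<lambda>_ x. x * x"] 1[of "{i, j}" "\<lambda>_ x. x"] std_normal_integrals by (cases "i = j"; simp)+
qed

text \<open>The Cholesky factor is lower triangular, so each variable is a finite combination, and
  one sequence on one space realizes all finite-dimensional laws at once.\<close>

definition "gauss_seq K n \<omega> = (\<Sum>i<Suc n. cholesky K n i * \<omega> i)"

lemma borel_measurable_gauss_seq [measurable]: "gauss_seq K n \<in> borel_measurable normal_sequence"
  unfolding gauss_seq_def[abs_def] by measurable

lemma gauss_seq_extend:
  assumes K: "psd_kernel K" and n: "n < m"
  shows "gauss_seq K n \<omega> = (\<Sum>i<m. cholesky K n i * \<omega> i)"
  unfolding gauss_seq_def using n cholesky_upper[OF K] by (intro sum.mono_neutral_left) auto

lemma distr_gauss_seq_combination: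
  assumes K: "psd_kernel K" and J: "finite J"
  shows "distr normal_sequence borel (\<lambda>\<omega>. \<Sum>n\<in>J. t n * gauss_seq K n \<omega>) = gaussian 0 (\<Sum>l\<in>J. \<Sum>j\<in>J. t l * t j * K j l)"
proof -
  define m where "m = Suc (Max (insert 0 J))"
  have m: "n < m" if "n \<in> J" for n unfolding m_def using that J by (simp add: less_Suc_eq_le)
  define c where "c = (\<lambda>i. \<Sum>n\<in>J. t n * cholesky K n i)"
  have "(\<Sum>n\<in>J. t n * gauss_seq K n \<omega>) = (\<Sum>i<m. c i * \<omega> i)" for \<omega>
  proof -
    have "(\<Sum>n\<in>J. t n * gauss_seq K n \<omega>) = (\<Sum>n\<in>J. \<Sum>i<m. t n * (cholesky K n i * \<omega> i))"
      by (intro sum.cong refl) (simp add: gauss_seq_extend[OF K m] sum_distrib_left)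
    also have "\<dots> = (\<Sum>i<m. \<Sum>n\<in>J. t n * (cholesky K n i * \<omega> i))" by (rule sum.swap)
    finally show ?thesis by (simp add: c_def sum_distrib_right mult.assoc)
  qed
  moreover have "(\<Sum>i<m. (c i)\<^sup>2) = (\<Sum>l\<in>J. \<Sum>j\<in>J. t l * t j * K j l)"
  proof -
    have "(\<Sum>i<m. (c i)\<^sup>2) = (\<Sum>i<m. \<Sum>l\<in>J. \<Sum>j\<in>J. t l * t j * (cholesky K j i * cholesky K l i))"
      unfolding c_def power2_eq_square sum_product by (simp add: mult_ac)
    also have "\<dots> = (\<Sum>l\<in>J. \<Sum>i<m. \<Sum>j\<in>J. t l * t j * (cholesky K j i * cholesky K l i))" by (rule sum.swap)
    also have "\<dots> = (\<Sum>l\<in>J. \<Sum>j\<in>J. \<Sum>i<m. t l * t j * (cholesky K j i * cholesky K l i))" by (rule sum.cong[OF refl sum.swap])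
    also have "\<dots> = (\<Sum>l\<in>J. \<Sum>j\<in>J. t l * t j * K j l)"
      unfolding sum_distrib_left[symmetric] by (intro sum.cong refl) (simp add: cholesky_factorization[OF K m])
    finally show ?thesis .
  qed
  ultimately show ?thesis using distr_normal_combination[of "{..<m}" c] by simp
qed

lemma gauss_seq_moments:
  assumes K: "psd_kernel K"
  shows "integrable normal_sequence (gauss_seq K n)" "integral\<^sup>L normal_sequence (gauss_seq K n) = 0"
    "integrable normal_sequence (\<lambda>\<omega>. gauss_seq K k \<omega> * gauss_seq K l \<omega>)"
    "integral\<^sup>L normal_sequence (\<lambda>\<omega>. gauss_seq K k \<omega> * gauss_seq K l \<omega>) = K k l"
proof -
  show "integrable normal_sequence (gauss_seq K n)" "integral\<^sup>L normal_sequence (gauss_seq K n) = 0"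
    unfolding gauss_seq_def[abs_def] by (simp_all add: normal_sequence_moments)
  define m where "m = Suc (max k l)"
  have kl: "k < m" "l < m" by (auto simp: m_def)
  have e: "gauss_seq K k \<omega> * gauss_seq K l \<omega> = (\<Sum>i<m. \<Sum>j<m. cholesky K k i * cholesky K l j * (\<omega> i * \<omega> j))" for \<omega>
    unfolding gauss_seq_extend[OF K kl(1)] gauss_seq_extend[OF K kl(2)] by (simp add: sum_product mult_ac)
  show "integrable normal_sequence (\<lambda>\<omega>. gauss_seq K k \<omega> * gauss_seq K l \<omega>)"
    unfolding e by (simp add: normal_sequence_moments)
  have "integral\<^sup>L normal_sequence (\<lambda>\<omega>. gauss_seq K k \<omega> * gauss_seq K l \<omega>) = (\<Sum>i<m. \<Sum>j<m. cholesky K k i * cholesky K l j * (if i = j then 1 else 0))"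
    unfolding e by (simp add: normal_sequence_moments)
  also have "\<dots> = (\<Sum>i<m. cholesky K k i * cholesky K l i)"
    by (intro sum.cong refl) (simp add: mult_delta_right)
  also have "\<dots> = K k l" by (rule cholesky_factorization[OF K]) (simp add: m_def)
  finally show "integral\<^sup>L normal_sequence (\<lambda>\<omega>. gauss_seq K k \<omega> * gauss_seq K l \<omega>) = K k l" .
qed

lemma real_distribution_gaussian: "v \<ge> 0 \<Longrightarrow> real_distribution (gaussian 0 v)"
  unfolding gaussian_def real_distribution_def real_distribution_axioms_def
  by (auto intro: prob_space_return prob_space_normal_density)

text \<open>Representing the law by sqrt v times a standard normal variable treats v = 0 and v > 0
  together.\<close>

lemma char_gaussian:
  assumes "v \<ge> 0"
  shows "char (gaussian 0 v) s = exp (- (s\<^sup>2 * v / 2))"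
proof -
  interpret prob_space normal_sequence by (rule prob_space_normal_sequence)
  have "gaussian 0 v = distr normal_sequence borel (\<lambda>\<omega>. sqrt v * \<omega> 0)"
    using distr_normal_combination[of "{0}" "\<lambda>_. sqrt v"] assms by simp
  then have "char (gaussian 0 v) s = (\<integral>\<omega>. iexp (s * (sqrt v * \<omega> 0)) \<partial>normal_sequence)"
    by (simp add: char_def integral_distr)
  also have "\<dots> = (\<integral>x. iexp ((s * sqrt v) * x) \<partial>distr normal_sequence borel (\<lambda>\<omega>. \<omega> 0))"
    by (subst integral_distr) (auto simp: mult_ac)
  also have "\<dots> = char std_normal (s * sqrt v)" unfolding distr_normal_coordinate char_def ..
  also have "\<dots> = exp (- ((s * sqrt v)\<^sup>2) / 2)" by (simp add: char_std_normal_distribution)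
  finally show ?thesis using assms by (simp add: power_mult_distrib)
qed

section \<open>Weak convergence from trigonometric test functions\<close>

inductive trig_poly :: "'i set \<Rightarrow> (('i \<Rightarrow> real) \<Rightarrow> real) \<Rightarrow> bool" for I where
  trig_cos: "trig_poly I (\<lambda>x. cos (\<Sum>i\<in>I. t i * x i))"
| trig_sin: "trig_poly I (\<lambda>x. sin (\<Sum>i\<in>I. t i * x i))"
| trig_add: "trig_poly I f \<Longrightarrow> trig_poly I g \<Longrightarrow> trig_poly I (\<lambda>x. f x + g x)"
| trig_scale: "trig_poly I f \<Longrightarrow> trig_poly I (\<lambda>x. c * f x)"

text \<open>By the product-to-sum formulas a product of trigonometric test functions is again a
  linear combination of such functions. Convergence of the cosine and sine integrals therefore
  extends to the whole algebra.\<close>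

lemma trig_poly_mult_cos_sin:
  assumes "trig_poly I f"
  shows "trig_poly I (\<lambda>x. f x * cos (\<Sum>i\<in>I. s i * x i)) \<and> trig_poly I (\<lambda>x. f x * sin (\<Sum>i\<in>I. s i * x i))"
  using assms
proof induction
  case (trig_cos t)
  have 1: "(\<lambda>x. cos (\<Sum>i\<in>I. t i * x i) * cos (\<Sum>i\<in>I. s i * x i)) = (\<lambda>x. 1/2 * cos (\<Sum>i\<in>I. (t i - s i) * x i) + 1/2 * cos (\<Sum>i\<in>I. (t i + s i) * x i))"
    by (simp add: fun_eq_iff cos_times_cos left_diff_distrib distrib_right sum_subtractf sum.distrib add_divide_distrib)
  have 2: "(\<lambda>x. cos (\<Sum>i\<in>I. t i * x i) * sin (\<Sum>i\<in>I. s i * x i)) = (\<lambda>x. 1/2 * sin (\<Sum>i\<in>I. (t i + s i) * x i) + (-1/2) * sin (\<Sum>i\<in>I. (t i - s i) * x i))"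
    by (simp add: fun_eq_iff cos_times_sin left_diff_distrib distrib_right sum_subtractf sum.distrib diff_divide_distrib)
  show ?case unfolding 1 2 by (intro conjI trig_poly.intros)
next
  case (trig_sin t)
  have 1: "(\<lambda>x. sin (\<Sum>i\<in>I. t i * x i) * cos (\<Sum>i\<in>I. s i * x i)) = (\<lambda>x. 1/2 * sin (\<Sum>i\<in>I. (t i + s i) * x i) + 1/2 * sin (\<Sum>i\<in>I. (t i - s i) * x i))"
    by (simp add: fun_eq_iff sin_times_cos left_diff_distrib distrib_right sum_subtractf sum.distrib add_divide_distrib)
  have 2: "(\<lambda>x. sin (\<Sum>i\<in>I. t i * x i) * sin (\<Sum>i\<in>I. s i * x i)) = (\<lambda>x. 1/2 * cos (\<Sum>i\<in>I. (t i - s i) * x i) + (-1/2) * cos (\<Sum>i\<in>I. (t i + s i) * x i))"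
    by (simp add: fun_eq_iff sin_times_sin left_diff_distrib distrib_right sum_subtractf sum.distrib diff_divide_distrib)
  show ?case unfolding 1 2 by (intro conjI trig_poly.intros)
next
  case (trig_add f g)
  then show ?case by (auto simp: distrib_right intro: trig_poly.intros)
next
  case (trig_scale f c)
  then show ?case by (auto simp: mult.assoc intro: trig_poly.intros)
qed

lemma trig_poly_mult:
  assumes f: "trig_poly I f" and g: "trig_poly I g"
  shows "trig_poly I (\<lambda>x. f x * g x)"
  using g
proof induction
  case (trig_add g h)
  then show ?case by (auto simp: distrib_left intro: trig_poly.intros)
next
  case (trig_scale g c)
  then have "trig_poly I (\<lambda>x. c * (f x * g x))" by (intro trig_poly.intros)
  then show ?case by (simp add: mult_ac)
qed (use trig_poly_mult_cos_sin[OF f] in auto)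

lemma trig_poly_const: "trig_poly I (\<lambda>x. c)"
  using trig_scale[OF trig_cos[of I "\<lambda>_. 0"], of c] by simp

lemma trig_poly_sin_coordinate:
  assumes "finite I" "i \<in> I"
  shows "trig_poly I (\<lambda>x. sin (w * x i))"
proof -
  have "(\<Sum>j\<in>I. (if j = i then w else 0) * x j) = w * x i" for x :: "'a \<Rightarrow> real"
    using assms by (simp add: mult_delta_left)
  then show ?thesis using trig_sin[of I "\<lambda>j. if j = i then w else 0"] by simp
qed

inductive coord_poly :: "'i set \<Rightarrow> (('i \<Rightarrow> real) \<Rightarrow> real) \<Rightarrow> bool" for I where
  cp_const: "coord_poly I (\<lambda>_. c)"
| cp_coord: "i \<in> I \<Longrightarrow> coord_poly I (\<lambda>v. v i)"
| cp_add: "coord_poly I f \<Longrightarrow> coord_poly I g \<Longrightarrow> coord_poly I (\<lambda>v. f v + g v)"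
| cp_mult: "coord_poly I f \<Longrightarrow> coord_poly I g \<Longrightarrow> coord_poly I (\<lambda>v. f v * g v)"

lemma coord_poly_continuous: "coord_poly I f \<Longrightarrow> continuous_on S f"
  by (induction rule: coord_poly.induct) (auto intro!: continuous_intros continuous_on_subset[OF continuous_on_product_coordinates])

lemma coord_poly_trig:
  assumes "finite I" "coord_poly I f"
  shows "trig_poly I (\<lambda>x. f (\<lambda>i. if i \<in> I then sin (w * x i) else 0))"
  using assms(2)
proof induction
  case (cp_coord i)
  then show ?case using trig_poly_sin_coordinate[OF assms(1)] by simp
qed (auto intro: trig_poly_const trig_add trig_poly_mult)

text \<open>Coordinates outside I are pinned to 0. This makes the set compact in the product
  topology over all natural numbers and lets the coordinates in I separate its points.\<close>

definition sine_cube :: "nat set \<Rightarrow> (nat \<Rightarrow> real) set" where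
  "sine_cube I = {v. \<forall>i. v i \<in> (if i \<in> I then {-1..1} else {0})}"

lemma compact_sine_cube: "compact (sine_cube I)"
proof -
  have "sine_cube I = PiE UNIV (\<lambda>i. if i \<in> I then {-1..1} else {0})"
    by (simp add: sine_cube_def PiE_UNIV_domain Pi_def)
  moreover have "compactin (product_topology (\<lambda>_. euclidean) UNIV) (PiE UNIV (\<lambda>i. if i \<in> I then {-1..1::real} else {0}))"
    by (subst compactin_PiE) auto
  ultimately show ?thesis by (simp add: euclidean_product_topology)
qed

lemma coord_poly_dense:
  assumes "continuous_on (sine_cube I) h" "e > 0"
  shows "\<exists>g. coord_poly I g \<and> (\<forall>v\<in>sine_cube I. \<bar>h v - g v\<bar> < e)"
proof -
  interpret function_ring_on "{g. coord_poly I g}" "sine_cube I"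
  proof
    fix x y :: "nat \<Rightarrow> real" assume xy: "x \<in> sine_cube I" "y \<in> sine_cube I" "x \<noteq> y"
    then obtain i where i: "x i \<noteq> y i" by auto
    have "i \<in> I"
    proof (rule ccontr)
      assume "i \<notin> I"
      then have "z i = 0" if "z \<in> sine_cube I" for z using that unfolding sine_cube_def mem_Collect_eq by (metis singletonD)
      from this[OF xy(1)] this[OF xy(2)] show False using i by simp
    qed
    then have "(\<lambda>v. v i) \<in> {g. coord_poly I g}" by (simp add: cp_coord)
    then show "\<exists>f\<in>{g. coord_poly I g}. f x \<noteq> f y" by (rule bexI[rotated]) (rule i)
  next
    show "compact (sine_cube I)" by (rule compact_sine_cube)
    fix f g :: "(nat \<Rightarrow> real) \<Rightarrow> real" and c :: real
    show "continuous_on (sine_cube I) f" if "f \<in> {g. coord_poly I g}" using that by (simp add: coord_poly_continuous)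
    show "(\<lambda>x. f x + g x) \<in> {g. coord_poly I g}" if "f \<in> {g. coord_poly I g}" "g \<in> {g. coord_poly I g}"
      using that by (simp add: cp_add)
    show "(\<lambda>x. f x * g x) \<in> {g. coord_poly I g}" if "f \<in> {g. coord_poly I g}" "g \<in> {g. coord_poly I g}"
      using that by (simp add: cp_mult)
    show "(\<lambda>_. c) \<in> {g. coord_poly I g}" by (simp add: cp_const)
  qed
  show ?thesis using Stone_Weierstrass_basic[OF assms] by auto
qed

lemma continuous_on_restrict: "continuous_on UNIV (\<lambda>z :: nat \<Rightarrow> real. restrict z I)"
proof (rule continuous_on_coordinatewise_then_product)
  fix i
  show "continuous_on UNIV (\<lambda>z :: nat \<Rightarrow> real. restrict z I i)" by (cases "i \<in> I") auto
qed

lemma borel_measurable_PiM_continuous: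
  fixes h :: "(nat \<Rightarrow> real) \<Rightarrow> real"
  assumes h: "continuous_on UNIV h"
  shows "h \<in> borel_measurable (PiM I (\<lambda>_. borel))"
proof -
  have "(\<lambda>x. x) \<in> measurable (PiM I (\<lambda>_. borel)) (borel :: (nat \<Rightarrow> real) measure)"
  proof (rule measurable_coordinatewise_then_product)
    fix i
    show "(\<lambda>x. x i) \<in> borel_measurable (PiM I (\<lambda>_. borel :: real measure))"
    proof (cases "i \<in> I")
      case False
      \<comment> \<open>Points of the product over I are constant outside I, so these coordinates
        are measurable too.\<close>
      then have "x i = undefined" if "x \<in> space (PiM I (\<lambda>_. borel :: real measure))" for x
        using that by (auto simp: space_PiM)
      then show ?thesis by (subst measurable_cong[where g = "\<lambda>_. undefined"]) auto
    qed (rule measurable_component_singleton)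
  qed
  from measurable_compose[OF this borel_measurable_continuous_onI[OF h]] show ?thesis .
qed

lemma trig_poly_continuous: "trig_poly I f \<Longrightarrow> continuous_on UNIV f"
proof (induction rule: trig_poly.induct)
  have lin: "continuous_on UNIV (\<lambda>x. \<Sum>i\<in>I. t i * x i)" for t :: "'a \<Rightarrow> real"
    by (intro continuous_on_sum continuous_on_mult continuous_on_const continuous_on_product_coordinates)
  show "continuous_on UNIV (\<lambda>x. cos (\<Sum>i\<in>I. t i * x i))" for t :: "'a \<Rightarrow> real"
    by (rule continuous_on_compose2[OF continuous_on_cos[OF continuous_on_id] lin]) auto
  show "continuous_on UNIV (\<lambda>x. sin (\<Sum>i\<in>I. t i * x i))" for t :: "'a \<Rightarrow> real"
    by (rule continuous_on_compose2[OF continuous_on_sin[OF continuous_on_id] lin]) auto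
qed (auto intro!: continuous_intros)

lemma trig_poly_bounded: "trig_poly I f \<Longrightarrow> \<exists>B. \<forall>x. \<bar>f x\<bar> \<le> B"
proof (induction rule: trig_poly.induct)
  case (trig_add f g)
  then obtain B C where "\<forall>x. \<bar>f x\<bar> \<le> B" "\<forall>x. \<bar>g x\<bar> \<le> C" by auto
  then have "\<bar>f x + g x\<bar> \<le> B + C" for x by (intro order_trans[OF abs_triangle_ineq] add_mono) auto
  then show ?case by blast
next
  case (trig_scale f c)
  then obtain B where "\<forall>x. \<bar>f x\<bar> \<le> B" by auto
  then have "\<bar>c * f x\<bar> \<le> \<bar>c\<bar> * B" for x by (auto simp: abs_mult intro: mult_left_mono)
  then show ?case by blast
qed (auto intro: exI[of _ 1])

text \<open>On \<open>[-R, R]\<^sup>I\<close> each coordinate is \<open>(2 R / pi)\<close> times the arcsine of \<open>sin (w x\<^sub>i)\<close> with \<open>w = pi / (2 R)\<close>, so there a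
  test function is a continuous function of these sines, hence by Stone--Weierstrass close to a trigonometric
  polynomial; the second moments control the complement of the cube.\<close>

theorem weak_conv_PiM_of_trig:
  fixes I :: "nat set" and \<mu> :: "nat \<Rightarrow> (nat \<Rightarrow> real) measure"
  assumes I: "finite I"
    and \<mu>: "eventually (\<lambda>N. prob_space (\<mu> N) \<and> sets (\<mu> N) = sets (PiM I (\<lambda>_. borel))) sequentially"
    and \<mu>': "prob_space \<mu>'" "sets \<mu>' = sets (PiM I (\<lambda>_. borel))"
    and conv: "\<And>t. (\<lambda>N. \<integral>x. cos (\<Sum>i\<in>I. t i * x i) \<partial>\<mu> N) \<longlonglongrightarrow> (\<integral>x. cos (\<Sum>i\<in>I. t i * x i) \<partial>\<mu>')"
      "\<And>t. (\<lambda>N. \<integral>x. sin (\<Sum>i\<in>I. t i * x i) \<partial>\<mu> N) \<longlonglongrightarrow> (\<integral>x. sin (\<Sum>i\<in>I. t i * x i) \<partial>\<mu>')"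
    and tight: "\<And>i. i \<in> I \<Longrightarrow> \<exists>C. eventually (\<lambda>N. integrable (\<mu> N) (\<lambda>x. (x i)\<^sup>2) \<and> (\<integral>x. (x i)\<^sup>2 \<partial>\<mu> N) \<le> C) sequentially"
    and tight': "\<And>i. i \<in> I \<Longrightarrow> integrable \<mu>' (\<lambda>x. (x i)\<^sup>2)"
  shows "weak_conv_PiM I \<mu> \<mu>'"
  unfolding weak_conv_PiM_def
proof (intro allI impI)
  fix f :: "(nat \<Rightarrow> real) \<Rightarrow> real"
  assume f: "continuous_on (PiE I (\<lambda>_. UNIV)) f \<and> bounded (f ` PiE I (\<lambda>_. UNIV))"
  \<comment> \<open>Extends the test function to all functions on the naturals, where it is
    continuous and still sees only the coordinates in I.\<close>
  define h where "h = (\<lambda>z. f (restrict z I))"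
  have ch: "continuous_on UNIV h"
    unfolding h_def using f by (intro continuous_on_compose2[OF _ continuous_on_restrict]) auto
  from f obtain B where "\<forall>y\<in>f ` PiE I (\<lambda>_. UNIV). norm y \<le> B" unfolding bounded_iff by blast
  then have B: "\<bar>h z\<bar> \<le> B" for z unfolding h_def by (auto intro!: bspec[of _ _ "f (restrict z I)"])
  have B0: "B \<ge> 0" using B[of "\<lambda>_. 0"] by linarith
  have hf: "integral\<^sup>L \<nu> f = integral\<^sup>L \<nu> h" if "sets \<nu> = sets (PiM I (\<lambda>_. borel))" for \<nu>
  proof (rule Bochner_Integration.integral_cong[OF refl])
    fix x assume "x \<in> space \<nu>"
    then have "x \<in> PiE I (\<lambda>_. UNIV)" using sets_eq_imp_space_eq[OF that] by (simp add: space_PiM)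
    then show "f x = h x" by (simp add: h_def PiE_restrict)
  qed
  have bint: "integrable \<nu> g" if "prob_space \<nu>" "sets \<nu> = sets (PiM I (\<lambda>_. borel))" "continuous_on UNIV g" "\<And>x. \<bar>g x\<bar> \<le> K" for \<nu> and g :: "(nat \<Rightarrow> real) \<Rightarrow> real" and K
  proof -
    interpret prob_space \<nu> by fact
    have "g \<in> borel_measurable \<nu>"
      using borel_measurable_PiM_continuous[OF that(3), of I] that(2) by (simp cong: measurable_cong_sets)
    then show ?thesis using that(4) by (intro integrable_const_bound[of _ K]) auto
  qed
  have trig: "(\<lambda>N. integral\<^sup>L (\<mu> N) g) \<longlonglongrightarrow> integral\<^sup>L \<mu>' g" if "trig_poly I g" for g
    using that
  proof induction
    case (trig_add g1 g2)
    obtain K1 K2 where K: "\<And>x. \<bar>g1 x\<bar> \<le> K1" "\<And>x. \<bar>g2 x\<bar> \<le> K2" using trig_poly_bounded trig_add.hyps by metis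
    have s: "integral\<^sup>L \<nu> (\<lambda>x. g1 x + g2 x) = integral\<^sup>L \<nu> g1 + integral\<^sup>L \<nu> g2" if "prob_space \<nu>" "sets \<nu> = sets (PiM I (\<lambda>_. borel))" for \<nu>
      by (intro Bochner_Integration.integral_add bint[OF that trig_poly_continuous[OF trig_add.hyps(1)] K(1)] bint[OF that trig_poly_continuous[OF trig_add.hyps(2)] K(2)])
    have "eventually (\<lambda>N. integral\<^sup>L (\<mu> N) (\<lambda>x. g1 x + g2 x) = integral\<^sup>L (\<mu> N) g1 + integral\<^sup>L (\<mu> N) g2) sequentially"
      using \<mu> by (rule eventually_mono) (use s in blast)
    then show ?case unfolding s[OF \<mu>'] using tendsto_add[OF trig_add.IH] by (simp add: tendsto_cong)
  next
    case (trig_scale g c)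
    then show ?case by (simp add: tendsto_mult_left)
  qed (rule conv)+
  show "(\<lambda>N. integral\<^sup>L (\<mu> N) f) \<longlonglongrightarrow> integral\<^sup>L \<mu>' f"
  proof (rule tendstoI)
    fix e :: real assume e: "e > 0"
    have "\<forall>i\<in>I. \<exists>C. eventually (\<lambda>N. integrable (\<mu> N) (\<lambda>x. (x i)\<^sup>2) \<and> (\<integral>x. (x i)\<^sup>2 \<partial>\<mu> N) \<le> C) sequentially"
      using tight by blast
    from bchoice[OF this] obtain C where C: "\<forall>i\<in>I. eventually (\<lambda>N. integrable (\<mu> N) (\<lambda>x. (x i)\<^sup>2) \<and> (\<integral>x. (x i)\<^sup>2 \<partial>\<mu> N) \<le> C i) sequentially" ..
    define D where "D = (\<Sum>i\<in>I. \<bar>C i\<bar> + \<bar>\<integral>x. (x i)\<^sup>2 \<partial>\<mu>'\<bar>)"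
    have D0: "D \<ge> 0" unfolding D_def by (intro sum_nonneg) auto
    \<comment> \<open>Chosen so that the tail estimate 2 B D / R^2 is at most e / 4; the added 1
      ensures R > 0.\<close>
    define R where "R = sqrt (8 * (B + 1) * (D + 1) / e) + 1"
    have R1: "R > 0" unfolding R_def using e B0 D0 by (intro add_nonneg_pos) auto
    have R2: "2 * B * D / R\<^sup>2 \<le> e / 4"
    proof -
      have "8 * (B + 1) * (D + 1) / e \<le> R\<^sup>2"
      proof -
        have "sqrt (8 * (B + 1) * (D + 1) / e) \<le> R" by (simp add: R_def)
        then have "(sqrt (8 * (B + 1) * (D + 1) / e))\<^sup>2 \<le> R\<^sup>2" using e B0 D0 by (intro power_mono) auto
        then show ?thesis using e B0 D0 by simp
      qed
      then have "8 * (B + 1) * (D + 1) \<le> R\<^sup>2 * e" using e by (simp add: field_simps)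
      moreover have "8 * (B * D) \<le> 8 * ((B + 1) * (D + 1))" using B0 D0 by (intro mult_left_mono mult_mono) auto
      ultimately show ?thesis using R1 by (simp add: field_simps)
    qed
    define w where "w = pi / (2 * R)"
    define s where "s = (\<lambda>x :: nat \<Rightarrow> real. \<lambda>i. if i \<in> I then sin (w * x i) else 0)"
    define H where "H = (\<lambda>v :: nat \<Rightarrow> real. h (\<lambda>i. (2 * R / pi) * arcsin (v i)))"
    have cH: "continuous_on (sine_cube I) H"
      unfolding H_def
    proof (rule continuous_on_compose2[OF ch])
      show "continuous_on (sine_cube I) (\<lambda>v i. (2 * R / pi) * arcsin (v i))"
      proof (rule continuous_on_coordinatewise_then_product)
        fix i
        have "continuous_on (sine_cube I) (\<lambda>v. v i)" by (rule continuous_on_subset[OF continuous_on_product_coordinates]) auto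
        moreover have "\<forall>v\<in>sine_cube I. -1 \<le> v i \<and> v i \<le> 1"
          by (auto simp: sine_cube_def dest!: spec[of _ i] split: if_splits)
        ultimately show "continuous_on (sine_cube I) (\<lambda>v. (2 * R / pi) * arcsin (v i))"
          by (intro continuous_on_mult continuous_on_const continuous_on_arcsin)
      qed
    qed auto
    have "e / 8 > 0" using e by simp
    from coord_poly_dense[OF cH this] obtain g where g: "coord_poly I g" "\<And>v. v \<in> sine_cube I \<Longrightarrow> \<bar>H v - g v\<bar> < e / 8" by blast
    define G where "G = (\<lambda>x. g (s x))"
    have tG: "trig_poly I G" unfolding G_def s_def by (rule coord_poly_trig[OF I g(1)])
    obtain K where K: "\<And>x. \<bar>G x\<bar> \<le> K" using trig_poly_bounded[OF tG] by blast
    have pw: "\<bar>h x - G x\<bar> \<le> e / 8 + 2 * B / R\<^sup>2 * (\<Sum>i\<in>I. (x i)\<^sup>2)" for x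
    proof -
      have "s x \<in> sine_cube I" by (simp add: s_def sine_cube_def)
      then have 1: "\<bar>H (s x) - G x\<bar> \<le> e / 8" unfolding G_def using g(2) by (simp add: less_imp_le)
      have 2: "\<bar>h x - H (s x)\<bar> \<le> 2 * B / R\<^sup>2 * (\<Sum>i\<in>I. (x i)\<^sup>2)"
      proof (cases "\<forall>i\<in>I. \<bar>x i\<bar> \<le> R")
        case True
        have "(2 * R / pi) * arcsin (s x i) = x i" if "i \<in> I" for i
        proof -
          have r: "\<bar>x i\<bar> \<le> R" using True that by blast
          have "\<bar>w * x i\<bar> \<le> w * R" unfolding abs_mult w_def using R1 r by (intro mult_mono) auto
          also have "w * R = pi / 2" unfolding w_def using R1 by simp
          finally have "arcsin (sin (w * x i)) = w * x i" by (intro arcsin_sin) (auto simp: abs_le_iff)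
          then show ?thesis using that R1 by (simp add: s_def w_def)
        qed
        then have "restrict (\<lambda>i. (2 * R / pi) * arcsin (s x i)) I = restrict x I" by (intro ext) auto
        then have "H (s x) = h x" by (simp add: H_def h_def)
        then show ?thesis using B0 by (auto intro!: mult_nonneg_nonneg divide_nonneg_nonneg sum_nonneg)
      next
        case False
        then obtain i where i: "i \<in> I" "R < \<bar>x i\<bar>" by auto
        have "R\<^sup>2 \<le> (x i)\<^sup>2" using i R1 by (metis abs_of_pos abs_le_square_iff less_imp_le)
        also have "\<dots> \<le> (\<Sum>i\<in>I. (x i)\<^sup>2)" using i I by (intro member_le_sum) auto
        finally have "2 * B / R\<^sup>2 * R\<^sup>2 \<le> 2 * B / R\<^sup>2 * (\<Sum>i\<in>I. (x i)\<^sup>2)" using B0 by (intro mult_left_mono) auto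
        \<comment> \<open>Outside the cube both values are bounded by B, and the sum of squares
          divided by R^2 exceeds 1.\<close>
        moreover have "\<bar>h x - H (s x)\<bar> \<le> 2 * B" unfolding H_def using B by (intro order_trans[OF abs_triangle_ineq4]) (smt (verit, best))
        ultimately show ?thesis using R1 by simp
      qed
      show ?thesis using 1 2 by linarith
    qed
    \<comment> \<open>This is used for the N-th law and for the limit; with e / 8 for the
      trigonometric polynomial the total is 7 e / 8.\<close>
    have err: "\<bar>integral\<^sup>L \<nu> h - integral\<^sup>L \<nu> G\<bar> \<le> e / 8 + e / 4"
      if \<nu>: "prob_space \<nu>" "sets \<nu> = sets (PiM I (\<lambda>_. borel))" and q: "\<And>i. i \<in> I \<Longrightarrow> integrable \<nu> (\<lambda>x. (x i)\<^sup>2)" "(\<Sum>i\<in>I. \<integral>x. (x i)\<^sup>2 \<partial>\<nu>) \<le> D" for \<nu>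
    proof -
      interpret prob_space \<nu> by fact
      have ih: "integrable \<nu> h" by (rule bint[OF \<nu> ch B])
      have iG: "integrable \<nu> G" by (rule bint[OF \<nu> trig_poly_continuous[OF tG] K])
      have iq: "integrable \<nu> (\<lambda>x. \<Sum>i\<in>I. (x i)\<^sup>2)" using q(1) by auto
      have "\<bar>integral\<^sup>L \<nu> h - integral\<^sup>L \<nu> G\<bar> = \<bar>\<integral>x. h x - G x \<partial>\<nu>\<bar>" using ih iG by simp
      also have "\<dots> \<le> (\<integral>x. \<bar>h x - G x\<bar> \<partial>\<nu>)" by (rule integral_abs_bound)
      also have "\<dots> \<le> (\<integral>x. e / 8 + 2 * B / R\<^sup>2 * (\<Sum>i\<in>I. (x i)\<^sup>2) \<partial>\<nu>)"
        using ih iG iq pw by (intro integral_mono) auto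
      also have "\<dots> = e / 8 + 2 * B / R\<^sup>2 * (\<Sum>i\<in>I. \<integral>x. (x i)\<^sup>2 \<partial>\<nu>)" using iq q(1) by (simp add: prob_space)
      also have "\<dots> \<le> e / 8 + 2 * B / R\<^sup>2 * D" using q(2) B0 by (intro add_left_mono mult_left_mono) auto
      also have "\<dots> \<le> e / 8 + e / 4" using R2 by simp
      finally show ?thesis .
    qed
    have err': "\<bar>integral\<^sup>L \<mu>' h - integral\<^sup>L \<mu>' G\<bar> \<le> e / 8 + e / 4"
      unfolding D_def by (rule err[OF \<mu>' tight']) (auto simp: D_def intro!: sum_mono)
    have ev: "eventually (\<lambda>N. \<forall>i\<in>I. integrable (\<mu> N) (\<lambda>x. (x i)\<^sup>2) \<and> (\<integral>x. (x i)\<^sup>2 \<partial>\<mu> N) \<le> C i) sequentially"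
      by (rule eventually_ball_finite[OF I]) (use C in auto)
    have "e / 8 > 0" using e by simp
    from tendstoD[OF trig[OF tG] this]
    show "eventually (\<lambda>N. dist (integral\<^sup>L (\<mu> N) f) (integral\<^sup>L \<mu>' f) < e) sequentially"
      using ev \<mu>
    proof eventually_elim
      case (elim N)
      have "\<bar>integral\<^sup>L (\<mu> N) h - integral\<^sup>L (\<mu> N) G\<bar> \<le> e / 8 + e / 4"
      proof (rule err)
        show "(\<Sum>i\<in>I. \<integral>x. (x i)\<^sup>2 \<partial>\<mu> N) \<le> D"
          unfolding D_def
        proof (rule sum_mono)
          fix i assume "i \<in> I"
          then have "(\<integral>x. (x i)\<^sup>2 \<partial>\<mu> N) \<le> C i" using elim by blast
          then show "(\<integral>x. (x i)\<^sup>2 \<partial>\<mu> N) \<le> \<bar>C i\<bar> + \<bar>\<integral>x. (x i)\<^sup>2 \<partial>\<mu>'\<bar>" by linarith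
        qed
      qed (use elim in auto)
      moreover have "\<bar>integral\<^sup>L (\<mu> N) G - integral\<^sup>L \<mu>' G\<bar> < e / 8" using elim by (simp add: dist_real_def)
      ultimately have "\<bar>integral\<^sup>L (\<mu> N) h - integral\<^sup>L \<mu>' h\<bar> < e" using err' e by linarith
      then show ?case using elim \<mu>' by (simp add: hf dist_real_def)
    qed
  qed
qed

section \<open>Convergence in distribution on the real line\<close>

lemma char_cos_sin:
  assumes "real_distribution \<nu>"
  shows "char \<nu> t = complex_of_real (\<integral>x. cos (t * x) \<partial>\<nu>) + \<i> * complex_of_real (\<integral>x. sin (t * x) \<partial>\<nu>)"
proof -
  interpret real_distribution \<nu> by fact
  have i: "complex_integrable \<nu> (\<lambda>x. iexp (t * x))" by (rule integrable_iexp) auto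
  have "Re (char \<nu> t) = (\<integral>x. cos (t * x) \<partial>\<nu>)" "Im (char \<nu> t) = (\<integral>x. sin (t * x) \<partial>\<nu>)"
    unfolding char_def using integral_Re[OF i] integral_Im[OF i] by (simp_all add: Re_exp Im_exp)
  then show ?thesis by (simp add: complex_eq_iff)
qed

lemma weak_conv_m_of_trig:
  fixes \<mu> :: "nat \<Rightarrow> real measure"
  assumes \<mu>: "eventually (\<lambda>N. real_distribution (\<mu> N)) sequentially" and \<mu>': "real_distribution \<mu>'"
    and conv: "\<And>t. (\<lambda>N. \<integral>x. cos (t * x) \<partial>\<mu> N) \<longlonglongrightarrow> (\<integral>x. cos (t * x) \<partial>\<mu>')"
      "\<And>t. (\<lambda>N. \<integral>x. sin (t * x) \<partial>\<mu> N) \<longlonglongrightarrow> (\<integral>x. sin (t * x) \<partial>\<mu>')"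
  shows "weak_conv_m \<mu> \<mu>'"
proof -
  \<comment> \<open>Finitely many measures may fail to be probability measures, as the empirical
    measure for N = 0 does; the sequence is shifted past them.\<close>
  obtain n0 where n0: "\<And>n. n \<ge> n0 \<Longrightarrow> real_distribution (\<mu> n)" using \<mu> unfolding eventually_sequentially by blast
  have "weak_conv_m (\<lambda>n. \<mu> (n + n0)) \<mu>'"
  proof (rule levy_continuity)
    show "real_distribution (\<mu> (n + n0))" for n by (rule n0) simp
    show "real_distribution \<mu>'" by fact
    fix t
    have "(\<lambda>n. complex_of_real (\<integral>x. cos (t * x) \<partial>\<mu> (n + n0)) + \<i> * complex_of_real (\<integral>x. sin (t * x) \<partial>\<mu> (n + n0)))
      \<longlonglongrightarrow> complex_of_real (\<integral>x. cos (t * x) \<partial>\<mu>') + \<i> * complex_of_real (\<integral>x. sin (t * x) \<partial>\<mu>')"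
      by (intro tendsto_intros LIMSEQ_ignore_initial_segment[OF conv(1)] LIMSEQ_ignore_initial_segment[OF conv(2)])
    then show "(\<lambda>n. char (\<mu> (n + n0)) t) \<longlonglongrightarrow> char \<mu>' t"
      using n0 by (simp add: char_cos_sin \<mu>')
  qed
  then show ?thesis unfolding weak_conv_m_def weak_conv_def
    by (auto intro: LIMSEQ_offset[where k = n0])
qed

section \<open>Measures on the unit interval\<close>

definition unit_distribution :: "real measure \<Rightarrow> bool" where
  "unit_distribution \<nu> \<longleftrightarrow> real_distribution \<nu> \<and> (AE x in \<nu>. x \<in> {0..1})"

lemma unit_distributionD:
  assumes "unit_distribution \<nu>"
  shows "real_distribution \<nu>" "AE x in \<nu>. x \<in> {0..1}"
  using assms by (auto simp only: unit_distribution_def)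

lemma unit_distribution_iff:
  "unit_distribution \<nu> \<longleftrightarrow> sets \<nu> = sets borel \<and> prob_space \<nu> \<and> emeasure \<nu> {0..1} = 1"
proof -
  have "(AE x in \<nu>. x \<in> {0..1}) \<longleftrightarrow> emeasure \<nu> {0..1} = 1" if "sets \<nu> = sets borel" "prob_space \<nu>"
  proof -
    interpret prob_space \<nu> by fact
    have "{0..1} \<in> events" using that(1) by simp
    from AE_in_set_eq_1[OF this] show ?thesis by (simp add: emeasure_eq_measure)
  qed
  then show ?thesis
    unfolding unit_distribution_def real_distribution_def real_distribution_axioms_def by blast
qed

lemma unit_distribution_integrable:
  fixes g :: "real \<Rightarrow> real"
  assumes "unit_distribution \<nu>" "continuous_on UNIV g"
  shows "integrable \<nu> g"
proof -
  interpret real_distribution \<nu> using assms by (simp add: unit_distribution_def)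
  have "bounded (g ` {0..1})"
    by (intro compact_imp_bounded compact_continuous_image continuous_on_subset[OF assms(2)]) auto
  then obtain B where "\<forall>y\<in>g ` {0..1}. norm y \<le> B" unfolding bounded_iff ..
  then have B: "\<And>x. x \<in> {0..1} \<Longrightarrow> norm (g x) \<le> B" by simp
  have "g \<in> borel_measurable borel" by (rule borel_measurable_continuous_onI[OF assms(2)])
  then have "g \<in> borel_measurable \<nu>" by (simp cong: measurable_cong_sets)
  moreover have "AE x in \<nu>. norm (g x) \<le> B"
    by (rule eventually_mono[OF unit_distributionD(2)[OF assms(1)] B])
  ultimately show ?thesis by (intro integrable_const_bound)
qed

lemma integral_poly:
  assumes "unit_distribution \<nu>"
  shows "integral\<^sup>L \<nu> (poly p) = (\<Sum>k\<le>degree p. coeff p k * (\<integral>x. x ^ k \<partial>\<nu>))"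
proof -
  have "integrable \<nu> (\<lambda>x. x ^ k)" for k using assms by (rule unit_distribution_integrable) (intro continuous_intros)
  then show ?thesis unfolding poly_altdef by simp
qed

text \<open>Uniform polynomial approximation on [0, 1] bounds the replacement error for all these
  measures simultaneously, and polynomials converge by their moments.\<close>

lemma unit_distribution_integral_tendsto:
  fixes g :: "real \<Rightarrow> real"
  assumes \<mu>: "eventually (\<lambda>N. unit_distribution (\<mu> N)) sequentially" and \<nu>: "unit_distribution \<nu>"
    and conv: "\<And>k. (\<lambda>N. \<integral>x. x ^ k \<partial>\<mu> N) \<longlonglongrightarrow> (\<integral>x. x ^ k \<partial>\<nu>)"
    and g: "continuous_on UNIV g"
  shows "(\<lambda>N. integral\<^sup>L (\<mu> N) g) \<longlonglongrightarrow> integral\<^sup>L \<nu> g"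
proof (rule tendstoI)
  fix e :: real assume e: "e > 0"
  have "compact {0..1::real}" "continuous_on {0..1} g" "e / 3 > 0" using e g continuous_on_subset by auto
  then obtain P where P: "real_polynomial_function P" "\<And>x. x \<in> {0..1} \<Longrightarrow> \<bar>g x - P x\<bar> < e / 3"
    using Stone_Weierstrass_real_polynomial_function by metis
  then obtain a n where a: "P = (\<lambda>x. \<Sum>i\<le>n. a i * x ^ i)" unfolding real_polynomial_function_iff_sum by blast
  have cP: "continuous_on UNIV P" unfolding a by (intro continuous_intros)
  have intP: "integral\<^sup>L \<rho> P = (\<Sum>i\<le>n. a i * (\<integral>x. x ^ i \<partial>\<rho>))" if "unit_distribution \<rho>" for \<rho>
  proof -
    have "integrable \<rho> (\<lambda>x. x ^ k)" for k using that by (rule unit_distribution_integrable) (intro continuous_intros)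
    then show ?thesis unfolding a by simp
  qed
  have err: "\<bar>integral\<^sup>L \<rho> g - integral\<^sup>L \<rho> P\<bar> \<le> e / 3" if r: "unit_distribution \<rho>" for \<rho>
  proof -
    interpret real_distribution \<rho> using r by (simp add: unit_distribution_def)
    have i: "integrable \<rho> g" "integrable \<rho> P" using unit_distribution_integrable[OF r] g cP by auto
    have "integral\<^sup>L \<rho> g - integral\<^sup>L \<rho> P = (\<integral>x. g x - P x \<partial>\<rho>)" using i by simp
    moreover have "\<bar>\<integral>x. g x - P x \<partial>\<rho>\<bar> \<le> (\<integral>x. \<bar>g x - P x\<bar> \<partial>\<rho>)" by (rule integral_abs_bound)
    moreover have "(\<integral>x. \<bar>g x - P x\<bar> \<partial>\<rho>) \<le> (\<integral>x. e / 3 \<partial>\<rho>)"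
    proof (rule integral_mono_AE)
      show "AE x in \<rho>. \<bar>g x - P x\<bar> \<le> e / 3"
        by (rule eventually_mono[OF unit_distributionD(2)[OF r] less_imp_le[OF P(2)]])
    qed (use i in auto)
    moreover have "(\<integral>x. e / 3 \<partial>\<rho>) = e / 3" using prob_space by simp
    ultimately show ?thesis by linarith
  qed
  have "(\<lambda>N. \<Sum>i\<le>n. a i * (\<integral>x. x ^ i \<partial>\<mu> N)) \<longlonglongrightarrow> (\<Sum>i\<le>n. a i * (\<integral>x. x ^ i \<partial>\<nu>))"
    by (intro tendsto_intros conv)
  from tendstoD[OF this \<open>e / 3 > 0\<close>] \<mu> show "eventually (\<lambda>N. dist (integral\<^sup>L (\<mu> N) g) (integral\<^sup>L \<nu> g) < e) sequentially"
  proof eventually_elim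
    case (elim N)
    then have "\<bar>integral\<^sup>L (\<mu> N) P - integral\<^sup>L \<nu> P\<bar> < e / 3" using intP[OF elim(2)] intP[OF \<nu>] by (simp add: dist_real_def)
    then show ?case using err[OF elim(2)] err[OF \<nu>] unfolding dist_real_def by linarith
  qed
qed

lemma weak_conv_m_of_moments:
  assumes "eventually (\<lambda>N. unit_distribution (\<mu> N)) sequentially" "unit_distribution \<nu>"
    and "\<And>k. (\<lambda>N. \<integral>x. x ^ k \<partial>\<mu> N) \<longlonglongrightarrow> (\<integral>x. x ^ k \<partial>\<nu>)"
  shows "weak_conv_m \<mu> \<nu>"
proof (rule weak_conv_m_of_trig)
  show "eventually (\<lambda>N. real_distribution (\<mu> N)) sequentially"
    using assms(1) by (rule eventually_mono) (simp add: unit_distribution_def)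
  show "real_distribution \<nu>" using assms(2) by (simp add: unit_distribution_def)
  have "continuous_on UNIV (\<lambda>x::real. cos (t * x))" "continuous_on UNIV (\<lambda>x::real. sin (t * x))" for t
    by (intro continuous_intros)+
  then show "(\<lambda>N. \<integral>x. cos (t * x) \<partial>\<mu> N) \<longlonglongrightarrow> (\<integral>x. cos (t * x) \<partial>\<nu>)"
    "(\<lambda>N. \<integral>x. sin (t * x) \<partial>\<mu> N) \<longlonglongrightarrow> (\<integral>x. sin (t * x) \<partial>\<nu>)" for t
    by (auto intro!: unit_distribution_integral_tendsto[OF assms])
qed

text \<open>Moment convergence applied to a constant sequence identifies the integrals of all
  continuous functions, in particular the characteristic functions.\<close>

lemma unit_distribution_unique:
  assumes "unit_distribution \<mu>" "unit_distribution \<nu>" "\<And>k. (\<integral>x. x ^ k \<partial>\<mu>) = (\<integral>x. x ^ k \<partial>\<nu>)"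
  shows "\<mu> = \<nu>"
proof -
  have eq: "integral\<^sup>L \<mu> g = integral\<^sup>L \<nu> g" if "continuous_on UNIV g" for g :: "real \<Rightarrow> real"
    using unit_distribution_integral_tendsto[of "\<lambda>_. \<mu>" \<nu> g] assms that by (auto simp: LIMSEQ_const_iff)
  have d: "real_distribution \<mu>" "real_distribution \<nu>" using assms by (auto simp: unit_distribution_def)
  have "char \<mu> t = char \<nu> t" for t
    unfolding char_cos_sin[OF d(1)] char_cos_sin[OF d(2)]
    by (intro arg_cong2[where f = "(+)"] arg_cong2[where f = "(*)"] arg_cong[where f = complex_of_real] eq refl continuous_intros)
  then show ?thesis by (intro Levy_uniqueness d) auto
qed

lemma unit_distribution_limit_exists:
  assumes \<mu>: "\<And>n. unit_distribution (\<mu> n)" and conv: "\<And>k. (\<lambda>n. \<integral>x. x ^ k \<partial>\<mu> n) \<longlonglongrightarrow> u k"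
  shows "\<exists>\<nu>. unit_distribution \<nu> \<and> (\<forall>k. (\<integral>x. x ^ k \<partial>\<nu>) = u k)"
proof -
  have rd: "real_distribution (\<mu> n)" for n using \<mu> by (simp add: unit_distribution_def)
  have "tight \<mu>"
    unfolding tight_def
  proof (intro conjI allI impI rd)
    fix \<epsilon> :: real assume e: "\<epsilon> > 0"
    \<comment> \<open>Tightness is formulated with half-open intervals; this one contains [0, 1] for
      every n.\<close>
    have "measure (\<mu> n) {-1<..1} = 1" for n
    proof -
      interpret real_distribution "\<mu> n" by (rule rd)
      have "{-1<..1} \<in> events" by simp
      moreover have "AE x in \<mu> n. x \<in> {-1<..1}"
        by (rule eventually_mono[OF unit_distributionD(2)[OF \<mu>[of n]]]) simp
      ultimately show ?thesis using AE_in_set_eq_1 by blast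
    qed
    then have "(-1::real) < 1 \<and> (\<forall>n. 1 - \<epsilon> < measure (\<mu> n) {-1<..1})" using e by simp
    then show "\<exists>a b. a < b \<and> (\<forall>n. 1 - \<epsilon> < measure (\<mu> n) {a<..b})" by blast
  qed
  from tight_imp_convergent_subsubsequence[OF this strict_mono_id]
  obtain r \<nu> where r: "strict_mono r" and \<nu>: "real_distribution \<nu>" "weak_conv_m (\<lambda>n. \<mu> (r n)) \<nu>" by (auto simp: comp_def)
  interpret \<nu>: real_distribution \<nu> by fact
  have lim: "(\<lambda>n. integral\<^sup>L (\<mu> (r n)) g) \<longlonglongrightarrow> integral\<^sup>L \<nu> g" if "\<And>x. isCont g x" "\<And>x. norm (g x) \<le> 1" for g :: "real \<Rightarrow> real"
    by (rule weak_conv_imp_integral_bdd_continuous_conv[OF rd \<nu>(1) \<nu>(2) that])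
  \<comment> \<open>Clamping to [0, 1]. The distance to the clamped point detects the support of the
    limit, and powers of it are bounded continuous substitutes for x^k.\<close>
  define cl where "cl = (\<lambda>x::real. max 0 (min 1 x))"
  have c1: "isCont (\<lambda>x. min 1 \<bar>x - cl x\<bar>) x" for x unfolding cl_def by (intro continuous_intros)
  have c2: "isCont (\<lambda>x. cl x ^ k) x" for x k unfolding cl_def by (intro continuous_intros)
  have cl01: "0 \<le> cl x" "cl x \<le> 1" "x \<in> {0..1} \<Longrightarrow> cl x = x" "cl x = x \<Longrightarrow> x \<in> {0..1}" for x by (auto simp: cl_def)
  have "(\<lambda>n. \<integral>x. min 1 \<bar>x - cl x\<bar> \<partial>\<mu> (r n)) \<longlonglongrightarrow> (\<integral>x. min 1 \<bar>x - cl x\<bar> \<partial>\<nu>)"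
    by (rule lim[OF c1]) simp
  moreover have "(\<integral>x. min 1 \<bar>x - cl x\<bar> \<partial>\<mu> (r n)) = 0" for n
    by (rule integral_eq_zero_AE, rule eventually_mono[OF unit_distributionD(2)[OF \<mu>]]) (simp add: cl01)
  ultimately have "(\<integral>x. min 1 \<bar>x - cl x\<bar> \<partial>\<nu>) = 0" by (simp add: LIMSEQ_const_iff)
  moreover have "integrable \<nu> (\<lambda>x. min 1 \<bar>x - cl x\<bar>)"
    unfolding cl_def by (rule \<nu>.integrable_const_bound[where B = 1]) auto
  ultimately have "AE x in \<nu>. min 1 \<bar>x - cl x\<bar> = 0"
    by (subst integral_nonneg_eq_0_iff_AE[symmetric]) auto
  then have AE: "AE x in \<nu>. x \<in> {0..1}" by (rule eventually_mono) (rule cl01, simp add: min_def split: if_splits)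
  have "(\<integral>x. x ^ k \<partial>\<nu>) = u k" for k
  proof -
    have "(\<lambda>n. \<integral>x. cl x ^ k \<partial>\<mu> (r n)) \<longlonglongrightarrow> (\<integral>x. cl x ^ k \<partial>\<nu>)"
      by (rule lim[OF c2]) (simp add: cl01 power_le_one)
    moreover have "(\<integral>x. cl x ^ k \<partial>\<rho>) = (\<integral>x. x ^ k \<partial>\<rho>)" if r: "unit_distribution \<rho>" for \<rho>
    proof -
      interpret real_distribution \<rho> by (rule unit_distributionD(1)[OF r])
      have "AE x in \<rho>. cl x ^ k = x ^ k" by (rule eventually_mono[OF unit_distributionD(2)[OF r]]) (simp add: cl01)
      then show ?thesis unfolding cl_def by (intro integral_cong_AE) auto
    qed
    ultimately have "(\<lambda>n. \<integral>x. x ^ k \<partial>\<mu> (r n)) \<longlonglongrightarrow> (\<integral>x. x ^ k \<partial>\<nu>)"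
      using \<mu> \<nu>(1) AE by (simp add: unit_distribution_def)
    moreover have "(\<lambda>n. \<integral>x. x ^ k \<partial>\<mu> (r n)) \<longlonglongrightarrow> u k"
      using LIMSEQ_subseq_LIMSEQ[OF conv r] by (simp add: comp_def)
    ultimately show ?thesis by (rule LIMSEQ_unique)
  qed
  then show ?thesis using \<nu>(1) AE unfolding unit_distribution_def by blast
qed

section \<open>The empirical moments of the Jacobi ensemble\<close>

lemma integral_empirical:
  assumes "h \<in> borel_measurable borel"
  shows "integral\<^sup>L (empirical N x) h = (\<Sum>i\<in>{1..N}. h (x i)) / real N"
proof -
  have "x \<in> measurable (uniform_count_measure {1..N}) borel"
    by (auto simp: measurable_def space_uniform_count_measure sets_uniform_count_measure)
  then have "integral\<^sup>L (empirical N x) h = (\<integral>i. h (x i) \<partial>uniform_count_measure {1..N})"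
    unfolding empirical_def using assms by (rule integral_distr)
  then show ?thesis by (simp add: integral_uniform_count_measure)
qed

lemma integral_empirical_power: "(\<integral>z. z ^ k \<partial>empirical N x) = emp_moment N x k"
  by (simp add: integral_empirical emp_moment_def)

lemma integral_empirical_poly: "integral\<^sup>L (empirical N x) (poly p) = (\<Sum>k\<le>degree p. coeff p k * emp_moment N x k)"
proof -
  have "poly p \<in> borel_measurable borel" by (intro borel_measurable_continuous_onI continuous_intros)
  then show ?thesis
    by (simp add: integral_empirical poly_altdef emp_moment_def sum.swap[of _ "{1..N}"] sum_divide_distrib sum_distrib_left)
qed

lemma unit_distribution_empirical:
  assumes "N \<ge> 1" "x \<in> unit_cube N"
  shows "unit_distribution (empirical N x)"
proof -
  have m: "x \<in> measurable (uniform_count_measure {1..N}) borel"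
    by (auto simp: measurable_def space_uniform_count_measure sets_uniform_count_measure)
  have "prob_space (uniform_count_measure {1..N})" by (rule prob_space_uniform_count_measure) (use assms in auto)
  from prob_space.prob_space_distr[OF this m] have "prob_space (empirical N x)" by (simp add: empirical_def)
  moreover have "AE z in empirical N x. z \<in> {0..1}"
    unfolding empirical_def by (subst AE_distr_iff[OF m]) (use unit_cubeD[OF assms(2)] in \<open>auto intro!: AE_I2 simp: space_uniform_count_measure\<close>)
  ultimately show ?thesis
    unfolding unit_distribution_def real_distribution_def real_distribution_axioms_def by (simp add: empirical_def)
qed

text \<open>The empirical moments, changed on a null set so as to be moments of a measure on \<open>[0, 1]\<close> everywhere.\<close>

definition cube_moment :: "nat \<Rightarrow> (nat \<Rightarrow> real) \<Rightarrow> nat \<Rightarrow> real" where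
  "cube_moment N x k = (if N \<ge> 1 \<and> x \<in> unit_cube N then emp_moment N x k else if k = 0 then 1 else 0)"

lemma cube_moment_range: "0 \<le> cube_moment N x k" "cube_moment N x k \<le> 1" "cube_moment N x 0 = 1"
proof -
  have "0 \<le> emp_moment N x k \<and> emp_moment N x k \<le> 1" if "N \<ge> 1" "x \<in> unit_cube N"
  proof -
    have r: "0 \<le> x i ^ k \<and> x i ^ k \<le> 1" if "i \<in> {1..N}" for i
      using unit_cubeD[OF \<open>x \<in> unit_cube N\<close> that] by (auto intro: power_le_one)
    have "(\<Sum>i\<in>{1..N}. x i ^ k) \<le> (\<Sum>i\<in>{1..N}. 1)" using r by (intro sum_mono) auto
    moreover have "0 \<le> (\<Sum>i\<in>{1..N}. x i ^ k)" using r by (intro sum_nonneg) auto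
    ultimately show ?thesis using \<open>N \<ge> 1\<close> by (simp add: emp_moment_def)
  qed
  then show "0 \<le> cube_moment N x k" "cube_moment N x k \<le> 1" by (auto simp: cube_moment_def)
  show "cube_moment N x 0 = 1" by (auto simp: cube_moment_def emp_moment_def)
qed

lemma pred_unit_cube [measurable]: "Measurable.pred (config_space N) (\<lambda>x. x \<in> unit_cube N)"
proof -
  note [measurable] = measurable_coordinate
  have "Measurable.pred (config_space N) (\<lambda>x. \<forall>i\<in>{1..N}. 0 \<le> x i \<and> x i \<le> 1)"
    by (intro pred_intros_logic pred_intros_finite borel_measurable_pair_factors measurable_coordinate) auto
  then show ?thesis by (simp add: unit_cube_def image_subset_iff)
qed

lemma borel_measurable_cube_moment [measurable]: "(\<lambda>x. cube_moment N x k) \<in> borel_measurable (config_space N)"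
  unfolding cube_moment_def by measurable

lemma measurable_jacobi_ensemble: "borel_measurable (jacobi_ensemble \<beta> a b N) = borel_measurable (config_space N)"
  by (rule measurable_cong_sets) (auto simp: sets_jacobi_ensemble)

lemma AE_cube_moment:
  assumes "\<beta> > 0" "a > -1" "b > -1" "N \<ge> 1"
  shows "AE x in jacobi_ensemble \<beta> a b N. cube_moment N x = emp_moment N x"
  using AE_jacobi_ensemble_unit_cube[OF assms(1-3)]
  by (rule eventually_mono) (use assms(4) in \<open>auto simp: cube_moment_def fun_eq_iff\<close>)

lemma integral_cube_moment:
  fixes F :: "(nat \<Rightarrow> real) \<Rightarrow> real"
  assumes "\<beta> > 0" "a > -1" "b > -1" "N \<ge> 1"
    and "(\<lambda>x. F (cube_moment N x)) \<in> borel_measurable (config_space N)" "(\<lambda>x. F (emp_moment N x)) \<in> borel_measurable (config_space N)"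
  shows "(\<integral>x. F (cube_moment N x) \<partial>jacobi_ensemble \<beta> a b N) = (\<integral>x. F (emp_moment N x) \<partial>jacobi_ensemble \<beta> a b N)"
  by (rule integral_cong_AE)
    (use assms AE_cube_moment[OF assms(1-4)] in \<open>auto simp: measurable_jacobi_ensemble elim!: eventually_mono\<close>)

theorem loop_model_jacobi_ensemble:
  assumes par: "a > -1" "b > -1" "c > 0" and \<beta>: "\<And>N. N \<ge> 1 \<Longrightarrow> \<beta> N > 0" "(\<lambda>N. \<beta> N * real N) \<longlonglongrightarrow> 2 * c"
  shows "loop_model (\<lambda>N. jacobi_ensemble (\<beta> N) a b N) cube_moment \<beta> a b c"
proof (rule loop_model.intro)
  fix N k :: nat and x :: "nat \<Rightarrow> real"
  show "(\<lambda>x. cube_moment N x k) \<in> borel_measurable (jacobi_ensemble (\<beta> N) a b N)" by (simp add: measurable_jacobi_ensemble)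
  show "0 \<le> cube_moment N x k" "cube_moment N x k \<le> 1" "cube_moment N x 0 = 1" by (rule cube_moment_range)+
next
  fix N k :: nat and f f' f'' :: "real \<Rightarrow> real" and t :: "nat \<Rightarrow> real" and J :: "nat set"
  assume N: "N \<ge> 1" and f: "\<And>z. (f has_real_derivative f' z) (at z)" "\<And>z. (f' has_real_derivative f'' z) (at z)"
    "continuous_on UNIV f''" "finite J"
  have "continuous_on UNIV f" "continuous_on UNIV f'" using f(1,2) by (auto intro!: DERIV_continuous_on)
  then have [measurable]: "f \<in> borel_measurable borel" "f' \<in> borel_measurable borel"
    by (auto intro: borel_measurable_continuous_onI)
  let ?F = "\<lambda>M. f' (\<Sum>j\<in>J. t j * M j) * (\<Sum>j\<in>J. t j * (real j * (M (j + k) - M (Suc (j + k)))))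
    + real N * (f (\<Sum>j\<in>J. t j * M j) * loop_term (\<beta> N) a b N k M)"
  have "(\<integral>x. ?F (cube_moment N x) \<partial>jacobi_ensemble (\<beta> N) a b N) = (\<integral>x. ?F (emp_moment N x) \<partial>jacobi_ensemble (\<beta> N) a b N)"
    by (rule integral_cube_moment) (use par N \<beta>(1) in \<open>simp_all add: loop_term_def moment_conv_def\<close>)
  also have "\<dots> = 0" by (rule jacobi_loop_equation) (use f N par \<beta>(1) in auto)
  finally show "(\<integral>x. ?F (cube_moment N x) \<partial>jacobi_ensemble (\<beta> N) a b N) = 0" .
qed (use par \<beta> in \<open>auto intro: prob_space_jacobi_ensemble\<close>)

section \<open>The law of large numbers and the limiting measure\<close>

text \<open>The sum of the functions has finite mean, so the series converges almost surely and its
  terms tend to 0.\<close>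

lemma (in prob_space) AE_tendsto_0_of_summable_mean:
  fixes f :: "nat \<Rightarrow> 'a \<Rightarrow> real"
  assumes f: "\<And>n. integrable M (f n)" "\<And>n x. 0 \<le> f n x" "\<And>n. expectation (f n) \<le> g n" and g: "summable g"
  shows "AE x in M. (\<lambda>n. f n x) \<longlonglongrightarrow> 0"
proof -
  have g0: "0 \<le> g n" for n using f(3)[of n] Bochner_Integration.integral_nonneg[of M "f n"] f(2) by fastforce
  have "(\<integral>\<^sup>+x. (\<Sum>n. ennreal (f n x)) \<partial>M) = (\<Sum>n. \<integral>\<^sup>+x. ennreal (f n x) \<partial>M)"
    using borel_measurable_integrable[OF f(1)] by (intro nn_integral_suminf) auto
  also have "\<dots> \<le> (\<Sum>n. ennreal (g n))"
    using f by (intro suminf_le) (auto simp: nn_integral_eq_integral intro: ennreal_leI)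
  also have "\<dots> < \<infinity>" using ennreal_suminf_neq_top[OF g g0] by (simp add: less_top)
  finally have "AE x in M. (\<Sum>n. ennreal (f n x)) \<noteq> \<infinity>"
    using borel_measurable_integrable[OF f(1)] by (intro nn_integral_noteq_infinite) (auto simp: less_top)
  then have "AE x in M. (\<Sum>n. ennreal (f n x)) \<noteq> top" by simp
  then show ?thesis
    by (rule eventually_mono) (intro summable_LIMSEQ_zero summable_suminf_not_top f(2))
qed

context loop_model
begin

text \<open>Only the marginal laws enter the summed means, so the result holds for every coupling of
  the different sizes. The deterministic convergence of v to u completes it.\<close>

lemma AE_m_tendsto_u:
  fixes \<Omega> :: "'w measure" and X :: "nat \<Rightarrow> 'w \<Rightarrow> 'a"
  assumes \<Omega>: "prob_space \<Omega>" and X: "\<And>N. N \<ge> 1 \<Longrightarrow> X N \<in> measurable \<Omega> (M N)" "\<And>N. N \<ge> 1 \<Longrightarrow> distr \<Omega> (M N) (X N) = M N"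
  shows "AE \<omega> in \<Omega>. (\<lambda>N. m N (X N \<omega>) k) \<longlonglongrightarrow> u k"
proof -
  interpret \<Omega>: prob_space \<Omega> by fact
  obtain N0 C where N0: "N0 \<ge> 1" and C: "\<And>N. N \<ge> N0 \<Longrightarrow> (\<integral>x. (m N x k - v N k) ^ 4 \<partial>M N) \<le> C / real N ^ 2"
    using fourth_moment_summable by blast
  define f where "f = (\<lambda>n \<omega>. (m (n + N0) (X (n + N0) \<omega>) k - v (n + N0) k) ^ 4)"
  have N: "n + N0 \<ge> 1" for n using N0 by simp
  have b: "brv (M (n + N0)) (\<lambda>x. (m (n + N0) x k - v (n + N0) k) ^ 4)" for n by (intro brv_intros brv_m N)
  have i: "integrable (M (n + N0)) (\<lambda>x. (m (n + N0) x k - v (n + N0) k) ^ 4)" for n by (intro brv_integrable b prob N)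
  have "AE \<omega> in \<Omega>. (\<lambda>n. f n \<omega>) \<longlonglongrightarrow> 0"
  proof (rule \<Omega>.AE_tendsto_0_of_summable_mean)
    fix n
    have "integrable (distr \<Omega> (M (n + N0)) (X (n + N0))) (\<lambda>x. (m (n + N0) x k - v (n + N0) k) ^ 4)"
      unfolding X(2)[OF N] by (rule i)
    then show "integrable \<Omega> (f n)"
      unfolding f_def by (rule integrable_distr[OF X(1)[OF N]])
    have "\<Omega>.expectation (f n) = (\<integral>x. (m (n + N0) x k - v (n + N0) k) ^ 4 \<partial>distr \<Omega> (M (n + N0)) (X (n + N0)))"
      unfolding f_def by (rule integral_distr[symmetric, OF X(1)[OF N]]) (use b[of n] in \<open>simp add: brv_def\<close>)
    then show "\<Omega>.expectation (f n) \<le> C / real (n + N0) ^ 2"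
      unfolding X(2)[OF N] using C[of "n + N0"] by simp
    show "0 \<le> f n \<omega>" for \<omega> by (simp add: f_def)
  next
    have "summable (\<lambda>n. C * (1 / real n ^ 2))"
      using inverse_power_summable[of 2, where 'a = real] by (intro summable_mult) (simp add: inverse_eq_divide)
    then show "summable (\<lambda>n. C / real (n + N0) ^ 2)"
      using summable_ignore_initial_segment[of "\<lambda>n. C / real n ^ 2" N0] by simp
  qed
  then show ?thesis
  proof (rule eventually_mono)
    fix \<omega> assume "(\<lambda>n. f n \<omega>) \<longlonglongrightarrow> 0"
    then have "(\<lambda>n. root 4 (f n \<omega>)) \<longlonglongrightarrow> 0" using tendsto_real_root[of "\<lambda>n. f n \<omega>" 0 sequentially 4] by simp
    then have "(\<lambda>n. \<bar>m (n + N0) (X (n + N0) \<omega>) k - v (n + N0) k\<bar>) \<longlonglongrightarrow> 0"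
      using root_abs_power[of 4] by (simp add: f_def power_even_abs_numeral)
    then have "(\<lambda>n. m (n + N0) (X (n + N0) \<omega>) k - v (n + N0) k) \<longlonglongrightarrow> 0" by (rule tendsto_rabs_zero_cancel)
    from tendsto_add[OF this LIMSEQ_ignore_initial_segment[OF v_tendsto_u, of N0 k]]
    have "(\<lambda>n. m (n + N0) (X (n + N0) \<omega>) k) \<longlonglongrightarrow> u k" by simp
    then show "(\<lambda>N. m N (X N \<omega>) k) \<longlonglongrightarrow> u k" by (rule LIMSEQ_offset)
  qed
qed

end

lemma AE_empirical_moments_tendsto:
  fixes \<Omega> :: "'w measure" and X :: "nat \<Rightarrow> 'w \<Rightarrow> nat \<Rightarrow> real"
  assumes par: "a > -1" "b > -1" "c > 0" and \<beta>: "\<And>N. N \<ge> 1 \<Longrightarrow> \<beta> N > 0" "(\<lambda>N. \<beta> N * real N) \<longlonglongrightarrow> 2 * c"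
    and \<Omega>: "prob_space \<Omega>"
    and X: "\<And>N. N \<ge> 1 \<Longrightarrow> X N \<in> measurable \<Omega> (PiM {1..N} (\<lambda>_. borel))"
      "\<And>N. N \<ge> 1 \<Longrightarrow> distr \<Omega> (PiM {1..N} (\<lambda>_. borel)) (X N) = jacobi_ensemble (\<beta> N) a b N"
  shows "AE \<omega> in \<Omega>. (\<forall>N\<ge>1. X N \<omega> \<in> unit_cube N) \<and> (\<forall>k. (\<lambda>N. emp_moment N (X N \<omega>) k) \<longlonglongrightarrow> mean_moment (c + a + 1) c (2 * c + a + b + 2) k)"
proof -
  let ?M = "\<lambda>N. jacobi_ensemble (\<beta> N) a b N"
  interpret loop_model ?M cube_moment \<beta> a b c by (rule loop_model_jacobi_ensemble[OF par \<beta>])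
  have s: "sets (PiM {1..N} (\<lambda>_. borel)) = sets (?M N)" for N
    unfolding sets_jacobi_ensemble by (intro sets_PiM_cong) auto
  have X': "X N \<in> measurable \<Omega> (?M N)" "distr \<Omega> (?M N) (X N) = ?M N" if "N \<ge> 1" for N
    using X[OF that] measurable_cong_sets[OF refl s, of \<Omega> N] distr_cong[OF refl s, of \<Omega> "X N" "X N" N] by auto
  have "AE \<omega> in \<Omega>. N \<ge> 1 \<longrightarrow> X N \<omega> \<in> unit_cube N" for N
  proof (cases "N \<ge> 1")
    case True
    have "AE x in distr \<Omega> (?M N) (X N). x \<in> unit_cube N"
      unfolding X'(2)[OF True] by (rule AE_jacobi_ensemble_unit_cube) (use par \<beta>(1) True in auto)
    from AE_distrD[OF X'(1)[OF True] this] show ?thesis by (rule eventually_mono) simp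
  qed simp
  then have 1: "AE \<omega> in \<Omega>. \<forall>N. N \<ge> 1 \<longrightarrow> X N \<omega> \<in> unit_cube N" by (simp add: AE_all_countable)
  have "AE \<omega> in \<Omega>. (\<lambda>N. cube_moment N (X N \<omega>) k) \<longlonglongrightarrow> u k" for k
    by (rule AE_m_tendsto_u[OF \<Omega> X'])
  then have "AE \<omega> in \<Omega>. \<forall>k. (\<lambda>N. cube_moment N (X N \<omega>) k) \<longlonglongrightarrow> u k" by (simp add: AE_all_countable)
  with 1 show ?thesis
  proof eventually_elim
    case (elim \<omega>)
    have "eventually (\<lambda>N. cube_moment N (X N \<omega>) k = emp_moment N (X N \<omega>) k) sequentially" for k
      using eventually_ge_at_top[of "1::nat"] by (rule eventually_mono) (use elim in \<open>simp add: cube_moment_def\<close>)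
    from tendsto_cong[OF this] elim show ?case by (simp add: u_def)
  qed
qed

text \<open>The definite description denotes something only if a measure with these moments exists.
  It is obtained from the convergence of moments for independent ensembles of all sizes: one good
  sample point suffices, and compactness gives the limit.\<close>

lemma limit_measure_moments:
  assumes par: "a > -1" "b > -1" "c > (0::real)"
  shows "unit_distribution (limit_measure a b c)" "(\<integral>x. x ^ k \<partial>limit_measure a b c) = mean_moment (c + a + 1) c (2 * c + a + b + 2) k"
proof -
  let ?u = "mean_moment (c + a + 1) c (2 * c + a + b + 2)"
  \<comment> \<open>The value at N = 0 is irrelevant to the limit but keeps \<beta> positive, so
    that every factor of the product is a probability space.\<close>
  define \<beta> where "\<beta> = (\<lambda>N. if N \<ge> 1 then 2 * c / real N else 1)"
  have \<beta>: "\<beta> N > 0" for N using par by (simp add: \<beta>_def)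
  have \<beta>_lim: "(\<lambda>N. \<beta> N * real N) \<longlonglongrightarrow> 2 * c"
    by (rule tendsto_eventually, rule eventually_mono[OF eventually_ge_at_top[of 1]]) (simp add: \<beta>_def)
  let ?M = "\<lambda>N. jacobi_ensemble (\<beta> N) a b N"
  let ?\<Omega> = "PiM UNIV ?M"
  have p: "prob_space (?M N)" for N by (rule prob_space_jacobi_ensemble) (use \<beta> par in auto)
  have s: "sets (PiM {1..N} (\<lambda>_. borel)) = sets (?M N)" for N
    unfolding sets_jacobi_ensemble by (intro sets_PiM_cong) auto
  interpret \<Omega>: prob_space ?\<Omega> by (rule prob_space_PiM[OF p])
  have ae: "AE \<omega> in ?\<Omega>. (\<forall>N\<ge>1. \<omega> N \<in> unit_cube N) \<and> (\<forall>k. (\<lambda>N. emp_moment N (\<omega> N) k) \<longlonglongrightarrow> ?u k)"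
  proof (rule AE_empirical_moments_tendsto[OF par \<beta> \<beta>_lim])
    show "prob_space ?\<Omega>" by (rule \<Omega>.prob_space_axioms)
    fix N
    show "(\<lambda>\<omega>. \<omega> N) \<in> measurable ?\<Omega> (PiM {1..N} (\<lambda>_. borel))"
      unfolding measurable_cong_sets[OF refl s] by (rule measurable_component_singleton) simp
    show "distr ?\<Omega> (PiM {1..N} (\<lambda>_. borel)) (\<lambda>\<omega>. \<omega> N) = ?M N"
      using distr_PiM_component[of UNIV ?M N] p distr_cong[OF refl s, of ?\<Omega> "\<lambda>\<omega>. \<omega> N" "\<lambda>\<omega>. \<omega> N" N] by simp
  qed
  \<comment> \<open>An event of probability 1 is nonempty.\<close>
  have "\<exists>\<omega>. (\<forall>N\<ge>1. \<omega> N \<in> unit_cube N) \<and> (\<forall>k. (\<lambda>N. emp_moment N (\<omega> N) k) \<longlonglongrightarrow> ?u k)"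
  proof (rule ccontr)
    assume n: "\<not> ?thesis"
    from ae have "AE \<omega> in ?\<Omega>. False" by (rule eventually_mono) (use n in blast)
    then show False by (simp only: \<Omega>.AE_False)
  qed
  then obtain \<omega> where \<omega>: "\<And>N. N \<ge> 1 \<Longrightarrow> \<omega> N \<in> unit_cube N" "\<And>k. (\<lambda>N. emp_moment N (\<omega> N) k) \<longlonglongrightarrow> ?u k"
    by blast
  have "\<exists>\<nu>. unit_distribution \<nu> \<and> (\<forall>k. (\<integral>x. x ^ k \<partial>\<nu>) = ?u k)"
  proof (rule unit_distribution_limit_exists)
    show "unit_distribution (empirical (Suc n) (\<omega> (Suc n)))" for n by (rule unit_distribution_empirical) (use \<omega>(1) in auto)
    show "(\<lambda>n. \<integral>x. x ^ k \<partial>empirical (Suc n) (\<omega> (Suc n))) \<longlonglongrightarrow> ?u k" for k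
      unfolding integral_empirical_power by (rule LIMSEQ_Suc[OF \<omega>(2)])
  qed
  then obtain \<nu> where \<nu>: "unit_distribution \<nu>" "\<And>k. (\<integral>x. x ^ k \<partial>\<nu>) = ?u k" by blast
  have "limit_measure a b c = (THE \<rho>. unit_distribution \<rho> \<and> (\<forall>k. (\<integral>x. x ^ k \<partial>\<rho>) = ?u k))"
    unfolding limit_measure_def limit_parameters_moment[OF par] unit_distribution_iff by (simp add: conj_assoc)
  also have "\<dots> = \<nu>" by (rule the_equality) (use \<nu> unit_distribution_unique in auto)
  finally show "unit_distribution (limit_measure a b c)" "(\<integral>x. x ^ k \<partial>limit_measure a b c) = ?u k" using \<nu> by auto
qed

theorem empirical_law_of_large_numbers:
  fixes \<Omega> :: "'w measure" and X :: "nat \<Rightarrow> 'w \<Rightarrow> nat \<Rightarrow> real"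
  assumes par: "a > -1" "b > -1" "c > 0" and \<beta>: "\<And>N. N \<ge> 1 \<Longrightarrow> \<beta> N > 0" "(\<lambda>N. \<beta> N * real N) \<longlonglongrightarrow> 2 * c"
    and \<Omega>: "prob_space \<Omega>"
    and X: "\<And>N. N \<ge> 1 \<Longrightarrow> X N \<in> measurable \<Omega> (PiM {1..N} (\<lambda>_. borel))"
      "\<And>N. N \<ge> 1 \<Longrightarrow> distr \<Omega> (PiM {1..N} (\<lambda>_. borel)) (X N) = jacobi_ensemble (\<beta> N) a b N"
  shows "AE \<omega> in \<Omega>. weak_conv_m (\<lambda>N. empirical N (X N \<omega>)) (limit_measure a b c)"
    and "AE \<omega> in \<Omega>. (\<lambda>N. integral\<^sup>L (empirical N (X N \<omega>)) (poly p)) \<longlonglongrightarrow> integral\<^sup>L (limit_measure a b c) (poly p)"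
proof -
  have AE: "AE \<omega> in \<Omega>. (\<forall>N\<ge>1. X N \<omega> \<in> unit_cube N) \<and>
    (\<forall>k. (\<lambda>N. \<integral>x. x ^ k \<partial>empirical N (X N \<omega>)) \<longlonglongrightarrow> (\<integral>x. x ^ k \<partial>limit_measure a b c))"
    unfolding integral_empirical_power limit_measure_moments(2)[OF par] by (rule AE_empirical_moments_tendsto[OF par \<beta> \<Omega> X])
  note unit = limit_measure_moments(1)[OF par]
  have ev: "eventually (\<lambda>N. unit_distribution (empirical N (X N \<omega>))) sequentially" if "\<forall>N\<ge>1. X N \<omega> \<in> unit_cube N" for \<omega>
    using eventually_ge_at_top[of "1::nat"] by (rule eventually_mono) (use that in \<open>simp add: unit_distribution_empirical\<close>)
  show "AE \<omega> in \<Omega>. weak_conv_m (\<lambda>N. empirical N (X N \<omega>)) (limit_measure a b c)"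
    using AE by (rule eventually_mono) (rule weak_conv_m_of_moments[OF ev unit], auto)
  have c: "continuous_on UNIV (poly p)" by (intro continuous_intros)
  show "AE \<omega> in \<Omega>. (\<lambda>N. integral\<^sup>L (empirical N (X N \<omega>)) (poly p)) \<longlonglongrightarrow> integral\<^sup>L (limit_measure a b c) (poly p)"
    using AE by (rule eventually_mono) (rule unit_distribution_integral_tendsto[OF ev unit _ c], auto)
qed

section \<open>The central limit theorem\<close>

lemma gaussian_cos_sin_scaled:
  assumes "v \<ge> 0"
  shows "(\<integral>x. cos (s * x) \<partial>gaussian 0 v) = exp (- (s\<^sup>2 * v / 2))" "(\<integral>x. sin (s * x) \<partial>gaussian 0 v) = 0"
  using char_gaussian[OF assms, of s] unfolding char_cos_sin[OF real_distribution_gaussian[OF assms]]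
  by (simp_all add: complex_eq_iff exp_of_real del: of_real_exp)

lemma (in clt_model) variance_tendsto:
  assumes J: "finite J"
  shows "(\<lambda>N. real N * (\<integral>x. ((\<Sum>j\<in>J. t j * m N x j) - (\<integral>x. (\<Sum>j\<in>J. t j * m N x j) \<partial>M N))\<^sup>2 \<partial>M N)) \<longlonglongrightarrow> quad_form J t"
proof -
  let ?S = "\<lambda>N x. \<Sum>j\<in>J. t j * y N x j" and ?L = "\<lambda>N x. \<Sum>j\<in>J. t j * m N x j"
  have "(\<lambda>N. \<Sum>j\<in>J. t j * (\<integral>x. y N x j \<partial>M N)) \<longlonglongrightarrow> (\<Sum>j\<in>J. t j * 0)"
    by (intro tendsto_sum tendsto_mult tendsto_const mean_y_tendsto_0)
  then have "(\<lambda>N. (\<integral>x. (?S N x)\<^sup>2 \<partial>M N) - (\<Sum>j\<in>J. t j * (\<integral>x. y N x j \<partial>M N))\<^sup>2) \<longlonglongrightarrow> quad_form J t - (\<Sum>j\<in>J. t j * 0)\<^sup>2"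
    by (intro tendsto_diff tendsto_power quad_form_tendsto[OF J])
  moreover have "eventually (\<lambda>N. (\<integral>x. (?S N x)\<^sup>2 \<partial>M N) - (\<Sum>j\<in>J. t j * (\<integral>x. y N x j \<partial>M N))\<^sup>2
      = real N * (\<integral>x. (?L N x - (\<integral>x. ?L N x \<partial>M N))\<^sup>2 \<partial>M N)) sequentially"
    using eventually_ge_at_top[of "1::nat"]
  proof eventually_elim
    case (elim N)
    interpret prob_space "M N" by (rule prob[OF elim])
    have im: "integrable (M N) (\<lambda>x. m N x j)" for j by (rule brv_integrable[OF prob[OF elim] brv_m[OF elim]])
    have iy: "integrable (M N) (\<lambda>x. y N x j)" for j by (rule brv_integrable[OF prob[OF elim] brv_y[OF elim]])
    have iS: "integrable (M N) (?S N)" "integrable (M N) (\<lambda>x. (?S N x)\<^sup>2)"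
      by (intro brv_integrable prob elim brv_intros brv_y)+
    have mS: "expectation (?S N) = (\<Sum>j\<in>J. t j * expectation (\<lambda>x. y N x j))" using iy by simp
    have mL: "expectation (?L N) = (\<Sum>j\<in>J. t j * expectation (\<lambda>x. m N x j))" using im by simp
    have ey: "expectation (\<lambda>x. y N x j) = sqrt (real N) * (expectation (\<lambda>x. m N x j) - u j)" for j
      unfolding y_def using im by (simp add: prob_space)
    have "?S N x - expectation (?S N) = sqrt (real N) * (?L N x - expectation (?L N))" for x
      unfolding mS mL ey by (simp add: y_def sum_subtractf[symmetric] sum_distrib_left algebra_simps)
    then have "variance (?S N) = real N * variance (?L N)" by (simp add: power_mult_distrib)
    then show ?case using variance_eq[OF iS] mS by simp
  qed
  ultimately show ?thesis using J by (simp add: tendsto_cong)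
qed

locale jacobi_clt =
  fixes a b c :: real
  assumes parameters: "a > -1" "b > -1" "c > 0"

sublocale jacobi_clt \<subseteq> clt_model "\<lambda>N. jacobi_ensemble (2 * c / real N) a b N" cube_moment "\<lambda>N. 2 * c / real N" a b c
proof (rule clt_model.intro)
  show "loop_model (\<lambda>N. jacobi_ensemble (2 * c / real N) a b N) cube_moment (\<lambda>N. 2 * c / real N) a b c"
  proof (rule loop_model_jacobi_ensemble[OF parameters])
    show "(\<lambda>N. 2 * c / real N * real N) \<longlonglongrightarrow> 2 * c"
      by (rule tendsto_eventually, rule eventually_mono[OF eventually_ge_at_top[of 1]]) simp
  qed (use parameters in simp)
qed (simp add: clt_model_axioms_def)

section \<open>Fluctuations of the empirical measure itself\<close>

context jacobi_clt
begin

abbreviation "ensemble N \<equiv> jacobi_ensemble (2 * c / real N) a b N"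

text \<open>The counterpart of y for the unmodified empirical moments: almost surely equal to it,
  but not bounded off the cube.\<close>

definition "fluctuation N x k = sqrt (real N) * (emp_moment N x k - u k)"

lemma limit_moment: "(\<integral>x. x ^ k \<partial>limit_measure a b c) = u k"
  unfolding u_def by (rule limit_measure_moments(2)[OF parameters])

lemma AE_moment:
  assumes "N \<ge> 1"
  shows "AE x in ensemble N. cube_moment N x = emp_moment N x"
  by (rule AE_cube_moment) (use assms parameters in auto)

lemma AE_fluctuation:
  assumes "N \<ge> 1"
  shows "AE x in ensemble N. y N x = fluctuation N x"
  using AE_moment[OF assms] by (rule eventually_mono) (simp add: fun_eq_iff y_def fluctuation_def)

lemma measurable_moment [measurable]: "(\<lambda>x. emp_moment N x k) \<in> borel_measurable (ensemble N)"
  by (simp add: measurable_jacobi_ensemble)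

lemma measurable_fluctuation [measurable]: "(\<lambda>x. fluctuation N x k) \<in> borel_measurable (ensemble N)"
  unfolding fluctuation_def by (intro borel_measurable_times borel_measurable_diff borel_measurable_const measurable_moment)

lemma measurable_y: "N \<ge> 1 \<Longrightarrow> (\<lambda>x. y N x k) \<in> borel_measurable (ensemble N)"
  using brv_y by (simp add: brv_def)

lemma integral_fluctuation:
  fixes F :: "(nat \<Rightarrow> real) \<Rightarrow> real"
  assumes "N \<ge> 1" "(\<lambda>x. F (y N x)) \<in> borel_measurable (ensemble N)" "(\<lambda>x. F (fluctuation N x)) \<in> borel_measurable (ensemble N)"
  shows "(\<integral>x. F (fluctuation N x) \<partial>ensemble N) = (\<integral>x. F (y N x) \<partial>ensemble N)"
  by (rule integral_cong_AE[OF assms(3,2)], rule eventually_mono[OF AE_fluctuation[OF assms(1)]]) simp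

lemma fluctuation_cos_sin_tendsto:
  assumes J: "finite J"
  shows "(\<lambda>N. \<integral>x. cos (\<Sum>j\<in>J. t j * fluctuation N x j) \<partial>ensemble N) \<longlonglongrightarrow> exp (- quad_form J t / 2)"
    "(\<lambda>N. \<integral>x. sin (\<Sum>j\<in>J. t j * fluctuation N x j) \<partial>ensemble N) \<longlonglongrightarrow> 0"
proof -
  have "eventually (\<lambda>N. (\<integral>x. cos (\<Sum>j\<in>J. t j * fluctuation N x j) \<partial>ensemble N) = (\<integral>x. cos (\<Sum>j\<in>J. t j * y N x j) \<partial>ensemble N)) sequentially"
    using eventually_ge_at_top[of "1::nat"]
  proof eventually_elim
    case (elim N)
    note [measurable] = measurable_y[OF elim]
    show ?case by (rule integral_fluctuation[where F = "\<lambda>w. cos (\<Sum>j\<in>J. t j * w j)", OF elim]) measurable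
  qed
  then show "(\<lambda>N. \<integral>x. cos (\<Sum>j\<in>J. t j * fluctuation N x j) \<partial>ensemble N) \<longlonglongrightarrow> exp (- quad_form J t / 2)"
    using cos_sin_tendsto(1)[OF J] by (simp add: tendsto_cong)
  have "eventually (\<lambda>N. (\<integral>x. sin (\<Sum>j\<in>J. t j * fluctuation N x j) \<partial>ensemble N) = (\<integral>x. sin (\<Sum>j\<in>J. t j * y N x j) \<partial>ensemble N)) sequentially"
    using eventually_ge_at_top[of "1::nat"]
  proof eventually_elim
    case (elim N)
    note [measurable] = measurable_y[OF elim]
    show ?case by (rule integral_fluctuation[where F = "\<lambda>w. sin (\<Sum>j\<in>J. t j * w j)", OF elim]) measurable
  qed
  then show "(\<lambda>N. \<integral>x. sin (\<Sum>j\<in>J. t j * fluctuation N x j) \<partial>ensemble N) \<longlonglongrightarrow> 0"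
    using cos_sin_tendsto(2)[OF J] by (simp add: tendsto_cong)
qed

text \<open>Supplies the tightness bound for the multivariate convergence.\<close>

lemma fluctuation_second_moment:
  "\<exists>C. eventually (\<lambda>N. integrable (ensemble N) (\<lambda>x. (fluctuation N x k)\<^sup>2) \<and> (\<integral>x. (fluctuation N x k)\<^sup>2 \<partial>ensemble N) \<le> C) sequentially"
proof -
  have "eventually (\<lambda>N. (\<integral>x. y N x k * y N x k \<partial>ensemble N) < cov k k + 1) sequentially"
    by (rule order_tendstoD(2)[OF second_moment_tendsto]) simp
  with eventually_ge_at_top[of "1::nat"]
  have "eventually (\<lambda>N. integrable (ensemble N) (\<lambda>x. (fluctuation N x k)\<^sup>2) \<and> (\<integral>x. (fluctuation N x k)\<^sup>2 \<partial>ensemble N) \<le> cov k k + 1) sequentially"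
  proof eventually_elim
    case (elim N)
    note [measurable] = measurable_y[OF elim(1)]
    have i: "integrable (ensemble N) (\<lambda>x. (y N x k)\<^sup>2)" by (intro brv_integrable prob elim(1) brv_intros brv_y)
    have "AE x in ensemble N. (y N x k)\<^sup>2 = (fluctuation N x k)\<^sup>2"
      by (rule eventually_mono[OF AE_fluctuation[OF elim(1)]]) simp
    then have "integrable (ensemble N) (\<lambda>x. (y N x k)\<^sup>2) \<longleftrightarrow> integrable (ensemble N) (\<lambda>x. (fluctuation N x k)\<^sup>2)"
      by (intro integrable_cong_AE) measurable
    moreover have "(\<integral>x. (fluctuation N x k)\<^sup>2 \<partial>ensemble N) = (\<integral>x. (y N x k)\<^sup>2 \<partial>ensemble N)"
      by (rule integral_fluctuation[where F = "\<lambda>w. (w k)\<^sup>2", OF elim(1)]) measurable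
    ultimately show ?case using elim(2) i by (simp add: power2_eq_square)
  qed
  then show ?thesis ..
qed

lemma empirical_covariance_tendsto:
  "(\<lambda>N. real N * covar (ensemble N) (\<lambda>x. integral\<^sup>L (empirical N x) (\<lambda>y. y ^ k)) (\<lambda>x. integral\<^sup>L (empirical N x) (\<lambda>y. y ^ l))) \<longlonglongrightarrow> cov k l"
proof -
  have "eventually (\<lambda>N. covar (ensemble N) (\<lambda>x. emp_moment N x k) (\<lambda>x. emp_moment N x l)
      = covar (ensemble N) (\<lambda>x. cube_moment N x k) (\<lambda>x. cube_moment N x l)) sequentially"
    using eventually_ge_at_top[of "1::nat"]
  proof eventually_elim
    case (elim N)
    have p: "2 * c / real N > 0" using elim parameters by simp
    have "(\<integral>x. cube_moment N x j \<partial>ensemble N) = (\<integral>x. emp_moment N x j \<partial>ensemble N)" for j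
      by (rule integral_cube_moment[where F = "\<lambda>w. w j", OF p parameters(1,2) elim]) measurable
    then show ?case unfolding covar_def
      by (simp only:) (rule integral_cube_moment[where F = "\<lambda>w. (w k - _) * (w l - _)", OF p parameters(1,2) elim, symmetric],
        intro borel_measurable_times borel_measurable_diff borel_measurable_const borel_measurable_cube_moment,
        intro borel_measurable_times borel_measurable_diff borel_measurable_const borel_measurable_emp_moment)
  qed
  then show ?thesis unfolding integral_empirical_power
    by (intro Lim_transform_eventually[OF covariance_tendsto]) (auto elim!: eventually_mono)
qed

lemma integral_limit_poly: "integral\<^sup>L (limit_measure a b c) (poly p) = (\<Sum>k\<le>degree p. coeff p k * u k)"
  using integral_poly[OF limit_measure_moments(1)[OF parameters]] by (simp add: limit_moment)

lemma empirical_poly_variance_tendsto: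
  "(\<lambda>N. real N * prob_space.variance (ensemble N) (\<lambda>x. integral\<^sup>L (empirical N x) (poly p))) \<longlonglongrightarrow> quad_form {..degree p} (coeff p)"
proof -
  let ?L = "\<lambda>w. \<Sum>k\<le>degree p. coeff p k * w k"
  have "eventually (\<lambda>N. (\<integral>x. (?L (emp_moment N x) - (\<integral>x. ?L (emp_moment N x) \<partial>ensemble N))\<^sup>2 \<partial>ensemble N)
      = (\<integral>x. (?L (cube_moment N x) - (\<integral>x. ?L (cube_moment N x) \<partial>ensemble N))\<^sup>2 \<partial>ensemble N)) sequentially"
    using eventually_ge_at_top[of "1::nat"]
  proof eventually_elim
    case (elim N)
    have p: "2 * c / real N > 0" using elim parameters by simp
    have "(\<integral>x. ?L (cube_moment N x) \<partial>ensemble N) = (\<integral>x. ?L (emp_moment N x) \<partial>ensemble N)"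
      by (rule integral_cube_moment[where F = ?L, OF p parameters(1,2) elim]) measurable
    then show ?case
      by (simp only:) (rule integral_cube_moment[where F = "\<lambda>w. (?L w - _)\<^sup>2", OF p parameters(1,2) elim, symmetric],
        intro borel_measurable_power borel_measurable_diff borel_measurable_sum borel_measurable_times borel_measurable_const borel_measurable_cube_moment,
        intro borel_measurable_power borel_measurable_diff borel_measurable_sum borel_measurable_times borel_measurable_const borel_measurable_emp_moment)
  qed
  then show ?thesis unfolding integral_empirical_poly
    by (intro Lim_transform_eventually[OF variance_tendsto]) (auto elim!: eventually_mono)
qed

lemma empirical_poly_clt:
  "weak_conv_m
    (\<lambda>N. distr (ensemble N) borel
      (\<lambda>x. sqrt (real N) * (integral\<^sup>L (empirical N x) (poly p) - integral\<^sup>L (limit_measure a b c) (poly p))))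
    (gaussian 0 (quad_form {..degree p} (coeff p)))"
proof -
  let ?J = "{..degree p}" and ?\<sigma> = "quad_form {..degree p} (coeff p)"
  let ?S = "\<lambda>N x. \<Sum>k\<in>?J. coeff p k * fluctuation N x k"
  have S: "sqrt (real N) * (integral\<^sup>L (empirical N x) (poly p) - integral\<^sup>L (limit_measure a b c) (poly p)) = ?S N x" for N x
    unfolding integral_empirical_poly integral_limit_poly
    by (simp add: fluctuation_def sum_subtractf[symmetric] sum_distrib_left algebra_simps)
  have v: "?\<sigma> \<ge> 0" by (rule quad_form_nonneg) simp
  \<comment> \<open>Homogeneity of degree 2 turns the limit for the coefficients s * coeff p into
    the characteristic function at s of the polynomial statistic.\<close>
  have scale: "quad_form ?J (\<lambda>k. s * coeff p k) = s\<^sup>2 * ?\<sigma>" for s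
    unfolding quad_form_def by (simp add: sum_distrib_left power2_eq_square mult_ac)
  have sum: "s * ?S N x = (\<Sum>k\<in>?J. (s * coeff p k) * fluctuation N x k)" for s N x by (simp add: sum_distrib_left mult.assoc)
  show ?thesis unfolding S
  proof (rule weak_conv_m_of_trig)
    show "eventually (\<lambda>N. real_distribution (distr (ensemble N) borel (?S N))) sequentially"
      using eventually_ge_at_top[of "1::nat"]
    proof eventually_elim
      case (elim N)
      interpret prob_space "ensemble N" by (rule prob[OF elim])
      show ?case unfolding real_distribution_def real_distribution_axioms_def by (auto intro!: prob_space_distr)
    qed
    show "real_distribution (gaussian 0 ?\<sigma>)" by (rule real_distribution_gaussian[OF v])
    fix s
    show "(\<lambda>N. \<integral>x. cos (s * x) \<partial>distr (ensemble N) borel (?S N)) \<longlonglongrightarrow> (\<integral>x. cos (s * x) \<partial>gaussian 0 ?\<sigma>)"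
      using fluctuation_cos_sin_tendsto(1)[of ?J "\<lambda>k. s * coeff p k"]
      by (simp add: integral_distr sum scale gaussian_cos_sin_scaled[OF v])
    show "(\<lambda>N. \<integral>x. sin (s * x) \<partial>distr (ensemble N) borel (?S N)) \<longlonglongrightarrow> (\<integral>x. sin (s * x) \<partial>gaussian 0 ?\<sigma>)"
      using fluctuation_cos_sin_tendsto(2)[of ?J "\<lambda>k. s * coeff p k"]
      by (simp add: integral_distr sum scale gaussian_cos_sin_scaled[OF v])
  qed
qed

lemma psd_kernel_cov: "psd_kernel cov"
  unfolding psd_kernel_def
proof (intro conjI allI impI)
  fix J :: "nat set" and t :: "nat \<Rightarrow> real" assume "finite J"
  from quad_form_nonneg[OF this, of t] show "0 \<le> (\<Sum>i\<in>J. \<Sum>j\<in>J. t i * t j * cov i j)"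
    unfolding quad_form_def using cov_commute by simp
qed (rule cov_commute)

lemma distr_limit_combination:
  "finite J \<Longrightarrow> distr normal_sequence borel (\<lambda>\<omega>. \<Sum>n\<in>J. t n * gauss_seq cov n \<omega>) = gaussian 0 (quad_form J t)"
  unfolding quad_form_def by (rule distr_gauss_seq_combination[OF psd_kernel_cov])

lemma jointly_gaussian_limit: "jointly_gaussian normal_sequence I (gauss_seq cov)"
  unfolding jointly_gaussian_def
  using prob_space_normal_sequence distr_limit_combination quad_form_nonneg by (metis borel_measurable_gauss_seq)

lemma gaussian_vector_limit: "gaussian_vector normal_sequence I (gauss_seq cov) (\<lambda>_. 0) cov"
  unfolding gaussian_vector_def covar_def
  using jointly_gaussian_limit by (simp add: gauss_seq_moments[OF psd_kernel_cov])

lemma empirical_moments_clt: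
  fixes I :: "nat set"
  assumes I: "finite I"
  shows "weak_conv_PiM I
    (\<lambda>N. distr (ensemble N) (PiM I (\<lambda>_. borel))
      (\<lambda>x. \<lambda>n\<in>I. sqrt (real N) * (integral\<^sup>L (empirical N x) (\<lambda>y. y ^ n) - integral\<^sup>L (limit_measure a b c) (\<lambda>y. y ^ n))))
    (distr normal_sequence (PiM I (\<lambda>_. borel)) (\<lambda>\<omega>. \<lambda>n\<in>I. gauss_seq cov n \<omega>))"
proof -
  let ?B = "PiM I (\<lambda>_. borel :: real measure)"
  have mZ: "(\<lambda>x. \<lambda>n\<in>I. fluctuation N x n) \<in> measurable (ensemble N) ?B" for N by (intro measurable_restrict) measurable
  have mG: "(\<lambda>\<omega>. \<lambda>n\<in>I. gauss_seq cov n \<omega>) \<in> measurable normal_sequence ?B" by (intro measurable_restrict) measurable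
  have [measurable]: "(\<lambda>x. x i) \<in> borel_measurable ?B" if "i \<in> I" for i using that by measurable
  have mlin: "(\<lambda>x. \<Sum>i\<in>I. t i * x i) \<in> borel_measurable ?B" for t :: "nat \<Rightarrow> real" by measurable
  have trig: "(\<lambda>x. cos (\<Sum>i\<in>I. t i * x i)) \<in> borel_measurable ?B" "(\<lambda>x. sin (\<Sum>i\<in>I. t i * x i)) \<in> borel_measurable ?B" for t :: "nat \<Rightarrow> real"
    using mlin by measurable
  have G: "(\<integral>\<omega>. cos (\<Sum>i\<in>I. t i * gauss_seq cov i \<omega>) \<partial>normal_sequence) = exp (- quad_form I t / 2)"
    "(\<integral>\<omega>. sin (\<Sum>i\<in>I. t i * gauss_seq cov i \<omega>) \<partial>normal_sequence) = 0" for t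
    using gaussian_cos_sin_scaled[OF quad_form_nonneg[OF I, of t], of 1] unfolding distr_limit_combination[OF I, symmetric]
    by (simp_all add: integral_distr)
  show ?thesis unfolding integral_empirical_power limit_moment fluctuation_def[symmetric]
  proof (rule weak_conv_PiM_of_trig[OF I])
    show "eventually (\<lambda>N. prob_space (distr (ensemble N) ?B (\<lambda>x. \<lambda>n\<in>I. fluctuation N x n)) \<and>
        sets (distr (ensemble N) ?B (\<lambda>x. \<lambda>n\<in>I. fluctuation N x n)) = sets ?B) sequentially"
      using eventually_ge_at_top[of "1::nat"] by (rule eventually_mono) (auto intro!: prob_space.prob_space_distr prob mZ)
    show "prob_space (distr normal_sequence ?B (\<lambda>\<omega>. \<lambda>n\<in>I. gauss_seq cov n \<omega>))"
      by (rule prob_space.prob_space_distr[OF prob_space_normal_sequence mG])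
    fix t :: "nat \<Rightarrow> real"
    show "(\<lambda>N. \<integral>x. cos (\<Sum>i\<in>I. t i * x i) \<partial>distr (ensemble N) ?B (\<lambda>x. \<lambda>n\<in>I. fluctuation N x n))
        \<longlonglongrightarrow> (\<integral>x. cos (\<Sum>i\<in>I. t i * x i) \<partial>distr normal_sequence ?B (\<lambda>\<omega>. \<lambda>n\<in>I. gauss_seq cov n \<omega>))"
      unfolding integral_distr[OF mZ trig(1)] integral_distr[OF mG trig(1)]
      using fluctuation_cos_sin_tendsto(1)[OF I, of t] by (simp add: G cong: sum.cong)
    show "(\<lambda>N. \<integral>x. sin (\<Sum>i\<in>I. t i * x i) \<partial>distr (ensemble N) ?B (\<lambda>x. \<lambda>n\<in>I. fluctuation N x n))
        \<longlonglongrightarrow> (\<integral>x. sin (\<Sum>i\<in>I. t i * x i) \<partial>distr normal_sequence ?B (\<lambda>\<omega>. \<lambda>n\<in>I. gauss_seq cov n \<omega>))"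
      unfolding integral_distr[OF mZ trig(2)] integral_distr[OF mG trig(2)]
      using fluctuation_cos_sin_tendsto(2)[OF I, of t] by (simp add: G cong: sum.cong)
  next
    fix i assume i: "i \<in> I"
    have mi: "(\<lambda>x. (x i)\<^sup>2) \<in> borel_measurable ?B" using i by measurable
    show "\<exists>C. eventually (\<lambda>N. integrable (distr (ensemble N) ?B (\<lambda>x. \<lambda>n\<in>I. fluctuation N x n)) (\<lambda>x. (x i)\<^sup>2) \<and>
        (\<integral>x. (x i)\<^sup>2 \<partial>distr (ensemble N) ?B (\<lambda>x. \<lambda>n\<in>I. fluctuation N x n)) \<le> C) sequentially"
      unfolding integral_distr[OF mZ mi] integrable_distr_eq[OF mZ mi] using fluctuation_second_moment[of i] i by simp
    show "integrable (distr normal_sequence ?B (\<lambda>\<omega>. \<lambda>n\<in>I. gauss_seq cov n \<omega>)) (\<lambda>x. (x i)\<^sup>2)"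
      unfolding integrable_distr_eq[OF mG mi] using gauss_seq_moments(3)[OF psd_kernel_cov, of i i] i by (simp add: power2_eq_square)
  qed simp
qed

end

theorem theorem2p3:
  fixes a b c :: real
  assumes "a > -1" and "b > -1" and "c > 0"
  shows
    "(\<forall>(\<beta> :: nat \<Rightarrow> real) (\<Omega> :: 'w measure) (X :: nat \<Rightarrow> 'w \<Rightarrow> nat \<Rightarrow> real).
        prob_space \<Omega> \<and>
        (\<forall>N\<ge>1. \<beta> N > 0) \<and>
        (\<forall>N\<ge>1. X N \<in> measurable \<Omega> (PiM {1..N} (\<lambda>_. borel)) \<and>
               distr \<Omega> (PiM {1..N} (\<lambda>_. borel)) (X N) = jacobi_ensemble (\<beta> N) a b N) \<and>
        (\<lambda>N. \<beta> N * real N) \<longlonglongrightarrow> 2 * c \<longrightarrow>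
          (AE \<omega> in \<Omega>. weak_conv_m (\<lambda>N. empirical N (X N \<omega>)) (limit_measure a b c)) \<and>
          (\<forall>p :: real poly.
             AE \<omega> in \<Omega>. (\<lambda>N. integral\<^sup>L (empirical N (X N \<omega>)) (poly p))
                          \<longlonglongrightarrow> integral\<^sup>L (limit_measure a b c) (poly p)))
     \<and>
     (\<forall>p :: real poly. \<exists>\<sigma>2\<ge>0.
        (\<lambda>N. real N * prob_space.variance (jacobi_ensemble (2 * c / real N) a b N)
                        (\<lambda>x. integral\<^sup>L (empirical N x) (poly p))) \<longlonglongrightarrow> \<sigma>2 \<and>
        weak_conv_m
          (\<lambda>N. distr (jacobi_ensemble (2 * c / real N) a b N) borel
                 (\<lambda>x. sqrt (real N) *
                    (integral\<^sup>L (empirical N x) (poly p) - integral\<^sup>L (limit_measure a b c) (poly p))))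
          (gaussian 0 \<sigma>2))
     \<and>
     (\<exists>(\<sigma> :: nat \<Rightarrow> nat \<Rightarrow> real) (P :: (nat \<Rightarrow> real) measure) (\<zeta> :: nat \<Rightarrow> (nat \<Rightarrow> real) \<Rightarrow> real).
        (\<forall>k\<ge>1. \<forall>l\<ge>1.
           (\<lambda>N. real N * covar (jacobi_ensemble (2 * c / real N) a b N)
                           (\<lambda>x. integral\<^sup>L (empirical N x) (\<lambda>y. y ^ k))
                           (\<lambda>x. integral\<^sup>L (empirical N x) (\<lambda>y. y ^ l))) \<longlonglongrightarrow> \<sigma> k l) \<and>
        jointly_gaussian P {1..} \<zeta> \<and>
        (\<forall>M::nat.
           gaussian_vector P {1..M} \<zeta> (\<lambda>_. 0) \<sigma> \<and>
           weak_conv_PiM {1..M}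
             (\<lambda>N. distr (jacobi_ensemble (2 * c / real N) a b N) (PiM {1..M} (\<lambda>_. borel))
                    (\<lambda>x. \<lambda>n\<in>{1..M}. sqrt (real N) *
                       (integral\<^sup>L (empirical N x) (\<lambda>y. y ^ n) -
                        integral\<^sup>L (limit_measure a b c) (\<lambda>y. y ^ n))))
             (distr P (PiM {1..M} (\<lambda>_. borel)) (\<lambda>\<omega>. \<lambda>n\<in>{1..M}. \<zeta> n \<omega>))))"
proof -
  interpret jacobi_clt a b c by unfold_locales fact+
  show ?thesis
  proof (intro conjI allI impI, goal_cases)
    case (1 \<beta> \<Omega> X)
    then show ?case using empirical_law_of_large_numbers(1)[OF assms, of \<beta> \<Omega> X] by blast
  next
    case (2 \<beta> \<Omega> X p)
    then show ?case using empirical_law_of_large_numbers(2)[OF assms, of \<beta> \<Omega> X p] by blast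
  next
    case (3 p)
    show ?case
      using quad_form_nonneg[of "{..degree p}" "coeff p"] empirical_poly_variance_tendsto[of p] empirical_poly_clt[of p] by blast
  next
    case 4
    show ?case
      using empirical_covariance_tendsto jointly_gaussian_limit gaussian_vector_limit empirical_moments_clt[OF finite_atLeastAtMost]
      by (intro exI[of _ cov] exI[of _ normal_sequence] exI[of _ "gauss_seq cov"] conjI allI impI)
  qed
qed

end
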